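(* Consider the random initial value problem $\partial_t u+\partial_x f(u)=0$ on $(0,T)\times\mathbb{R}\times\Xi$ with $u(0,x,y)=u^0(x,y)$, and let $u$ be its random entropy solution. Let $u_h^n(x,y)$, $n=0,\ldots,N_t$, be the NISP numerical solution at the time points $t_0,\dots,t_{N_t}$, let $\hat u^{sts}$ be the space-time-stochastic reconstruction, and let $\mathcal{E}^{det},\mathcal{E}^{sq},\mathcal{E}^{sc}$ be the deterministic, stochastic quadrature and stochastic cut-off residual quantities (all defined in the context). Let $C_f$, $C_{\underline{\eta}}$, $C_{\overline{\eta}}$ be the constants introduced in the context, which bound the Hessians of $f$ and $\eta$ on a convex and compact set $\mathcal{C}\subset\mathcal{U}$. Then, for any $n=0,\ldots,N_t$, $$\begin{aligned}\|u(t_n,\cdot,\cdot)-u_h^n\|_{L^2_\xi(\Xi;L^2(\mathbb{R}))}^2\le{}& 2\|\hat u^{sts}(t_n,\cdot,\cdot)-u_h^n\|_{L^2_\xi(\Xi;L^2(\mathbb{R}))}^2\\&+2C_{\underline{\eta}}^{-1}\Big(2\mathcal{E}^{det}(t_n)+2\mathcal{E}^{sq}(t_n)+\mathcal{E}^{sc}(t_n)+C_{\overline{\eta}}\,\mathcal{E}^{sts}_0\Big)\\&\quad\times\exp\Big(C_{\underline{\eta}}^{-1}\int_0^{t_n}\Big(C_{\overline{\eta}}C_f\|\partial_x\hat u^{sts}(t,\cdot,\cdot)\|_{L^\infty_\xi(\Xi;L^\infty(\mathbb{R}))}+C_{\overline{\eta}}^2\Big)\,\mathrm{d}t\Big),\end{aligned}$$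 where $\mathcal{E}^{sts}_0:=\|u^0-\hat u^{sts}(0,\cdot,\cdot)\|^2_{L^2_\xi(\Xi;L^2(\mathbb{R}))}$.
   Context: Random space. $\xi:\Omega\to\Xi\subset\mathbb{R}$ is a random variable on a probability space with probability density $w_\xi:\Xi\to\mathbb{R}_+$; $\Xi$ carries the law $\tilde{\mathbb{P}}$ of $\xi$. For a normed space $E$, $\|g\|_{L^p_\xi(\Xi;E)}=(\int_\Xi\|g(y)\|_E^p\,w_\xi(y)\,dy)^{1/p}$ for $1\le p<\infty$, and $\|g\|_{L^\infty_\xi(\Xi;E)}=\operatorname{ess\,sup}_{y\in\Xi}\|g(y)\|_E$. Indices in $\mathbb{N}$ start at $0$. Equation. $T\in(0,\infty)$, the state space $\mathcal{U}\subset\mathbb{R}^m$ is open, $f\in C^2(\mathcal{U};\mathbb{R}^m)$, and the system is strictly hyperbolic (the Jacobian $Df$ has $m$ distinct real eigenvalues). The system is equipped with an entropy/entropy-flux pair $(\eta,q)$: $\eta,q\in C^2(\mathcal{U};\mathbb{R})$, $\eta$ strictly convex, $D\eta\,Df=Dq$. A function $u\in L^1_\xi(\Xi;L^1((0,T)\times\mathbb{R};\mathcal{U}))$ is a random entropy solution if, for $\tilde{\mathbb{P}}$-almost every $y$, $u(\cdot,\cdot,y)$ is a classical entropy solution with initial datum $u^0(\cdot,y)$, i.e. a weak solution satisfying $\int_0^T\!\int_{\mathbb{R}}(\eta(u)\partial_t\varphi+q(u)\partial_x\varphi)\,dx\,dt+\int_{\mathbb{R}}\eta(u^0)\varphi(0,\cdot)\,dx\ge0$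 for all nonnegative Lipschitz test functions $\varphi$ with compact support in $[0,T)\times\mathbb{R}$. $u$ is assumed square-integrable with respect to $y\in\Xi$. Constants. Let $\mathcal{C}\subset\mathcal{U}$ be convex and compact. Since $f$ and $\eta$ are $C^2$ and $\eta$ is strictly convex, there exist constants $0<C_f<\infty$ and $0<C_{\underline{\eta}}<C_{\overline{\eta}}<\infty$ such that $$|v^\top Hf(w)v|\le C_f|v|^2,\qquad C_{\underline{\eta}}|v|^2\le v^\top H\eta(w)v\le C_{\overline{\eta}}|v|^2\qquad\text{for all }v\in\mathbb{R}^m,\ w\in\mathcal{C},$$ where $H\eta$ is the Hessian of $\eta$ and $Hf$ is the tensor of second derivatives of $f$. Discretization. $\{\Psi_i\}_{i\in\mathbb{N}}$ is an orthonormal basis of $L^2_\xi(\Xi)$; $\langle g,h\rangle:=\int_\Xi g(y)h(y)w_\xi(y)\,dy$ (componentwise in $\mathbb{R}^m$, pointwise in $(t,x)$), so $\langle\Psi_i,\Psi_j\rangle=\delta_{ij}$. $M,R\in\mathbb{N}$; $y_0,\dots,y_R\in\Xi$ are quadrature points with weights $w_0,\dots,w_R$. $\mathcal{T}$ is a uniform triangulation of $\mathbb{R}$, $V_p^s=\{v:\mathbb{R}\to\mathbb{R}^m : v|_K\text{ is a polynomial of degree at most }p\text{ for all }K\in\mathcal{T}\}$, $p\in\mathbb{N}$, and $\{t_n\}_{n=0}^{N_t}$ is a partition of the time interval. For each $l=0,\dots,R$, $u_h^n(\cdot,y_l)\in V_p^s$ is the Runge–Kutta Discontinuous Galerkin approximation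 at time $t_n$ of the deterministic problem with initial datum $u^0(\cdot,y_l)$ (same triangulation and time partition for all $l$). The NISP (non-intrusive spectral projection) numerical solution is $$u_h^n(x,y)=\sum_{i=0}^M\Big(\sum_{l=0}^Ru_h^n(x,y_l)\Psi_i(y_l)w_l\Big)\Psi_i(y).$$ Reconstruction and residuals. For each $l$, $\hat u^{st}(y_l)\in W^{1}_\infty((0,T);V^s_{p+1}\cap C^0(\mathbb{R}))$ is a computable, Lipschitz continuous space-time reconstruction of $\{u_h^n(\cdot,y_l)\}_{n=0}^{N_t}$, with space-time residual $\mathcal{R}^{st}(y_l):=\partial_t\hat u^{st}(y_l)+\partial_xf(\hat u^{st}(y_l))\in L^2((0,T)\times\mathbb{R};\mathbb{R}^m)$. Set $\hat u^{st}_i=\sum_{l=0}^R\hat u^{st}(y_l)\Psi_i(y_l)w_l$ for $i=0,\dots,M$ and $\hat u^{sts}(t,x,y)=\sum_{i=0}^M\hat u_i^{st}(t,x)\Psi_i(y)$; the space-time-stochastic residual $\mathcal{R}^{sts}:=\partial_t\hat u^{sts}+\partial_xf(\hat u^{sts})$ belongs to $L^2_\xi(\Xi;L^2((0,T)\times\mathbb{R};\mathbb{R}^m))$. Define $$\mathcal{R}^{det}_j:=\sum_{l=0}^R\mathcal{R}^{st}(y_l)\Psi_j(y_l)w_l\quad(j=0,\dots,M),$$ $$\mathcal{R}^{sq}_j:=\Big\langle\partial_xf\Big(\sum_{i=0}^M\hat u^{st}_i\Psi_i\Big),\Psi_j\Big\rangle-\sum_{l=0}^R\partial_xf(\hat u^{st}(y_l))\Psi_j(y_l)w_l\quad(j=0,\dots,M),$$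 $$\mathcal{R}^{sc}_j:=\Big\langle\partial_xf\Big(\sum_{i=0}^M\hat u^{st}_i\Psi_i\Big),\Psi_j\Big\rangle\quad(j>M),$$ and $$\mathcal{E}^{det}(t):=\sum_{j=0}^M\|\mathcal{R}^{det}_j\|^2_{L^2((0,t)\times\mathbb{R})},\quad\mathcal{E}^{sq}(t):=\sum_{j=0}^M\|\mathcal{R}^{sq}_j\|^2_{L^2((0,t)\times\mathbb{R})},\quad\mathcal{E}^{sc}(t):=\sum_{j>M}\|\mathcal{R}^{sc}_j\|^2_{L^2((0,t)\times\mathbb{R})}.$$
   Formalization: Adds that u and û^sts take values in C for almost every y (otherwise the constants do not control them and the bound can fail), and that each û^st(y_l) takes values in U so that f(û^st) is defined; u(t_n) is the value of the representative weakly continuous in time. *)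

theory Defs
  imports "HOL-Probability.Probability"
begin

definition xi_law :: "real set \<Rightarrow> (real \<Rightarrow> real) \<Rightarrow> real measure" where
  "xi_law \<Xi> w = density (restrict_space lborel \<Xi>) (\<lambda>y. ennreal (w y))"

definition time_strip :: "real \<Rightarrow> (real \<times> real) measure" where
  "time_strip t = restrict_space lborel ({0<..<t} \<times> UNIV)"

text \<open>Squared norms are \<open>ennreal\<close>-valued, so they may be infinite.\<close>

definition sqnorm_L2 :: "'a measure \<Rightarrow> ('a \<Rightarrow> 'b::real_normed_vector) \<Rightarrow> ennreal" where
  "sqnorm_L2 M g = (\<integral>\<^sup>+ z. ennreal ((norm (g z))\<^sup>2) \<partial>M)"

definition in_L2 :: "'a measure \<Rightarrow> ('a \<Rightarrow> 'b::real_normed_vector) \<Rightarrow> bool" where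
  "in_L2 M g \<longleftrightarrow> g \<in> borel_measurable M \<and> sqnorm_L2 M g < \<infinity>"

text \<open>\<open>sqnorm_L2_L2 P N g\<close> is the squared norm of \<open>L\<^sup>2\<^sub>\<xi>(\<Xi>; L\<^sup>2(N))\<close>, with \<open>P\<close> the law of \<open>\<xi>\<close>;
  the first argument of \<open>g\<close> is the random variable. Likewise for \<open>norm_Linf_Linf\<close>.\<close>

definition sqnorm_L2_L2 ::
  "real measure \<Rightarrow> 'a measure \<Rightarrow> (real \<Rightarrow> 'a \<Rightarrow> 'b::real_normed_vector) \<Rightarrow> ennreal" where
  "sqnorm_L2_L2 P N g = (\<integral>\<^sup>+ y. sqnorm_L2 N (g y) \<partial>P)"

definition in_L2_L2 ::
  "real measure \<Rightarrow> 'a measure \<Rightarrow> (real \<Rightarrow> 'a \<Rightarrow> 'b::real_normed_vector) \<Rightarrow> bool" where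
  "in_L2_L2 P N g \<longleftrightarrow>
    (\<lambda>(y, z). g y z) \<in> borel_measurable (P \<Otimes>\<^sub>M N) \<and> sqnorm_L2_L2 P N g < \<infinity>"

definition norm_Linf_Linf ::
  "real measure \<Rightarrow> 'a measure \<Rightarrow> (real \<Rightarrow> 'a \<Rightarrow> 'b::real_normed_vector) \<Rightarrow> ennreal" where
  "norm_Linf_Linf P N g = esssup P (\<lambda>y. esssup N (\<lambda>z. ennreal (norm (g y z))))"

definition ennreal_exp :: "ennreal \<Rightarrow> ennreal" where
  "ennreal_exp a = (if a = \<infinity> then \<infinity> else ennreal (exp (enn2real a)))"

definition orthonormal_basis_L2 :: "real measure \<Rightarrow> (nat \<Rightarrow> real \<Rightarrow> real) \<Rightarrow> bool" where
  "orthonormal_basis_L2 P \<Psi> \<longleftrightarrow>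
    (\<forall>i. in_L2 P (\<Psi> i)) \<and>
    (\<forall>i j. (LINT y|P. \<Psi> i y * \<Psi> j y) = (if i = j then 1 else 0)) \<and>
    (\<forall>g::real \<Rightarrow> real. in_L2 P g \<longrightarrow>
      (\<lambda>n. sqnorm_L2 P (\<lambda>y. g y - (\<Sum>i<n. (LINT z|P. g z * \<Psi> i z) * \<Psi> i y))) \<longlonglongrightarrow> 0)"

text \<open>\<open>hess F w v v'\<close> is the second derivative of \<open>F\<close> at \<open>w\<close> in the directions \<open>v\<close>, \<open>v'\<close>;
  for real-valued \<open>F\<close> this is \<open>v\<^sup>T HF(w) v'\<close>.\<close>

definition hess ::
  "('a::real_normed_vector \<Rightarrow> 'b::real_normed_vector) \<Rightarrow> 'a \<Rightarrow> 'a \<Rightarrow> 'a \<Rightarrow> 'b" where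
  "hess F w v v' = frechet_derivative (\<lambda>z. frechet_derivative F (at z) v) (at w) v'"

definition C2_on ::
  "'a::real_normed_vector set \<Rightarrow> ('a \<Rightarrow> 'b::real_normed_vector) \<Rightarrow> bool" where
  "C2_on U F \<longleftrightarrow>
    (\<forall>w\<in>U. F differentiable (at w)) \<and>
    (\<forall>v. \<forall>w\<in>U. (\<lambda>z. frechet_derivative F (at z) v) differentiable (at w)) \<and>
    (\<forall>v v'. continuous_on U (\<lambda>w. hess F w v v'))"

definition strictly_hyperbolic ::
  "(real ^ 'm::finite) set \<Rightarrow> (real ^ 'm \<Rightarrow> real ^ 'm) \<Rightarrow> bool" where
  "strictly_hyperbolic U f \<longleftrightarrow>
    (\<forall>w\<in>U. card {c::real. \<exists>v. v \<noteq> 0 \<and> jacobian f (at w) *v v = c *\<^sub>R v} = CARD('m))"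

text \<open>\<open>U\<close> is open but not assumed convex, so strict convexity is required along every
  segment contained in \<open>U\<close>.\<close>

definition strictly_convex_on ::
  "'a::real_vector set \<Rightarrow> ('a \<Rightarrow> real) \<Rightarrow> bool" where
  "strictly_convex_on U \<eta> \<longleftrightarrow>
    (\<forall>a b \<theta>. closed_segment a b \<subseteq> U \<and> a \<noteq> b \<and> 0 < \<theta> \<and> \<theta> < 1 \<longrightarrow>
      \<eta> ((1 - \<theta>) *\<^sub>R a + \<theta> *\<^sub>R b) < (1 - \<theta>) * \<eta> a + \<theta> * \<eta> b)"

definition entropy_pair ::
  "(real ^ 'm::finite) set \<Rightarrow> (real ^ 'm \<Rightarrow> real ^ 'm) \<Rightarrow> (real ^ 'm \<Rightarrow> real) \<Rightarrow> (real ^ 'm \<Rightarrow> real)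
    \<Rightarrow> bool" where
  "entropy_pair U f \<eta> q \<longleftrightarrow>
    C2_on U \<eta> \<and> C2_on U q \<and> strictly_convex_on U \<eta> \<and>
    (\<forall>w\<in>U. \<forall>v. frechet_derivative \<eta> (at w) (frechet_derivative f (at w) v)
                = frechet_derivative q (at w) v)"

text \<open>Partial derivatives of functions of \<open>(t,x)\<close>. They are only applied to functions that are
  Lipschitz in the respective variable, for which they exist almost everywhere and coincide with
  the weak derivatives.\<close>

definition dt :: "(real \<Rightarrow> real \<Rightarrow> 'a::real_normed_vector) \<Rightarrow> real \<Rightarrow> real \<Rightarrow> 'a" where
  "dt v t x = vector_derivative (\<lambda>s. v s x) (at t)"

definition dx :: "(real \<Rightarrow> real \<Rightarrow> 'a::real_normed_vector) \<Rightarrow> real \<Rightarrow> real \<Rightarrow> 'a" where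
  "dx v t x = vector_derivative (\<lambda>z. v t z) (at x)"

definition test_function :: "real \<Rightarrow> (real \<Rightarrow> real \<Rightarrow> real) \<Rightarrow> bool" where
  "test_function T \<phi> \<longleftrightarrow>
    (\<exists>L. L-lipschitz_on ({0..<T} \<times> UNIV) (\<lambda>(t, x). \<phi> t x)) \<and>
    (\<exists>K. compact K \<and> K \<subseteq> {0..<T} \<times> UNIV \<and> (\<forall>t\<in>{0..<T}. \<forall>x. (t, x) \<notin> K \<longrightarrow> \<phi> t x = 0))"

definition locally_integrable ::
  "real \<Rightarrow> (real \<Rightarrow> real \<Rightarrow> 'a::euclidean_space) \<Rightarrow> bool" where
  "locally_integrable T g \<longleftrightarrow>
    (\<forall>K. compact K \<and> K \<subseteq> {0..<T} \<times> UNIV \<longrightarrow> set_integrable lborel K (\<lambda>(t, x). g t x))"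

definition locally_integrable_R :: "(real \<Rightarrow> 'a::euclidean_space) \<Rightarrow> bool" where
  "locally_integrable_R g \<longleftrightarrow> (\<forall>a b. set_integrable lborel {a..b} g)"

definition weak_solution ::
  "real \<Rightarrow> (real ^ 'm::finite \<Rightarrow> real ^ 'm) \<Rightarrow> (real \<Rightarrow> real ^ 'm) \<Rightarrow> (real \<Rightarrow> real \<Rightarrow> real ^ 'm)
    \<Rightarrow> bool" where
  "weak_solution T f u0 u \<longleftrightarrow>
    locally_integrable T u \<and> locally_integrable T (\<lambda>t x. f (u t x)) \<and>
    locally_integrable_R u0 \<and>
    (\<forall>\<phi>. test_function T \<phi> \<longrightarrow>
      (LINT (t, x)|time_strip T. dt \<phi> t x *\<^sub>R u t x + dx \<phi> t x *\<^sub>R f (u t x))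
        + (LINT x|lborel. \<phi> 0 x *\<^sub>R u0 x) = 0)"

definition entropy_solution ::
  "real \<Rightarrow> (real ^ 'm::finite \<Rightarrow> real ^ 'm) \<Rightarrow> (real ^ 'm \<Rightarrow> real) \<Rightarrow> (real ^ 'm \<Rightarrow> real)
    \<Rightarrow> (real \<Rightarrow> real ^ 'm) \<Rightarrow> (real \<Rightarrow> real \<Rightarrow> real ^ 'm) \<Rightarrow> bool" where
  "entropy_solution T f \<eta> q u0 u \<longleftrightarrow>
    weak_solution T f u0 u \<and>
    locally_integrable T (\<lambda>t x. \<eta> (u t x)) \<and> locally_integrable T (\<lambda>t x. q (u t x)) \<and>
    locally_integrable_R (\<lambda>x. \<eta> (u0 x)) \<and>
    (\<forall>\<phi>. test_function T \<phi> \<and> (\<forall>t\<in>{0..<T}. \<forall>x. 0 \<le> \<phi> t x) \<longrightarrow>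
      (LINT (t, x)|time_strip T. \<eta> (u t x) * dt \<phi> t x + q (u t x) * dx \<phi> t x)
        + (LINT x|lborel. \<eta> (u0 x) * \<phi> 0 x) \<ge> 0)"

text \<open>The value at a fixed time, as in \<open>u(t\<^sub>n,\<cdot>,\<cdot>)\<close>, is that of the representative
  that is weakly continuous in time on \<open>[0,T]\<close>.\<close>

definition weakly_continuous_in_time ::
  "real \<Rightarrow> (real \<Rightarrow> real \<Rightarrow> real ^ 'm::finite) \<Rightarrow> bool" where
  "weakly_continuous_in_time T u \<longleftrightarrow>
    (\<forall>t\<in>{0..T}. locally_integrable_R (u t)) \<and>
    (\<forall>\<psi>::real \<Rightarrow> real. continuous_on UNIV \<psi> \<and> (\<exists>K. compact K \<and> (\<forall>x. x \<notin> K \<longrightarrow> \<psi> x = 0)) \<longrightarrow>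
      continuous_on {0..T} (\<lambda>t. LINT x|lborel. \<psi> x *\<^sub>R u t x))"

text \<open>\<open>P\<close> is the law of \<open>\<xi>\<close>; arguments of \<open>u\<close> are \<open>t\<close>, \<open>x\<close>, \<open>y\<close>.\<close>

definition random_entropy_solution ::
  "real \<Rightarrow> (real ^ 'm::finite) set \<Rightarrow> (real ^ 'm \<Rightarrow> real ^ 'm) \<Rightarrow> (real ^ 'm \<Rightarrow> real)
    \<Rightarrow> (real ^ 'm \<Rightarrow> real) \<Rightarrow> real measure \<Rightarrow> (real \<Rightarrow> real \<Rightarrow> real ^ 'm)
    \<Rightarrow> (real \<Rightarrow> real \<Rightarrow> real \<Rightarrow> real ^ 'm) \<Rightarrow> bool" where
  "random_entropy_solution T U f \<eta> q P u0 u \<longleftrightarrow>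
    (\<lambda>(t, x, y). u t x y) \<in> borel_measurable (restrict_space lborel {0..T} \<Otimes>\<^sub>M lborel \<Otimes>\<^sub>M P) \<and>
    (\<integral>\<^sup>+ y. (\<integral>\<^sup>+ (t, x). ennreal (norm (u t x y)) \<partial>time_strip T) \<partial>P) < \<infinity> \<and>
    (AE y in P. AE (t, x) in time_strip T. u t x y \<in> U) \<and>
    (AE y in P. entropy_solution T f \<eta> q (\<lambda>x. u0 x y) (\<lambda>t x. u t x y) \<and>
                weakly_continuous_in_time T (\<lambda>t x. u t x y))"

definition node :: "real \<Rightarrow> real \<Rightarrow> int \<Rightarrow> real" where
  "node x0 h k = x0 + of_int k * h"

definition cell :: "real \<Rightarrow> real \<Rightarrow> int \<Rightarrow> real set" where
  "cell x0 h k = {node x0 h k<..<node x0 h (k + 1)}"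

definition vec_poly :: "nat \<Rightarrow> (real \<Rightarrow> real ^ 'm::finite) \<Rightarrow> bool" where
  "vec_poly p \<psi> \<longleftrightarrow> (\<exists>c. \<forall>x. \<psi> x = (\<Sum>i\<le>p. x ^ i *\<^sub>R c i))"

text \<open>Cells are open: a discontinuous piecewise polynomial carries no value at the nodes.\<close>

definition DG_space :: "real \<Rightarrow> real \<Rightarrow> nat \<Rightarrow> (real \<Rightarrow> real ^ 'm::finite) set" where
  "DG_space x0 h p = {v. \<forall>k. \<exists>\<psi>. vec_poly p \<psi> \<and> (\<forall>x\<in>cell x0 h k. v x = \<psi> x)}"

definition numerical_flux ::
  "(real ^ 'm::finite) set \<Rightarrow> (real ^ 'm \<Rightarrow> real ^ 'm)
    \<Rightarrow> (real ^ 'm \<Rightarrow> real ^ 'm \<Rightarrow> real ^ 'm) \<Rightarrow> bool" where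
  "numerical_flux U f F \<longleftrightarrow>
    (\<forall>a\<in>U. F a a = f a) \<and>
    (\<forall>z\<in>U \<times> U. \<exists>e>0. \<exists>L. L-lipschitz_on (ball z e \<inter> U \<times> U) (\<lambda>(a, b). F a b))"

definition L2_projection ::
  "real \<Rightarrow> real \<Rightarrow> nat \<Rightarrow> (real \<Rightarrow> real ^ 'm::finite) \<Rightarrow> (real \<Rightarrow> real ^ 'm) \<Rightarrow> bool" where
  "L2_projection x0 h p v w \<longleftrightarrow> w \<in> DG_space x0 h p \<and>
    (\<forall>k. set_integrable lborel (cell x0 h k) v \<and>
      (\<forall>\<psi>. vec_poly p \<psi> \<longrightarrow>
        (LINT x:cell x0 h k|lborel. w x \<bullet> \<psi> x) = (LINT x:cell x0 h k|lborel. v x \<bullet> \<psi> x)))"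

text \<open>\<open>w\<close> is the semi-discrete DG right-hand side, approximating \<open>-\<partial>\<^sub>x f(v)\<close>.\<close>

definition DG_operator ::
  "(real ^ 'm::finite \<Rightarrow> real ^ 'm) \<Rightarrow> (real ^ 'm \<Rightarrow> real ^ 'm \<Rightarrow> real ^ 'm)
    \<Rightarrow> real \<Rightarrow> real \<Rightarrow> nat \<Rightarrow> (real \<Rightarrow> real ^ 'm) \<Rightarrow> (real \<Rightarrow> real ^ 'm) \<Rightarrow> bool" where
  "DG_operator f F x0 h p v w \<longleftrightarrow> w \<in> DG_space x0 h p \<and>
    (\<forall>k \<psi>. vec_poly p \<psi> \<longrightarrow>
      (let flux = (\<lambda>z. F (Lim (at_left z) v) (Lim (at_right z) v));
           a = node x0 h k; b = node x0 h (k + 1)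
       in (LINT x:cell x0 h k|lborel. w x \<bullet> \<psi> x)
          = (LINT x:cell x0 h k|lborel. f (v x) \<bullet> vector_derivative \<psi> (at x))
            - flux b \<bullet> \<psi> b + flux a \<bullet> \<psi> a))"

text \<open>One step of size \<open>\<tau>\<close> of an explicit \<open>s\<close>-stage Runge--Kutta method in Shu--Osher form.
  \<open>\<Lambda> j\<close> is the (possibly trivial) limiter applied after stage \<open>j\<close>.\<close>

definition RKDG_step ::
  "(real ^ 'm::finite \<Rightarrow> real ^ 'm) \<Rightarrow> (real ^ 'm \<Rightarrow> real ^ 'm \<Rightarrow> real ^ 'm)
    \<Rightarrow> real \<Rightarrow> real \<Rightarrow> nat \<Rightarrow> nat \<Rightarrow> (nat \<Rightarrow> nat \<Rightarrow> real) \<Rightarrow> (nat \<Rightarrow> nat \<Rightarrow> real)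
    \<Rightarrow> (nat \<Rightarrow> (real \<Rightarrow> real ^ 'm) \<Rightarrow> (real \<Rightarrow> real ^ 'm))
    \<Rightarrow> real \<Rightarrow> (real \<Rightarrow> real ^ 'm) \<Rightarrow> (real \<Rightarrow> real ^ 'm) \<Rightarrow> bool" where
  "RKDG_step f F x0 h p s \<alpha> \<beta> \<Lambda> \<tau> v v' \<longleftrightarrow>
    (\<exists>V W. V 0 = v \<and> (\<forall>j<s. DG_operator f F x0 h p (V j) (W j)) \<and>
      (\<forall>j\<in>{1..s}. V j = \<Lambda> j (\<lambda>x. \<Sum>k<j. \<alpha> j k *\<^sub>R V k x + (\<tau> * \<beta> j k) *\<^sub>R W k x)) \<and>
      v' = V s)"

definition RKDG_scheme ::
  "(real ^ 'm::finite) set \<Rightarrow> (real ^ 'm \<Rightarrow> real ^ 'm) \<Rightarrow> (real ^ 'm \<Rightarrow> real ^ 'm \<Rightarrow> real ^ 'm)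
    \<Rightarrow> real \<Rightarrow> real \<Rightarrow> nat \<Rightarrow> nat \<Rightarrow> (nat \<Rightarrow> nat \<Rightarrow> real)
    \<Rightarrow> (nat \<Rightarrow> (real \<Rightarrow> real ^ 'm) \<Rightarrow> (real \<Rightarrow> real ^ 'm)) \<Rightarrow> bool" where
  "RKDG_scheme U f F x0 h p s \<alpha> \<Lambda> \<longleftrightarrow>
    numerical_flux U f F \<and> 0 < s \<and> (\<forall>j\<in>{1..s}. (\<Sum>k<j. \<alpha> j k) = 1) \<and>
    (\<forall>j\<le>s. \<forall>v\<in>DG_space x0 h p. \<Lambda> j v \<in> DG_space x0 h p)"

definition RKDG_approximation ::
  "(real ^ 'm::finite \<Rightarrow> real ^ 'm) \<Rightarrow> (real ^ 'm \<Rightarrow> real ^ 'm \<Rightarrow> real ^ 'm)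
    \<Rightarrow> real \<Rightarrow> real \<Rightarrow> nat \<Rightarrow> nat \<Rightarrow> (nat \<Rightarrow> nat \<Rightarrow> real) \<Rightarrow> (nat \<Rightarrow> nat \<Rightarrow> real)
    \<Rightarrow> (nat \<Rightarrow> (real \<Rightarrow> real ^ 'm) \<Rightarrow> (real \<Rightarrow> real ^ 'm))
    \<Rightarrow> nat \<Rightarrow> (nat \<Rightarrow> real) \<Rightarrow> (real \<Rightarrow> real ^ 'm) \<Rightarrow> (nat \<Rightarrow> real \<Rightarrow> real ^ 'm) \<Rightarrow> bool" where
  "RKDG_approximation f F x0 h p s \<alpha> \<beta> \<Lambda> Nt tp u0 uh \<longleftrightarrow>
    (\<forall>n\<le>Nt. uh n \<in> DG_space x0 h p) \<and>
    (\<exists>v. L2_projection x0 h p u0 v \<and> uh 0 = \<Lambda> 0 v) \<and>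
    (\<forall>n<Nt. RKDG_step f F x0 h p s \<alpha> \<beta> \<Lambda> (tp (Suc n) - tp n) (uh n) (uh (Suc n)))"

text \<open>Sobolev--Bochner space \<open>W\<^sup>1\<^sub>\<infinity>((0,T); X)\<close>, \<open>X\<close> a space of functions on
  \<open>\<real>\<close> with the supremum norm; Bochner measurability is rendered by joint measurability.\<close>

definition Linf_in_time ::
  "real \<Rightarrow> (real \<Rightarrow> real ^ 'm::finite) set \<Rightarrow> (real \<Rightarrow> real \<Rightarrow> real ^ 'm) \<Rightarrow> bool" where
  "Linf_in_time T X v \<longleftrightarrow>
    (\<lambda>(t, x). v t x) \<in> borel_measurable (time_strip T) \<and>
    (\<exists>B. AE t in lborel. t \<in> {0<..<T} \<longrightarrow> v t \<in> X \<and> (\<forall>x. norm (v t x) \<le> B))"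

definition W1inf_in_time ::
  "real \<Rightarrow> (real \<Rightarrow> real ^ 'm::finite) set \<Rightarrow> (real \<Rightarrow> real \<Rightarrow> real ^ 'm) \<Rightarrow> bool" where
  "W1inf_in_time T X v \<longleftrightarrow> Linf_in_time T X v \<and>
    (\<exists>g. Linf_in_time T X g \<and>
      (\<forall>\<phi>::real \<Rightarrow> real. \<phi> C1_differentiable_on UNIV \<and>
          (\<exists>a b. 0 < a \<and> b < T \<and> (\<forall>t. t \<notin> {a..b} \<longrightarrow> \<phi> t = 0)) \<longrightarrow>
        (\<forall>x. (LINT t:{0<..<T}|lborel. deriv \<phi> t *\<^sub>R v t x)
              = - (LINT t:{0<..<T}|lborel. \<phi> t *\<^sub>R g t x))))"

definition st_reconstruction ::
  "real \<Rightarrow> real \<Rightarrow> real \<Rightarrow> nat \<Rightarrow> (real \<Rightarrow> real \<Rightarrow> real ^ 'm::finite) \<Rightarrow> bool" where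
  "st_reconstruction T x0 h p v \<longleftrightarrow>
    (let X = DG_space x0 h (p + 1) \<inter> {z. continuous_on UNIV z}
     in W1inf_in_time T X v \<and> (\<forall>t\<in>{0..T}. v t \<in> X) \<and>
        (\<exists>L. L-lipschitz_on ({0..T} \<times> UNIV) (\<lambda>(t, x). v t x)))"

definition residual ::
  "(real ^ 'm::finite \<Rightarrow> real ^ 'm) \<Rightarrow> (real \<Rightarrow> real \<Rightarrow> real ^ 'm) \<Rightarrow> real \<Rightarrow> real \<Rightarrow> real ^ 'm" where
  "residual f v t x = dt v t x + dx (\<lambda>s z. f (v s z)) t x"

text \<open>\<open>nisp_coeff\<close> is the quadrature approximation of the \<open>i\<close>-th mode of the data \<open>a l\<close> at the
  points \<open>yq l\<close> with weights \<open>wq l\<close>, \<open>l = 0,\<dots>,R\<close>.\<close>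

definition nisp_coeff ::
  "nat \<Rightarrow> (nat \<Rightarrow> real \<Rightarrow> real) \<Rightarrow> (nat \<Rightarrow> real) \<Rightarrow> (nat \<Rightarrow> real) \<Rightarrow> (nat \<Rightarrow> real ^ 'm::finite)
    \<Rightarrow> nat \<Rightarrow> real ^ 'm" where
  "nisp_coeff R \<Psi> yq wq a i = (\<Sum>l\<le>R. (\<Psi> i (yq l) * wq l) *\<^sub>R a l)"

definition nisp ::
  "nat \<Rightarrow> nat \<Rightarrow> (nat \<Rightarrow> real \<Rightarrow> real) \<Rightarrow> (nat \<Rightarrow> real) \<Rightarrow> (nat \<Rightarrow> real) \<Rightarrow> (nat \<Rightarrow> real ^ 'm::finite)
    \<Rightarrow> real \<Rightarrow> real ^ 'm" where
  "nisp M R \<Psi> yq wq a y = (\<Sum>i\<le>M. \<Psi> i y *\<^sub>R nisp_coeff R \<Psi> yq wq a i)"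

definition res_det ::
  "nat \<Rightarrow> (nat \<Rightarrow> real \<Rightarrow> real) \<Rightarrow> (nat \<Rightarrow> real) \<Rightarrow> (nat \<Rightarrow> real)
    \<Rightarrow> (real ^ 'm::finite \<Rightarrow> real ^ 'm) \<Rightarrow> (nat \<Rightarrow> real \<Rightarrow> real \<Rightarrow> real ^ 'm)
    \<Rightarrow> nat \<Rightarrow> real \<Rightarrow> real \<Rightarrow> real ^ 'm" where
  "res_det R \<Psi> yq wq f ust j t x = nisp_coeff R \<Psi> yq wq (\<lambda>l. residual f (ust l) t x) j"

text \<open>\<open>usts\<close> is the space-time-stochastic reconstruction, with arguments \<open>t\<close>, \<open>x\<close>, \<open>y\<close>.\<close>

definition res_sc ::
  "real measure \<Rightarrow> (nat \<Rightarrow> real \<Rightarrow> real) \<Rightarrow> (real ^ 'm::finite \<Rightarrow> real ^ 'm)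
    \<Rightarrow> (real \<Rightarrow> real \<Rightarrow> real \<Rightarrow> real ^ 'm) \<Rightarrow> nat \<Rightarrow> real \<Rightarrow> real \<Rightarrow> real ^ 'm" where
  "res_sc P \<Psi> f usts j t x = (LINT y|P. \<Psi> j y *\<^sub>R dx (\<lambda>s z. f (usts s z y)) t x)"

definition res_sq ::
  "real measure \<Rightarrow> nat \<Rightarrow> (nat \<Rightarrow> real \<Rightarrow> real) \<Rightarrow> (nat \<Rightarrow> real) \<Rightarrow> (nat \<Rightarrow> real)
    \<Rightarrow> (real ^ 'm::finite \<Rightarrow> real ^ 'm) \<Rightarrow> (nat \<Rightarrow> real \<Rightarrow> real \<Rightarrow> real ^ 'm)
    \<Rightarrow> (real \<Rightarrow> real \<Rightarrow> real \<Rightarrow> real ^ 'm) \<Rightarrow> nat \<Rightarrow> real \<Rightarrow> real \<Rightarrow> real ^ 'm" where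
  "res_sq P R \<Psi> yq wq f ust usts j t x =
    (LINT y|P. \<Psi> j y *\<^sub>R dx (\<lambda>s z. f (usts s z y)) t x)
      - nisp_coeff R \<Psi> yq wq (\<lambda>l. dx (\<lambda>s z. f (ust l s z)) t x) j"

definition E_det ::
  "nat \<Rightarrow> nat \<Rightarrow> (nat \<Rightarrow> real \<Rightarrow> real) \<Rightarrow> (nat \<Rightarrow> real) \<Rightarrow> (nat \<Rightarrow> real)
    \<Rightarrow> (real ^ 'm::finite \<Rightarrow> real ^ 'm) \<Rightarrow> (nat \<Rightarrow> real \<Rightarrow> real \<Rightarrow> real ^ 'm) \<Rightarrow> real \<Rightarrow> ennreal" where
  "E_det M R \<Psi> yq wq f ust t =
    (\<Sum>j\<le>M. sqnorm_L2 (time_strip t) (\<lambda>(s, x). res_det R \<Psi> yq wq f ust j s x))"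

definition E_sq ::
  "real measure \<Rightarrow> nat \<Rightarrow> nat \<Rightarrow> (nat \<Rightarrow> real \<Rightarrow> real) \<Rightarrow> (nat \<Rightarrow> real) \<Rightarrow> (nat \<Rightarrow> real)
    \<Rightarrow> (real ^ 'm::finite \<Rightarrow> real ^ 'm) \<Rightarrow> (nat \<Rightarrow> real \<Rightarrow> real \<Rightarrow> real ^ 'm)
    \<Rightarrow> (real \<Rightarrow> real \<Rightarrow> real \<Rightarrow> real ^ 'm) \<Rightarrow> real \<Rightarrow> ennreal" where
  "E_sq P M R \<Psi> yq wq f ust usts t =
    (\<Sum>j\<le>M. sqnorm_L2 (time_strip t) (\<lambda>(s, x). res_sq P R \<Psi> yq wq f ust usts j s x))"

definition E_sc ::
  "real measure \<Rightarrow> nat \<Rightarrow> (nat \<Rightarrow> real \<Rightarrow> real) \<Rightarrow> (real ^ 'm::finite \<Rightarrow> real ^ 'm)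
    \<Rightarrow> (real \<Rightarrow> real \<Rightarrow> real \<Rightarrow> real ^ 'm) \<Rightarrow> real \<Rightarrow> ennreal" where
  "E_sc P M \<Psi> f usts t =
    (\<Sum>\<^sub>\<infinity>j\<in>{M<..}. sqnorm_L2 (time_strip t) (\<lambda>(s, x). res_sc P \<Psi> f usts j s x))"

end

theory Submission imports Defs begin

text \<open>For almost every \<open>y\<close> the entropy solution \<open>u\<close> is compared with the Lipschitz reconstruction \<open>v\<close> through the
  relative entropy \<open>\<eta>(u) - \<eta>(v) - D\<eta>(v)(u - v)\<close>, which is comparable to \<open>|u - v|\<^sup>2\<close> on \<open>C\<close>. Testing the entropy
  inequality with \<open>\<phi>\<close> and the weak formulation with \<open>\<phi> D\<eta>(v)\<close> bounds its growth by the residual. As \<open>\<phi>\<close> one takes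
  the product of a ramp in time, a cutoff to a backward cone whose speed dominates the ratio of relative entropy flux
  to relative entropy, and the weight \<open>exp (- B t)\<close>, which replaces Gronwall's lemma. This controls averages in time
  only; the bound at the time \<open>t\<^sub>n\<close> itself follows by weak continuity of \<open>u\<close> in time and weak lower semicontinuity
  of the norm. Integrating over \<open>y\<close>, Parseval's identity splits the residual into the modes \<open>j \<le> M\<close>
  (deterministic and quadrature parts) and \<open>j > M\<close> (cut-off part).\<close>

section \<open>Lipschitz functions of one real variable\<close>


text \<open>The reconstruction is merely Lipschitz in \<open>(t, x)\<close>, hence so are all test
  functions built from it. Product rule, chain rule and integration by parts hold almost everywhere
  only, which is why differentiability of Lipschitz functions on the line comes first. The terms
  linear in \<open>u - v\<close> cancel because \<open>H\<eta> Df\<close> is symmetric, the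
  derivative of the compatibility relation; Young's inequality on the residual term then leaves the
  square of the upper entropy constant in the exponent. The cone speed disappears when the cone
  radius tends to infinity. The exponent must be one number for almost all \<open>y\<close>,
  although the nested essential supremum has, at each \<open>t\<close>, its own exceptional set of
  \<open>y\<close>; a joint essential supremum in \<open>(y, x)\<close>, truncated at the Lipschitz
  constant of the slice, resolves this. Membership in \<open>C\<close> is assumed for
  \<open>u\<close> on the open strip, so for the initial datum it has to be derived. Two factors 2
  arise from squaring sums of two terms: one from inserting the reconstruction between
  \<open>u\<close> and the numerical solution, one from splitting a mode \<open>j \<le> M\<close>; a
  mode \<open>j > M\<close> consists of the cut-off residual alone and gets none.\<close>

lemma le_of_right_step:
  fixes w :: "real \<Rightarrow> real"
  assumes "a \<le> b" "continuous_on {a..b} w"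
    and step: "\<And>t. a \<le> t \<Longrightarrow> t < b \<Longrightarrow> \<exists>s>t. s \<le> b \<and> w t \<le> w s"
  shows "w a \<le> w b"
proof -
  \<comment> \<open>The supremum of this closed set belongs to it, and a step to the right from a
    point below \<open>b\<close> would stay in it; so the supremum is \<open>b\<close>.\<close>
  define S where "S = {t\<in>{a..b}. w a \<le> w t}"
  have "closed S"
    unfolding S_def using assms(2) by (intro continuous_on_closed_Collect_le continuous_intros) auto
  moreover have S: "a \<in> S" "bdd_above S" using assms(1) by (auto simp: S_def intro!: bdd_aboveI[of _ b])
  ultimately have m: "Sup S \<in> S" by (intro closed_contains_Sup) auto
  have "Sup S = b"
  proof (rule ccontr)
    assume "Sup S \<noteq> b"
    then have "a \<le> Sup S" "Sup S < b" using m by (auto simp: S_def)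
    from step[OF this] obtain s where "s > Sup S" "s \<le> b" "w (Sup S) \<le> w s" by auto
    then have "s \<in> S" using m by (auto simp: S_def)
    then have "s \<le> Sup S" using S(2) by (rule cSup_upper)
    with \<open>s > Sup S\<close> show False by simp
  qed
  with m show ?thesis by (auto simp: S_def)
qed

lemma set_integrable_bounded:
  fixes f :: "real \<Rightarrow> 'b::{banach, second_countable_topology}"
  assumes "f \<in> borel_measurable borel" "\<And>t. norm (f t) \<le> K"
  shows "set_integrable lborel {a..b} f"
  unfolding set_integrable_def
  by (rule integrableI_bounded_set_indicator[where B=K]) (use assms in \<open>auto simp: emeasure_lborel_Icc_eq\<close>)

text \<open>For \<open>e > 0\<close> the superlevel set \<open>{t. j * e \<le> g t}\<close> is covered by an open set \<open>O' j\<close> of nearly the same measure;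
  \<open>e\<close> times the sum over \<open>j\<close> of the primitives of their indicators then grows everywhere at least as fast as \<open>v\<close>,
  up to a slope of order \<open>e\<close>.\<close>
lemma increment_le_integral_of_lower_Dini_nonneg:
  fixes v g :: "real \<Rightarrow> real"
  assumes ab: "a \<le> b" and v: "continuous_on {a..b} v" and g: "g \<in> borel_measurable borel"
    and bd: "\<And>t. 0 \<le> g t" "\<And>t. g t \<le> K"
    and step: "\<And>t \<epsilon> \<delta>. 0 < \<epsilon> \<Longrightarrow> 0 < \<delta> \<Longrightarrow> \<exists>s>t. s < t + \<delta> \<and> v s - v t \<le> (g t + \<epsilon>) * (s - t)"
  shows "v b - v a \<le> (LINT t:{a..b}|lborel. g t)"
proof -
  have main: "v b - v a \<le> (LINT t:{a..b}|lborel. g t) + e * (2 * (b - a) + 1)" if e: "0 < e" for e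
  proof -
    \<comment> \<open>With this many levels of height \<open>e\<close> the whole range of
      \<open>g\<close> is covered.\<close>
    obtain n :: nat where n: "K < real n * e" "n > 0"
    proof -
      obtain n :: nat where "K / e < real n" using reals_Archimedean2 by blast
      then show ?thesis using that[of "Suc n"] e by (auto simp: field_simps)
    qed
    define A where "A j = {t\<in>{a..b}. real j * e \<le> g t}" for j :: nat
    have A: "A j \<in> sets borel" for j unfolding A_def using g by measurable
    have Afin: "emeasure lborel (A j) < \<infinity>" for j
    proof -
      have "emeasure lborel (A j) \<le> emeasure lborel {a..b}" by (rule emeasure_mono) (auto simp: A_def)
      also have "\<dots> < \<infinity>" by (simp add: emeasure_lborel_Icc_eq)
      finally show ?thesis .
    qed
    \<comment> \<open>An excess measure of \<open>1 / n\<close> for each of the \<open>n\<close>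
      levels adds up to at most 1, so after multiplication by \<open>e\<close> the coverings cost no
      more than \<open>e\<close>.\<close>
    have "\<exists>O'. open O' \<and> A j \<subseteq> O' \<and> emeasure lborel (O' - A j) < ennreal (1 / n)" for j
      using outer_regular_lborel[OF A, of "1 / n" j] n by auto
    then obtain O' where O': "\<And>j. open (O' j)" "\<And>j. A j \<subseteq> O' j" "\<And>j. emeasure lborel (O' j - A j) < ennreal (1 / n)"
      by metis
    define m where "m j t = measure lborel (O' j \<inter> {a..t})" for j t
    have [simp]: "O' j \<in> sets borel" for j using O' by auto
    have fmI: "{s..t} \<in> fmeasurable lborel" "{s<..t} \<in> fmeasurable lborel" for s t :: real
      by (cases "s \<le> t"; auto simp: fmeasurable_def emeasure_lborel_Icc_eq)+
    have fm: "O' j \<inter> {s..t} \<in> fmeasurable lborel" for j s t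
      by (rule fmeasurableI2[OF fmI(1)[of s t]]) auto
    have fm': "O' j \<inter> {s<..t} \<in> fmeasurable lborel" for j s t
      by (rule fmeasurableI2[OF fmI(2)[of s t]]) auto
    have msplit: "m j s = m j t + measure lborel (O' j \<inter> {t<..s})" if "a \<le> t" "t \<le> s" for j s t
    proof -
      have "O' j \<inter> {a..s} = (O' j \<inter> {a..t}) \<union> (O' j \<inter> {t<..s})" using that by auto
      then show ?thesis unfolding m_def using fm[of j a t] fm'[of j t s]
        by (simp only:) (rule measure_Union, auto simp: fmeasurable_def)
    qed
    have mle: "measure lborel (O' j \<inter> {t<..s}) \<le> s - t" if "t \<le> s" for j s t
      using measure_mono_fmeasurable[of "O' j \<inter> {t<..s}" "{t<..s}" lborel] fmI(2)[of t s] fm'[of j t s] that by (auto simp: fmeasurable_def)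
    have mono: "m j t \<le> m j s" if "a \<le> t" "t \<le> s" for j s t using msplit[OF that] by simp
    have "1-lipschitz_on {a..b} (m j)" for j
    proof (rule lipschitz_onI)
      fix x y assume "x \<in> {a..b}" "y \<in> {a..b}"
      then show "dist (m j x) (m j y) \<le> 1 * dist x y"
        using msplit[of x y j] msplit[of y x j] mle[of x y j] mle[of y x j] mono[of x y j] mono[of y x j]
        by (cases "x \<le> y") (auto simp: dist_real_def)
    qed simp
    then have mc: "continuous_on {a..b} (m j)" for j using lipschitz_on_continuous_on by blast
    \<comment> \<open>Of the extra slope \<open>2 * e\<close>, one \<open>e\<close> pays for
      rounding \<open>g\<close> down to a level and the other for the tolerance in
      \<open>step\<close>.\<close>
    define W where "W t = 2 * e * (t - a) + e * (\<Sum>j=1..n. m j t) - v t" for t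
    have "W a \<le> W b"
    proof (rule le_of_right_step[OF ab])
      show "continuous_on {a..b} W" unfolding W_def by (intro continuous_intros mc v)
      fix t assume t: "a \<le> t" "t < b"
      \<comment> \<open>\<open>k\<close> is the highest level reached by \<open>g\<close> at
        \<open>t\<close>. The point \<open>t\<close> lies in the open sets of all levels up to
        \<open>k\<close>, so on a short interval to its right each of these \<open>k\<close>
        primitives has slope exactly 1.\<close>
      define k where "k = nat \<lfloor>g t / e\<rfloor>"
      have kr: "real k = of_int \<lfloor>g t / e\<rfloor>" using bd(1)[of t] e by (simp add: k_def)
      have k: "real k * e \<le> g t" "g t < (real k + 1) * e"
        using e mult_right_mono[OF of_int_floor_le[of "g t / e"], of e] real_of_int_floor_add_one_gt[of "g t / e"]
        unfolding kr by (auto simp: field_simps)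
      have "real k * e < real n * e" using k(1) bd(2)[of t] n(1) by linarith
      then have kn: "k \<le> n" using e by simp
      have tO: "t \<in> O' j" if "j \<in> {1..k}" for j
      proof -
        have "real j * e \<le> real k * e" using that e by simp
        then have "t \<in> A j" using k t by (auto simp: A_def)
        then show ?thesis using O'(2) by blast
      qed
      have "open (\<Inter>j\<in>{1..k}. O' j)" by (intro open_INT) (auto simp: O')
      moreover have "t \<in> (\<Inter>j\<in>{1..k}. O' j)" using tO by auto
      ultimately obtain d where d: "d > 0" "ball t d \<subseteq> (\<Inter>j\<in>{1..k}. O' j)" by (meson open_contains_ball)
      obtain s where s: "s > t" "s < t + min d (b - t)" "v s - v t \<le> (g t + e) * (s - t)"
        using step[OF e, of "min d (b - t)" t] d(1) t by auto
      have "m j s - m j t \<ge> (if j \<in> {1..k} then s - t else 0)" for j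
      proof (cases "j \<in> {1..k}")
        case True
        have "{t<..s} \<subseteq> ball t d" using s by (auto simp: dist_real_def)
        then have "O' j \<inter> {t<..s} = {t<..s}" using d(2) True by blast
        then show ?thesis using msplit[of t s j] t s True by simp
      qed (use mono[of t s j] t s in auto)
      then have "(\<Sum>j=1..n. if j \<in> {1..k} then s - t else 0) \<le> (\<Sum>j=1..n. m j s - m j t)"
        by (intro sum_mono)
      also have "(\<Sum>j=1..n. if j \<in> {1..k} then s - t else 0) = (\<Sum>j=1..k. s - t)"
        using kn by (subst sum.inter_restrict[symmetric]) (auto simp: Int_absorb1 intro!: sum.cong)
      finally have "real k * (s - t) \<le> (\<Sum>j=1..n. m j s) - (\<Sum>j=1..n. m j t)" by (simp add: sum_subtractf)
      then have "e * (real k * (s - t)) \<le> e * ((\<Sum>j=1..n. m j s) - (\<Sum>j=1..n. m j t))" using e by simp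
      moreover have "(g t + e) * (s - t) \<le> ((real k + 1) * e + e) * (s - t)" using k s by (intro mult_right_mono) auto
      ultimately have "W t \<le> W s" using s(3) by (simp add: W_def algebra_simps)
      then show "\<exists>s>t. s \<le> b \<and> W t \<le> W s" using s by (intro exI[of _ s]) auto
    qed
    moreover have "m j a = 0" for j
    proof -
      have "m j a \<le> measure lborel {a}" unfolding m_def by (rule measure_mono_fmeasurable) (auto simp: fmeasurable_def)
      then show ?thesis by (simp add: m_def measure_nonneg order_antisym)
    qed
    ultimately have "v b - v a \<le> 2 * e * (b - a) + e * (\<Sum>j=1..n. m j b)" by (simp add: W_def)
    also have "(\<Sum>j=1..n. m j b) \<le> (\<Sum>j=1..n. measure lborel (A j) + 1 / n)"
    proof (rule sum_mono)
      fix j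
      have Af: "A j \<in> fmeasurable lborel" using A[of j] by (intro fmeasurableI2[OF fmI(1)[of a b]]) (auto simp: A_def)
      have Df: "O' j - A j \<in> fmeasurable lborel"
        by (rule fmeasurableI) (use A O'(3)[of j] in \<open>auto intro: less_trans\<close>)
      have "m j b \<le> measure lborel (A j \<union> (O' j - A j))"
        unfolding m_def using fm fmeasurable.Un[OF Af Df] by (intro measure_mono_fmeasurable) auto
      also have "\<dots> = measure lborel (A j) + measure lborel (O' j - A j)"
        using Af Df by (intro measure_Union) (auto simp: fmeasurable_def)
      also have "measure lborel (O' j - A j) \<le> 1 / n"
        using O'(3)[of j] unfolding measure_def by (intro enn2real_leI) auto
      finally show "m j b \<le> measure lborel (A j) + 1 / n" by simp
    qed
    also have "e * (\<Sum>j=1..n. measure lborel (A j) + 1 / n) = (\<Sum>j=1..n. e * measure lborel (A j)) + e"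
      using n(2) by (simp add: sum.distrib sum_distrib_left distrib_left)
    also have "(\<Sum>j=1..n. e * measure lborel (A j)) = (LINT t|lborel. (\<Sum>j=1..n. e * indicator (A j) t))"
    proof -
      have *: "emeasure lborel (A j) < \<infinity>" for j by (rule Afin)
      have "(LINT t|lborel. (\<Sum>j=1..n. e * indicator (A j) t)) = (\<Sum>j=1..n. LINT t|lborel. e * indicator (A j) t)"
        using * A by (intro Bochner_Integration.integral_sum integrable_mult_right integrable_real_indicator) auto
      then show ?thesis by simp
    qed
    \<comment> \<open>Layer-cake estimate: at each \<open>t\<close> the number of levels
      \<open>j \<ge> 1\<close> with \<open>real j * e \<le> g t\<close>, times \<open>e\<close>,
      does not exceed \<open>g t\<close>.\<close>
    also have "\<dots> \<le> (LINT t:{a..b}|lborel. g t)"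
      unfolding set_lebesgue_integral_def
    proof (rule integral_mono)
      have "emeasure lborel (A j) < \<infinity>" for j by (rule Afin)
      then show "integrable lborel (\<lambda>t. \<Sum>j=1..n. e * indicator (A j) t)"
        using A by (intro Bochner_Integration.integrable_sum integrable_mult_right integrable_real_indicator) auto
      show "integrable lborel (\<lambda>t. indicat_real {a..b} t *\<^sub>R g t)"
        using set_integrable_bounded[OF g, of K a b] bd by (auto simp: set_integrable_def)
      fix t
      have "(\<Sum>j=1..n. e * indicator (A j) t) \<le> g t" if t: "t \<in> {a..b}"
      proof -
        define k where "k = nat \<lfloor>g t / e\<rfloor>"
        have kr: "real k = of_int \<lfloor>g t / e\<rfloor>" using bd(1)[of t] e by (simp add: k_def)
        have k: "real k * e \<le> g t" "g t < (real k + 1) * e"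
          using e mult_right_mono[OF of_int_floor_le[of "g t / e"], of e] real_of_int_floor_add_one_gt[of "g t / e"]
          unfolding kr by (auto simp: field_simps)
        have "j \<le> k" if "t \<in> A j" for j
        proof -
          have "real j * e < real (k + 1) * e" using that k by (auto simp: A_def algebra_simps)
          then show ?thesis using e by simp
        qed
        then have "(\<Sum>j=1..n. e * indicator (A j) t) = (\<Sum>j\<in>{1..n} \<inter> {..k}. e * indicator (A j) t)"
          by (intro sum.mono_neutral_right) (auto simp: indicator_def)
        also have "\<dots> \<le> (\<Sum>j\<in>{1..n} \<inter> {..k}. e)" using e by (intro sum_mono) (auto simp: indicator_def)
        also have "\<dots> \<le> (\<Sum>j\<in>{1..k}. e)" using e by (intro sum_mono2) auto
        finally show ?thesis using k by simp
      qed
      then show "(\<Sum>j=1..n. e * indicator (A j) t) \<le> indicat_real {a..b} t *\<^sub>R g t"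
        by (cases "t \<in> {a..b}") (auto simp: A_def indicator_def)
    qed
    finally show ?thesis using e by (simp add: algebra_simps)
  qed
  show ?thesis
  proof (rule field_le_epsilon)
    fix e :: real assume "0 < e"
    \<comment> \<open>The error in \<open>main\<close> is \<open>e\<close> times this denominator,
      so the choice makes it equal to the prescribed tolerance.\<close>
    define d where "d = e / (2 * (b - a) + 1)"
    have "d > 0" "d * (2 * (b - a) + 1) = e" using \<open>0 < e\<close> ab by (auto simp: d_def field_simps intro!: divide_pos_pos)
    with main[of d] show "v b - v a \<le> (LINT t:{a..b}|lborel. g t) + e" by simp
  qed
qed

text \<open>Adding \<open>K\<close> to \<open>g\<close> and the linear function \<open>K * t\<close>
  to \<open>v\<close> shifts both sides by \<open>K * (b - a)\<close> and reduces to the nonnegative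
  case.\<close>

lemma increment_le_integral_of_lower_Dini:
  fixes v g :: "real \<Rightarrow> real"
  assumes ab: "a \<le> b" and v: "continuous_on {a..b} v" and g: "g \<in> borel_measurable borel"
    and bd: "\<And>t. \<bar>g t\<bar> \<le> K"
    and step: "\<And>t \<epsilon> \<delta>. 0 < \<epsilon> \<Longrightarrow> 0 < \<delta> \<Longrightarrow> \<exists>s>t. s < t + \<delta> \<and> v s - v t \<le> (g t + \<epsilon>) * (s - t)"
  shows "v b - v a \<le> (LINT t:{a..b}|lborel. g t)"
proof -
  have "(v b + K * b) - (v a + K * a) \<le> (LINT t:{a..b}|lborel. g t + K)"
  proof (rule increment_le_integral_of_lower_Dini_nonneg[OF ab, where K="2*K"])
    fix t \<epsilon> \<delta> :: real assume "0 < \<epsilon>" "0 < \<delta>"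
    from step[OF this] obtain s where "s > t" "s < t + \<delta>" "v s - v t \<le> (g t + \<epsilon>) * (s - t)" by blast
    then show "\<exists>s>t. s < t + \<delta> \<and> v s + K * s - (v t + K * t) \<le> (g t + K + \<epsilon>) * (s - t)"
      by (intro exI[of _ s]) (auto simp: algebra_simps)
  next
    fix t show "0 \<le> g t + K" "g t + K \<le> 2 * K" using bd[of t] by auto
  qed (use g in \<open>auto intro!: continuous_intros v\<close>)
  also have "\<dots> = (LINT t:{a..b}|lborel. g t) + (LINT t:{a..b}|lborel. K)"
    using g bd by (intro set_integral_add set_integrable_bounded[where K=K] set_integrable_bounded[where K="\<bar>K\<bar>"]) auto
  also have "(LINT t:{a..b}|lborel. K) = K * (b - a)"
    using ab by (simp add: set_lebesgue_integral_def)
  finally show ?thesis by (simp add: algebra_simps)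
qed

text \<open>The lower right Dini derivative. Increments are restricted to rationals so that only
  countable infima and suprema occur and measurability in \<open>t\<close> is immediate; for
  continuous \<open>v\<close> this restriction does not change the value.\<close>

definition lower_Dini :: "(real \<Rightarrow> real) \<Rightarrow> real \<Rightarrow> ereal" where
  "lower_Dini v t = (SUP n::nat. INF h\<in>{h. h \<in> \<rat> \<and> 0 < h \<and> h < 1 / (real n + 1)}. ereal ((v (t + h) - v t) / h))"

lemma borel_measurable_lower_Dini:
  assumes "continuous_on UNIV v"
  shows "lower_Dini v \<in> borel_measurable borel"
proof -
  have [measurable]: "v \<in> borel_measurable borel" using assms by (rule borel_measurable_continuous_onI)
  have c: "countable {h::real. h \<in> \<rat> \<and> 0 < h \<and> h < 1 / (real n + 1)}" for n
    by (rule countable_subset[OF _ countable_rat]) auto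
  show ?thesis unfolding lower_Dini_def[abs_def]
    by (intro borel_measurable_SUP borel_measurable_INF c) auto
qed

text \<open>For fixed \<open>t\<close> the difference quotient is continuous in the increment away
  from 0. If it fell below \<open>c\<close> at a real increment, it would do so at a nearby rational
  one.\<close>

lemma lower_Dini_greaterD:
  assumes v: "continuous_on UNIV v" and c: "ereal c < lower_Dini v t"
  shows "\<exists>d>0. \<forall>h. 0 < h \<and> h < d \<longrightarrow> c \<le> (v (t + h) - v t) / h"
proof -
  obtain n :: nat where n: "ereal c < (INF h\<in>{h. h \<in> \<rat> \<and> 0 < h \<and> h < 1 / (real n + 1)}. ereal ((v (t + h) - v t) / h))"
    using c unfolding lower_Dini_def less_SUP_iff by auto
  have q: "c \<le> (v (t + h) - v t) / h" if "h \<in> \<rat>" "0 < h" "h < 1 / (real n + 1)" for h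
  proof -
    have "ereal c \<le> ereal ((v (t + h) - v t) / h)"
      using n that by (intro order.trans[OF less_imp_le[OF n] INF_lower]) auto
    then show ?thesis by simp
  qed
  show ?thesis
  proof (intro exI[of _ "1 / (real n + 1)"] conjI allI impI)
    fix h :: real assume h: "0 < h \<and> h < 1 / (real n + 1)"
    show "c \<le> (v (t + h) - v t) / h"
    proof (rule ccontr)
      assume "\<not> ?thesis"
      moreover have "((\<lambda>x. (v (t + x) - v t) / x) \<longlongrightarrow> (v (t + h) - v t) / h) (at h)"
        using v h by (intro tendsto_intros continuous_on_tendsto_compose[OF v]) auto
      ultimately have "eventually (\<lambda>x. (v (t + x) - v t) / x < c) (at h)"
        by (auto dest!: order_tendstoD(2))
      moreover have "eventually (\<lambda>x. x \<in> {0<..<1 / (real n + 1)}) (at h)"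
        using h by (intro eventually_at_in_open') auto
      ultimately have "eventually (\<lambda>x. (v (t + x) - v t) / x < c \<and> x \<in> {0<..<1 / (real n + 1)}) (at h)"
        by (rule eventually_conj)
      then obtain d where d: "d > 0" "\<And>x. x \<noteq> h \<Longrightarrow> dist x h < d \<Longrightarrow> (v (t + x) - v t) / x < c \<and> x \<in> {0<..<1 / (real n + 1)}"
        unfolding eventually_at by auto
      obtain x where "x \<in> \<rat>" "h < x" "x < h + d" using Rats_dense_in_real[of h "h + d"] d by auto
      then show False using d(2)[of x] q[of x] by (auto simp: dist_real_def)
    qed
  qed auto
qed

lemma lower_Dini_lessD:
  assumes c: "lower_Dini v t < ereal c" and "0 < d"
  shows "\<exists>h. 0 < h \<and> h < d \<and> (v (t + h) - v t) / h < c"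
proof -
  obtain n :: nat where n: "1 / (real n + 1) < d"
    using assms(2) nat_approx_posE[of d] by (metis of_nat_Suc add.commute)
  have "(INF h\<in>{h. h \<in> \<rat> \<and> 0 < h \<and> h < 1 / (real n + 1)}. ereal ((v (t + h) - v t) / h)) < ereal c"
    by (rule le_less_trans[OF _ c], unfold lower_Dini_def, rule SUP_upper) auto
  then obtain h where "h \<in> \<rat>" "0 < h" "h < 1 / (real n + 1)" "(v (t + h) - v t) / h < c"
    unfolding INF_less_iff by auto
  then show ?thesis using n by (intro exI[of _ h]) auto
qed

text \<open>All difference quotients lie between \<open>- K\<close> and \<open>K\<close>, hence so
  does their lower limit; the extended-real derivative becomes a bounded real function that can be
  integrated.\<close>

lemma lower_Dini_Lipschitz:
  assumes v: "K-lipschitz_on UNIV v"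
  obtains g where "g \<in> borel_measurable borel" "\<And>t. lower_Dini v t = ereal (g t)" "\<And>t. \<bar>g t\<bar> \<le> K"
proof -
  have vc: "continuous_on UNIV v" using v by (rule lipschitz_on_continuous_on)
  have q: "\<bar>(v (t + h) - v t) / h\<bar> \<le> K" if "h > 0" for t h
    using lipschitz_onD[OF v, of "t + h" t] that by (auto simp: dist_real_def field_simps)
  have "lower_Dini v t \<le> ereal K" for t
  proof (rule ccontr)
    assume "\<not> ?thesis"
    then obtain c where "K < c" "ereal c < lower_Dini v t" by (metis not_le ereal_dense2 ereal_less_eq(3) less_ereal.simps(1))
    then obtain d where "d > 0" and dq: "\<forall>h. 0 < h \<and> h < d \<longrightarrow> c \<le> (v (t + h) - v t) / h"
      using lower_Dini_greaterD[OF vc] by blast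
    then have "c \<le> (v (t + d/2) - v t) / (d/2)" using \<open>d > 0\<close> by (intro dq[rule_format]) auto
    with q[of "d/2" t] \<open>K < c\<close> \<open>d > 0\<close> show False by linarith
  qed
  moreover have "ereal (-K) \<le> lower_Dini v t" for t
  proof (rule ccontr)
    assume "\<not> ?thesis"
    then obtain h where "0 < h" "h < 1" "(v (t + h) - v t) / h < -K"
      using lower_Dini_lessD[of v t "-K" 1] by (auto simp: not_le)
    with q[of h t] show False by linarith
  qed
  ultimately have b: "ereal (-K) \<le> lower_Dini v t" "lower_Dini v t \<le> ereal K" for t by auto
  show thesis
  proof (rule that[of "\<lambda>t. real_of_ereal (lower_Dini v t)"])
    show "(\<lambda>t. real_of_ereal (lower_Dini v t)) \<in> borel_measurable borel"
      using borel_measurable_lower_Dini[OF vc] by measurable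
    fix t
    show e: "lower_Dini v t = ereal (real_of_ereal (lower_Dini v t))"
      using b[of t] by (cases "lower_Dini v t") auto
    show "\<bar>real_of_ereal (lower_Dini v t)\<bar> \<le> K"
      using b[of t] unfolding e[symmetric] by (cases "lower_Dini v t") auto
  qed
qed

text \<open>Closed intervals form an intersection-stable generator of the Borel sets. Dynkin
  induction therefore extends the vanishing of integrals from intervals to all Borel sets.\<close>

lemma AE_eq_0_if_interval_integrals_eq_0:
  fixes z :: "real \<Rightarrow> 'b::{banach, second_countable_topology}"
  assumes i: "\<And>a b. set_integrable lborel {a..b} z" and 0: "\<And>a b. a \<le> b \<Longrightarrow> (LINT t:{a..b}|lborel. z t) = 0"
  shows "AE t in lborel. z t = 0"
proof -
  \<comment> \<open>Only local integrability is given. Truncation to a bounded interval makes the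
    function integrable on the whole line, as the complement and countable-union steps of the
    induction require.\<close>
  have "AE t in lborel. indicator {-real N..real N} t *\<^sub>R z t = 0" for N :: nat
  proof (rule sigma_finite_measure.density_zero[OF lborel.sigma_finite_measure_axioms])
    let ?g = "\<lambda>t. indicat_real {-real N..real N} t *\<^sub>R z t"
    show I: "integrable lborel ?g" using i[of "-N" N] by (simp add: set_integrable_def)
    have gen: "sets lborel = sigma_sets UNIV (range (\<lambda>(a::real,b). {a..b}))"
      unfolding sets_lborel by (subst borel_eq_atLeastAtMost) simp
    have Int_st: "Int_stable (range (\<lambda>(a::real,b). {a..b}))" by (auto simp: Int_stable_def image_iff)
    have Pw: "range (\<lambda>(a::real,b). {a..b}) \<subseteq> Pow UNIV" by simp
    fix A :: "real set" assume A: "A \<in> sets lborel"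
    have ii: "integrable lborel (\<lambda>t. indicator B t *\<^sub>R ?g t)" if "B \<in> sets lborel" for B
      using I that by (rule integrable_mult_indicator[rotated])
    show "set_lebesgue_integral lborel A ?g = 0"
      using Int_st Pw A[unfolded gen]
    proof (induction A rule: sigma_sets_induct_disjoint)
      case (basic A)
      then obtain a b where A: "A = {a..b}" by auto
      have "(\<lambda>t. indicator A t *\<^sub>R ?g t) = (\<lambda>t. indicator {max a (-real N)..min b (real N)} t *\<^sub>R z t)"
        by (auto simp: A indicator_def fun_eq_iff)
      then have "set_lebesgue_integral lborel A ?g = (LINT t:{max a (-real N)..min b (real N)}|lborel. z t)"
        unfolding set_lebesgue_integral_def by metis
      also have "\<dots> = 0" using 0[of "max a (-real N)" "min b (real N)"]
        by (cases "max a (-real N) \<le> min b (real N)") (auto simp: set_lebesgue_integral_def)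
      finally show ?case .
    next
      case empty then show ?case by (simp add: set_lebesgue_integral_def)
    next
      case (compl A)
      then have A: "A \<in> sets lborel" unfolding gen by blast
      have "indicator (UNIV - A) t *\<^sub>R ?g t = ?g t - indicator A t *\<^sub>R ?g t" for t by (auto simp: indicator_def)
      then have "set_lebesgue_integral lborel (UNIV - A) ?g = (LINT t|lborel. ?g t) - set_lebesgue_integral lborel A ?g"
        unfolding set_lebesgue_integral_def using ii[OF A] I by simp
      also have "\<dots> = 0" using compl 0[of "-real N" "real N"] by (simp add: set_lebesgue_integral_def)
      finally show ?case by simp
    next
      case (union A)
      then have "set_integrable lborel (\<Union>i. A i) ?g"
        unfolding set_integrable_def by (intro ii) (auto simp: gen[symmetric] simp del: sets_lborel)
      then have "set_lebesgue_integral lborel (\<Union>i. A i) ?g = (\<Sum>i. set_lebesgue_integral lborel (A i) ?g)"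
        using union by (intro lebesgue_integral_countable_add) (auto simp: gen[symmetric] disjoint_family_on_def simp del: sets_lborel)
      then show ?case using union by simp
    qed
  qed
  then have "AE t in lborel. \<forall>N::nat. indicator {-real N..real N} t *\<^sub>R z t = 0" by (subst AE_all_countable) auto
  then show ?thesis
  proof (rule AE_mp, intro AE_I2 impI)
    fix t assume *: "\<forall>N::nat. indicat_real {-real N..real N} t *\<^sub>R z t = 0"
    obtain N :: nat where "\<bar>t\<bar> \<le> real N" using real_arch_simple by blast
    then show "z t = 0" using spec[OF *, of N] by (auto simp: indicator_def)
  qed
qed


text \<open>The lower Dini derivative of \<open>- v\<close> is minus the upper one of
  \<open>v\<close>, so this is the inequality between lower and upper limits of the same
  quotients.\<close>

lemma lower_Dini_add_uminus_le:
  assumes v: "continuous_on UNIV v" and "lower_Dini v t = ereal r" "lower_Dini (\<lambda>x. - v x) t = ereal r'"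
  shows "r + r' \<le> 0"
proof (rule ccontr)
  assume *: "\<not> ?thesis"
  define e where "e = (r + r') / 4"
  have e: "e > 0" using * by (auto simp: e_def)
  obtain d where d: "d > 0" "\<forall>h. 0 < h \<and> h < d \<longrightarrow> r - e \<le> (v (t + h) - v t) / h"
    using lower_Dini_greaterD[OF v, of "r - e" t] assms(2) e by auto
  obtain d' where d': "d' > 0" "\<forall>h. 0 < h \<and> h < d' \<longrightarrow> r' - e \<le> (- v (t + h) - (- v t)) / h"
    using lower_Dini_greaterD[of "\<lambda>x. - v x" "r' - e" t] assms(3) e v by (auto intro!: continuous_intros)
  define h where "h = min d d' / 2"
  have h: "0 < h" "h < d" "h < d'" using d d' by (auto simp: h_def)
  have "r - e \<le> (v (t + h) - v t) / h" "r' - e \<le> - ((v (t + h) - v t) / h)"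
    using d d' h by (auto simp: diff_divide_distrib)
  then have "r + r' \<le> 2 * e" by linarith
  then show False using e by (simp add: e_def)
qed

text \<open>A fundamental theorem of calculus for Lipschitz functions: the lower Dini derivatives of \<open>v\<close> and \<open>- v\<close> have
  a nonpositive sum, while their integrals dominate increments of opposite sign.\<close>
lemma right_derivative_of_Lipschitz:
  fixes v :: "real \<Rightarrow> real"
  assumes v: "K-lipschitz_on UNIV v"
  obtains g where "g \<in> borel_measurable borel" "\<And>t. \<bar>g t\<bar> \<le> K"
    "\<And>a b. a \<le> b \<Longrightarrow> (LINT t:{a..b}|lborel. g t) = v b - v a"
    "AE t in lborel. lower_Dini v t = ereal (g t) \<and> lower_Dini (\<lambda>x. - v x) t = ereal (- g t)"
proof -
  have vc: "continuous_on S v" for S using v by (meson lipschitz_on_continuous_on continuous_on_subset subset_UNIV)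
  have v': "K-lipschitz_on UNIV (\<lambda>x. - v x)" using v by (simp add: lipschitz_on_minus_iff)
  obtain g where g: "g \<in> borel_measurable borel" "\<And>t. lower_Dini v t = ereal (g t)" "\<And>t. \<bar>g t\<bar> \<le> K"
    using lower_Dini_Lipschitz[OF v] by blast
  obtain g' where g': "g' \<in> borel_measurable borel" "\<And>t. lower_Dini (\<lambda>x. - v x) t = ereal (g' t)" "\<And>t. \<bar>g' t\<bar> \<le> K"
    using lower_Dini_Lipschitz[OF v'] by blast
  have sum: "g t + g' t \<le> 0" for t by (rule lower_Dini_add_uminus_le[OF vc g(2) g'(2)])
  have stp: "\<exists>s>t. s < t + \<delta> \<and> w s - w t \<le> (k t + \<epsilon>) * (s - t)"
    if pos: "0 < \<epsilon>" "0 < \<delta>" and w: "\<And>t. lower_Dini w t = ereal (k t)" for w k t \<epsilon> \<delta>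
  proof -
    obtain h where "0 < h" "h < \<delta>" "(w (t + h) - w t) / h < k t + \<epsilon>"
      using lower_Dini_lessD[of w t "k t + \<epsilon>" \<delta>] pos by (auto simp: w)
    then show ?thesis by (intro exI[of _ "t + h"]) (auto simp: divide_less_eq)
  qed
  have 1: "v b - v a \<le> (LINT t:{a..b}|lborel. g t)" if "a \<le> b" for a b
    by (rule increment_le_integral_of_lower_Dini[OF that vc g(1,3)]) (rule stp[OF _ _ g(2)])
  have 2: "(- v b) - (- v a) \<le> (LINT t:{a..b}|lborel. g' t)" if "a \<le> b" for a b
    by (rule increment_le_integral_of_lower_Dini[OF that _ g'(1,3)])
       (rule continuous_intros vc stp[OF _ _ g'(2)] | assumption)+
  have si: "set_integrable lborel {a..b} g" "set_integrable lborel {a..b} g'" for a b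
    using set_integrable_bounded[OF g(1), of K] set_integrable_bounded[OF g'(1), of K] g g' by auto
  have 3: "(LINT t:{a..b}|lborel. g t + g' t) = (LINT t:{a..b}|lborel. g t) + (LINT t:{a..b}|lborel. g' t)" for a b
    by (intro set_integral_add si)
  have 4: "(LINT t:{a..b}|lborel. g t + g' t) \<le> 0" for a b
  proof -
    have "0 \<le> (LINT t|lborel. - (indicat_real {a..b} t *\<^sub>R (g t + g' t)))"
      using sum by (intro integral_nonneg_AE) (auto simp: indicator_def)
    then show ?thesis by (simp add: set_lebesgue_integral_def)
  qed
  have 0: "(LINT t:{a..b}|lborel. g t + g' t) = 0" if "a \<le> b" for a b
    using 1[OF that] 2[OF that] 3[of a b] 4[of a b] by linarith
  have ae: "AE t in lborel. g t + g' t = 0"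
    by (rule AE_eq_0_if_interval_integrals_eq_0) (auto intro!: set_integral_add si 0)
  show thesis
  proof (rule that[OF g(1,3)])
    fix a b :: real assume "a \<le> b"
    then show "(LINT t:{a..b}|lborel. g t) = v b - v a" using 1[of a b] 2[of a b] 0[of a b] 3[of a b] by linarith
  next
    show "AE t in lborel. lower_Dini v t = ereal (g t) \<and> lower_Dini (\<lambda>x. - v x) t = ereal (- g t)"
      using ae by eventually_elim (auto simp: g(2) g'(2))
  qed
qed

text \<open>The one-sided result is applied to \<open>v\<close> and to its reflection, whose right
  derivative is the left derivative of \<open>v\<close>. Both one-sided derivatives have the
  increments of \<open>v\<close> as interval integrals, so they agree almost everywhere.\<close>

theorem Lipschitz_real_AE_derivative:
  fixes v :: "real \<Rightarrow> real"
  assumes v: "K-lipschitz_on UNIV v"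
  obtains g where "g \<in> borel_measurable borel" "\<And>t. \<bar>g t\<bar> \<le> K"
    "\<And>a b. a \<le> b \<Longrightarrow> (LINT t:{a..b}|lborel. g t) = v b - v a"
    "AE t in lborel. (v has_real_derivative g t) (at t)"
proof -
  have vc: "continuous_on UNIV v" using v by (rule lipschitz_on_continuous_on)
  obtain g where g: "g \<in> borel_measurable borel" "\<And>t. \<bar>g t\<bar> \<le> K"
    "\<And>a b. a \<le> b \<Longrightarrow> (LINT t:{a..b}|lborel. g t) = v b - v a"
    "AE t in lborel. lower_Dini v t = ereal (g t) \<and> lower_Dini (\<lambda>x. - v x) t = ereal (- g t)"
    using right_derivative_of_Lipschitz[OF v] by blast
  \<comment> \<open>Point reflection of the graph: the right difference quotients of
    \<open>w\<close> at \<open>- t\<close> are the left difference quotients of \<open>v\<close> at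
    \<open>t\<close>.\<close>
  define w where "w t = - v (- t)" for t
  have w: "K-lipschitz_on UNIV w"
    using lipschitz_onD[OF v, of "- _" "- _"] lipschitz_on_nonneg[OF v]
    by (intro lipschitz_onI) (auto simp: w_def dist_minus)
  have wc: "continuous_on UNIV w" using w by (rule lipschitz_on_continuous_on)
  obtain k where k: "k \<in> borel_measurable borel" "\<And>t. \<bar>k t\<bar> \<le> K"
    "\<And>a b. a \<le> b \<Longrightarrow> (LINT t:{a..b}|lborel. k t) = w b - w a"
    "AE t in lborel. lower_Dini w t = ereal (k t) \<and> lower_Dini (\<lambda>x. - w x) t = ereal (- k t)"
    using right_derivative_of_Lipschitz[OF w] by blast
  have ki: "(LINT t:{a..b}|lborel. k (- t)) = v b - v a" if "a \<le> b" for a b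
  proof -
    have "{x. - x \<in> {a..b}} = {- b..- a}" by auto
    then show ?thesis
      using set_integral_reflect[of "{a..b}" "\<lambda>t. k (- t)"] k(3)[of "-b" "-a"] that by (simp add: w_def)
  qed
  have kb: "(\<lambda>t. k (- t)) \<in> borel_measurable borel" using k(1) by measurable
  have si: "set_integrable lborel {a..b} g" "set_integrable lborel {a..b} (\<lambda>t. k (- t))" for a b
    using set_integrable_bounded[OF g(1), of K] set_integrable_bounded[OF kb, of K] g k by auto
  have gk: "AE t in lborel. g t - k (- t) = 0"
    by (rule AE_eq_0_if_interval_integrals_eq_0) (auto simp: set_integral_diff si g(3) ki)
  have [measurable]: "lower_Dini w \<in> borel_measurable borel" "lower_Dini (\<lambda>x. - w x) \<in> borel_measurable borel"
    using borel_measurable_lower_Dini[OF wc] borel_measurable_lower_Dini[of "\<lambda>x. - w x"] wc by (auto intro!: continuous_intros)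
  \<comment> \<open>Lebesgue measure is invariant under reflection, so the exceptional null set of
    \<open>w\<close> may be reflected back to a null set in the variable of
    \<open>v\<close>.\<close>
  have "AE t in distr lborel borel (uminus :: real \<Rightarrow> real). lower_Dini w t = ereal (k t) \<and> lower_Dini (\<lambda>x. - w x) t = ereal (- k t)"
    unfolding lborel_distr_uminus by (rule k(4))
  then have wk: "AE t in lborel. lower_Dini w (- t) = ereal (k (- t)) \<and> lower_Dini (\<lambda>x. - w x) (- t) = ereal (- k (- t))"
    using k(1) by (subst (asm) AE_distr_iff) auto
  show thesis
  proof (rule that[OF g(1-3)])
    show "AE t in lborel. (v has_real_derivative g t) (at t)"
      using g(4) gk wk
    proof eventually_elim
      case (elim t)
      have side: "\<exists>d>0. \<forall>h. 0 < h \<and> h < d \<longrightarrow> \<bar>(f (s + h) - f s) / h - g t\<bar> \<le> e"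
        if f: "continuous_on UNIV f" and D: "lower_Dini f s = ereal (g t)" "lower_Dini (\<lambda>x. - f x) s = ereal (- g t)" and e: "e > 0" for f s e
      proof -
        obtain d where d: "d > 0" "\<forall>h. 0 < h \<and> h < d \<longrightarrow> g t - e \<le> (f (s + h) - f s) / h"
          using lower_Dini_greaterD[OF f, of "g t - e" s] e by (auto simp: D)
        have "ereal (- g t - e) < lower_Dini (\<lambda>x. - f x) s" unfolding D using e by simp
        then obtain d' where d': "d' > 0" "\<forall>h. 0 < h \<and> h < d' \<longrightarrow> - g t - e \<le> (- f (s + h) - (- f s)) / h"
          using lower_Dini_greaterD[OF continuous_on_minus[OF f], of "- g t - e" s] by blast
        show ?thesis
        proof (intro exI[of _ "min d d'"] conjI allI impI)
          fix h assume "0 < h \<and> h < min d d'"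
          then have "g t - e \<le> (f (s + h) - f s) / h" "- g t - e \<le> - ((f (s + h) - f s) / h)"
            using d d' by (auto simp: diff_divide_distrib)
          then show "\<bar>(f (s + h) - f s) / h - g t\<bar> \<le> e" by linarith
        qed (use d d' in auto)
      qed
      show ?case
        unfolding DERIV_def
      proof (rule LIM_I)
        fix r :: real assume r: "0 < r"
        obtain d where d: "d > 0" "\<forall>h. 0 < h \<and> h < d \<longrightarrow> \<bar>(v (t + h) - v t) / h - g t\<bar> \<le> r/2"
          using side[OF vc, of t "r/2"] elim r by auto
        obtain d' where d': "d' > 0" "\<forall>h. 0 < h \<and> h < d' \<longrightarrow> \<bar>(w (- t + h) - w (- t)) / h - g t\<bar> \<le> r/2"
          using side[OF wc, of "- t" "r/2"] elim r by auto
        show "\<exists>s>0. \<forall>x. x \<noteq> 0 \<and> norm (x - 0) < s \<longrightarrow> norm ((v (t + x) - v t) / x - g t) < r"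
        proof (intro exI[of _ "min d d'"] conjI allI impI)
          fix x :: real assume x: "x \<noteq> 0 \<and> norm (x - 0) < min d d'"
          show "norm ((v (t + x) - v t) / x - g t) < r"
          proof (cases "x > 0")
            case True
            have "\<bar>(v (t + x) - v t) / x - g t\<bar> \<le> r/2" using d x True by auto
            then show ?thesis using r by (simp only: real_norm_def)
          next
            case False
            have "\<bar>(w (- t + (- x)) - w (- t)) / (- x) - g t\<bar> \<le> r/2"
              using x False by (intro d'(2)[rule_format]) auto
            moreover have "(w (- t + (- x)) - w (- t)) / (- x) = (v (t + x) - v t) / x"
              using x by (simp add: w_def field_simps)
            ultimately show ?thesis using r by (simp only: real_norm_def)
          qed
        qed (use d d' in auto)
      qed
    qed
  qed
qed

section \<open>Partial derivatives of Lipschitz functions\<close>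

lemma has_vector_derivative_iff_quotient:
  fixes f :: "real \<Rightarrow> 'a::real_normed_vector"
  shows "(f has_vector_derivative d) (at t) \<longleftrightarrow> ((\<lambda>h. (f (t + h) - f t) /\<^sub>R h) \<longlongrightarrow> d) (at 0)"
proof -
  have eq: "norm ((f (t + h) - f t) - h *\<^sub>R d) / norm h = norm ((f (t + h) - f t) /\<^sub>R h - d)" if "h \<noteq> 0" for h
  proof -
    have "(f (t + h) - f t) /\<^sub>R h - d = ((f (t + h) - f t) - h *\<^sub>R d) /\<^sub>R h"
      using that by (simp add: scaleR_diff_right)
    then show ?thesis by (simp add: divide_inverse mult.commute)
  qed
  have "(f has_vector_derivative d) (at t) \<longleftrightarrow> ((\<lambda>y. norm ((f y - f t) - (y - t) *\<^sub>R d) / norm (y - t)) \<longlongrightarrow> 0) (at t)"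
    unfolding has_vector_derivative_def has_derivative_iff_norm by (simp add: bounded_linear_scaleR_left)
  also have "\<dots> \<longleftrightarrow> ((\<lambda>h. norm ((f (t + h) - f t) - h *\<^sub>R d) / norm h) \<longlongrightarrow> 0) (at 0)"
    by (subst LIM_offset_zero_iff[where a=t]) auto
  also have "\<dots> \<longleftrightarrow> ((\<lambda>h. norm ((f (t + h) - f t) /\<^sub>R h - d)) \<longlongrightarrow> 0) (at 0)"
    by (rule filterlim_cong[OF refl refl]) (simp add: eventually_at_filter eq[unfolded real_norm_def])
  also have "\<dots> \<longleftrightarrow> ((\<lambda>h. (f (t + h) - f t) /\<^sub>R h) \<longlongrightarrow> d) (at 0)"
    by (simp add: tendsto_norm_zero_iff LIM_zero_iff)
  finally show ?thesis .
qed

lemma has_vector_derivative_Lipschitz_le: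
  assumes "L-lipschitz_on UNIV v" "(v has_vector_derivative d) (at t)"
  shows "norm d \<le> L"
proof (rule tendsto_upperbound)
  show "((\<lambda>h. norm ((v (t + h) - v t) /\<^sub>R h)) \<longlongrightarrow> norm d) (at 0)"
    using assms(2) unfolding has_vector_derivative_iff_quotient by (rule tendsto_norm)
  show "eventually (\<lambda>h. norm ((v (t + h) - v t) /\<^sub>R h) \<le> L) (at 0)"
    unfolding eventually_at_filter
  proof (intro always_eventually allI impI)
    fix h :: real assume "h \<noteq> 0"
    then show "norm ((v (t + h) - v t) /\<^sub>R h) \<le> L"
      using lipschitz_onD[OF assms(1), of "t + h" t] by (simp add: dist_norm divide_simps mult.commute)
  qed
qed auto

lemma Lipschitz_AE_differentiable:
  fixes v :: "real \<Rightarrow> 'a::euclidean_space"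
  assumes "K-lipschitz_on UNIV v"
  shows "AE t in lborel. v differentiable (at t)"
proof -
  have "AE t in lborel. (\<lambda>s. v s \<bullet> b) differentiable (at t)" if "b \<in> Basis" for b
  proof -
    have "K-lipschitz_on UNIV (\<lambda>s. v s \<bullet> b)"
    proof (rule lipschitz_onI)
      fix x y
      have "\<bar>(v x - v y) \<bullet> b\<bar> \<le> norm (v x - v y)" using Basis_le_norm[OF that] by blast
      then show "dist (v x \<bullet> b) (v y \<bullet> b) \<le> K * dist x y"
        using lipschitz_onD[OF assms, of x y] by (simp add: dist_norm inner_diff_left)
    qed (rule lipschitz_on_nonneg[OF assms])
    then obtain g where "AE t in lborel. ((\<lambda>s. v s \<bullet> b) has_real_derivative g t) (at t)"
      by (rule Lipschitz_real_AE_derivative)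
    then show ?thesis
    proof eventually_elim
      case (elim t)
      then show ?case unfolding real_differentiable_def by (rule exI)
    qed
  qed
  then have "AE t in lborel. \<forall>b\<in>Basis. (\<lambda>s. v s \<bullet> b) differentiable (at t)" by (simp add: AE_finite_all)
  then show ?thesis
  proof eventually_elim
    case (elim t)
    then show ?case by (rule differentiable_componentwise_within[THEN iffD2])
  qed
qed

text \<open>A Cauchy criterion does not mention the derivative, and with rational increments it
  consists of countably many conditions. This makes the set of points of differentiability a Borel
  set.\<close>

lemma differentiable_iff_Cauchy_quotient:
  fixes f :: "real \<Rightarrow> 'a::banach"
  assumes f: "continuous_on UNIV f"
  shows "f differentiable (at t) \<longleftrightarrow>
    (\<forall>n::nat. \<exists>m::nat. \<forall>h\<in>\<rat>. \<forall>k\<in>\<rat>. h \<noteq> 0 \<and> \<bar>h\<bar> < 1 / (real m + 1) \<and> k \<noteq> 0 \<and> \<bar>k\<bar> < 1 / (real m + 1) \<longrightarrow>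
      norm ((f (t + h) - f t) /\<^sub>R h - (f (t + k) - f t) /\<^sub>R k) \<le> 1 / (real n + 1))" (is "_ \<longleftrightarrow> ?R")
proof
  assume "f differentiable (at t)"
  then obtain d where d: "((\<lambda>h. (f (t + h) - f t) /\<^sub>R h) \<longlongrightarrow> d) (at 0)"
    unfolding has_vector_derivative_iff_quotient[symmetric] using vector_derivative_works by blast
  show ?R
  proof
    fix n :: nat
    have "1 / (2 * (real n + 1)) > 0" by simp
    from tendstoD[OF d this] obtain e where e: "e > 0"
      "\<And>h. h \<noteq> 0 \<Longrightarrow> dist h 0 < e \<Longrightarrow> dist ((f (t + h) - f t) /\<^sub>R h) d < 1 / (2 * (real n + 1))"
      unfolding eventually_at by auto
    obtain m where m: "1 / (real m + 1) < e" using nat_approx_posE[OF e(1)] by (metis of_nat_Suc add.commute)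
    show "\<exists>m::nat. \<forall>h\<in>\<rat>. \<forall>k\<in>\<rat>. h \<noteq> 0 \<and> \<bar>h\<bar> < 1 / (real m + 1) \<and> k \<noteq> 0 \<and> \<bar>k\<bar> < 1 / (real m + 1) \<longrightarrow>
      norm ((f (t + h) - f t) /\<^sub>R h - (f (t + k) - f t) /\<^sub>R k) \<le> 1 / (real n + 1)"
    proof (intro exI[of _ m] ballI impI)
      fix h k :: real assume *: "h \<noteq> 0 \<and> \<bar>h\<bar> < 1 / (real m + 1) \<and> k \<noteq> 0 \<and> \<bar>k\<bar> < 1 / (real m + 1)"
      have "dist ((f (t + h) - f t) /\<^sub>R h) d < 1 / (2 * (real n + 1))"
           "dist ((f (t + k) - f t) /\<^sub>R k) d < 1 / (2 * (real n + 1))" using * m e(2) by auto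
      then have "dist ((f (t + h) - f t) /\<^sub>R h) ((f (t + k) - f t) /\<^sub>R k) < 1 / (2 * (real n + 1)) + 1 / (2 * (real n + 1))"
        using dist_triangle2[of "(f (t + h) - f t) /\<^sub>R h" "(f (t + k) - f t) /\<^sub>R k" d] by linarith
      also have "\<dots> = 1 / (real n + 1)" by (simp add: field_simps)
      finally show "norm ((f (t + h) - f t) /\<^sub>R h - (f (t + k) - f t) /\<^sub>R k) \<le> 1 / (real n + 1)" by (simp add: dist_norm)
    qed
  qed
next
  assume R: ?R
  define q where "q h = (f (t + h) - f t) /\<^sub>R h" for h
  have qc: "(q \<longlongrightarrow> q h) (at h)" if "h \<noteq> 0" for h
    unfolding q_def using that by (intro tendsto_intros continuous_on_tendsto_compose[OF f]) auto
  \<comment> \<open>The quotient \<open>q\<close> is continuous away from 0 and rationals are dense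
    in the punctured interval, so the bound for rational increments passes to all nonzero
    ones.\<close>
  have *: "\<exists>m::nat. \<forall>h k. h \<noteq> 0 \<and> \<bar>h\<bar> < 1 / (real m + 1) \<and> k \<noteq> 0 \<and> \<bar>k\<bar> < 1 / (real m + 1) \<longrightarrow>
      norm (q h - q k) \<le> 1 / (real n + 1)" for n :: nat
  proof -
    obtain m :: nat where m: "\<And>h k. h \<in> \<rat> \<Longrightarrow> k \<in> \<rat> \<Longrightarrow> h \<noteq> 0 \<Longrightarrow> \<bar>h\<bar> < 1 / (real m + 1) \<Longrightarrow> k \<noteq> 0 \<Longrightarrow> \<bar>k\<bar> < 1 / (real m + 1) \<Longrightarrow>
      norm (q h - q k) \<le> 1 / (real n + 1)"
      using R unfolding q_def by blast
    define B where "B = {-1 / (real m + 1)<..<1 / (real m + 1)} - {0::real}"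
    have B: "open B" "\<And>h. h \<in> B \<longleftrightarrow> h \<noteq> 0 \<and> \<bar>h\<bar> < 1 / (real m + 1)" unfolding B_def by (auto simp: abs_if)
    have seq: "\<exists>X. (\<forall>i. X i \<in> \<rat> \<inter> B) \<and> X \<longlonglongrightarrow> h" if "h \<in> B" for h
    proof -
      have "h \<in> closure (\<rat> \<inter> B)"
        using open_Int_closure_subset[OF B(1), of \<rat>] that by (auto simp: Rats_closure_real Int_commute)
      then show ?thesis by (auto simp: closure_sequential)
    qed
    have qs: "(\<lambda>i. q (X i)) \<longlonglongrightarrow> q h" if "h \<in> B" "X \<longlonglongrightarrow> h" for X h
      using that qc[of h] by (intro isCont_tendsto_compose[of h q X]) (auto simp: B isCont_def)
    have "norm (q h - q k) \<le> 1 / (real n + 1)" if hk: "h \<in> B" "k \<in> B" for h k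
    proof -
      obtain X Y where X: "\<And>i. X i \<in> \<rat> \<inter> B" "X \<longlonglongrightarrow> h" and Y: "\<And>i. Y i \<in> \<rat> \<inter> B" "Y \<longlonglongrightarrow> k"
        using seq[OF hk(1)] seq[OF hk(2)] by blast
      have "(\<lambda>i. norm (q (X i) - q (Y i))) \<longlonglongrightarrow> norm (q h - q k)"
        by (intro tendsto_intros qs hk X Y)
      then show ?thesis
        by (rule LIMSEQ_le_const2) (use X Y B m in blast)
    qed
    then show ?thesis using B by (intro exI[of _ m]) auto
  qed
  \<comment> \<open>The shift by 2 makes \<open>1 / (real i + 2)\<close> strictly smaller than
    \<open>1 / (real m + 1)\<close> for every \<open>i \<ge> m\<close>, including
    \<open>i = m\<close>.\<close>
  have "Cauchy (\<lambda>i. q (1 / (real i + 2)))"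
  proof (rule metric_CauchyI)
    fix e :: real assume "e > 0"
    then obtain n where n: "1 / (real n + 1) < e" using nat_approx_posE by (metis of_nat_Suc add.commute)
    obtain m where m: "\<And>h k. h \<noteq> 0 \<and> \<bar>h\<bar> < 1 / (real m + 1) \<and> k \<noteq> 0 \<and> \<bar>k\<bar> < 1 / (real m + 1) \<Longrightarrow>
      norm (q h - q k) \<le> 1 / (real n + 1)" using *[of n] by blast
    show "\<exists>M. \<forall>i\<ge>M. \<forall>j\<ge>M. dist (q (1 / (real i + 2))) (q (1 / (real j + 2))) < e"
    proof (intro exI[of _ m] allI impI)
      fix i j assume "m \<le> i" "m \<le> j"
      then have "norm (q (1 / (real i + 2)) - q (1 / (real j + 2))) \<le> 1 / (real n + 1)"
        by (intro m) (auto simp: frac_less2)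
      then show "dist (q (1 / (real i + 2))) (q (1 / (real j + 2))) < e" using n by (simp add: dist_norm)
    qed
  qed
  then obtain d where d: "(\<lambda>i. q (1 / (real i + 2))) \<longlonglongrightarrow> d" by (auto simp: Cauchy_convergent_iff convergent_def)
  have "(q \<longlongrightarrow> d) (at 0)"
  proof (rule tendstoI)
    fix e :: real assume "e > 0"
    then obtain n where n: "1 / (real n + 1) < e" using nat_approx_posE by (metis of_nat_Suc add.commute)
    obtain m where m: "\<And>h k. h \<noteq> 0 \<and> \<bar>h\<bar> < 1 / (real m + 1) \<and> k \<noteq> 0 \<and> \<bar>k\<bar> < 1 / (real m + 1) \<Longrightarrow>
      norm (q h - q k) \<le> 1 / (real n + 1)" using *[of n] by blast
    have "dist (q h) d < e" if h: "h \<noteq> 0" "\<bar>h\<bar> < 1 / (real m + 1)" for h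
    proof -
      have "(\<lambda>i. norm (q h - q (1 / (real i + 2)))) \<longlonglongrightarrow> norm (q h - d)" by (intro tendsto_intros d)
      moreover have "norm (q h - q (1 / (real i + 2))) \<le> 1 / (real n + 1)" if "i \<ge> m" for i
        using that h by (intro m) (auto simp: frac_less2)
      ultimately have "norm (q h - d) \<le> 1 / (real n + 1)" by (intro LIMSEQ_le_const2) auto
      then show ?thesis using n by (simp add: dist_norm)
    qed
    then show "eventually (\<lambda>h. dist (q h) d < e) (at 0)"
      unfolding eventually_at by (intro exI[of _ "1 / (real m + 1)"]) auto
  qed
  then have "(f has_vector_derivative d) (at t)" unfolding has_vector_derivative_iff_quotient q_def .
  then show "f differentiable (at t)" using differentiableI_vector by blast
qed

lemma borel_measurable_dt:
  fixes w :: "real \<Rightarrow> real \<Rightarrow> 'a::euclidean_space"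
  assumes w: "continuous_on UNIV (\<lambda>(t, x). w t x)"
  shows "{(t, x). (\<lambda>s. w s x) differentiable (at t)} \<in> sets borel" (is "?D \<in> _")
    and "(\<lambda>(t, x). dt w t x) \<in> borel_measurable borel"
proof -
  have wm: "(\<lambda>z. w (f z) (g z)) \<in> borel_measurable borel"
    if "continuous_on UNIV f" "continuous_on UNIV g" for f g :: "real \<times> real \<Rightarrow> real"
    using continuous_on_compose2[OF w, of UNIV "\<lambda>z. (f z, g z)"] that
    by (intro borel_measurable_continuous_onI) (auto intro!: continuous_intros)
  have [measurable]: "(\<lambda>z. w (fst z + h) (snd z)) \<in> borel_measurable borel" "(\<lambda>z. w (fst z) (snd z)) \<in> borel_measurable borel" for h
    by (intro wm continuous_intros)+
  have c: "continuous_on UNIV (\<lambda>s. w s x)" for x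
    using continuous_on_compose2[OF w, of UNIV "\<lambda>s. (s, x)"] by (simp add: continuous_on_Pair)
  define A where "A n h k = {z. norm ((w (fst z + h) (snd z) - w (fst z) (snd z)) /\<^sub>R h - (w (fst z + k) (snd z) - w (fst z) (snd z)) /\<^sub>R k) \<le> 1 / (real n + 1)}"
    for n :: nat and h k :: real
  have A: "A n h k \<in> sets borel" for n h k
  proof -
    have "{z\<in>space borel. norm ((w (fst z + h) (snd z) - w (fst z) (snd z)) /\<^sub>R h - (w (fst z + k) (snd z) - w (fst z) (snd z)) /\<^sub>R k) \<le> 1 / (real n + 1)} \<in> sets borel"
      by measurable
    then show ?thesis by (simp add: A_def)
  qed
  define Q where "Q m = {(h::real, k::real). h \<in> \<rat> \<and> k \<in> \<rat> \<and> h \<noteq> 0 \<and> \<bar>h\<bar> < 1 / (real m + 1) \<and> k \<noteq> 0 \<and> \<bar>k\<bar> < 1 / (real m + 1)}" for m :: nat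
  have Q: "countable (Q m)" for m
    by (rule countable_subset[of _ "\<rat> \<times> \<rat>"]) (auto simp: Q_def countable_rat)
  have "?D = (\<Inter>n. \<Union>m. \<Inter>(h,k)\<in>Q m. A n h k)"
  proof (rule set_eqI)
    fix z :: "real \<times> real"
    obtain t x where z: "z = (t, x)" by (cases z)
    have "z \<in> ?D \<longleftrightarrow> (\<forall>n. \<exists>m. \<forall>h k. (h, k) \<in> Q m \<longrightarrow> (t, x) \<in> A n h k)"
      unfolding z mem_Collect_eq prod.case differentiable_iff_Cauchy_quotient[OF c]
      by (intro iff_allI iff_exI) (simp add: A_def Q_def, blast)
    then show "z \<in> ?D \<longleftrightarrow> z \<in> (\<Inter>n. \<Union>m. \<Inter>(h,k)\<in>Q m. A n h k)"
      unfolding z by (simp only: INT_iff UN_iff Ball_def Bex_def UNIV_I simp_thms split_paired_All prod.case)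
  qed
  moreover have "(\<Inter>(h,k)\<in>Q m. A n h k) \<in> sets borel" for m n
  proof (cases "Q m = {}")
    case False
    then show ?thesis using A Q by (intro sets.countable_INT') auto
  qed auto
  ultimately show D: "?D \<in> sets borel" by auto
  \<comment> \<open>Where no derivative exists, the choice in \<open>vector_derivative\<close>
    ranges over an unsatisfiable predicate and returns the same value at all such points. So
    \<open>dt\<close> is a limit of continuous functions on a Borel set and constant off it.\<close>
  have "dt w t x = (if (t, x) \<in> ?D then lim (\<lambda>i. (w (t + 1 / (real i + 1)) x - w t x) /\<^sub>R (1 / (real i + 1))) else (SOME f'. False))" for t x
  proof (cases "(t, x) \<in> ?D")
    case True
    then have "((\<lambda>s. w s x) has_vector_derivative dt w t x) (at t)"
      unfolding dt_def using vector_derivative_works by auto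
    then have "((\<lambda>h. (w (t + h) x - w t x) /\<^sub>R h) \<longlongrightarrow> dt w t x) (at 0)"
      by (simp add: has_vector_derivative_iff_quotient)
    moreover have "filterlim (\<lambda>i. 1 / (real i + 1)) (at 0) sequentially"
      using LIMSEQ_inverse_real_of_nat by (intro filterlim_atI) (auto simp: inverse_eq_divide add.commute)
    ultimately have "(\<lambda>i. (w (t + 1 / (real i + 1)) x - w t x) /\<^sub>R (1 / (real i + 1))) \<longlonglongrightarrow> dt w t x"
      by (rule filterlim_compose)
    then have "lim (\<lambda>i. (w (t + 1 / (real i + 1)) x - w t x) /\<^sub>R (1 / (real i + 1))) = dt w t x" by (rule limI)
    with True show ?thesis by simp
  next
    case False
    then have "\<not> ((\<lambda>s. w s x) has_vector_derivative f') (at t)" for f'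
      using differentiableI_vector by auto
    with False show ?thesis unfolding dt_def vector_derivative_def by simp
  qed
  then have "(\<lambda>(t, x). dt w t x) = (\<lambda>z. if z \<in> ?D then lim (\<lambda>i. (w (fst z + 1 / (real i + 1)) (snd z) - w (fst z) (snd z)) /\<^sub>R (1 / (real i + 1))) else (SOME f'. False))"
    by (auto simp: fun_eq_iff)
  also have "\<dots> \<in> borel_measurable borel"
    using D by (intro measurable_If_set borel_measurable_lim_metric) auto
  finally show "(\<lambda>(t, x). dt w t x) \<in> borel_measurable borel" .
qed

lemma borel_measurable_dx:
  fixes w :: "real \<Rightarrow> real \<Rightarrow> 'a::euclidean_space"
  assumes w: "continuous_on UNIV (\<lambda>(t, x). w t x)"
  shows "{(t, x). w t differentiable (at x)} \<in> sets borel"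
    and "(\<lambda>(t, x). dx w t x) \<in> borel_measurable borel"
proof -
  have c: "continuous_on UNIV (\<lambda>(t, x). w x t)"
    using continuous_on_compose2[OF w, of UNIV "\<lambda>z. (snd z, fst z)"] by (simp add: continuous_on_Pair continuous_on_fst continuous_on_snd case_prod_unfold)
  have s: "(\<lambda>(t, x). (x, t)) \<in> borel_measurable (borel :: (real \<times> real) measure)"
    by (intro borel_measurable_continuous_onI) (auto simp: case_prod_unfold intro!: continuous_intros)
  have "{(t, x). w t differentiable (at x)} = (\<lambda>(t, x). (x, t)) -` {(t, x). (\<lambda>s. w x s) differentiable (at t)} \<inter> space borel"
    by auto
  then show "{(t, x). w t differentiable (at x)} \<in> sets borel"
    using measurable_sets[OF s borel_measurable_dt(1)[OF c]] by simp
  show "(\<lambda>(t, x). dx w t x) \<in> borel_measurable borel"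
    using measurable_compose[OF s borel_measurable_dt(2)[OF c]] by (simp add: dx_def dt_def case_prod_unfold)
qed

lemma Lipschitz_sections:
  assumes "L-lipschitz_on UNIV (\<lambda>(t, x). w t x)"
  shows "L-lipschitz_on UNIV (\<lambda>s. w s x)" "L-lipschitz_on UNIV (w t)"
proof -
  have 1: "dist (w s y) (w s' y') \<le> L * dist (s, y) (s', y')" for s y s' y'
    using lipschitz_onD[OF assms, of "(s, y)" "(s', y')"] by simp
  note 2 = lipschitz_on_nonneg[OF assms]
  show "L-lipschitz_on UNIV (\<lambda>s. w s x)"
  proof (rule lipschitz_onI)
    fix s s' show "dist (w s x) (w s' x) \<le> L * dist s s'" using 1[of s x s' x] by (simp add: dist_Pair_Pair)
  qed (rule 2)
  show "L-lipschitz_on UNIV (w t)"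
  proof (rule lipschitz_onI)
    fix y y' show "dist (w t y) (w t y') \<le> L * dist y y'" using 1[of t y t y'] by (simp add: dist_Pair_Pair)
  qed (rule 2)
qed

lemma AE_lborel_pairI:
  assumes "{z. P z} \<in> sets borel" "\<And>t. AE x in lborel. P (t, x)"
  shows "AE z in (lborel :: (real \<times> real) measure). P z"
proof -
  have m: "{z. P z} \<in> sets (lborel \<Otimes>\<^sub>M lborel)" using assms(1) by (simp only: lborel_prod sets_lborel)
  show ?thesis
    unfolding lborel_prod[symmetric]
    by (rule lborel_pair.AE_pair_measure) (use m assms(2) in \<open>auto simp: space_pair_measure\<close>)
qed

lemma AE_lborel_pairI':
  assumes "{z. P z} \<in> sets borel" "\<And>x. AE t in lborel. P (t, x)"
  shows "AE z in (lborel :: (real \<times> real) measure). P z"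
proof -
  have m: "{z. P z} \<in> sets (lborel \<Otimes>\<^sub>M lborel)" using assms(1) by (simp only: lborel_prod sets_lborel)
  then have "AE t in lborel. AE x in lborel. P (t, x)"
    by (subst lborel_pair.AE_commute) (use assms(2) in \<open>auto simp: space_pair_measure\<close>)
  then show ?thesis
    unfolding lborel_prod[symmetric]
    by (rule lborel_pair.AE_pair_measure[rotated]) (use m in \<open>auto simp: space_pair_measure\<close>)
qed

text \<open>Almost everywhere differentiability holds along every line parallel to an axis. Since
  the set of differentiability is Borel in the plane, Fubini turns these linewise null sets into a
  planar one. Total differentiability is avoided.\<close>

lemma Lipschitz_AE_partial_derivatives:
  fixes w :: "real \<Rightarrow> real \<Rightarrow> 'a::euclidean_space"
  assumes w: "L-lipschitz_on UNIV (\<lambda>(t, x). w t x)"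
  shows "AE (t, x) in lborel. ((\<lambda>s. w s x) has_vector_derivative dt w t x) (at t) \<and> norm (dt w t x) \<le> L \<and>
    (w t has_vector_derivative dx w t x) (at x) \<and> norm (dx w t x) \<le> L"
proof -
  have c: "continuous_on UNIV (\<lambda>(t, x). w t x)" using w by (rule lipschitz_on_continuous_on)
  have "AE z in lborel. (\<lambda>s. w s (snd z)) differentiable (at (fst z))"
    by (rule AE_lborel_pairI') (use borel_measurable_dt(1)[OF c] in \<open>auto intro: Lipschitz_AE_differentiable[OF Lipschitz_sections(1)[OF w]] simp: case_prod_unfold\<close>)
  moreover have "AE z in lborel. w (fst z) differentiable (at (snd z))"
    by (rule AE_lborel_pairI) (use borel_measurable_dx(1)[OF c] in \<open>auto intro: Lipschitz_AE_differentiable[OF Lipschitz_sections(2)[OF w]] simp: case_prod_unfold\<close>)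
  ultimately show ?thesis
  proof eventually_elim
    case (elim z)
    then have "((\<lambda>s. w s (snd z)) has_vector_derivative dt w (fst z) (snd z)) (at (fst z))"
      "(w (fst z) has_vector_derivative dx w (fst z) (snd z)) (at (snd z))"
      unfolding dt_def dx_def using vector_derivative_works by auto
    moreover from this have "norm (dt w (fst z) (snd z)) \<le> L" "norm (dx w (fst z) (snd z)) \<le> L"
      using has_vector_derivative_Lipschitz_le[OF Lipschitz_sections(1)[OF w]] has_vector_derivative_Lipschitz_le[OF Lipschitz_sections(2)[OF w]] by blast+
    ultimately show ?case by (auto simp: case_prod_unfold)
  qed
qed

section \<open>Integration over the time strip\<close>

lemma lipschitz_on_mult_bounded:
  fixes f g :: "'a::metric_space \<Rightarrow> real"
  assumes "A-lipschitz_on S f" "B-lipschitz_on S g" "\<And>x. x \<in> S \<Longrightarrow> \<bar>f x\<bar> \<le> a" "\<And>x. x \<in> S \<Longrightarrow> \<bar>g x\<bar> \<le> b" "0 \<le> a" "0 \<le> b"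
  shows "(A * b + a * B)-lipschitz_on S (\<lambda>x. f x * g x)"
proof (rule lipschitz_onI)
  fix x y assume xy: "x \<in> S" "y \<in> S"
  have "f x * g x - f y * g y = (f x - f y) * g x + f y * (g x - g y)" by (simp add: algebra_simps)
  then have "\<bar>f x * g x - f y * g y\<bar> \<le> \<bar>f x - f y\<bar> * \<bar>g x\<bar> + \<bar>f y\<bar> * \<bar>g x - g y\<bar>"
    by (metis abs_mult abs_triangle_ineq)
  also have "\<dots> \<le> (A * dist x y) * b + a * (B * dist x y)"
    using lipschitz_onD[OF assms(1) xy] lipschitz_onD[OF assms(2) xy] assms(3-6) xy
    by (intro add_mono mult_mono) (auto simp: dist_real_def lipschitz_on_nonneg[OF assms(1)])
  finally show "dist (f x * g x) (f y * g y) \<le> (A * b + a * B) * dist x y" by (simp add: dist_real_def algebra_simps)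
qed (use assms lipschitz_on_nonneg in \<open>auto intro!: add_nonneg_nonneg mult_nonneg_nonneg\<close>)

lemma strip_sets: "{0<..<T} \<times> UNIV \<in> sets (borel :: (real \<times> real) measure)"
  by (intro borel_open open_Times) auto

lemma space_time_strip: "space (time_strip T) = {0<..<T} \<times> UNIV"
  by (simp add: time_strip_def space_restrict_space)

lemma measurable_time_strip: "f \<in> borel_measurable borel \<Longrightarrow> f \<in> borel_measurable (time_strip T)"
  unfolding time_strip_def by (rule measurable_restrict_space1) simp

lemma AE_time_stripI: "AE z in lborel. z \<in> {0<..<T} \<times> UNIV \<longrightarrow> P z \<Longrightarrow> AE z in time_strip T. P z"
  unfolding time_strip_def by (subst AE_restrict_space_iff) (auto simp: strip_sets)

lemma AE_time_strip_iff: "(AE z in time_strip T. P z) \<longleftrightarrow> (AE z in lborel. z \<in> {0<..<T} \<times> UNIV \<longrightarrow> P z)"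
  unfolding time_strip_def by (subst AE_restrict_space_iff) (auto simp: strip_sets)

lemma integral_time_strip:
  fixes f :: "real \<times> real \<Rightarrow> 'b::{banach, second_countable_topology}"
  shows "(LINT z|time_strip T. f z) = (LINT z|lborel. indicator ({0<..<T} \<times> UNIV) z *\<^sub>R f z)"
  unfolding time_strip_def by (subst integral_restrict_space) (auto simp: strip_sets)

lemma integrable_time_strip_iff:
  fixes f :: "real \<times> real \<Rightarrow> 'b::{banach, second_countable_topology}"
  shows "integrable (time_strip T) f \<longleftrightarrow> integrable lborel (\<lambda>z. indicator ({0<..<T} \<times> UNIV) z *\<^sub>R f z)"
  unfolding time_strip_def by (subst integrable_restrict_space) (auto simp: strip_sets)

lemma nn_integral_time_strip:
  "(\<integral>\<^sup>+ z. f z \<partial>time_strip T) = (\<integral>\<^sup>+ z. f z * indicator ({0<..<T} \<times> UNIV) z \<partial>lborel)"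
  unfolding time_strip_def by (subst nn_integral_restrict_space) (auto simp: strip_sets)

lemma integrable_time_strip_bounded:
  fixes f :: "real \<times> real \<Rightarrow> 'b::{banach, second_countable_topology}"
  assumes "f \<in> borel_measurable (time_strip T)"
    and "AE z in time_strip T. norm (f z) \<le> B"
    and "AE (t, x) in time_strip T. \<rho> < \<bar>x\<bar> \<longrightarrow> f (t, x) = 0"
  shows "integrable (time_strip T) f"
proof (rule integrableI_bounded_set[where A="{0<..<T} \<times> {-\<rho>..\<rho>}" and B=B])
  have s: "{0<..<T} \<times> {-\<rho>..\<rho>} \<in> sets borel"
  proof -
    have "{0<..<T} \<times> {-\<rho>..\<rho>} = ({0<..<T} \<times> UNIV) \<inter> (UNIV \<times> {-\<rho>..\<rho>})" by auto
    moreover have "UNIV \<times> {-\<rho>..\<rho>} \<in> sets (borel :: (real \<times> real) measure)" by (intro borel_closed closed_Times) auto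
    ultimately show ?thesis using strip_sets by (simp only: sets.Int)
  qed
  then show "{0<..<T} \<times> {-\<rho>..\<rho>} \<in> sets (time_strip T)"
    unfolding time_strip_def by (subst sets_restrict_space_iff) (auto simp: strip_sets)
  have "emeasure (time_strip T) ({0<..<T} \<times> {-\<rho>..\<rho>}) = emeasure lborel ({0<..<T} \<times> {-\<rho>..\<rho>})"
    unfolding time_strip_def by (subst emeasure_restrict_space) (auto simp: strip_sets)
  also have "\<dots> \<le> emeasure lborel (cbox (0, -\<rho>) (T, \<rho>))"
    by (intro emeasure_mono) (auto simp: cbox_Pair_eq intro!: borel_closed closed_Times)
  also have "\<dots> < \<infinity>" using emeasure_lborel_cbox_finite by blast
  finally show "emeasure (time_strip T) ({0<..<T} \<times> {-\<rho>..\<rho>}) < \<infinity>" .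
  show "AE z in time_strip T. z \<in> {0<..<T} \<times> {-\<rho>..\<rho>} \<longrightarrow> norm (f z) \<le> B" using assms(2) by eventually_elim auto
  show "AE z in time_strip T. z \<notin> {0<..<T} \<times> {-\<rho>..\<rho>} \<longrightarrow> f z = 0"
    using assms(3) AE_space by eventually_elim (auto simp: space_time_strip)
qed (use assms in auto)

lemma has_vector_derivative_zero_on_open:
  assumes "open S" "t \<in> S" "\<And>s. s \<in> S \<Longrightarrow> f s = 0"
  shows "(f has_vector_derivative 0) (at t)"
  by (rule has_vector_derivative_transform_within_open[OF has_vector_derivative_const assms(1,2)]) (simp add: assms(3))

text \<open>The strict inequalities in \<open>out\<close> leave an open neighbourhood on which the
  function vanishes, and \<open>0 < t\<close> keeps it inside the times to which the support
  condition applies.\<close>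

lemma support_partial_derivatives:
  assumes sup: "\<And>t x. 0 \<le> t \<Longrightarrow> b \<le> t \<or> \<rho> \<le> \<bar>x\<bar> \<Longrightarrow> \<Phi> t x = 0" and t: "0 < t" and out: "b < t \<or> \<rho> < \<bar>x\<bar>"
  shows "dt \<Phi> t x = 0" "dx \<Phi> t x = 0"
proof -
  have "((\<lambda>s. \<Phi> s x) has_vector_derivative 0) (at t)"
  proof (cases "b < t")
    case True
    then show ?thesis using t by (intro has_vector_derivative_zero_on_open[of "{max 0 b<..}"]) (auto intro: sup)
  next
    case False
    then show ?thesis using t out by (intro has_vector_derivative_zero_on_open[of "{0<..}"]) (auto intro: sup)
  qed
  then show "dt \<Phi> t x = 0" unfolding dt_def by (rule vector_derivative_at)
  have "(\<Phi> t has_vector_derivative 0) (at x)"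
  proof (cases "b < t")
    case True
    then show ?thesis using t by (intro has_vector_derivative_zero_on_open[of UNIV]) (auto intro: sup)
  next
    case False
    have "open {y::real. \<rho> < \<bar>y\<bar>}" by (intro open_Collect_less continuous_intros)
    then show ?thesis using t out False by (intro has_vector_derivative_zero_on_open[of "{y. \<rho> < \<bar>y\<bar>}"]) (auto intro: sup)
  qed
  then show "dx \<Phi> t x = 0" unfolding dx_def by (simp add: vector_derivative_at)
qed

lemma integrable_partial_derivatives:
  fixes \<Phi> :: "real \<Rightarrow> real \<Rightarrow> 'a::euclidean_space"
  assumes lip: "L-lipschitz_on UNIV (\<lambda>(t, x). \<Phi> t x)"
    and sup: "\<And>t x. 0 \<le> t \<Longrightarrow> b \<le> t \<or> \<rho> \<le> \<bar>x\<bar> \<Longrightarrow> \<Phi> t x = 0"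
  shows "integrable (time_strip T) (\<lambda>(t, x). dt \<Phi> t x)" "integrable (time_strip T) (\<lambda>(t, x). dx \<Phi> t x)"
proof -
  have c: "continuous_on UNIV (\<lambda>(t, x). \<Phi> t x)" using lip by (rule lipschitz_on_continuous_on)
  have ae: "AE (t, x) in time_strip T. norm (dt \<Phi> t x) \<le> L \<and> norm (dx \<Phi> t x) \<le> L"
    by (rule AE_time_stripI) (use Lipschitz_AE_partial_derivatives[OF lip] in eventually_elim, auto)
  have z: "AE (t, x) in time_strip T. \<rho> < \<bar>x\<bar> \<longrightarrow> dt \<Phi> t x = 0 \<and> dx \<Phi> t x = 0"
    using AE_space
  proof eventually_elim
    case (elim z)
    show ?case using support_partial_derivatives[OF sup, where ?t="fst z" and x="snd z"] elim by (auto simp: space_time_strip)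
  qed
  show "integrable (time_strip T) (\<lambda>(t, x). dt \<Phi> t x)"
  proof (rule integrable_time_strip_bounded[where \<rho>=\<rho> and B=L])
    show "AE z in time_strip T. norm (case z of (t, x) \<Rightarrow> dt \<Phi> t x) \<le> L" using ae by eventually_elim auto
    show "AE (t, x) in time_strip T. \<rho> < \<bar>x\<bar> \<longrightarrow> (case (t, x) of (t, x) \<Rightarrow> dt \<Phi> t x) = 0" using z by eventually_elim auto
  qed (intro measurable_time_strip borel_measurable_dt(2)[OF c])
  show "integrable (time_strip T) (\<lambda>(t, x). dx \<Phi> t x)"
  proof (rule integrable_time_strip_bounded[where \<rho>=\<rho> and B=L])
    show "AE z in time_strip T. norm (case z of (t, x) \<Rightarrow> dx \<Phi> t x) \<le> L" using ae by eventually_elim auto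
    show "AE (t, x) in time_strip T. \<rho> < \<bar>x\<bar> \<longrightarrow> (case (t, x) of (t, x) \<Rightarrow> dx \<Phi> t x) = 0" using z by eventually_elim auto
  qed (intro measurable_time_strip borel_measurable_dx(2)[OF c])
qed

lemma integral_derivative_Lipschitz:
  fixes v :: "real \<Rightarrow> real"
  assumes v: "K-lipschitz_on UNIV v" and "a \<le> b"
  shows "(LINT t|lborel. indicator {a<..<b} t *\<^sub>R vector_derivative v (at t)) = v b - v a"
proof -
  obtain g where g: "g \<in> borel_measurable borel" "\<And>a b. a \<le> b \<Longrightarrow> (LINT t:{a..b}|lborel. g t) = v b - v a"
    "AE t in lborel. (v has_real_derivative g t) (at t)"
    using Lipschitz_real_AE_derivative[OF v] by metis
  have c: "continuous_on UNIV (\<lambda>(t, x::real). v t)"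
    using lipschitz_on_continuous_on[OF v] by (auto intro!: continuous_intros continuous_on_compose2[of UNIV v] simp: case_prod_unfold)
  have "(\<lambda>z. vector_derivative v (at (fst z))) \<in> borel_measurable (borel :: (real \<times> real) measure)"
    using borel_measurable_dt(2)[OF c] by (simp add: dt_def case_prod_unfold)
  moreover have "(\<lambda>t. (t, 0::real)) \<in> borel_measurable (borel :: real measure)"
    by (intro borel_measurable_continuous_onI continuous_intros)
  ultimately have [measurable]: "(\<lambda>t. vector_derivative v (at t)) \<in> borel_measurable borel"
    using measurable_compose[of "\<lambda>t. (t, 0::real)" borel borel "\<lambda>z. vector_derivative v (at (fst z))" borel] by simp
  have "(LINT t|lborel. indicator {a<..<b} t *\<^sub>R vector_derivative v (at t)) = (LINT t|lborel. indicator {a..b} t *\<^sub>R g t)"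
  proof (rule integral_cong_AE)
    show "AE t in lborel. indicator {a<..<b} t *\<^sub>R vector_derivative v (at t) = indicator {a..b} t *\<^sub>R g t"
      using g(3) AE_lborel_singleton[of a] AE_lborel_singleton[of b]
    proof eventually_elim
      case (elim t)
      then have "vector_derivative v (at t) = g t"
        by (simp add: vector_derivative_at has_real_derivative_iff_has_vector_derivative)
      with elim show ?case by (auto simp: indicator_def)
    qed
  qed (use g in auto)
  then show ?thesis using g(2)[OF assms(2)] by (simp add: set_lebesgue_integral_def)
qed

text \<open>By Fubini each derivative is integrated first in its own direction. The support
  condition with \<open>b \<le> T\<close> removes the boundary terms at time \<open>T\<close> and at
  large \<open>\<bar>x\<bar>\<close>, so that only the value at time 0 is left.\<close>

lemma integral_partial_derivatives:
  fixes \<Phi> :: "real \<Rightarrow> real \<Rightarrow> real"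
  assumes lip: "L-lipschitz_on UNIV (\<lambda>(t, x). \<Phi> t x)"
    and sup: "\<And>t x. 0 \<le> t \<Longrightarrow> b \<le> t \<or> \<rho> \<le> \<bar>x\<bar> \<Longrightarrow> \<Phi> t x = 0" and T: "0 < T" "b \<le> T"
  shows "(LINT (t, x)|time_strip T. dt \<Phi> t x) = - (LINT x|lborel. \<Phi> 0 x)"
    and "(LINT (t, x)|time_strip T. dx \<Phi> t x) = 0"
proof -
  note i = integrable_partial_derivatives[OF lip sup, where T=T]
  note s = Lipschitz_sections[OF lip]
  have it: "integrable (lborel \<Otimes>\<^sub>M lborel) (\<lambda>(t, x). indicator {0<..<T} t *\<^sub>R dt \<Phi> t x)"
    using i(1) unfolding integrable_time_strip_iff lborel_prod
    by (rule Bochner_Integration.integrable_cong[THEN iffD1, rotated -1]) (auto simp: indicator_def)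
  have ix: "integrable (lborel \<Otimes>\<^sub>M lborel) (\<lambda>(t, x). indicator {0<..<T} t *\<^sub>R dx \<Phi> t x)"
    using i(2) unfolding integrable_time_strip_iff lborel_prod
    by (rule Bochner_Integration.integrable_cong[THEN iffD1, rotated -1]) (auto simp: indicator_def)
  have "(LINT (t, x)|time_strip T. dt \<Phi> t x) = (LINT z|(lborel \<Otimes>\<^sub>M lborel). (case z of (t, x) \<Rightarrow> indicator {0<..<T} t *\<^sub>R dt \<Phi> t x))"
    unfolding integral_time_strip lborel_prod
    by (rule Bochner_Integration.integral_cong) (auto simp: indicator_def)
  also have "\<dots> = (LINT x|lborel. LINT t|lborel. indicator {0<..<T} t *\<^sub>R dt \<Phi> t x)"
    using lborel_pair.integral_snd[OF it] by simp
  also have "\<dots> = (LINT x|lborel. - \<Phi> 0 x)"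
  proof (rule Bochner_Integration.integral_cong[OF refl])
    fix x
    show "(LINT t|lborel. indicator {0<..<T} t *\<^sub>R dt \<Phi> t x) = - \<Phi> 0 x"
      using integral_derivative_Lipschitz[OF s(1), of 0 T x] T sup[of T x] by (simp add: dt_def)
  qed
  finally show "(LINT (t, x)|time_strip T. dt \<Phi> t x) = - (LINT x|lborel. \<Phi> 0 x)" by simp
  have "(LINT (t, x)|time_strip T. dx \<Phi> t x) = (LINT z|(lborel \<Otimes>\<^sub>M lborel). (case z of (t, x) \<Rightarrow> indicator {0<..<T} t *\<^sub>R dx \<Phi> t x))"
    unfolding integral_time_strip lborel_prod
    by (rule Bochner_Integration.integral_cong) (auto simp: indicator_def)
  also have "\<dots> = (LINT t|lborel. LINT x|lborel. indicator {0<..<T} t *\<^sub>R dx \<Phi> t x)"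
    using lborel_pair.integral_fst'[OF ix] by simp
  also have "\<dots> = (LINT (t::real)|lborel. (0::real))"
  proof (rule Bochner_Integration.integral_cong[OF refl])
    fix t :: real
    show "(LINT x|lborel. indicator {0<..<T} t *\<^sub>R dx \<Phi> t x) = 0"
    proof (cases "t \<in> {0<..<T}")
      case True
      \<comment> \<open>\<open>\<rho>\<close> may be negative; this radius gives a proper interval
        whose end points lie where \<open>\<Phi>\<close> vanishes.\<close>
      define r where "r = \<bar>\<rho>\<bar> + 1"
      have "dx \<Phi> t x = indicator {-r<..<r} x *\<^sub>R vector_derivative (\<Phi> t) (at x)" for x
      proof (cases "\<rho> < \<bar>x\<bar>")
        case out: True
        then have "dx \<Phi> t x = 0"
          using support_partial_derivatives(2)[where b=b and \<rho>=\<rho> and \<Phi>=\<Phi> and t=t and x=x, OF sup] True by auto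
        then show ?thesis by (simp add: dx_def)
      next
        case False
        then have "x \<in> {-r<..<r}" by (auto simp: r_def)
        then show ?thesis by (simp add: dx_def)
      qed
      then have "(LINT x|lborel. dx \<Phi> t x) = \<Phi> t r - \<Phi> t (-r)"
        using integral_derivative_Lipschitz[OF s(2), of "-r" r t] by (simp add: r_def)
      moreover have "\<rho> \<le> \<bar>r\<bar>" by (simp add: r_def)
      ultimately have "(LINT x|lborel. dx \<Phi> t x) = 0" using True sup[of t r] sup[of t "-r"] by simp
      then show ?thesis by simp
    qed simp
  qed
  finally show "(LINT (t, x)|time_strip T. dx \<Phi> t x) = 0" by simp
qed

section \<open>Twice continuously differentiable maps\<close>

lemma C2_onD:
  assumes "C2_on U F" "w \<in> U"
  shows "(F has_derivative frechet_derivative F (at w)) (at w)"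
    "((\<lambda>z. frechet_derivative F (at z) v) has_derivative hess F w v) (at w)"
    "continuous_on U (\<lambda>w. hess F w v v')"
  using assms unfolding C2_on_def hess_def[abs_def] by (auto simp: frechet_derivative_works[symmetric])

lemma frechet_derivative_eqI: "(F has_derivative F') (at w) \<Longrightarrow> frechet_derivative F (at w) = F'"
  using frechet_derivative_at by metis

text \<open>Linearity in the second direction is that of a derivative. In the first direction it
  comes from linearity of \<open>frechet_derivative F (at z)\<close> at all \<open>z\<close> near
  \<open>w\<close>, so that the functions being differentiated agree on a neighbourhood; hence
  \<open>open U\<close>.\<close>

lemma hess_linear:
  assumes "C2_on U F" "open U" "w \<in> U"
  shows "linear (hess F w v)" "linear (\<lambda>v. hess F w v v')"
proof -
  show "linear (hess F w v)" using has_derivative_linear[OF C2_onD(2)[OF assms(1,3)]] .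
  have D: "linear (frechet_derivative F (at z))" if "z \<in> U" for z using has_derivative_linear[OF C2_onD(1)[OF assms(1) that]] .
  show "linear (\<lambda>v. hess F w v v')"
  proof (rule linearI)
    fix a b
    have "((\<lambda>z. frechet_derivative F (at z) a + frechet_derivative F (at z) b) has_derivative (\<lambda>v'. hess F w a v' + hess F w b v')) (at w)"
      by (intro has_derivative_add C2_onD(2)[OF assms(1,3)])
    then have "((\<lambda>z. frechet_derivative F (at z) (a + b)) has_derivative (\<lambda>v'. hess F w a v' + hess F w b v')) (at w)"
      by (rule has_derivative_transform_within_open[OF _ assms(2,3)]) (simp add: linear_add[OF D])
    from frechet_derivative_eqI[OF this] show "hess F w (a + b) v' = hess F w a v' + hess F w b v'" by (simp add: hess_def)
  next
    fix r b
    have "((\<lambda>z. r *\<^sub>R frechet_derivative F (at z) b) has_derivative (\<lambda>v'. r *\<^sub>R hess F w b v')) (at w)"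
      by (intro has_derivative_scaleR_right C2_onD(2)[OF assms(1,3)])
    then have "((\<lambda>z. frechet_derivative F (at z) (r *\<^sub>R b)) has_derivative (\<lambda>v'. r *\<^sub>R hess F w b v')) (at w)"
      by (rule has_derivative_transform_within_open[OF _ assms(2,3)]) (simp add: linear_scale[OF D])
    from frechet_derivative_eqI[OF this] show "hess F w (r *\<^sub>R b) v' = r *\<^sub>R hess F w b v'" by (simp add: hess_def)
  qed
qed

lemma C2_on_inner:
  fixes F :: "'a::real_normed_vector \<Rightarrow> 'b::real_inner"
  assumes F: "C2_on U F" and U: "open U"
  shows "C2_on U (\<lambda>w. F w \<bullet> b)"
    and "w \<in> U \<Longrightarrow> frechet_derivative (\<lambda>w. F w \<bullet> b) (at w) v = frechet_derivative F (at w) v \<bullet> b"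
    and "w \<in> U \<Longrightarrow> hess (\<lambda>w. F w \<bullet> b) w v v' = hess F w v v' \<bullet> b"
proof -
  have 1: "((\<lambda>w. F w \<bullet> b) has_derivative (\<lambda>v. frechet_derivative F (at w) v \<bullet> b)) (at w)" if "w \<in> U" for w
    by (intro has_derivative_inner_left C2_onD(1)[OF F that])
  show D: "frechet_derivative (\<lambda>w. F w \<bullet> b) (at w) v = frechet_derivative F (at w) v \<bullet> b" if "w \<in> U" for w v
    using frechet_derivative_eqI[OF 1[OF that]] by simp
  have i: "((\<lambda>z. frechet_derivative F (at z) v \<bullet> b) has_derivative (\<lambda>v'. hess F w v v' \<bullet> b)) (at w)" if "w \<in> U" for w v
    by (intro has_derivative_inner_left C2_onD(2)[OF F that])
  have 2: "((\<lambda>z. frechet_derivative (\<lambda>w. F w \<bullet> b) (at z) v) has_derivative (\<lambda>v'. hess F w v v' \<bullet> b)) (at w)" if "w \<in> U" for w v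
    by (rule has_derivative_transform_within_open[OF i[OF that] U that]) (simp add: D)
  show H: "hess (\<lambda>w. F w \<bullet> b) w v v' = hess F w v v' \<bullet> b" if "w \<in> U" for w v v'
    using frechet_derivative_eqI[OF 2[OF that]] by (simp add: hess_def)
  show "C2_on U (\<lambda>w. F w \<bullet> b)"
    unfolding C2_on_def
  proof (intro conjI ballI allI)
    fix w assume "w \<in> U"
    then show "(\<lambda>w. F w \<bullet> b) differentiable (at w)" using 1 by (auto simp: differentiable_def)
  next
    fix w v assume "w \<in> U"
    then show "(\<lambda>z. frechet_derivative (\<lambda>w. F w \<bullet> b) (at z) v) differentiable (at w)" using 2 by (auto simp: differentiable_def)
  next
    fix v v'
    have "continuous_on U (\<lambda>w. hess F w v v' \<bullet> b)"
      using F unfolding C2_on_def by (intro continuous_intros) blast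
    then show "continuous_on U (\<lambda>w. hess (\<lambda>w. F w \<bullet> b) w v v')" by (subst continuous_on_cong[OF refl H]) auto
  qed
qed

lemma DERIV_along_line:
  fixes g :: "'a::real_normed_vector \<Rightarrow> real"
  assumes "(g has_derivative g') (at (a + s *\<^sub>R d))"
  shows "((\<lambda>s. g (a + s *\<^sub>R d)) has_real_derivative g' d) (at s)"
proof -
  have "((\<lambda>s. a + s *\<^sub>R d) has_derivative (\<lambda>h. h *\<^sub>R d)) (at s)"
    by (auto intro!: derivative_eq_intros)
  from has_derivative_compose[OF this assms]
  show ?thesis
    unfolding has_field_derivative_def
    by (rule has_derivative_eq_rhs) (simp add: fun_eq_iff linear_scale[OF has_derivative_linear[OF assms]])
qed

text \<open>The mean value theorem, applied first along \<open>v\<close> and then along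
  \<open>v'\<close>, produces the second derivative in one particular order, whereas the second
  difference itself is symmetric in the two directions. This contrast gives the symmetry of
  \<open>hess\<close>.\<close>

lemma second_difference:
  fixes g :: "'a::real_normed_vector \<Rightarrow> real"
  assumes g: "C2_on U g" and h: "0 < h" "cball w (h * (norm v + norm v')) \<subseteq> U"
  shows "\<exists>p\<in>cball w (h * (norm v + norm v')). g (w + h *\<^sub>R v + h *\<^sub>R v') - g (w + h *\<^sub>R v) - g (w + h *\<^sub>R v') + g w = h\<^sup>2 * hess g p v v'"
proof -
  have in_ball: "w + s *\<^sub>R v + r *\<^sub>R v' \<in> cball w (h * (norm v + norm v'))" if "0 \<le> s" "s \<le> h" "0 \<le> r" "r \<le> h" for s r
  proof -
    have "norm (s *\<^sub>R v + r *\<^sub>R v') \<le> s * norm v + r * norm v'" using norm_triangle_ineq[of "s *\<^sub>R v" "r *\<^sub>R v'"] that by simp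
    also have "\<dots> \<le> h * norm v + h * norm v'" using that by (intro add_mono mult_right_mono) auto
    finally show ?thesis by (simp add: dist_norm algebra_simps norm_minus_commute)
  qed
  have inU: "w + s *\<^sub>R v + r *\<^sub>R v' \<in> U" if "0 \<le> s" "s \<le> h" "0 \<le> r" "r \<le> h" for s r
    using in_ball[OF that] h(2) by blast
  have "\<exists>z>0. z < h \<and> (g (w + h *\<^sub>R v' + h *\<^sub>R v) - g (w + h *\<^sub>R v)) - (g (w + h *\<^sub>R v' + 0 *\<^sub>R v) - g (w + 0 *\<^sub>R v))
      = (h - 0) * (frechet_derivative g (at (w + h *\<^sub>R v' + z *\<^sub>R v)) v - frechet_derivative g (at (w + z *\<^sub>R v)) v)"
  proof (rule MVT2[OF h(1), where f="\<lambda>s. g (w + h *\<^sub>R v' + s *\<^sub>R v) - g (w + s *\<^sub>R v)"])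
    fix s assume s: "0 \<le> s" "s \<le> h"
    have "w + h *\<^sub>R v' + s *\<^sub>R v \<in> U" "w + s *\<^sub>R v \<in> U" using inU[of s h] inU[of s 0] s h(1) by (auto simp: algebra_simps)
    then show "((\<lambda>s. g (w + h *\<^sub>R v' + s *\<^sub>R v) - g (w + s *\<^sub>R v)) has_real_derivative
        frechet_derivative g (at (w + h *\<^sub>R v' + s *\<^sub>R v)) v - frechet_derivative g (at (w + s *\<^sub>R v)) v) (at s)"
      by (intro DERIV_diff DERIV_along_line C2_onD(1)[OF g])
  qed
  then obtain s where s: "0 < s" "s < h" and e1: "g (w + h *\<^sub>R v' + h *\<^sub>R v) - g (w + h *\<^sub>R v) - g (w + h *\<^sub>R v') + g w =
      h * (frechet_derivative g (at (w + h *\<^sub>R v' + s *\<^sub>R v)) v - frechet_derivative g (at (w + s *\<^sub>R v)) v)" by auto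
  have "\<exists>z>0. z < h \<and> frechet_derivative g (at (w + s *\<^sub>R v + h *\<^sub>R v')) v - frechet_derivative g (at (w + s *\<^sub>R v + 0 *\<^sub>R v')) v
      = (h - 0) * hess g (w + s *\<^sub>R v + z *\<^sub>R v') v v'"
  proof (rule MVT2[OF h(1), where f="\<lambda>r. frechet_derivative g (at (w + s *\<^sub>R v + r *\<^sub>R v')) v"])
    fix r assume r: "0 \<le> r" "r \<le> h"
    then have "w + s *\<^sub>R v + r *\<^sub>R v' \<in> U" using inU[of s r] s by auto
    then show "((\<lambda>r. frechet_derivative g (at (w + s *\<^sub>R v + r *\<^sub>R v')) v) has_real_derivative hess g (w + s *\<^sub>R v + r *\<^sub>R v') v v') (at r)"
      by (rule DERIV_along_line[OF C2_onD(2)[OF g]])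
  qed
  then obtain r where r: "0 < r" "r < h" and e2: "frechet_derivative g (at (w + s *\<^sub>R v + h *\<^sub>R v')) v - frechet_derivative g (at (w + s *\<^sub>R v)) v
      = h * hess g (w + s *\<^sub>R v + r *\<^sub>R v') v v'" by auto
  have c: "w + h *\<^sub>R v' + s *\<^sub>R v = w + s *\<^sub>R v + h *\<^sub>R v'" "w + h *\<^sub>R v' + h *\<^sub>R v = w + h *\<^sub>R v + h *\<^sub>R v'" by (simp_all add: algebra_simps)
  show ?thesis
    using e1 e2 in_ball[of s r] s r unfolding c by (intro bexI[of _ "w + s *\<^sub>R v + r *\<^sub>R v'"]) (auto simp: power2_eq_square)
qed

text \<open>One and the same second difference equals \<open>hess\<close> at a point
  \<open>p\<close> in one order and at a point \<open>p'\<close> in the other. Both points are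
  within a multiple of \<open>h\<close> of \<open>w\<close>, so continuity of the second derivatives
  excludes different values at \<open>w\<close>.\<close>

lemma hess_symmetric_real:
  fixes g :: "'a::real_normed_vector \<Rightarrow> real"
  assumes g: "C2_on U g" and U: "open U" "w \<in> U"
  shows "hess g w v v' = hess g w v' v"
proof (rule ccontr)
  assume ne: "\<not> ?thesis"
  define e where "e = dist (hess g w v v') (hess g w v' v) / 2"
  have e: "e > 0" using ne by (simp add: e_def)
  have ct: "isCont (\<lambda>w. hess g w a b) w" for a b using C2_onD(3)[OF g U(2)] U continuous_on_eq_continuous_at by blast
  obtain d1 where d1: "d1 > 0" "\<And>p. dist p w < d1 \<Longrightarrow> dist (hess g p v v') (hess g w v v') < e"
    using ct[of v v'] e unfolding continuous_at_eps_delta by (metis dist_commute)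
  obtain d2 where d2: "d2 > 0" "\<And>p. dist p w < d2 \<Longrightarrow> dist (hess g p v' v) (hess g w v' v) < e"
    using ct[of v' v] e unfolding continuous_at_eps_delta by (metis dist_commute)
  obtain d3 where d3: "d3 > 0" "cball w d3 \<subseteq> U" using U open_contains_cball by metis
  \<comment> \<open>The summand 1 keeps the divisor positive when both directions vanish and makes
    \<open>h * (norm v + norm v')\<close> strictly smaller than half of the least radius.\<close>
  define N where "N = norm v + norm v' + 1"
  define h where "h = min d3 (min d1 d2) / 2 / N"
  have N: "N \<ge> 1" by (simp add: N_def)
  have h: "h > 0" using d1 d2 d3 N by (simp add: h_def)
  have "h * (norm v + norm v') < h * N" using h by (simp add: N_def)
  also have "h * N = min d3 (min d1 d2) / 2" using N by (simp add: h_def)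
  finally have hN: "h * (norm v + norm v') < d1" "h * (norm v + norm v') < d2" "h * (norm v + norm v') < d3" using d1 d2 d3 by auto
  have sub: "cball w (h * (norm v + norm v')) \<subseteq> U" using d3 hN(3) by (meson subset_cball less_imp_le order_trans)
  obtain p where p: "p \<in> cball w (h * (norm v + norm v'))" "g (w + h *\<^sub>R v + h *\<^sub>R v') - g (w + h *\<^sub>R v) - g (w + h *\<^sub>R v') + g w = h\<^sup>2 * hess g p v v'"
    using second_difference[OF g h sub] by blast
  obtain p' where p': "p' \<in> cball w (h * (norm v' + norm v))" "g (w + h *\<^sub>R v' + h *\<^sub>R v) - g (w + h *\<^sub>R v') - g (w + h *\<^sub>R v) + g w = h\<^sup>2 * hess g p' v' v"
    using second_difference[OF g h, of w v' v] sub by (auto simp: add.commute)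
  have "w + h *\<^sub>R v' + h *\<^sub>R v = w + h *\<^sub>R v + h *\<^sub>R v'" by simp
  then have "h\<^sup>2 * hess g p v v' = h\<^sup>2 * hess g p' v' v" using p(2) p'(2) by (simp only:)
  then have "hess g p v v' = hess g p' v' v" using h by simp
  moreover have "dist (hess g p v v') (hess g w v v') < e" using p(1) hN(1) by (intro d1(2)) (auto simp: dist_commute)
  moreover have "dist (hess g p' v' v) (hess g w v' v) < e" using p'(1) hN(2) by (intro d2(2)) (auto simp: dist_commute add.commute)
  ultimately have "dist (hess g w v v') (hess g w v' v) < 2 * e" by (metis dist_triangle_half_l dist_commute mult_2 field_sum_of_halves add_divide_distrib)
  then show False by (simp add: e_def)
qed

lemma hess_symmetric:
  fixes F :: "'a::real_normed_vector \<Rightarrow> 'b::euclidean_space"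
  assumes F: "C2_on U F" and U: "open U" "w \<in> U"
  shows "hess F w v v' = hess F w v' v"
proof (rule euclidean_eqI)
  fix b :: 'b assume "b \<in> Basis"
  show "hess F w v v' \<bullet> b = hess F w v' v \<bullet> b"
    using hess_symmetric_real[OF C2_on_inner(1)[OF F U(1)] U, of b v v'] C2_on_inner(3)[OF F U(1) U(2), of b] by simp
qed

lemma Taylor_second_order:
  fixes g :: "'a::real_normed_vector \<Rightarrow> real"
  assumes g: "C2_on U g" and C: "convex C" "C \<subseteq> U" "a \<in> C" "b \<in> C"
  shows "\<exists>w\<in>C. g a - g b - frechet_derivative g (at b) (a - b) = hess g w (a - b) (a - b) / 2"
proof -
  define d where "d = a - b"
  define D where "D m s = (if m = 0 then g (b + s *\<^sub>R d) else if m = 1 then frechet_derivative g (at (b + s *\<^sub>R d)) d else hess g (b + s *\<^sub>R d) d d)" for m :: nat and s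
  have inC: "b + s *\<^sub>R d \<in> C" if "0 \<le> s" "s \<le> 1" for s
  proof -
    have "b + s *\<^sub>R d = (1 - s) *\<^sub>R b + s *\<^sub>R a" by (simp add: d_def algebra_simps)
    then show ?thesis using C that convexD_alt[of C b a s] by simp
  qed
  have "\<exists>t. 0 < t \<and> t < 1 \<and> g (b + 1 *\<^sub>R d) = (\<Sum>m<2. D m 0 / fact m * (1 - 0) ^ m) + D 2 t / fact 2 * (1 - 0) ^ 2"
  proof (rule Taylor_up[where f="\<lambda>s. g (b + s *\<^sub>R d)" and diff=D and a=0 and b=1])
    show "D 0 = (\<lambda>s. g (b + s *\<^sub>R d))" by (simp add: D_def[abs_def])
    show "\<forall>m t. m < 2 \<and> 0 \<le> t \<and> t \<le> 1 \<longrightarrow> (D m has_real_derivative D (Suc m) t) (at t)"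
    proof (intro allI impI)
      fix m :: nat and t :: real assume *: "m < 2 \<and> 0 \<le> t \<and> t \<le> 1"
      then have U: "b + t *\<^sub>R d \<in> U" using inC C by blast
      from * consider "m = 0" | "m = 1" by linarith
      then show "(D m has_real_derivative D (Suc m) t) (at t)"
        by cases (use DERIV_along_line[OF C2_onD(1)[OF g U]] DERIV_along_line[OF C2_onD(2)[OF g U]] in \<open>simp_all add: D_def[abs_def]\<close>)
    qed
  qed auto
  then obtain t where t: "0 < t" "t < 1" "g (b + d) = g b + frechet_derivative g (at b) d + hess g (b + t *\<^sub>R d) d d / 2"
    by (auto simp: D_def numeral_2_eq_2)
  then show ?thesis using inC[of t] by (intro bexI[of _ "b + t *\<^sub>R d"]) (auto simp: d_def)
qed

text \<open>Continuity is available for each fixed argument \<open>v\<close> only. A bound on each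
  of the finitely many basis vectors, combined by linearity, is uniform in \<open>v\<close> as
  well.\<close>

lemma compact_uniform_bound_linear:
  fixes G :: "'c::topological_space \<Rightarrow> 'a::euclidean_space \<Rightarrow> 'b::real_normed_vector"
  assumes "compact C" "\<And>v. continuous_on C (\<lambda>w. G w v)" "\<And>w. w \<in> C \<Longrightarrow> linear (G w)"
  obtains K where "0 \<le> K" "\<And>w v. w \<in> C \<Longrightarrow> norm (G w v) \<le> K * norm v"
proof -
  have "\<exists>B\<ge>0. \<forall>w\<in>C. norm (G w i) \<le> B" for i
  proof -
    have "bounded ((\<lambda>w. G w i) ` C)" by (intro compact_imp_bounded compact_continuous_image assms)
    then obtain B where "\<forall>w\<in>C. norm (G w i) \<le> B" by (auto simp: bounded_iff)
    then show ?thesis by (intro exI[of _ "max B 0"]) (auto simp: le_max_iff_disj)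
  qed
  then obtain B where B: "\<And>i. 0 \<le> B i" "\<And>i w. w \<in> C \<Longrightarrow> norm (G w i) \<le> B i" by metis
  show thesis
  proof (rule that[of "\<Sum>i\<in>Basis. B i"])
    fix w v assume w: "w \<in> C"
    have "G w v = (\<Sum>i\<in>Basis. (v \<bullet> i) *\<^sub>R G w i)"
      by (subst euclidean_representation[of v, symmetric]) (simp add: linear_sum[OF assms(3)[OF w]] linear_scale[OF assms(3)[OF w]])
    also have "norm \<dots> \<le> (\<Sum>i\<in>Basis. norm v * B i)"
      using B w by (intro order.trans[OF norm_sum] sum_mono) (auto intro!: mult_mono simp: Basis_le_norm)
    also have "\<dots> = (\<Sum>i\<in>Basis. B i) * norm v" by (simp add: sum_distrib_left mult.commute)
    finally show "norm (G w v) \<le> (\<Sum>i\<in>Basis. B i) * norm v" .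
  qed (simp add: sum_nonneg B)
qed

lemma C2_on_bounds:
  fixes F :: "'a::euclidean_space \<Rightarrow> 'b::real_normed_vector"
  assumes F: "C2_on U F" and U: "open U" and C: "compact C" "C \<subseteq> U"
  obtains K where "0 \<le> K" "\<And>w v. w \<in> C \<Longrightarrow> norm (frechet_derivative F (at w) v) \<le> K * norm v"
    "\<And>w v v'. w \<in> C \<Longrightarrow> norm (hess F w v v') \<le> K * norm v * norm v'"
proof -
  obtain K1 where K1: "0 \<le> K1" "\<And>w v. w \<in> C \<Longrightarrow> norm (frechet_derivative F (at w) v) \<le> K1 * norm v"
  proof (rule compact_uniform_bound_linear[OF C(1), of "\<lambda>w. frechet_derivative F (at w)"])
    fix v show "continuous_on C (\<lambda>w. frechet_derivative F (at w) v)"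
      using C2_onD(2)[OF F] C by (intro continuous_at_imp_continuous_on ballI has_derivative_continuous) blast
  qed (use C2_onD(1)[OF F] C has_derivative_linear in blast)+
  have "\<exists>K\<ge>0. \<forall>w\<in>C. \<forall>v. norm (hess F w v v') \<le> K * norm v" for v'
  proof (rule compact_uniform_bound_linear[OF C(1), of "\<lambda>w v. hess F w v v'"])
    fix v show "continuous_on C (\<lambda>w. hess F w v v')" using F C unfolding C2_on_def by (meson continuous_on_subset)
  qed (use hess_linear(2)[OF F U] C in blast)+
  then obtain B where B: "\<And>i. 0 \<le> B i" "\<And>i w v. w \<in> C \<Longrightarrow> norm (hess F w v i) \<le> B i * norm v" by metis
  define K2 where "K2 = (\<Sum>i\<in>(Basis :: 'a set). B i)"
  have K2: "norm (hess F w v v') \<le> K2 * norm v * norm v'" if w: "w \<in> C" for w v v'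
  proof -
    note l = hess_linear(1)[OF F U, of w v]
    have wU: "w \<in> U" using w C by blast
    have "hess F w v v' = (\<Sum>i\<in>Basis. (v' \<bullet> i) *\<^sub>R hess F w v i)"
      by (subst euclidean_representation[of v', symmetric]) (simp add: linear_sum[OF l[OF wU]] linear_scale[OF l[OF wU]])
    also have "norm \<dots> \<le> (\<Sum>i\<in>Basis. norm v' * (B i * norm v))"
      using B w by (intro order.trans[OF norm_sum] sum_mono) (auto intro!: mult_mono simp: Basis_le_norm)
    finally show ?thesis by (simp add: K2_def sum_distrib_left sum_distrib_right mult_ac)
  qed
  show thesis
  proof (rule that[of "max K1 K2"])
    fix w v v' assume w: "w \<in> C"
    show "norm (frechet_derivative F (at w) v) \<le> max K1 K2 * norm v"
      using K1(2)[OF w, of v] by (rule order.trans) (auto intro: mult_right_mono)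
    show "norm (hess F w v v') \<le> max K1 K2 * norm v * norm v'"
      using K2[OF w, of v v'] by (rule order.trans) (auto intro!: mult_right_mono)
  qed (use K1 in auto)
qed

lemma Lipschitz_on_of_derivative_bound:
  fixes F :: "'a::real_normed_vector \<Rightarrow> 'b::real_normed_vector"
  assumes "convex C" "\<And>w. w \<in> C \<Longrightarrow> (F has_derivative F' w) (at w)" "0 \<le> K" "\<And>w v. w \<in> C \<Longrightarrow> norm (F' w v) \<le> K * norm v"
  shows "K-lipschitz_on C F"
  by (rule bounded_derivative_imp_lipschitz[where f'=F'])
     (use assms in \<open>auto intro: has_derivative_at_withinI onorm_bound\<close>)

text \<open>Polarisation: \<open>4 * B a b\<close> is the difference of \<open>B\<close> on the
  diagonal at \<open>a + b\<close> and at \<open>a - b\<close>, and the latter is dropped because it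
  is nonnegative. For unit vectors \<open>norm (a + b) \<le> 2\<close> gives exactly
  \<open>K\<close>, without a dimension-dependent factor, so the constants of the final estimate
  stay sharp.\<close>

lemma psd_bilinear_bound:
  fixes B :: "'a::real_inner \<Rightarrow> 'a \<Rightarrow> real"
  assumes l: "\<And>a. linear (B a)" "\<And>b. linear (\<lambda>a. B a b)" and sym: "\<And>a b. B a b = B b a"
    and psd: "\<And>a. 0 \<le> B a a" "\<And>a. B a a \<le> K * (norm a)\<^sup>2"
  shows "\<bar>B a b\<bar> \<le> K * norm a * norm b"
proof -
  have unit: "B a b \<le> K" if "norm a = 1" "norm b = 1" for a b
  proof -
    have "4 * B a b = B (a + b) (a + b) - B (a - b) (a - b)"
      using linear_add[OF l(1)] linear_add[OF l(2)] linear_diff[OF l(1)] linear_diff[OF l(2)] sym[of a b] by simp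
    also have "\<dots> \<le> K * (norm (a + b))\<^sup>2" using psd(1)[of "a - b"] psd(2)[of "a + b"] by linarith
    also have "\<dots> \<le> K * 2\<^sup>2"
    proof (intro mult_left_mono power_mono)
      show "norm (a + b) \<le> 2" using norm_triangle_ineq[of a b] that by simp
      show "0 \<le> K" using psd(1)[of a] psd(2)[of a] that by simp
    qed auto
    finally show ?thesis by simp
  qed
  show ?thesis
  proof (cases "a = 0 \<or> b = 0")
    case True
    then show ?thesis using linear_0[OF l(1)] linear_0[OF l(2)] by auto
  next
    case False
    define a' b' where "a' = a /\<^sub>R norm a" "b' = b /\<^sub>R norm b"
    have n: "norm a' = 1" "norm b' = 1" "norm (- b') = 1" using False by (auto simp: a'_b'_def)
    have "\<bar>B a' b'\<bar> \<le> K" using unit[OF n(1,2)] unit[OF n(1,3)] linear_neg[OF l(1), of a' b'] by simp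
    moreover have "B a b = norm a * norm b * B a' b'"
      using False by (simp add: a'_b'_def linear_scale[OF l(1)] linear_scale[OF l(2)] field_simps)
    ultimately show ?thesis using False by (simp add: abs_mult mult.commute mult.left_commute mult_left_mono)
  qed
qed

lemma frechet_derivative_linear_in:
  assumes "C2_on U F" "w \<in> U"
  shows "linear (frechet_derivative F (at w))"
  using has_derivative_linear[OF C2_onD(1)[OF assms]] .

text \<open>A product rule. \<open>C2_on\<close> provides the derivative of
  \<open>z \<mapsto> DF(z) v\<close> for fixed \<open>v\<close> only, so the moving argument
  \<open>g z\<close> is expanded in the basis and the scalar coefficients are differentiated
  separately.\<close>

lemma has_derivative_frechet_derivative_apply:
  fixes F :: "'a::euclidean_space \<Rightarrow> 'b::real_normed_vector"
  assumes F: "C2_on U F" "open U" "w \<in> U" and g: "(g has_derivative g') (at w)"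
  shows "((\<lambda>z. frechet_derivative F (at z) (g z)) has_derivative (\<lambda>h. hess F w (g w) h + frechet_derivative F (at w) (g' h))) (at w)"
proof -
  have rep: "frechet_derivative F (at z) y = (\<Sum>i\<in>Basis. (y \<bullet> i) *\<^sub>R frechet_derivative F (at z) i)" if "z \<in> U" for z y
    by (subst euclidean_representation[of y, symmetric])
       (simp add: linear_sum[OF frechet_derivative_linear_in[OF F(1) that]] linear_scale[OF frechet_derivative_linear_in[OF F(1) that]])
  have hrep: "hess F w y h = (\<Sum>i\<in>Basis. (y \<bullet> i) *\<^sub>R hess F w i h)" for y h
    by (subst euclidean_representation[of y, symmetric])
       (simp add: linear_sum[OF hess_linear(2)[OF F]] linear_scale[OF hess_linear(2)[OF F]])
  have "((\<lambda>z. \<Sum>i\<in>Basis. (g z \<bullet> i) *\<^sub>R frechet_derivative F (at z) i) has_derivative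
     (\<lambda>h. \<Sum>i\<in>Basis. (g w \<bullet> i) *\<^sub>R hess F w i h + (g' h \<bullet> i) *\<^sub>R frechet_derivative F (at w) i)) (at w)"
    by (intro has_derivative_sum has_derivative_scaleR has_derivative_inner_left g C2_onD(2)[OF F(1,3)])
  then have "((\<lambda>z. frechet_derivative F (at z) (g z)) has_derivative
     (\<lambda>h. \<Sum>i\<in>Basis. (g w \<bullet> i) *\<^sub>R hess F w i h + (g' h \<bullet> i) *\<^sub>R frechet_derivative F (at w) i)) (at w)"
    by (rule has_derivative_transform_within_open[OF _ F(2,3)]) (simp add: rep[symmetric])
  then show ?thesis by (simp add: sum.distrib hrep[symmetric] rep[OF F(3), symmetric])
qed

section \<open>Relative entropy\<close>

locale entropy_system =
  fixes U C :: "(real ^ 'm::finite) set" and f :: "real ^ 'm \<Rightarrow> real ^ 'm" and \<eta> q :: "real ^ 'm \<Rightarrow> real"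
    and Cf Cl Cu :: real
  assumes open_U: "open U" and C2_f: "C2_on U f" and entropy: "entropy_pair U f \<eta> q"
    and C_sub: "C \<subseteq> U" and convex_C: "convex C" and compact_C: "compact C"
    and Cl_pos: "0 < Cl"
    and hess_f_bound: "\<And>v w. w \<in> C \<Longrightarrow> norm (hess f w v v) \<le> Cf * (norm v)\<^sup>2"
    and hess_\<eta>_lower: "\<And>v w. w \<in> C \<Longrightarrow> Cl * (norm v)\<^sup>2 \<le> hess \<eta> w v v"
    and hess_\<eta>_upper: "\<And>v w. w \<in> C \<Longrightarrow> hess \<eta> w v v \<le> Cu * (norm v)\<^sup>2"
begin

abbreviation D\<eta> where "D\<eta> w \<equiv> frechet_derivative \<eta> (at w)"
abbreviation Df where "Df w \<equiv> frechet_derivative f (at w)"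

definition rel_\<eta> where "rel_\<eta> a b = \<eta> a - \<eta> b - D\<eta> b (a - b)"
definition rel_q where "rel_q a b = q a - q b - D\<eta> b (f a - f b)"
definition rel_f where "rel_f a b = f a - f b - Df b (a - b)"

lemma C2_\<eta>: "C2_on U \<eta>" and C2_q: "C2_on U q" using entropy by (auto simp: entropy_pair_def)

lemma compat: "w \<in> U \<Longrightarrow> D\<eta> w (Df w v) = frechet_derivative q (at w) v"
  using entropy by (auto simp: entropy_pair_def)

lemma CU: "w \<in> C \<Longrightarrow> w \<in> U" using C_sub by blast

lemma linear_D\<eta>: "w \<in> U \<Longrightarrow> linear (D\<eta> w)" and linear_Df: "w \<in> U \<Longrightarrow> linear (Df w)"
  using frechet_derivative_linear_in C2_\<eta> C2_f by blast+

lemma linear_hess_\<eta>: "w \<in> U \<Longrightarrow> linear (hess \<eta> w v)" "w \<in> U \<Longrightarrow> linear (\<lambda>v. hess \<eta> w v v')"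
  using hess_linear[OF C2_\<eta> open_U] by blast+

lemma hess_\<eta>_sym: "w \<in> U \<Longrightarrow> hess \<eta> w v v' = hess \<eta> w v' v"
  using hess_symmetric[OF C2_\<eta> open_U] by blast

lemma rel_\<eta>_bounds:
  assumes "a \<in> C" "b \<in> C"
  shows "Cl / 2 * (norm (a - b))\<^sup>2 \<le> rel_\<eta> a b" "rel_\<eta> a b \<le> Cu / 2 * (norm (a - b))\<^sup>2"
proof -
  obtain w where "w \<in> C" "rel_\<eta> a b = hess \<eta> w (a - b) (a - b) / 2"
    using Taylor_second_order[OF C2_\<eta> convex_C C_sub assms] by (auto simp: rel_\<eta>_def)
  then show "Cl / 2 * (norm (a - b))\<^sup>2 \<le> rel_\<eta> a b" "rel_\<eta> a b \<le> Cu / 2 * (norm (a - b))\<^sup>2"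
    using hess_\<eta>_lower[of w "a - b"] hess_\<eta>_upper[of w "a - b"] by auto
qed

lemma rel_\<eta>_nonneg: "a \<in> C \<Longrightarrow> b \<in> C \<Longrightarrow> 0 \<le> rel_\<eta> a b"
  using rel_\<eta>_bounds(1)[of a b] Cl_pos by (meson divide_nonneg_nonneg less_imp_le mult_nonneg_nonneg order_trans zero_le_numeral zero_le_power2)

text \<open>The Taylor remainder with an intermediate point exists for scalar functions only.
  Projecting \<open>f\<close> onto the unit vector \<open>e\<close> in the direction of
  \<open>rel_f a b\<close> itself loses nothing in the norm, and the constant \<open>Cf / 2\<close>
  survives.\<close>

lemma rel_f_bound:
  assumes "a \<in> C" "b \<in> C"
  shows "norm (rel_f a b) \<le> Cf / 2 * (norm (a - b))\<^sup>2"
proof (cases "rel_f a b = 0")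
  case True
  have "0 \<le> Cf * (norm (a - b))\<^sup>2" using hess_f_bound[OF assms(1), of "a - b"] norm_ge_zero[of "hess f a (a - b) (a - b)"] by linarith
  then show ?thesis using True by simp
next
  case False
  define e where "e = rel_f a b /\<^sub>R norm (rel_f a b)"
  have ne: "norm e = 1" using False by (simp add: e_def)
  note i = C2_on_inner[OF C2_f open_U, where b=e]
  obtain w where w: "w \<in> C" "f a \<bullet> e - f b \<bullet> e - Df b (a - b) \<bullet> e = hess f w (a - b) (a - b) \<bullet> e / 2"
    using Taylor_second_order[OF i(1) convex_C C_sub assms] i(2)[OF CU[OF assms(2)]] i(3)[OF CU] by auto
  have "norm (rel_f a b) = rel_f a b \<bullet> e" using False by (simp add: e_def power2_norm_eq_inner[symmetric] power2_eq_square)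
  also have "\<dots> = hess f w (a - b) (a - b) \<bullet> e / 2" using w(2) by (simp add: rel_f_def inner_diff_left)
  also have "\<dots> \<le> norm (hess f w (a - b) (a - b)) * norm e / 2" using norm_cauchy_schwarz[of "hess f w (a - b) (a - b)" e] by simp
  also have "\<dots> \<le> Cf / 2 * (norm (a - b))\<^sup>2" using hess_f_bound[OF w(1), of "a - b"] ne by simp
  finally show ?thesis .
qed

text \<open>The compatibility of \<open>\<eta>\<close> and \<open>q\<close> cancels the first-order
  terms, so the relative flux is quadratic in \<open>a - b\<close>, and convexity bounds the square
  by the relative entropy. The constant \<open>lam\<close> becomes the propagation speed of the cone
  on which the stability estimate is localised.\<close>

lemma rel_q_bound:
  obtains lam where "0 \<le> lam" "\<And>a b. a \<in> C \<Longrightarrow> b \<in> C \<Longrightarrow> \<bar>rel_q a b\<bar> \<le> lam * rel_\<eta> a b"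
proof -
  obtain K where K: "0 \<le> K" "\<And>w v v'. w \<in> C \<Longrightarrow> norm (hess q w v v') \<le> K * norm v * norm v'"
    using C2_on_bounds[OF C2_q open_U compact_C C_sub] by metis
  obtain K' where K': "0 \<le> K'" "\<And>w v. w \<in> C \<Longrightarrow> norm (D\<eta> w v) \<le> K' * norm v"
    using C2_on_bounds[OF C2_\<eta> open_U compact_C C_sub] by metis
  \<comment> \<open>\<open>K / 2\<close> bounds the Taylor remainder of \<open>q\<close>, and the
    second summand bounds \<open>D\<eta> b\<close> applied to the remainder of \<open>f\<close>. The
    absolute value is taken because the locale does not fix the sign of \<open>Cf\<close>.\<close>
  define N where "N = K / 2 + K' * (\<bar>Cf\<bar> / 2)"
  have N: "0 \<le> N" using K K' by (simp add: N_def)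
  have "\<bar>rel_q a b\<bar> \<le> (2 * N / Cl) * rel_\<eta> a b" if ab: "a \<in> C" "b \<in> C" for a b
  proof -
    obtain w where w: "w \<in> C" "q a - q b - frechet_derivative q (at b) (a - b) = hess q w (a - b) (a - b) / 2"
      using Taylor_second_order[OF C2_q convex_C C_sub ab] by auto
    have "D\<eta> b (f a - f b) = D\<eta> b (rel_f a b) + D\<eta> b (Df b (a - b))"
      using linear_add[OF linear_D\<eta>[OF CU[OF ab(2)]], of "rel_f a b" "Df b (a - b)"] by (simp add: rel_f_def)
    then have "rel_q a b = hess q w (a - b) (a - b) / 2 - D\<eta> b (rel_f a b)"
      using w(2) compat[OF CU[OF ab(2)], of "a - b"] by (simp add: rel_q_def)
    moreover have "\<bar>hess q w (a - b) (a - b)\<bar> \<le> K * (norm (a - b))\<^sup>2"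
      using K(2)[OF w(1), of "a - b" "a - b"] by (simp add: power2_eq_square mult.assoc)
    moreover have "\<bar>D\<eta> b (rel_f a b)\<bar> \<le> K' * (\<bar>Cf\<bar> / 2 * (norm (a - b))\<^sup>2)"
    proof -
      have "norm (rel_f a b) \<le> \<bar>Cf\<bar> / 2 * (norm (a - b))\<^sup>2"
        using rel_f_bound[OF ab] by (rule order_trans) (intro mult_right_mono, auto)
      then have "K' * norm (rel_f a b) \<le> K' * (\<bar>Cf\<bar> / 2 * (norm (a - b))\<^sup>2)" using K' by (intro mult_left_mono)
      then show ?thesis using K'(2)[OF ab(2), of "rel_f a b"] by simp
    qed
    ultimately have "\<bar>rel_q a b\<bar> \<le> N * (norm (a - b))\<^sup>2" unfolding N_def by (simp add: algebra_simps)
    also have "\<dots> = 2 * N / Cl * (Cl / 2 * (norm (a - b))\<^sup>2)" using Cl_pos by simp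
    also have "\<dots> \<le> 2 * N / Cl * rel_\<eta> a b" using rel_\<eta>_bounds[OF ab] N Cl_pos by (intro mult_left_mono) auto
    finally show ?thesis .
  qed
  moreover have "0 \<le> 2 * N / Cl" using N Cl_pos by simp
  ultimately show thesis using that by blast
qed

text \<open>Differentiating \<open>D\<eta> Df = Dq\<close> writes \<open>H\<eta>(Df v, h)\<close> as
  \<open>Hq(v, h)\<close> minus \<open>D\<eta>\<close> applied to \<open>Hf(v, h)\<close>. Both
  Hessians on the right are symmetric in \<open>v\<close> and \<open>h\<close>, so the left side is
  symmetric too.\<close>

lemma hess_\<eta>_Df:
  assumes w: "w \<in> U"
  shows "hess \<eta> w (Df w a) b = hess \<eta> w a (Df w b)"
proof -
  have *: "hess \<eta> w (Df w v) h + D\<eta> w (hess f w v h) = hess q w v h" for v h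
  proof -
    have "((\<lambda>z. D\<eta> z (Df z v)) has_derivative (\<lambda>h. hess \<eta> w (Df w v) h + D\<eta> w (hess f w v h))) (at w)"
      by (rule has_derivative_frechet_derivative_apply[OF C2_\<eta> open_U w C2_onD(2)[OF C2_f w]])
    then have "((\<lambda>z. frechet_derivative q (at z) v) has_derivative (\<lambda>h. hess \<eta> w (Df w v) h + D\<eta> w (hess f w v h))) (at w)"
      by (rule has_derivative_transform_within_open[OF _ open_U w]) (simp add: compat)
    from frechet_derivative_eqI[OF this] show ?thesis by (simp add: hess_def)
  qed
  have "hess \<eta> w (Df w a) b = hess \<eta> w (Df w b) a"
    using *[of a b] *[of b a] hess_symmetric[OF C2_f open_U w, of a b] hess_symmetric[OF C2_q open_U w, of a b] by simp
  then show ?thesis by (simp add: hess_\<eta>_sym[OF w, of a])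
qed

lemma hess_\<eta>_bilinear_bound:
  assumes "w \<in> C"
  shows "\<bar>hess \<eta> w a b\<bar> \<le> Cu * norm a * norm b"
proof (rule psd_bilinear_bound)
  show "0 \<le> hess \<eta> w a a" for a using hess_\<eta>_lower[OF assms, of a] Cl_pos by (smt (verit) mult_nonneg_nonneg zero_le_power2)
qed (use assms CU linear_hess_\<eta> hess_\<eta>_sym hess_\<eta>_upper in blast)+

lemma Cu_nonneg:
  assumes "w \<in> C"
  shows "0 \<le> Cu"
proof -
  have "Cl * (norm (axis undefined 1 :: real^'m))\<^sup>2 \<le> Cu * (norm (axis undefined 1 :: real^'m))\<^sup>2"
    by (rule order_trans[OF hess_\<eta>_lower[OF assms] hess_\<eta>_upper[OF assms]])
  then show ?thesis using Cl_pos by (simp add: norm_axis_1)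
qed

text \<open>Replacing \<open>vt\<close> by \<open>r - Df b vx\<close> produces a first-order term
  that cancels, by the symmetry of \<open>H\<eta> Df\<close>, against the linear part of
  \<open>f a - f b\<close>. Only the residual and the quadratic remainder of \<open>f\<close>,
  paired with \<open>vx\<close>, are left.\<close>

lemma source_bound:
  assumes a: "a \<in> C" and b: "b \<in> C" and r: "r = vt + Df b vx" and S: "norm vx \<le> S" and Cf: "0 \<le> Cf"
  shows "- (hess \<eta> b (a - b) vt + hess \<eta> b (f a - f b) vx) \<le> (norm r)\<^sup>2 / 2 + (Cu * Cf * S + Cu\<^sup>2) / 2 * (norm (a - b))\<^sup>2"
proof -
  have bU: "b \<in> U" using CU b .
  have Cu: "0 \<le> Cu" using Cu_nonneg[OF a] .
  note l1 = linear_hess_\<eta>(1)[OF bU] and l2 = linear_hess_\<eta>(2)[OF bU]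
  have "hess \<eta> b (a - b) vt = hess \<eta> b (a - b) r - hess \<eta> b (a - b) (Df b vx)"
    using linear_diff[OF l1, of "a - b" r "Df b vx"] by (simp add: r)
  moreover have "hess \<eta> b (a - b) (Df b vx) = hess \<eta> b (Df b (a - b)) vx" by (rule hess_\<eta>_Df[OF bU, symmetric])
  moreover have "hess \<eta> b (f a - f b) vx = hess \<eta> b (rel_f a b) vx + hess \<eta> b (Df b (a - b)) vx"
    using linear_add[OF l2, of "rel_f a b" "Df b (a - b)"] by (simp add: rel_f_def)
  ultimately have "- (hess \<eta> b (a - b) vt + hess \<eta> b (f a - f b) vx) = - hess \<eta> b (a - b) r - hess \<eta> b (rel_f a b) vx" by simp
  also have "\<dots> \<le> Cu * norm (a - b) * norm r + Cu * norm (rel_f a b) * norm vx"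
    using hess_\<eta>_bilinear_bound[OF b, of "a - b" r] hess_\<eta>_bilinear_bound[OF b, of "rel_f a b" vx] by linarith
  \<comment> \<open>Young's inequality, weighted so that the squared residual gets the coefficient
    \<open>1 / 2\<close>; this is the origin of the summand \<open>Cu\<close> squared in the
    exponent.\<close>
  also have "Cu * norm (a - b) * norm r \<le> (norm r)\<^sup>2 / 2 + Cu\<^sup>2 / 2 * (norm (a - b))\<^sup>2"
    using zero_le_power2[of "norm r - Cu * norm (a - b)"] by (simp add: power2_eq_square algebra_simps)
  also have "Cu * norm (rel_f a b) * norm vx \<le> Cu * (Cf / 2 * (norm (a - b))\<^sup>2) * S"
    using rel_f_bound[OF a b] S Cu Cf by (intro mult_mono mult_left_mono) auto
  finally show ?thesis by (simp add: algebra_simps add_divide_distrib)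
qed

end

section \<open>Weak convergence\<close>

lemma not_in_symmetric_interval: "x \<notin> {-a..a} \<longleftrightarrow> a < \<bar>x\<bar>" for x a :: real
  by auto

lemma locally_integrable_R_measurable:
  fixes z :: "real \<Rightarrow> 'a::euclidean_space"
  assumes "locally_integrable_R z"
  shows "z \<in> borel_measurable borel"
proof (rule borel_measurable_LIMSEQ_metric)
  fix n :: nat
  have "integrable lborel (\<lambda>x. indicator {-real n..real n} x *\<^sub>R z x)"
    using assms by (auto simp: locally_integrable_R_def set_integrable_def)
  then show "(\<lambda>x. indicat_real {-real n..real n} x *\<^sub>R z x) \<in> borel_measurable borel"
    using borel_measurable_integrable by force
next
  fix x
  obtain N :: nat where N: "\<bar>x\<bar> \<le> real N" using real_arch_simple by blast
  have "eventually (\<lambda>n. indicat_real {-real n..real n} x *\<^sub>R z x = z x) sequentially"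
    using eventually_ge_at_top[of N] by eventually_elim (use N in \<open>auto simp: indicator_def\<close>)
  then show "(\<lambda>n. indicat_real {-real n..real n} x *\<^sub>R z x) \<longlonglongrightarrow> z x" by (rule tendsto_eventually)
qed

lemma integrable_test_times_local_R:
  fixes z :: "real \<Rightarrow> 'a::euclidean_space" and \<psi> :: "real \<Rightarrow> real"
  assumes z: "locally_integrable_R z" and \<psi>: "\<psi> \<in> borel_measurable borel" "\<And>x. \<bar>\<psi> x\<bar> \<le> B" "\<And>x. a < \<bar>x\<bar> \<Longrightarrow> \<psi> x = 0"
  shows "integrable lborel (\<lambda>x. \<psi> x *\<^sub>R z x)"
proof (rule Bochner_Integration.integrable_bound)
  show "integrable lborel (\<lambda>x. B *\<^sub>R (indicat_real {-a..a} x *\<^sub>R z x))"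
    using z by (intro integrable_scaleR_right) (auto simp: locally_integrable_R_def set_integrable_def)
  show "(\<lambda>x. \<psi> x *\<^sub>R z x) \<in> borel_measurable lborel"
    using \<psi>(1) locally_integrable_R_measurable[OF z] by simp
  have "0 \<le> B" using \<psi>(2)[of 0] by linarith
  show "AE x in lborel. norm (\<psi> x *\<^sub>R z x) \<le> norm (B *\<^sub>R (indicat_real {-a..a} x *\<^sub>R z x))"
  proof (intro AE_I2)
    fix x
    show "norm (\<psi> x *\<^sub>R z x) \<le> norm (B *\<^sub>R (indicat_real {-a..a} x *\<^sub>R z x))"
    proof (cases "x \<in> {-a..a}")
      case True
      then show ?thesis using \<psi>(2)[of x] \<open>0 \<le> B\<close> by (simp add: mult_right_mono)
    next
      case False
      then have "\<psi> x = 0" using \<psi>(3)[of x] by (simp only: not_in_symmetric_interval)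
      then show ?thesis by simp
    qed
  qed
qed

text \<open>Measurable functions are almost everywhere limits of continuous ones, but these need not
  be bounded by \<open>N\<close>. Composition with the projection onto the ball of radius
  \<open>N\<close> is continuous, enforces the bound and leaves the limit unchanged because
  \<open>M\<close> takes values in the ball.\<close>

lemma AE_limit_of_bounded_continuous:
  fixes M :: "real \<Rightarrow> 'a::euclidean_space"
  assumes M: "M \<in> borel_measurable borel" "\<And>x. norm (M x) \<le> N"
  obtains g :: "nat \<Rightarrow> real \<Rightarrow> 'a" where "\<And>j. continuous_on UNIV (g j)" "\<And>j x. norm (g j x) \<le> N"
    "AE x in lborel. (\<lambda>j. g j x) \<longlonglongrightarrow> M x"
proof -
  have N: "0 \<le> N" using M(2)[of 0] norm_ge_zero[of "M 0"] by linarith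
  have "M \<in> borel_measurable lebesgue" using M(1) by (intro measurable_completion) simp
  then have "M measurable_on UNIV" by (rule lebesgue_measurable_imp_measurable_on) simp
  then obtain Z g where Z: "negligible Z" and g: "\<And>n. continuous_on UNIV (g n)" "\<And>x. x \<notin> Z \<Longrightarrow> (\<lambda>n. g n x) \<longlonglongrightarrow> M x"
    unfolding measurable_on_def by (simp only: UNIV_I if_True) (elim exE conjE, metis)
  define P where "P = closest_point (cball (0::'a) N)"
  have Pc: "continuous_on UNIV P" unfolding P_def using N by (intro continuous_on_closest_point) auto
  have PN: "norm (P y) \<le> N" for y using closest_point_in_set[of "cball (0::'a) N" y] N by (auto simp: P_def)
  have PM: "P (M x) = M x" for x unfolding P_def using M(2)[of x] by (intro closest_point_self) auto
  show thesis
  proof (rule that[of "\<lambda>j x. P (g j x)"])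
    show "continuous_on UNIV (\<lambda>x. P (g j x))" for j
      by (rule continuous_on_compose2[OF Pc g(1)]) auto
    show "norm (P (g j x)) \<le> N" for j x by (rule PN)
    have "AE x in lebesgue. x \<notin> Z" using Z by (intro AE_not_in) (simp add: negligible_iff_null_sets)
    then have "AE x in lborel. x \<notin> Z" by (simp add: AE_completion_iff)
    then show "AE x in lborel. (\<lambda>j. P (g j x)) \<longlonglongrightarrow> M x"
    proof eventually_elim
      case (elim x)
      have "(\<lambda>j. P (g j x)) \<longlonglongrightarrow> P (M x)"
        using Pc by (intro continuous_on_tendsto_compose[OF Pc g(2)[OF elim]]) auto
      then show ?case by (simp add: PM)
    qed
  qed
qed

text \<open>Vague convergence of the vector-valued densities; the test functions are those of
  \<open>weakly_continuous_in_time\<close>.\<close>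

definition weakly_tendsto :: "(nat \<Rightarrow> real \<Rightarrow> 'a::euclidean_space) \<Rightarrow> (real \<Rightarrow> 'a) \<Rightarrow> bool" where
  "weakly_tendsto z zl \<longleftrightarrow> (\<forall>k. locally_integrable_R (z k)) \<and> locally_integrable_R zl \<and>
    (\<forall>\<psi>::real \<Rightarrow> real. continuous_on UNIV \<psi> \<and> (\<exists>K. compact K \<and> (\<forall>x. x \<notin> K \<longrightarrow> \<psi> x = 0)) \<longrightarrow>
      (\<lambda>k. LINT x|lborel. \<psi> x *\<^sub>R z k x) \<longlonglongrightarrow> (LINT x|lborel. \<psi> x *\<^sub>R zl x))"

lemma integrable_cutoff_inner:
  fixes z :: "real \<Rightarrow> 'a::euclidean_space"
  assumes z: "locally_integrable_R z" and w: "continuous_on UNIV w" "\<And>x. \<bar>w x\<bar> \<le> B" "\<And>x. a < \<bar>x\<bar> \<Longrightarrow> w x = (0::real)"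
    and g: "g \<in> borel_measurable borel" "\<And>x. norm (g x) \<le> N"
  shows "integrable lborel (\<lambda>x. w x * (g x \<bullet> z x))"
proof -
  have wm[measurable]: "w \<in> borel_measurable borel" using w(1) by (rule borel_measurable_continuous_onI)
  have N0: "0 \<le> N" using g(2)[of 0] norm_ge_zero[of "g 0"] by linarith
  show ?thesis
  proof (rule Bochner_Integration.integrable_bound)
    show "integrable lborel (\<lambda>x. N *\<^sub>R (w x *\<^sub>R z x))"
      by (intro integrable_scaleR_right integrable_test_times_local_R[OF z wm w(2,3)])
    show "(\<lambda>x. w x * (g x \<bullet> z x)) \<in> borel_measurable lborel" using g(1) locally_integrable_R_measurable[OF z] by simp
    show "AE x in lborel. norm (w x * (g x \<bullet> z x)) \<le> norm (N *\<^sub>R (w x *\<^sub>R z x))"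
    proof (rule AE_I2)
      fix x
      have "\<bar>g x \<bullet> z x\<bar> \<le> N * norm (z x)"
        using Cauchy_Schwarz_ineq2[of "g x" "z x"] mult_right_mono[OF g(2)[of x] norm_ge_zero[of "z x"]] by linarith
      then have "\<bar>w x\<bar> * \<bar>g x \<bullet> z x\<bar> \<le> \<bar>w x\<bar> * (N * norm (z x))" by (intro mult_left_mono) auto
      then show "norm (w x * (g x \<bullet> z x)) \<le> norm (N *\<^sub>R (w x *\<^sub>R z x))" using N0 by (simp add: abs_mult mult_ac)
    qed
  qed
qed

text \<open>The test functions in the definition are scalar, so a vector-valued test function
  \<open>g\<close> is treated componentwise, each component being multiplied by the cutoff
  \<open>w\<close>.\<close>

lemma weakly_tendsto_inner:
  fixes z :: "nat \<Rightarrow> real \<Rightarrow> 'a::euclidean_space"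
  assumes W: "weakly_tendsto z zl" and w: "continuous_on UNIV w" "\<And>x. \<bar>w x\<bar> \<le> B" "\<And>x. a < \<bar>x\<bar> \<Longrightarrow> w x = (0::real)"
    and g: "continuous_on UNIV g" "\<And>x. norm (g x) \<le> N"
  shows "(\<lambda>k. LINT x|lborel. w x * (g x \<bullet> z k x)) \<longlonglongrightarrow> (LINT x|lborel. w x * (g x \<bullet> zl x))"
proof -
  have comp: "continuous_on UNIV (\<lambda>x. w x * (g x \<bullet> i)) \<and> (\<exists>K. compact K \<and> (\<forall>x. x \<notin> K \<longrightarrow> w x * (g x \<bullet> i) = 0))" for i
    using w(1) g(1) by (intro conjI continuous_intros exI[of _ "{-a..a}"]) (auto simp only: not_in_symmetric_interval w(3) mult_zero_left compact_Icc)
  have rep: "(LINT x|lborel. w x * (g x \<bullet> y x)) = (\<Sum>i\<in>Basis. (LINT x|lborel. (w x * (g x \<bullet> i)) *\<^sub>R y x) \<bullet> i)"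
    if y: "locally_integrable_R y" for y :: "real \<Rightarrow> 'a"
  proof -
    have int: "integrable lborel (\<lambda>x. (w x * (g x \<bullet> i)) *\<^sub>R y x)" if "i \<in> Basis" for i
    proof (rule integrable_test_times_local_R[OF y, where B="B * N" and a=a])
      show "(\<lambda>x. w x * (g x \<bullet> i)) \<in> borel_measurable borel" using comp[of i] by (intro borel_measurable_continuous_onI) auto
      fix x
      have "\<bar>g x \<bullet> i\<bar> \<le> N" using Basis_le_norm[OF that, of "g x"] g(2)[of x] by linarith
      then show "\<bar>w x * (g x \<bullet> i)\<bar> \<le> B * N" using w(2)[of x] by (auto simp: abs_mult intro!: mult_mono)
      show "a < \<bar>x\<bar> \<Longrightarrow> w x * (g x \<bullet> i) = 0" using w(3)[of x] by auto
    qed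
    have "(LINT x|lborel. w x * (g x \<bullet> y x)) = (LINT x|lborel. (\<Sum>i\<in>Basis. ((w x * (g x \<bullet> i)) *\<^sub>R y x) \<bullet> i))"
      by (rule Bochner_Integration.integral_cong[OF refl]) (subst euclidean_inner, simp add: sum_distrib_left mult_ac)
    also have "\<dots> = (\<Sum>i\<in>Basis. (LINT x|lborel. ((w x * (g x \<bullet> i)) *\<^sub>R y x) \<bullet> i))"
      by (rule Bochner_Integration.integral_sum) (rule integrable_inner_left, rule int)
    also have "\<dots> = (\<Sum>i\<in>Basis. (LINT x|lborel. (w x * (g x \<bullet> i)) *\<^sub>R y x) \<bullet> i)"
      by (rule sum.cong[OF refl], rule integral_inner_left) (rule int)
    finally show ?thesis .
  qed
  have "(\<lambda>k. \<Sum>i\<in>Basis. (LINT x|lborel. (w x * (g x \<bullet> i)) *\<^sub>R z k x) \<bullet> i) \<longlonglongrightarrow> (\<Sum>i\<in>Basis. (LINT x|lborel. (w x * (g x \<bullet> i)) *\<^sub>R zl x) \<bullet> i)"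
    using W comp unfolding weakly_tendsto_def by (intro tendsto_intros) blast
  moreover have "\<And>k. locally_integrable_R (z k)" "locally_integrable_R zl" using W by (auto simp: weakly_tendsto_def)
  ultimately show ?thesis by (simp only: rep)
qed

text \<open>The square \<open>\<bar>z\<bar>\<close>-norm is the supremum over \<open>g\<close> of
  \<open>2 * (g \<bullet> z) - (norm g)\<^sup>2\<close>, which is affine in \<open>z\<close> and so
  passes to the weak limit for each bounded continuous \<open>g\<close>. Afterwards \<open>g\<close>
  is driven to a truncation of \<open>zl\<close>, and the truncation is removed by monotone
  convergence.\<close>

lemma weakly_tendsto_lower_semicontinuous:
  fixes z :: "nat \<Rightarrow> real \<Rightarrow> 'a::euclidean_space"
  assumes W: "weakly_tendsto z zl" and w: "continuous_on UNIV w" "\<And>x. 0 \<le> w x" "\<And>x. w x \<le> B" "\<And>x. a < \<bar>x\<bar> \<Longrightarrow> w x = 0"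
    and bound: "\<And>k. (\<integral>\<^sup>+ x. ennreal (w x * (norm (z k x))\<^sup>2) \<partial>lborel) \<le> ennreal (c k)"
    and c: "\<And>k. 0 \<le> c k" "c \<longlonglongrightarrow> cl"
  shows "(\<integral>\<^sup>+ x. ennreal (w x * (norm (zl x))\<^sup>2) \<partial>lborel) \<le> ennreal cl"
proof -
  have li: "locally_integrable_R (z k)" "locally_integrable_R zl" for k using W by (auto simp: weakly_tendsto_def)
  have [measurable]: "z k \<in> borel_measurable borel" "zl \<in> borel_measurable borel" for k
    using li locally_integrable_R_measurable by blast+
  have wm[measurable]: "w \<in> borel_measurable borel" using w(1) by (rule borel_measurable_continuous_onI)
  have wabs: "\<bar>w x\<bar> \<le> B" for x using w(2,3)[of x] by simp
  have B0: "0 \<le> B" using wabs[of 0] by simp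
  have int_sq: "integrable lborel (\<lambda>x. w x * (norm (g x))\<^sup>2)" if "g \<in> borel_measurable borel" "\<And>x. norm (g x) \<le> N" for g :: "real \<Rightarrow> 'a" and N
  proof (rule integrableI_bounded_set[where A="{-a..a}" and B="B * N\<^sup>2"])
    show "AE x in lborel. x \<in> {-a..a} \<longrightarrow> norm (w x * (norm (g x))\<^sup>2) \<le> B * N\<^sup>2"
      using that(2) wabs B0 by (auto simp: abs_mult intro!: AE_I2 mult_mono power_mono)
    show "AE x in lborel. x \<notin> {-a..a} \<longrightarrow> w x * (norm (g x))\<^sup>2 = 0"
      by (intro AE_I2 impI) (simp only: not_in_symmetric_interval w(4) mult_zero_left)
  qed (use that in \<open>auto simp: emeasure_lborel_Icc_eq\<close>)
  have step1: "(LINT x|lborel. w x * (2 * (g x \<bullet> zl x)) - w x * (norm (g x))\<^sup>2) \<le> cl"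
    if g: "continuous_on UNIV g" "\<And>x. norm (g x) \<le> N" for g :: "real \<Rightarrow> 'a" and N
  proof (rule LIMSEQ_le)
    have gm: "g \<in> borel_measurable borel" using g(1) by (rule borel_measurable_continuous_onI)
    have e: "(LINT x|lborel. w x * (2 * (g x \<bullet> y x)) - w x * (norm (g x))\<^sup>2) = 2 * (LINT x|lborel. w x * (g x \<bullet> y x)) - (LINT x|lborel. w x * (norm (g x))\<^sup>2)"
      if y: "locally_integrable_R y" for y
      using integrable_cutoff_inner[OF y w(1) wabs w(4) gm g(2)] int_sq[OF gm g(2)]
      by (subst Bochner_Integration.integral_diff) (auto simp: mult.left_commute[of _ 2])
    show "(\<lambda>k. LINT x|lborel. w x * (2 * (g x \<bullet> z k x)) - w x * (norm (g x))\<^sup>2) \<longlonglongrightarrow>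
      (LINT x|lborel. w x * (2 * (g x \<bullet> zl x)) - w x * (norm (g x))\<^sup>2)"
      unfolding e[OF li(1)] e[OF li(2)] by (intro tendsto_intros weakly_tendsto_inner[OF W w(1) wabs w(4) g])
    show "\<exists>K. \<forall>k\<ge>K. (LINT x|lborel. w x * (2 * (g x \<bullet> z k x)) - w x * (norm (g x))\<^sup>2) \<le> c k"
    proof (intro exI[of _ 0] allI impI)
      fix k
      have i: "integrable lborel (\<lambda>x. w x * (norm (z k x))\<^sup>2)"
        using bound[of k] w(2) by (intro integrableI_nonneg) (auto intro: le_less_trans)
      have "(LINT x|lborel. w x * (2 * (g x \<bullet> z k x)) - w x * (norm (g x))\<^sup>2) \<le> (LINT x|lborel. w x * (norm (z k x))\<^sup>2)"
      proof (rule integral_mono)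
        show "integrable lborel (\<lambda>x. w x * (2 * (g x \<bullet> z k x)) - w x * (norm (g x))\<^sup>2)"
          using integrable_cutoff_inner[OF li(1) w(1) wabs w(4) gm g(2)] int_sq[OF gm g(2)]
          by (intro Bochner_Integration.integrable_diff) (auto simp: mult.left_commute[of _ 2])
        fix x
        have "0 \<le> w x * (norm (g x - z k x))\<^sup>2" using w(2) by simp
        then show "w x * (2 * (g x \<bullet> z k x)) - w x * (norm (g x))\<^sup>2 \<le> w x * (norm (z k x))\<^sup>2"
          by (simp add: power2_norm_eq_inner inner_diff inner_commute algebra_simps)
      qed (rule i)
      also have "\<dots> \<le> c k"
        using bound[of k] w(2) c(1)[of k] nn_integral_eq_integral[OF i] by (simp add: ennreal_le_iff)
      finally show "(LINT x|lborel. w x * (2 * (g x \<bullet> z k x)) - w x * (norm (g x))\<^sup>2) \<le> c k" .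
    qed
  qed (rule c(2))
  \<comment> \<open>\<open>zl\<close> need not be bounded, whereas continuous approximation and
    dominated convergence ask for a bounded target.\<close>
  define M where "M n x = (if norm (zl x) \<le> real n then zl x else 0)" for n x
  have M[measurable]: "M n \<in> borel_measurable borel" and MN: "norm (M n x) \<le> real n" for n x
    unfolding M_def[abs_def] by (auto simp: M_def)
  have step2: "(\<integral>\<^sup>+ x. ennreal (w x * (norm (M n x))\<^sup>2) \<partial>lborel) \<le> ennreal cl" for n
  proof -
    obtain g where g: "\<And>j. continuous_on UNIV (g j)" "\<And>j x. norm (g j x) \<le> real n" "AE x in lborel. (\<lambda>j. g j x) \<longlonglongrightarrow> M n x"
      using AE_limit_of_bounded_continuous[OF M MN] by metis
    have gm[measurable]: "g j \<in> borel_measurable borel" for j using g(1) by (rule borel_measurable_continuous_onI)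
    have lim: "(\<lambda>j. LINT x|lborel. w x * (2 * (g j x \<bullet> zl x)) - w x * (norm (g j x))\<^sup>2) \<longlonglongrightarrow>
       (LINT x|lborel. w x * (2 * (M n x \<bullet> zl x)) - w x * (norm (M n x))\<^sup>2)"
    proof (rule integral_dominated_convergence[where w="\<lambda>x. 2 * real n * norm (w x *\<^sub>R zl x) + (real n)\<^sup>2 * w x"])
      have "integrable lborel w"
        by (rule integrableI_bounded_set[where A="{-a..a}" and B=B])
           (use wabs in \<open>auto simp: emeasure_lborel_Icc_eq simp del: atLeastAtMost_iff simp: not_in_symmetric_interval w(4)\<close>)
      then show "integrable lborel (\<lambda>x. 2 * real n * norm (w x *\<^sub>R zl x) + (real n)\<^sup>2 * w x)"
        by (intro Bochner_Integration.integrable_add integrable_mult_right integrable_norm integrable_test_times_local_R[OF li(2) wm wabs w(4)])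
      show "AE x in lborel. (\<lambda>j. w x * (2 * (g j x \<bullet> zl x)) - w x * (norm (g j x))\<^sup>2) \<longlonglongrightarrow> w x * (2 * (M n x \<bullet> zl x)) - w x * (norm (M n x))\<^sup>2"
        using g(3) by eventually_elim (intro tendsto_intros)
      fix j
      show "AE x in lborel. norm (w x * (2 * (g j x \<bullet> zl x)) - w x * (norm (g j x))\<^sup>2) \<le> 2 * real n * norm (w x *\<^sub>R zl x) + (real n)\<^sup>2 * w x"
      proof (rule AE_I2)
        fix x
        have "\<bar>g j x \<bullet> zl x\<bar> \<le> real n * norm (zl x)"
          using Cauchy_Schwarz_ineq2[of "g j x" "zl x"] mult_right_mono[OF g(2)[of j x] norm_ge_zero[of "zl x"]] by linarith
        moreover have "(norm (g j x))\<^sup>2 \<le> (real n)\<^sup>2" using g(2)[of j x] by (intro power_mono) auto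
        ultimately have "\<bar>2 * (g j x \<bullet> zl x) - (norm (g j x))\<^sup>2\<bar> \<le> 2 * real n * norm (zl x) + (real n)\<^sup>2" using zero_le_power2[of "norm (g j x)"] by linarith
        then have "w x * \<bar>2 * (g j x \<bullet> zl x) - (norm (g j x))\<^sup>2\<bar> \<le> w x * (2 * real n * norm (zl x) + (real n)\<^sup>2)"
          using w(2) by (intro mult_left_mono) auto
        moreover have "norm (w x * (2 * (g j x \<bullet> zl x)) - w x * (norm (g j x))\<^sup>2) = w x * \<bar>2 * (g j x \<bullet> zl x) - (norm (g j x))\<^sup>2\<bar>"
          using w(2)[of x] by (simp add: right_diff_distrib[symmetric] abs_mult)
        ultimately show "norm (w x * (2 * (g j x \<bullet> zl x)) - w x * (norm (g j x))\<^sup>2) \<le> 2 * real n * norm (w x *\<^sub>R zl x) + (real n)\<^sup>2 * w x"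
          using w(2)[of x] by (simp add: algebra_simps)
      qed
    qed measurable
    \<comment> \<open>Each value of \<open>M n\<close> is either that of \<open>zl\<close> or 0, and
      in both cases \<open>2 * (M \<bullet> zl)\<close> minus the squared norm of \<open>M\<close>
      equals that squared norm.\<close>
    have "(LINT x|lborel. w x * (norm (M n x))\<^sup>2) = (LINT x|lborel. w x * (2 * (M n x \<bullet> zl x)) - w x * (norm (M n x))\<^sup>2)"
      by (rule Bochner_Integration.integral_cong) (auto simp: M_def power2_norm_eq_inner)
    also have "\<dots> \<le> cl" by (rule LIMSEQ_le_const2[OF lim]) (use step1[OF g(1,2)] in auto)
    finally show ?thesis
      using nn_integral_eq_integral[OF int_sq[OF M MN]] w(2) by (simp add: ennreal_leI)
  qed
  have "(\<integral>\<^sup>+ x. ennreal (w x * (norm (zl x))\<^sup>2) \<partial>lborel) = (\<integral>\<^sup>+ x. (SUP n. ennreal (w x * (norm (M n x))\<^sup>2)) \<partial>lborel)"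
  proof (rule nn_integral_cong)
    fix x
    obtain n0 :: nat where n0: "norm (zl x) \<le> real n0" using real_arch_simple by blast
    show "ennreal (w x * (norm (zl x))\<^sup>2) = (SUP n. ennreal (w x * (norm (M n x))\<^sup>2))"
    proof (rule antisym)
      show "ennreal (w x * (norm (zl x))\<^sup>2) \<le> (SUP n. ennreal (w x * (norm (M n x))\<^sup>2))"
        by (rule SUP_upper2[of n0]) (use n0 in \<open>auto simp: M_def\<close>)
      show "(SUP n. ennreal (w x * (norm (M n x))\<^sup>2)) \<le> ennreal (w x * (norm (zl x))\<^sup>2)"
        by (rule SUP_least) (use w(2) in \<open>auto simp: M_def intro!: ennreal_leI\<close>)
    qed
  qed
  also have "\<dots> = (SUP n. \<integral>\<^sup>+ x. ennreal (w x * (norm (M n x))\<^sup>2) \<partial>lborel)"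
    by (rule nn_integral_monotone_convergence_SUP)
       (use w(2) in \<open>auto simp: incseq_def le_fun_def M_def intro!: ennreal_leI\<close>)
  also have "\<dots> \<le> ennreal cl" by (rule SUP_least) (rule step2)
  finally show ?thesis .
qed


text \<open>Let \<open>p\<close> be the projection onto \<open>C\<close>. The half-space inequality
  \<open>(g - p g) \<bullet> (z - p g) \<le> 0\<close> is affine in \<open>z\<close> and therefore
  survives the weak limit for continuous \<open>g\<close>. Letting \<open>g\<close> tend to
  \<open>zl\<close> itself makes the left side the squared distance of \<open>zl\<close> to
  \<open>C\<close>, which must then vanish.\<close>

lemma weakly_tendsto_in_convex:
  fixes z :: "nat \<Rightarrow> real \<Rightarrow> 'a::euclidean_space"
  assumes W: "weakly_tendsto z zl" and C: "convex C" "compact C" and zC: "\<And>k. AE x in lborel. z k x \<in> C"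
  shows "AE x in lborel. zl x \<in> C"
proof -
  have li: "locally_integrable_R (z k)" "locally_integrable_R zl" for k using W by (auto simp: weakly_tendsto_def)
  have zm[measurable]: "z k \<in> borel_measurable borel" "zl \<in> borel_measurable borel" for k
    using li locally_integrable_R_measurable by auto
  have "C \<noteq> {}"
  proof
    assume "C = {}"
    then have "AE x in (lborel :: real measure). False" using zC[of 0] by simp
    then show False by (simp add: eventually_False ae_filter_eq_bot_iff)
  qed
  then obtain c0 where c0: "c0 \<in> C" by blast
  have cl: "closed C" using C(2) by (rule compact_imp_closed)
  obtain R where R: "\<And>c. c \<in> C \<Longrightarrow> norm c \<le> R" using compact_imp_bounded[OF C(2)] by (auto simp: bounded_iff)
  have R0: "0 \<le> R" using R[OF c0] norm_ge_zero[of c0] by linarith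
  define p where "p = closest_point C"
  have pC: "p y \<in> C" for y unfolding p_def using cl \<open>C \<noteq> {}\<close> by (rule closest_point_in_set)
  have pc: "continuous_on UNIV p" unfolding p_def by (rule continuous_on_closest_point[OF C(1) cl \<open>C \<noteq> {}\<close>])
  have "AE x in lborel. \<bar>x\<bar> < real n + 1 \<and> norm (zl x) \<le> real n \<longrightarrow> zl x \<in> C" for n :: nat
  proof -
    define w where "w x = max 0 (1 - \<bar>x\<bar> / (real n + 1))" for x :: real
    have w: "continuous_on UNIV w" "\<And>x. 0 \<le> w x" "\<And>x. \<bar>w x\<bar> \<le> 1" "\<And>x. real n + 1 < \<bar>x\<bar> \<Longrightarrow> w x = 0"
      unfolding w_def by (auto intro!: continuous_intros simp: field_simps)
    have wm[measurable]: "w \<in> borel_measurable borel" using w(1) by (rule borel_measurable_continuous_onI)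
    \<comment> \<open>The default is a point of \<open>C\<close>, so that \<open>M - p M\<close>
      vanishes where \<open>zl\<close> is too large and the squared distance is produced only where
      \<open>M\<close> equals \<open>zl\<close>.\<close>
    define M where "M x = (if norm (zl x) \<le> real n then zl x else c0)" for x
    define N where "N = max (real n) R"
    have M[measurable]: "M \<in> borel_measurable borel" and MN: "norm (M x) \<le> N" for x
      unfolding M_def[abs_def] N_def using R[OF c0] by (auto simp: M_def)
    obtain g where g: "\<And>j. continuous_on UNIV (g j)" "\<And>j x. norm (g j x) \<le> N" "AE x in lborel. (\<lambda>j. g j x) \<longlonglongrightarrow> M x"
      using AE_limit_of_bounded_continuous[OF M MN] by metis
    \<comment> \<open>An outward normal of \<open>C\<close> at the projection of
      \<open>g j x\<close>, the direction in which the half-space inequality is tested.\<close>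
    define a where "a j x = g j x - p (g j x)" for j x
    have pgc: "continuous_on UNIV (\<lambda>x. p (g j x))" for j by (rule continuous_on_compose2[OF pc g(1)]) auto
    have ac: "continuous_on UNIV (a j)" for j unfolding a_def by (intro continuous_intros g(1) pgc)
    have pN: "norm (p y) \<le> R" for y using R[OF pC] .
    have aN: "norm (a j x) \<le> N + R" for j x
      using norm_triangle_ineq4[of "g j x" "p (g j x)"] g(2)[of j x] pN[of "g j x"] by (simp add: a_def)
    have NR0: "0 \<le> N + R" using R0 by (simp add: N_def)
    have [measurable]: "g j \<in> borel_measurable borel" "a j \<in> borel_measurable borel" "(\<lambda>x. p (g j x)) \<in> borel_measurable borel" "p \<in> borel_measurable borel" for j
      using g(1) ac pgc pc by (auto intro: borel_measurable_continuous_onI)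
    have il: "integrable lborel (\<lambda>x. w x * (a j x \<bullet> y x))" if "locally_integrable_R y" for j y
      by (rule integrable_cutoff_inner[OF that w(1,3,4) _ aN]) measurable
    have ip: "integrable lborel (\<lambda>x. w x * (a j x \<bullet> p (g j x)))" for j
    proof (rule integrableI_bounded_set[where A="{-(real n + 1)..real n + 1}" and B="(N + R) * R"])
      show "AE x in lborel. x \<in> {-(real n + 1)..real n + 1} \<longrightarrow> norm (w x * (a j x \<bullet> p (g j x))) \<le> (N + R) * R"
      proof (intro AE_I2 impI)
        fix x
        have "\<bar>a j x \<bullet> p (g j x)\<bar> \<le> (N + R) * R"
          using Cauchy_Schwarz_ineq2[of "a j x" "p (g j x)"] mult_mono[OF aN[of j x] pN[of "g j x"] NR0 norm_ge_zero] by linarith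
        then show "norm (w x * (a j x \<bullet> p (g j x))) \<le> (N + R) * R"
          using w(3)[of x] mult_mono[of "\<bar>w x\<bar>" 1 "\<bar>a j x \<bullet> p (g j x)\<bar>" "(N + R) * R"] by (simp add: abs_mult)
      qed
      show "AE x in lborel. x \<notin> {-(real n + 1)..real n + 1} \<longrightarrow> w x * (a j x \<bullet> p (g j x)) = 0"
        by (intro AE_I2 impI) (simp only: not_in_symmetric_interval w(4) mult_zero_left)
    qed (auto simp: emeasure_lborel_Icc_eq)
    have le0: "(LINT x|lborel. w x * (a j x \<bullet> zl x) - w x * (a j x \<bullet> p (g j x))) \<le> 0" for j
    proof -
      have "(LINT x|lborel. w x * (a j x \<bullet> zl x)) \<le> (LINT x|lborel. w x * (a j x \<bullet> p (g j x)))"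
      proof (rule LIMSEQ_le_const2)
        show "(\<lambda>k. LINT x|lborel. w x * (a j x \<bullet> z k x)) \<longlonglongrightarrow> (LINT x|lborel. w x * (a j x \<bullet> zl x))"
          by (rule weakly_tendsto_inner[OF W w(1,3,4) ac aN])
        have "(LINT x|lborel. w x * (a j x \<bullet> z k x)) \<le> (LINT x|lborel. w x * (a j x \<bullet> p (g j x)))" for k
        proof (rule integral_mono_AE[OF il[OF li(1)] ip])
          show "AE x in lborel. w x * (a j x \<bullet> z k x) \<le> w x * (a j x \<bullet> p (g j x))"
            using zC[of k]
          proof eventually_elim
            case (elim x)
            have "(g j x - closest_point C (g j x)) \<bullet> (z k x - closest_point C (g j x)) \<le> 0"
              by (rule closest_point_dot[OF C(1) cl elim])
            then show ?case using w(2)[of x] by (intro mult_left_mono) (auto simp: a_def p_def inner_diff_right)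
          qed
        qed
        then show "\<exists>N. \<forall>k\<ge>N. (LINT x|lborel. w x * (a j x \<bullet> z k x)) \<le> (LINT x|lborel. w x * (a j x \<bullet> p (g j x)))" by blast
      qed
      then show ?thesis using il[OF li(2)] ip by simp
    qed
    define G where "G x = w x * (norm (M x - p (M x)))\<^sup>2" for x
    have Geq: "G x = w x * ((M x - p (M x)) \<bullet> zl x) - w x * ((M x - p (M x)) \<bullet> p (M x))" for x
    proof (cases "norm (zl x) \<le> real n")
      case True
      then show ?thesis by (simp add: G_def M_def power2_norm_eq_inner inner_diff_right right_diff_distrib)
    next
      case False
      then have "M x - p (M x) = 0" using c0 by (simp add: M_def p_def closest_point_self)
      then show ?thesis by (simp add: G_def)
    qed
    have "(\<lambda>j. LINT x|lborel. w x * (a j x \<bullet> zl x) - w x * (a j x \<bullet> p (g j x))) \<longlonglongrightarrow> (LINT x|lborel. G x)"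
    proof (rule integral_dominated_convergence[where w="\<lambda>x. (N + R) * norm (w x *\<^sub>R zl x) + (N + R) * R * w x"])
      have "integrable lborel w"
      proof (rule integrableI_bounded_set[where A="{-(real n + 1)..real n + 1}" and B=1])
        show "AE x in lborel. x \<notin> {-(real n + 1)..real n + 1} \<longrightarrow> w x = 0"
          by (intro AE_I2 impI) (simp only: not_in_symmetric_interval w(4))
      qed (use w(3) in \<open>auto simp: emeasure_lborel_Icc_eq\<close>)
      then show "integrable lborel (\<lambda>x. (N + R) * norm (w x *\<^sub>R zl x) + (N + R) * R * w x)"
        by (intro Bochner_Integration.integrable_add integrable_mult_right integrable_norm integrable_test_times_local_R[OF li(2) wm w(3,4)])
      show "AE x in lborel. (\<lambda>j. w x * (a j x \<bullet> zl x) - w x * (a j x \<bullet> p (g j x))) \<longlonglongrightarrow> G x"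
        using g(3)
      proof eventually_elim
        case (elim x)
        have "(\<lambda>j. p (g j x)) \<longlonglongrightarrow> p (M x)" by (rule continuous_on_tendsto_compose[OF pc elim]) auto
        then show ?case unfolding Geq a_def by (intro tendsto_intros elim)
      qed
      fix j
      show "AE x in lborel. norm (w x * (a j x \<bullet> zl x) - w x * (a j x \<bullet> p (g j x))) \<le> (N + R) * norm (w x *\<^sub>R zl x) + (N + R) * R * w x"
      proof (rule AE_I2)
        fix x
        have 1: "\<bar>a j x \<bullet> zl x\<bar> \<le> (N + R) * norm (zl x)"
          using Cauchy_Schwarz_ineq2[of "a j x" "zl x"] mult_right_mono[OF aN[of j x] norm_ge_zero[of "zl x"]] by linarith
        have 2: "\<bar>a j x \<bullet> p (g j x)\<bar> \<le> (N + R) * R"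
          using Cauchy_Schwarz_ineq2[of "a j x" "p (g j x)"] mult_mono[OF aN[of j x] pN[of "g j x"] NR0 norm_ge_zero] by linarith
        have "norm (w x * (a j x \<bullet> zl x) - w x * (a j x \<bullet> p (g j x))) \<le> w x * \<bar>a j x \<bullet> zl x\<bar> + w x * \<bar>a j x \<bullet> p (g j x)\<bar>"
          using abs_triangle_ineq4[of "w x * (a j x \<bullet> zl x)" "w x * (a j x \<bullet> p (g j x))"] w(2)[of x] by (simp add: abs_mult)
        also have "\<dots> \<le> w x * ((N + R) * norm (zl x)) + w x * ((N + R) * R)"
          using 1 2 w(2)[of x] by (intro add_mono mult_left_mono)
        finally show "norm (w x * (a j x \<bullet> zl x) - w x * (a j x \<bullet> p (g j x))) \<le> (N + R) * norm (w x *\<^sub>R zl x) + (N + R) * R * w x"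
          using w(2)[of x] by (simp add: mult_ac)
      qed
    qed (unfold G_def, measurable)
    then have "(LINT x|lborel. G x) \<le> 0" by (rule LIMSEQ_le_const2) (use le0 in auto)
    moreover have Gi: "integrable lborel G"
    proof (rule integrableI_bounded_set[where A="{-(real n + 1)..real n + 1}" and B="(N + R)\<^sup>2"])
      have "norm (M x - p (M x)) \<le> N + R" for x using norm_triangle_ineq4[of "M x" "p (M x)"] MN[of x] pN[of "M x"] by simp
      then have "G x \<le> 1 * (N + R)\<^sup>2" for x unfolding G_def using w(3)[of x] by (intro mult_mono power_mono) auto
      then show "AE x in lborel. x \<in> {-(real n + 1)..real n + 1} \<longrightarrow> norm (G x) \<le> (N + R)\<^sup>2" using w(2) by (auto simp: G_def)
      show "AE x in lborel. x \<notin> {-(real n + 1)..real n + 1} \<longrightarrow> G x = 0"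
        by (intro AE_I2 impI) (simp only: not_in_symmetric_interval w(4) G_def mult_zero_left)
      show "G \<in> borel_measurable lborel" unfolding G_def by measurable
    qed (auto simp: emeasure_lborel_Icc_eq)
    moreover have G0: "AE x in lborel. 0 \<le> G x" using w(2) by (auto simp: G_def)
    ultimately have "AE x in lborel. G x = 0"
      using integral_nonneg_eq_0_iff_AE[OF Gi G0] integral_nonneg_AE[OF G0] by linarith
    then show ?thesis
    proof eventually_elim
      case (elim x)
      show ?case
      proof
        assume x: "\<bar>x\<bar> < real n + 1 \<and> norm (zl x) \<le> real n"
        then have "w x > 0" by (auto simp: w_def)
        then have "M x = p (M x)" using elim by (simp add: G_def)
        then show "zl x \<in> C" using x pC[of "zl x"] by (simp add: M_def)
      qed
    qed
  qed
  then have "AE x in lborel. \<forall>n::nat. \<bar>x\<bar> < real n + 1 \<and> norm (zl x) \<le> real n \<longrightarrow> zl x \<in> C" by (subst AE_all_countable) auto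
  then show ?thesis
  proof eventually_elim
    case (elim x)
    obtain n :: nat where "max \<bar>x\<bar> (norm (zl x)) \<le> real n" using real_arch_simple by blast
    then show ?case using elim[rule_format, of n] by auto
  qed
qed

text \<open>Indicators of closed intervals are decreasing limits of Lipschitz tents, so by dominated
  convergence the interval integrals of \<open>z\<close> vanish. This is how identities obtained
  from Lipschitz test functions become pointwise ones.\<close>

lemma AE_eq_0_of_Lipschitz_tests:
  fixes z :: "real \<Rightarrow> 'a::euclidean_space"
  assumes z: "locally_integrable_R z"
    and test: "\<And>\<psi> L a. L-lipschitz_on UNIV \<psi> \<Longrightarrow> (\<And>x. 0 \<le> \<psi> x \<and> \<psi> x \<le> (1::real)) \<Longrightarrow> (\<And>x. a \<le> \<bar>x\<bar> \<Longrightarrow> \<psi> x = 0) \<Longrightarrow> (LINT x|lborel. \<psi> x *\<^sub>R z x) = 0"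
  shows "AE x in lborel. z x = 0"
proof (rule AE_eq_0_if_interval_integrals_eq_0)
  show "set_integrable lborel {a..b} z" for a b using z by (simp add: locally_integrable_R_def)
  fix a b :: real assume ab: "a \<le> b"
  define r where "r = max \<bar>a\<bar> \<bar>b\<bar> + 1"
  \<comment> \<open>The slope \<open>Suc j\<close> is at least 1 already for \<open>j = 0\<close>,
    so one and the same radius \<open>r\<close> contains the supports of all these tents.\<close>
  define \<psi> where "\<psi> j x = max 0 (1 - real (Suc j) * infdist x {a..b})" for j x
  have inf_far: "infdist x {a..b} \<ge> 1" if "r \<le> \<bar>x\<bar>" for x
    unfolding infdist_def using ab that by (auto simp: r_def dist_real_def intro!: cINF_greatest)
  have lip: "(real (Suc j))-lipschitz_on UNIV (\<psi> j)" for j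
  proof (rule lipschitz_onI)
    fix x y
    have "\<bar>infdist x {a..b} - infdist y {a..b}\<bar> \<le> dist x y" by (rule infdist_triangle_abs)
    then have "real (Suc j) * \<bar>infdist x {a..b} - infdist y {a..b}\<bar> \<le> real (Suc j) * dist x y" by (intro mult_left_mono) auto
    moreover have "\<bar>real (Suc j) * infdist x {a..b} - real (Suc j) * infdist y {a..b}\<bar> = real (Suc j) * \<bar>infdist x {a..b} - infdist y {a..b}\<bar>"
      by (simp only: right_diff_distrib[symmetric] abs_mult abs_of_nat)
    ultimately show "dist (\<psi> j x) (\<psi> j y) \<le> real (Suc j) * dist x y"
      unfolding \<psi>_def dist_real_def by linarith
  qed simp
  have b: "0 \<le> \<psi> j x \<and> \<psi> j x \<le> 1" for j x using infdist_nonneg[of x "{a..b}"] by (auto simp: \<psi>_def mult_nonneg_nonneg)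
  have s: "\<psi> j x = 0" if "r \<le> \<bar>x\<bar>" for j x
  proof -
    have "1 * 1 \<le> real (Suc j) * infdist x {a..b}" using inf_far[OF that] by (intro mult_mono) auto
    then show ?thesis by (simp add: \<psi>_def)
  qed
  have zm[measurable]: "z \<in> borel_measurable borel" using z by (rule locally_integrable_R_measurable)
  have \<psi>m[measurable]: "\<psi> j \<in> borel_measurable borel" for j
    using lipschitz_on_continuous_on[OF lip] by (rule borel_measurable_continuous_onI)
  have "(\<lambda>j. LINT x|lborel. \<psi> j x *\<^sub>R z x) \<longlonglongrightarrow> (LINT x|lborel. indicator {a..b} x *\<^sub>R z x)"
  proof (rule integral_dominated_convergence[where w="\<lambda>x. norm (indicator {-r..r} x *\<^sub>R z x)"])
    show "integrable lborel (\<lambda>x. norm (indicat_real {-r..r} x *\<^sub>R z x))"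
      using z by (intro integrable_norm) (simp add: locally_integrable_R_def set_integrable_def)
    show "AE x in lborel. (\<lambda>j. \<psi> j x *\<^sub>R z x) \<longlonglongrightarrow> indicator {a..b} x *\<^sub>R z x"
    proof (rule AE_I2)
      fix x
      have "(\<lambda>j. \<psi> j x) \<longlonglongrightarrow> indicator {a..b} x"
      proof (cases "x \<in> {a..b}")
        case True
        then show ?thesis by (simp add: \<psi>_def)
      next
        case False
        then have pos: "0 < infdist x {a..b}" using ab by (intro infdist_pos_not_in_closed) auto
        obtain n :: nat where n: "1 / infdist x {a..b} < real n" using reals_Archimedean2 by blast
        have "eventually (\<lambda>j. \<psi> j x = 0) sequentially"
          using eventually_ge_at_top[of n]
        proof eventually_elim
          case (elim j)
          have "1 / infdist x {a..b} < real (Suc j)" using n elim by linarith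
          then show ?case using pos by (simp add: \<psi>_def field_simps)
        qed
        then show ?thesis using False by (intro tendsto_eventually) auto
      qed
      then show "(\<lambda>j. \<psi> j x *\<^sub>R z x) \<longlonglongrightarrow> indicator {a..b} x *\<^sub>R z x" by (intro tendsto_intros)
    qed
    fix j
    show "AE x in lborel. norm (\<psi> j x *\<^sub>R z x) \<le> norm (indicat_real {-r..r} x *\<^sub>R z x)"
    proof (rule AE_I2)
      fix x
      show "norm (\<psi> j x *\<^sub>R z x) \<le> norm (indicat_real {-r..r} x *\<^sub>R z x)"
      proof (cases "x \<in> {-r..r}")
        case True
        then show ?thesis using b[of j x] by (simp add: mult_left_le_one_le)
      next
        case False
        then have "r < \<bar>x\<bar>" by (simp only: not_in_symmetric_interval)
        then show ?thesis using s[of x j] by simp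
      qed
    qed
  qed measurable
  moreover have "(LINT x|lborel. \<psi> j x *\<^sub>R z x) = 0" for j by (rule test[OF lip b s])
  ultimately show "(LINT t:{a..b}|lborel. z t) = 0"
    by (simp add: set_lebesgue_integral_def LIMSEQ_const_iff)
qed

section \<open>The relative entropy inequality\<close>

lemma has_vector_derivative_chain:
  assumes "(v has_vector_derivative d) (at t)" "(a has_derivative a') (at (v t))"
  shows "((\<lambda>s. a (v s)) has_vector_derivative a' d) (at t)"
  using vector_derivative_diff_chain_within[of v d t UNIV a a'] assms
  by (simp add: has_derivative_at_withinI o_def)

text \<open>Because \<open>b < T\<close>, the factor \<open>h\<close> lives on a compact rectangle
  inside \<open>{0..<T} \<times> UNIV\<close>, where \<open>g\<close> is integrable; the bound on
  \<open>h\<close> does the rest.\<close>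

lemma integrable_test_times_local:
  fixes g :: "real \<Rightarrow> real \<Rightarrow> 'a::euclidean_space"
  assumes g: "locally_integrable T g" and h: "(\<lambda>(t, x). h t x) \<in> borel_measurable borel"
    and hB: "AE (t, x) in time_strip T. \<bar>h t x\<bar> \<le> B"
    and h0: "\<And>t x. 0 < t \<Longrightarrow> b < t \<or> \<rho> < \<bar>x\<bar> \<Longrightarrow> h t x = 0" and b: "0 \<le> b" "b < T"
  shows "integrable (time_strip T) (\<lambda>(t, x). h t x *\<^sub>R g t x)"
proof -
  define K where "K = {0..b} \<times> {-\<rho>..\<rho>}"
  have K: "compact K" "K \<subseteq> {0..<T} \<times> UNIV" using b by (auto simp: K_def intro!: compact_Times)
  have "integrable lborel (\<lambda>z. indicator K z *\<^sub>R (case z of (t, x) \<Rightarrow> g t x))"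
    using g K unfolding locally_integrable_def set_integrable_def by blast
  then have gi: "integrable (time_strip T) (\<lambda>z. indicator K z *\<^sub>R (case z of (t, x) \<Rightarrow> g t x))"
    unfolding integrable_time_strip_iff
    by (rule integrable_mult_indicator[rotated]) (simp add: strip_sets)
  have eq: "(case z of (t, x) \<Rightarrow> h t x *\<^sub>R g t x) = (case z of (t, x) \<Rightarrow> h t x) *\<^sub>R (indicator K z *\<^sub>R (case z of (t, x) \<Rightarrow> g t x))"
    if "z \<in> space (time_strip T)" for z
  proof (cases z)
    case (Pair t x)
    show ?thesis
    proof (cases "z \<in> K")
      case False
      then have "b < t \<or> \<rho> < \<bar>x\<bar>" using that Pair by (auto simp: K_def space_time_strip)
      then show ?thesis using h0[of t x] that Pair by (simp add: space_time_strip)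
    qed (simp add: Pair)
  qed
  have "integrable (time_strip T) (\<lambda>z. (case z of (t, x) \<Rightarrow> h t x) *\<^sub>R (indicator K z *\<^sub>R (case z of (t, x) \<Rightarrow> g t x)))"
  proof (rule Bochner_Integration.integrable_bound)
    show "integrable (time_strip T) (\<lambda>z. B *\<^sub>R (indicator K z *\<^sub>R (case z of (t, x) \<Rightarrow> g t x)))"
      by (rule integrable_scaleR_right) (rule gi)
    show "(\<lambda>z. (case z of (t, x) \<Rightarrow> h t x) *\<^sub>R (indicator K z *\<^sub>R (case z of (t, x) \<Rightarrow> g t x))) \<in> borel_measurable (time_strip T)"
      using borel_measurable_integrable[OF gi] measurable_time_strip[OF h] by (rule borel_measurable_scaleR[rotated])
    show "AE z in time_strip T. norm ((case z of (t, x) \<Rightarrow> h t x) *\<^sub>R (indicator K z *\<^sub>R (case z of (t, x) \<Rightarrow> g t x)))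
        \<le> norm (B *\<^sub>R (indicator K z *\<^sub>R (case z of (t, x) \<Rightarrow> g t x)))"
      using hB
    proof eventually_elim
      case (elim z)
      obtain t x where z: "z = (t, x)" by (cases z)
      have "\<bar>h t x\<bar> \<le> \<bar>B\<bar>" using elim z by simp
      then show ?case by (simp add: z abs_mult mult_right_mono)
    qed
  qed
  then show ?thesis
    by (rule Bochner_Integration.integrable_cong[OF refl, THEN iffD2, rotated]) (rule eq)
qed

context entropy_system
begin

text \<open>This makes \<open>\<phi> * a(v)\<close> admissible as a Lipschitz test function and
  evaluates its partial derivatives. Since \<open>v\<close> stays in \<open>C\<close>, convexity and
  compactness of \<open>C\<close> provide the Lipschitz constant and the bound of
  \<open>a\<close>.\<close>

lemma test_times_composite:
  fixes a :: "real ^ 'm \<Rightarrow> real" and v :: "real \<Rightarrow> real \<Rightarrow> real ^ 'm"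
  assumes \<phi>: "L-lipschitz_on UNIV (\<lambda>(t, x). \<phi> t x)" "\<And>t x. \<bar>\<phi> t x\<bar> \<le> 1"
    and v: "Lv-lipschitz_on UNIV (\<lambda>(t, x). v t x)" "\<And>t x. v t x \<in> C"
    and a: "\<And>w. w \<in> C \<Longrightarrow> (a has_derivative a' w) (at w)" "0 \<le> K" "\<And>w h. w \<in> C \<Longrightarrow> \<bar>a' w h\<bar> \<le> K * norm h"
  obtains L' where "L'-lipschitz_on UNIV (\<lambda>(t, x). \<phi> t x * a (v t x))"
    "AE (t, x) in lborel. dt (\<lambda>t x. \<phi> t x * a (v t x)) t x = dt \<phi> t x * a (v t x) + \<phi> t x * a' (v t x) (dt v t x) \<and>
      dx (\<lambda>t x. \<phi> t x * a (v t x)) t x = dx \<phi> t x * a (v t x) + \<phi> t x * a' (v t x) (dx v t x)"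
proof -
  have "K-lipschitz_on C a" by (rule Lipschitz_on_of_derivative_bound[OF convex_C a(1,2)]) (use a(3) in auto)
  then have "K-lipschitz_on ((\<lambda>(t, x). v t x) ` UNIV) a" by (rule lipschitz_on_subset) (use v(2) in auto)
  from lipschitz_on_compose[OF v(1) this] have av: "(K * Lv)-lipschitz_on UNIV (\<lambda>(t, x). a (v t x))"
    by (simp add: o_def case_prod_unfold)
  have "continuous_on C a" using a(1) by (intro continuous_at_imp_continuous_on ballI has_derivative_continuous) blast
  then have "bounded (a ` C)" using compact_C by (intro compact_imp_bounded compact_continuous_image)
  then obtain Ba where Ba: "\<And>w. w \<in> C \<Longrightarrow> \<bar>a w\<bar> \<le> Ba" by (auto simp: bounded_iff)
  have Ba0: "0 \<le> Ba" using Ba[OF v(2)[of 0 0]] by linarith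
  have "(L * Ba + 1 * (K * Lv))-lipschitz_on UNIV (\<lambda>z. (case z of (t, x) \<Rightarrow> \<phi> t x) * (case z of (t, x) \<Rightarrow> a (v t x)))"
    by (rule lipschitz_on_mult_bounded[OF \<phi>(1) av]) (use \<phi>(2) v(2) Ba Ba0 in auto)
  then have 1: "(L * Ba + 1 * (K * Lv))-lipschitz_on UNIV (\<lambda>(t, x). \<phi> t x * a (v t x))" by (simp add: case_prod_unfold)
  have 2: "AE (t, x) in lborel. dt (\<lambda>t x. \<phi> t x * a (v t x)) t x = dt \<phi> t x * a (v t x) + \<phi> t x * a' (v t x) (dt v t x) \<and>
      dx (\<lambda>t x. \<phi> t x * a (v t x)) t x = dx \<phi> t x * a (v t x) + \<phi> t x * a' (v t x) (dx v t x)"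
    using Lipschitz_AE_partial_derivatives[OF \<phi>(1)] Lipschitz_AE_partial_derivatives[OF v(1)]
  proof eventually_elim
    case (elim z)
    obtain t x where z: "z = (t, x)" by (cases z)
    have p: "((\<lambda>s. \<phi> s x) has_vector_derivative dt \<phi> t x) (at t)" "(\<phi> t has_vector_derivative dx \<phi> t x) (at x)"
      "((\<lambda>s. v s x) has_vector_derivative dt v t x) (at t)" "(v t has_vector_derivative dx v t x) (at x)"
      using elim by (auto simp: z)
    have c: "((\<lambda>s. a (v s x)) has_vector_derivative a' (v t x) (dt v t x)) (at t)"
      "((\<lambda>y. a (v t y)) has_vector_derivative a' (v t x) (dx v t x)) (at x)"
      using has_vector_derivative_chain[OF p(3) a(1)[OF v(2)]] has_vector_derivative_chain[OF p(4) a(1)[OF v(2)]] by auto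
    have "((\<lambda>s. \<phi> s x * a (v s x)) has_vector_derivative \<phi> t x * a' (v t x) (dt v t x) + dt \<phi> t x * a (v t x)) (at t)"
      "((\<lambda>y. \<phi> t y * a (v t y)) has_vector_derivative \<phi> t x * a' (v t x) (dx v t x) + dx \<phi> t x * a (v t x)) (at x)"
      using has_vector_derivative_mult[OF p(1) c(1)] has_vector_derivative_mult[OF p(2) c(2)] by auto
    then show ?case unfolding z by (auto simp: dt_def dx_def vector_derivative_at add.commute)
  qed
  from 1 2 show thesis by (rule that)
qed

text \<open>The weak formulation is vector-valued with scalar test functions, so it is tested with
  \<open>\<phi>\<close> times each component of \<open>D\<eta>(v)\<close>, and the corresponding
  component of the identity is taken. The parts of relative entropy and relative flux depending on
  \<open>v\<close> alone are total derivatives and are integrated by parts exactly. The integrand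
  \<open>H\<close> is kept as one function, because after regrouping into relative quantities the
  individual terms are no longer known to be integrable.\<close>

lemma relative_entropy_inequality:
  fixes u v :: "real \<Rightarrow> real \<Rightarrow> real ^ 'm" and \<phi> :: "real \<Rightarrow> real \<Rightarrow> real"
  assumes T: "0 \<le> b" "b < T"
    and sol: "entropy_solution T f \<eta> q u0 u"
    and v: "Lv-lipschitz_on UNIV (\<lambda>(t, x). v t x)" "\<And>t x. v t x \<in> C"
    and \<phi>: "L-lipschitz_on UNIV (\<lambda>(t, x). \<phi> t x)" "\<And>t x. 0 \<le> \<phi> t x" "\<And>t x. \<phi> t x \<le> 1"
      "\<And>t x. 0 \<le> t \<Longrightarrow> b \<le> t \<or> \<rho> \<le> \<bar>x\<bar> \<Longrightarrow> \<phi> t x = 0"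
  obtains H where "integrable (time_strip T) H"
    "AE (t, x) in time_strip T. H (t, x) = dt \<phi> t x * rel_\<eta> (u t x) (v t x) + dx \<phi> t x * rel_q (u t x) (v t x)
       - \<phi> t x * (hess \<eta> (v t x) (u t x - v t x) (dt v t x) + hess \<eta> (v t x) (f (u t x) - f (v t x)) (dx v t x))"
    "integrable lborel (\<lambda>x. \<phi> 0 x * rel_\<eta> (u0 x) (v 0 x))"
    "0 \<le> (LINT z|time_strip T. H z) + (LINT x|lborel. \<phi> 0 x * rel_\<eta> (u0 x) (v 0 x))"
proof -
  have Tpos: "0 < T" using T by simp
  have \<phi>abs: "\<bar>\<phi> t x\<bar> \<le> 1" for t x using \<phi>(2,3)[of t x] by simp
  have vU: "v t x \<in> U" for t x using CU v(2) .
  define K where "K = {0..b} \<times> {-\<rho>..\<rho>}"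
  have K: "compact K" "K \<subseteq> {0..<T} \<times> UNIV" using T by (auto simp: K_def intro!: compact_Times)
  have testI: "test_function T \<Phi>"
    if "L'-lipschitz_on UNIV (\<lambda>(t, x). \<Phi> t x)" "\<And>t x. 0 \<le> t \<Longrightarrow> b \<le> t \<or> \<rho> \<le> \<bar>x\<bar> \<Longrightarrow> \<Phi> t x = 0" for \<Phi> L'
  proof -
    have "L'-lipschitz_on ({0..<T} \<times> UNIV) (\<lambda>(t, x). \<Phi> t x)" using that(1) by (rule lipschitz_on_subset) auto
    moreover have "\<Phi> t x = 0" if "t \<in> {0..<T}" "(t, x) \<notin> K" for t x
    proof -
      have "b \<le> t \<or> \<rho> \<le> \<bar>x\<bar>" using that by (auto simp: K_def)
      then show ?thesis using that(1) \<open>\<And>t x. 0 \<le> t \<Longrightarrow> b \<le> t \<or> \<rho> \<le> \<bar>x\<bar> \<Longrightarrow> \<Phi> t x = 0\<close> by simp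
    qed
    ultimately show ?thesis using K unfolding test_function_def by blast
  qed
  have int: "integrable (time_strip T) (\<lambda>(t, x). dt \<Phi> t x *\<^sub>R g t x)" "integrable (time_strip T) (\<lambda>(t, x). dx \<Phi> t x *\<^sub>R g t x)"
    if lip: "L'-lipschitz_on UNIV (\<lambda>(t, x). \<Phi> t x)" and sup: "\<And>t x. 0 \<le> t \<Longrightarrow> b \<le> t \<or> \<rho> \<le> \<bar>x\<bar> \<Longrightarrow> \<Phi> t x = 0"
      and g: "locally_integrable T g"
    for \<Phi> :: "real \<Rightarrow> real \<Rightarrow> real" and L' and g :: "real \<Rightarrow> real \<Rightarrow> 'c::euclidean_space"
  proof -
    have c: "continuous_on UNIV (\<lambda>(t, x). \<Phi> t x)" using lip by (rule lipschitz_on_continuous_on)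
    have B: "AE (t, x) in time_strip T. \<bar>dt \<Phi> t x\<bar> \<le> L'" "AE (t, x) in time_strip T. \<bar>dx \<Phi> t x\<bar> \<le> L'"
      by (rule AE_time_stripI, use Lipschitz_AE_partial_derivatives[OF lip] in eventually_elim, auto)+
    have Z: "dt \<Phi> t x = 0 \<and> dx \<Phi> t x = 0" if "0 < t" "b < t \<or> \<rho> < \<bar>x\<bar>" for t x
      using support_partial_derivatives[of b \<rho> \<Phi> t x] sup that by blast
    show "integrable (time_strip T) (\<lambda>(t, x). dt \<Phi> t x *\<^sub>R g t x)"
      by (rule integrable_test_times_local[OF g borel_measurable_dt(2)[OF c] B(1) _ T]) (use Z in blast)
    show "integrable (time_strip T) (\<lambda>(t, x). dx \<Phi> t x *\<^sub>R g t x)"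
      by (rule integrable_test_times_local[OF g borel_measurable_dx(2)[OF c] B(2) _ T]) (use Z in blast)
  qed
  have int0: "integrable lborel (\<lambda>x. \<Phi> 0 x *\<^sub>R g x)"
    if lip: "L'-lipschitz_on UNIV (\<lambda>(t, x). \<Phi> t x)" and sup: "\<And>t x. 0 \<le> t \<Longrightarrow> b \<le> t \<or> \<rho> \<le> \<bar>x\<bar> \<Longrightarrow> \<Phi> t x = 0"
      and g: "locally_integrable_R g"
    for \<Phi> :: "real \<Rightarrow> real \<Rightarrow> real" and L' and g :: "real \<Rightarrow> 'c::euclidean_space"
  proof -
    have c: "continuous_on UNIV (\<Phi> 0)" using Lipschitz_sections(2)[OF lip] by (rule lipschitz_on_continuous_on)
    have "bounded (\<Phi> 0 ` {-\<rho>..\<rho>})" using c by (intro compact_imp_bounded compact_continuous_image) (auto intro: continuous_on_subset)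
    then obtain B where "\<forall>y\<in>\<Phi> 0 ` {-\<rho>..\<rho>}. norm y \<le> B" unfolding bounded_iff by blast
    then have B: "\<bar>\<Phi> 0 x\<bar> \<le> B" if "x \<in> {-\<rho>..\<rho>}" for x using that by simp
    have z: "\<Phi> 0 x = 0" if "\<rho> < \<bar>x\<bar>" for x using sup[of 0 x] that by simp
    show ?thesis
    proof (rule integrable_test_times_local_R[OF g, where B="max B 0" and a=\<rho>])
      show "\<Phi> 0 \<in> borel_measurable borel" using c by (rule borel_measurable_continuous_onI)
      fix x
      show "\<bar>\<Phi> 0 x\<bar> \<le> max B 0"
      proof (cases "x \<in> {-\<rho>..\<rho>}")
        case True then show ?thesis using B[OF True] by simp
      next
        case False
        then have "\<rho> < \<bar>x\<bar>" by (simp only: not_in_symmetric_interval)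
        then show ?thesis using z by simp
      qed
    qed (use z in auto)
  qed
  have lit: "locally_integrable T u" "locally_integrable T (\<lambda>t x. f (u t x))" "locally_integrable T (\<lambda>t x. \<eta> (u t x))"
      "locally_integrable T (\<lambda>t x. q (u t x))" "locally_integrable_R u0" "locally_integrable_R (\<lambda>x. \<eta> (u0 x))"
    using sol by (auto simp: entropy_solution_def weak_solution_def)
  obtain K\<eta> where K\<eta>: "0 \<le> K\<eta>" "\<And>w v. w \<in> C \<Longrightarrow> norm (D\<eta> w v) \<le> K\<eta> * norm v"
    "\<And>w v v'. w \<in> C \<Longrightarrow> norm (hess \<eta> w v v') \<le> K\<eta> * norm v * norm v'"
    using C2_on_bounds[OF C2_\<eta> open_U compact_C C_sub] by metis
  obtain RC where RC: "0 \<le> RC" "\<And>w. w \<in> C \<Longrightarrow> norm w \<le> RC" "\<And>w. w \<in> C \<Longrightarrow> norm (f w) \<le> RC"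
  proof -
    have "continuous_on C f" using C2_onD(1)[OF C2_f] CU by (intro continuous_at_imp_continuous_on ballI has_derivative_continuous) blast
    then have "bounded (f ` C)" using compact_C by (intro compact_imp_bounded compact_continuous_image)
    then obtain B1 where "\<And>w. w \<in> C \<Longrightarrow> norm (f w) \<le> B1" by (auto simp: bounded_iff)
    moreover obtain B2 where "\<And>w. w \<in> C \<Longrightarrow> norm w \<le> B2" using compact_imp_bounded[OF compact_C] by (auto simp: bounded_iff)
    ultimately show thesis by (intro that[of "max 0 (max B1 B2)"]) (auto simp: le_max_iff_disj)
  qed
  \<comment> \<open>\<open>Ai i\<close> is a component of \<open>D\<eta>\<close>. \<open>AA\<close>
    and \<open>BB\<close> are, up to sign, the parts of relative entropy and relative flux that are
    independent of the first argument.\<close>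
  define Ai where "Ai i w = D\<eta> w i" for i w
  define AA where "AA w = \<eta> w - D\<eta> w w" for w
  define BB where "BB w = q w - D\<eta> w (f w)" for w
  have dAi: "(Ai i has_derivative hess \<eta> w i) (at w)" if "w \<in> C" for w i
    unfolding Ai_def[abs_def] by (rule C2_onD(2)[OF C2_\<eta> CU[OF that]])
  have dAA: "(AA has_derivative (\<lambda>h. - hess \<eta> w w h)) (at w)" if "w \<in> C" for w
    unfolding AA_def[abs_def]
    by (rule has_derivative_eq_rhs[OF has_derivative_diff[OF C2_onD(1)[OF C2_\<eta> CU[OF that]]
          has_derivative_frechet_derivative_apply[OF C2_\<eta> open_U CU[OF that] has_derivative_ident]]]) auto
  \<comment> \<open>The product rule yields \<open>Dq\<close> minus \<open>D\<eta> Df\<close> in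
    addition to the Hessian term; the compatibility relation cancels these two. For
    \<open>AA\<close> the two copies of \<open>D\<eta>\<close> cancel in the same way.\<close>
  have dBB: "(BB has_derivative (\<lambda>h. - hess \<eta> w (f w) h)) (at w)" if "w \<in> C" for w
    unfolding BB_def[abs_def]
    by (rule has_derivative_eq_rhs[OF has_derivative_diff[OF C2_onD(1)[OF C2_q CU[OF that]]
          has_derivative_frechet_derivative_apply[OF C2_\<eta> open_U CU[OF that] C2_onD(1)[OF C2_f CU[OF that]]]]])
       (auto simp: compat[OF CU[OF that]])
  have bAi: "\<bar>hess \<eta> w i h\<bar> \<le> (K\<eta> * norm i) * norm h" if "w \<in> C" for w i h using K\<eta>(3)[OF that, of i h] by simp
  have bAA: "\<bar>- hess \<eta> w w h\<bar> \<le> (K\<eta> * RC) * norm h" if "w \<in> C" for w h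
    using K\<eta>(3)[OF that, of w h] mult_right_mono[OF mult_left_mono[OF RC(2)[OF that] K\<eta>(1)] norm_ge_zero[of h]] by simp
  have bBB: "\<bar>- hess \<eta> w (f w) h\<bar> \<le> (K\<eta> * RC) * norm h" if "w \<in> C" for w h
    using K\<eta>(3)[OF that, of "f w" h] mult_right_mono[OF mult_left_mono[OF RC(3)[OF that] K\<eta>(1)] norm_ge_zero[of h]] by simp
  have KR: "0 \<le> K\<eta> * RC" using K\<eta> RC by simp
  have "\<exists>L'. L'-lipschitz_on UNIV (\<lambda>(t, x). \<phi> t x * Ai i (v t x)) \<and>
    (AE (t, x) in lborel. dt (\<lambda>t x. \<phi> t x * Ai i (v t x)) t x = dt \<phi> t x * Ai i (v t x) + \<phi> t x * hess \<eta> (v t x) i (dt v t x) \<and>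
      dx (\<lambda>t x. \<phi> t x * Ai i (v t x)) t x = dx \<phi> t x * Ai i (v t x) + \<phi> t x * hess \<eta> (v t x) i (dx v t x))" for i
    by (rule test_times_composite[OF \<phi>(1) \<phi>abs v dAi _ bAi]) (use K\<eta>(1) in auto)
  then obtain LA where LA: "\<And>i. (LA i)-lipschitz_on UNIV (\<lambda>(t, x). \<phi> t x * Ai i (v t x))"
    and eA: "\<And>i. AE (t, x) in lborel. dt (\<lambda>t x. \<phi> t x * Ai i (v t x)) t x = dt \<phi> t x * Ai i (v t x) + \<phi> t x * hess \<eta> (v t x) i (dt v t x) \<and>
      dx (\<lambda>t x. \<phi> t x * Ai i (v t x)) t x = dx \<phi> t x * Ai i (v t x) + \<phi> t x * hess \<eta> (v t x) i (dx v t x)"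
    by metis
  obtain L1 where L1: "L1-lipschitz_on UNIV (\<lambda>(t, x). \<phi> t x * AA (v t x))"
    and e1: "AE (t, x) in lborel. dt (\<lambda>t x. \<phi> t x * AA (v t x)) t x = dt \<phi> t x * AA (v t x) + \<phi> t x * - hess \<eta> (v t x) (v t x) (dt v t x) \<and>
      dx (\<lambda>t x. \<phi> t x * AA (v t x)) t x = dx \<phi> t x * AA (v t x) + \<phi> t x * - hess \<eta> (v t x) (v t x) (dx v t x)"
    by (rule test_times_composite[OF \<phi>(1) \<phi>abs v dAA KR bAA]) auto
  obtain L2 where L2: "L2-lipschitz_on UNIV (\<lambda>(t, x). \<phi> t x * BB (v t x))"
    and e2: "AE (t, x) in lborel. dt (\<lambda>t x. \<phi> t x * BB (v t x)) t x = dt \<phi> t x * BB (v t x) + \<phi> t x * - hess \<eta> (v t x) (f (v t x)) (dt v t x) \<and>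
      dx (\<lambda>t x. \<phi> t x * BB (v t x)) t x = dx \<phi> t x * BB (v t x) + \<phi> t x * - hess \<eta> (v t x) (f (v t x)) (dx v t x)"
    by (rule test_times_composite[OF \<phi>(1) \<phi>abs v dBB KR bBB]) auto
  have supA: "\<phi> t x * Ai i (v t x) = 0" and supAA: "\<phi> t x * AA (v t x) = 0" and supBB: "\<phi> t x * BB (v t x) = 0"
    if "0 \<le> t" "b \<le> t \<or> \<rho> \<le> \<bar>x\<bar>" for t x i using \<phi>(4)[OF that] by auto
  define HE where "HE z = (case z of (t, x) \<Rightarrow> \<eta> (u t x) * dt \<phi> t x + q (u t x) * dx \<phi> t x)" for z
  define HW where "HW i z = (case z of (t, x) \<Rightarrow> dt (\<lambda>t x. \<phi> t x * Ai i (v t x)) t x *\<^sub>R u t x + dx (\<lambda>t x. \<phi> t x * Ai i (v t x)) t x *\<^sub>R f (u t x))" for i z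
  define HA where "HA z = (case z of (t, x) \<Rightarrow> dt (\<lambda>t x. \<phi> t x * AA (v t x)) t x)" for z
  define HB where "HB z = (case z of (t, x) \<Rightarrow> dx (\<lambda>t x. \<phi> t x * BB (v t x)) t x)" for z
  have iE: "integrable (time_strip T) HE"
    using Bochner_Integration.integrable_add[OF int(1)[OF \<phi>(1,4) lit(3)] int(2)[OF \<phi>(1,4) lit(4)]]
    by (simp add: HE_def[abs_def] case_prod_unfold mult.commute)
  have iW: "integrable (time_strip T) (HW i)" for i
    using Bochner_Integration.integrable_add[OF int(1)[OF LA[of i] supA[of _ _ i] lit(1)] int(2)[OF LA[of i] supA[of _ _ i] lit(2)]]
    by (simp add: HW_def[abs_def] case_prod_unfold)
  have iA: "integrable (time_strip T) HA" using integrable_partial_derivatives(1)[OF L1 supAA] by (simp add: HA_def[abs_def])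
  have iB: "integrable (time_strip T) HB" using integrable_partial_derivatives(2)[OF L2 supBB] by (simp add: HB_def[abs_def])
  have E: "0 \<le> (LINT z|time_strip T. HE z) + (LINT x|lborel. \<eta> (u0 x) * \<phi> 0 x)"
    using sol testI[OF \<phi>(1,4)] \<phi>(2) unfolding entropy_solution_def HE_def by blast
  have Wi: "(LINT z|time_strip T. HW i z) + (LINT x|lborel. (\<phi> 0 x * Ai i (v 0 x)) *\<^sub>R u0 x) = 0" for i
    using sol testI[OF LA[of i] supA[of _ _ i]] unfolding entropy_solution_def weak_solution_def HW_def by blast
  have A: "(LINT z|time_strip T. HA z) = - (LINT x|lborel. \<phi> 0 x * AA (v 0 x))"
    using integral_partial_derivatives(1)[OF L1 supAA Tpos] T by (simp add: HA_def)
  have B: "(LINT z|time_strip T. HB z) = 0"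
    using integral_partial_derivatives(2)[OF L2 supBB Tpos] T by (simp add: HB_def)
  \<comment> \<open>The entropy integrand minus those of the identities. Whatever is subtracted
    integrates to a term supported at time 0, so the sign of the entropy inequality is
    preserved.\<close>
  define H where "H z = HE z - (\<Sum>i\<in>Basis. HW i z \<bullet> i) - HA z - HB z" for z
  have li1: "locally_integrable_R (\<lambda>_. 1::real)" by (auto simp: locally_integrable_R_def set_integrable_def emeasure_lborel_Icc_eq)
  have i0: "integrable lborel (\<lambda>x. \<eta> (u0 x) * \<phi> 0 x)" "integrable lborel (\<lambda>x. (\<phi> 0 x * Ai i (v 0 x)) *\<^sub>R u0 x)"
    "integrable lborel (\<lambda>x. \<phi> 0 x * AA (v 0 x))" for i
    using int0[OF \<phi>(1,4) lit(6)] int0[OF LA[of i] supA[of _ _ i] lit(5)] int0[OF L1 supAA li1] by (auto simp: mult.commute)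
  have expand: "D\<eta> w y = (\<Sum>i\<in>Basis. Ai i w * (y \<bullet> i))" if "w \<in> U" for w y
    by (subst euclidean_representation[of y, symmetric])
       (simp add: linear_sum[OF linear_D\<eta>[OF that]] linear_scale[OF linear_D\<eta>[OF that]] Ai_def mult.commute)
  have hexpand: "hess \<eta> w y h = (\<Sum>i\<in>Basis. hess \<eta> w i h * (y \<bullet> i))" if "w \<in> U" for w y h
    by (subst euclidean_representation[of y, symmetric])
       (simp add: linear_sum[OF linear_hess_\<eta>(2)[OF that]] linear_scale[OF linear_hess_\<eta>(2)[OF that]] mult.commute)
  have I0eq: "\<phi> 0 x * rel_\<eta> (u0 x) (v 0 x) = \<eta> (u0 x) * \<phi> 0 x - (\<Sum>i\<in>Basis. ((\<phi> 0 x * Ai i (v 0 x)) *\<^sub>R u0 x) \<bullet> i) - \<phi> 0 x * AA (v 0 x)" for x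
  proof -
    have "rel_\<eta> (u0 x) (v 0 x) = \<eta> (u0 x) - D\<eta> (v 0 x) (u0 x) - AA (v 0 x)"
      using linear_diff[OF linear_D\<eta>[OF vU], of 0 x "u0 x" "v 0 x"] by (simp add: rel_\<eta>_def AA_def)
    moreover have "(\<Sum>i\<in>Basis. ((\<phi> 0 x * Ai i (v 0 x)) *\<^sub>R u0 x) \<bullet> i) = \<phi> 0 x * D\<eta> (v 0 x) (u0 x)"
      by (simp add: expand[OF vU] sum_distrib_left mult_ac)
    ultimately show ?thesis by (simp only:) (simp add: algebra_simps)
  qed
  show thesis
  proof (rule that[of H])
    show iH: "integrable (time_strip T) H"
      unfolding H_def[abs_def] using iE iW iA iB by (intro Bochner_Integration.integrable_diff Bochner_Integration.integrable_sum integrable_inner_left) auto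
    show i00: "integrable lborel (\<lambda>x. \<phi> 0 x * rel_\<eta> (u0 x) (v 0 x))"
      unfolding I0eq using i0 by (intro Bochner_Integration.integrable_diff Bochner_Integration.integrable_sum integrable_inner_left) auto
    have LH: "(LINT z|time_strip T. H z) = (LINT z|time_strip T. HE z) - (\<Sum>i\<in>Basis. (LINT z|time_strip T. HW i z) \<bullet> i) - (LINT z|time_strip T. HA z) - (LINT z|time_strip T. HB z)"
      unfolding H_def using iE iW iA iB by simp
    have L0: "(LINT x|lborel. \<phi> 0 x * rel_\<eta> (u0 x) (v 0 x)) = (LINT x|lborel. \<eta> (u0 x) * \<phi> 0 x) - (\<Sum>i\<in>Basis. (LINT x|lborel. (\<phi> 0 x * Ai i (v 0 x)) *\<^sub>R u0 x) \<bullet> i) - (LINT x|lborel. \<phi> 0 x * AA (v 0 x))"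
    proof -
      have "integrable lborel (\<lambda>x. \<Sum>i\<in>Basis. ((\<phi> 0 x * Ai i (v 0 x)) *\<^sub>R u0 x) \<bullet> i)"
        using i0(2) by (intro Bochner_Integration.integrable_sum integrable_inner_left)
      moreover have "(LINT x|lborel. (\<Sum>i\<in>Basis. ((\<phi> 0 x * Ai i (v 0 x)) *\<^sub>R u0 x) \<bullet> i)) = (\<Sum>i\<in>Basis. (LINT x|lborel. (\<phi> 0 x * Ai i (v 0 x)) *\<^sub>R u0 x) \<bullet> i)"
        using i0(2) by (subst Bochner_Integration.integral_sum) (auto intro!: sum.cong integrable_inner_left simp del: inner_scaleR_left)
      ultimately show ?thesis unfolding I0eq using i0(1,3) by (simp del: inner_scaleR_left)
    qed
    have "(\<Sum>i\<in>Basis. (LINT z|time_strip T. HW i z) \<bullet> i) + (\<Sum>i\<in>Basis. (LINT x|lborel. (\<phi> 0 x * Ai i (v 0 x)) *\<^sub>R u0 x) \<bullet> i) = 0"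
      using Wi by (simp add: sum.distrib[symmetric] inner_add_left[symmetric])
    then show "0 \<le> (LINT z|time_strip T. H z) + (LINT x|lborel. \<phi> 0 x * rel_\<eta> (u0 x) (v 0 x))"
      unfolding LH L0 using E A B by linarith
    have allA: "AE z in lborel. \<forall>i\<in>Basis. (case z of (t, x) \<Rightarrow> dt (\<lambda>t x. \<phi> t x * Ai i (v t x)) t x = dt \<phi> t x * Ai i (v t x) + \<phi> t x * hess \<eta> (v t x) i (dt v t x) \<and>
      dx (\<lambda>t x. \<phi> t x * Ai i (v t x)) t x = dx \<phi> t x * Ai i (v t x) + \<phi> t x * hess \<eta> (v t x) i (dx v t x))"
      using eA by (intro AE_finite_allI) auto
    show "AE (t, x) in time_strip T. H (t, x) = dt \<phi> t x * rel_\<eta> (u t x) (v t x) + dx \<phi> t x * rel_q (u t x) (v t x)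
       - \<phi> t x * (hess \<eta> (v t x) (u t x - v t x) (dt v t x) + hess \<eta> (v t x) (f (u t x) - f (v t x)) (dx v t x))"
      apply (rule AE_time_stripI)
      using allA e1 e2
    proof eventually_elim
      case (elim z)
      obtain t x where z: "z = (t, x)" by (cases z)
      have w: "v t x \<in> U" by (rule vU)
      have "(\<Sum>i\<in>Basis. HW i z \<bullet> i) = (\<Sum>i\<in>Basis. (dt \<phi> t x * Ai i (v t x) + \<phi> t x * hess \<eta> (v t x) i (dt v t x)) * (u t x \<bullet> i) +
          (dx \<phi> t x * Ai i (v t x) + \<phi> t x * hess \<eta> (v t x) i (dx v t x)) * (f (u t x) \<bullet> i))"
        using elim(1) by (intro sum.cong) (auto simp: HW_def z inner_add_left)
      also have "\<dots> = dt \<phi> t x * D\<eta> (v t x) (u t x) + \<phi> t x * hess \<eta> (v t x) (u t x) (dt v t x)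
          + dx \<phi> t x * D\<eta> (v t x) (f (u t x)) + \<phi> t x * hess \<eta> (v t x) (f (u t x)) (dx v t x)"
        by (simp add: expand[OF w] hexpand[OF w, of "u t x"] hexpand[OF w, of "f (u t x)"] sum_distrib_left sum.distrib[symmetric] algebra_simps)
      finally have W: "(\<Sum>i\<in>Basis. HW i z \<bullet> i) = dt \<phi> t x * D\<eta> (v t x) (u t x) + \<phi> t x * hess \<eta> (v t x) (u t x) (dt v t x)
          + dx \<phi> t x * D\<eta> (v t x) (f (u t x)) + \<phi> t x * hess \<eta> (v t x) (f (u t x)) (dx v t x)" .
      have A': "HA z = dt \<phi> t x * (\<eta> (v t x) - D\<eta> (v t x) (v t x)) - \<phi> t x * hess \<eta> (v t x) (v t x) (dt v t x)"
        using elim(2) by (simp add: HA_def z AA_def)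
      have B': "HB z = dx \<phi> t x * (q (v t x) - D\<eta> (v t x) (f (v t x))) - \<phi> t x * hess \<eta> (v t x) (f (v t x)) (dx v t x)"
        using elim(3) by (simp add: HB_def z BB_def)
      have ld: "D\<eta> (v t x) (u t x - v t x) = D\<eta> (v t x) (u t x) - D\<eta> (v t x) (v t x)"
        "D\<eta> (v t x) (f (u t x) - f (v t x)) = D\<eta> (v t x) (f (u t x)) - D\<eta> (v t x) (f (v t x))"
        "hess \<eta> (v t x) (u t x - v t x) (dt v t x) = hess \<eta> (v t x) (u t x) (dt v t x) - hess \<eta> (v t x) (v t x) (dt v t x)"
        "hess \<eta> (v t x) (f (u t x) - f (v t x)) (dx v t x) = hess \<eta> (v t x) (f (u t x)) (dx v t x) - hess \<eta> (v t x) (f (v t x)) (dx v t x)"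
        using linear_diff[OF linear_D\<eta>[OF w]] linear_diff[OF linear_hess_\<eta>(2)[OF w]] by blast+
      show ?case
        unfolding z prod.case H_def W[unfolded z] A'[unfolded z] B'[unfolded z] rel_\<eta>_def rel_q_def ld HE_def
        by (simp add: algebra_simps)
    qed
  qed
qed

end

section \<open>Stability for a fixed parameter\<close>

lemma nn_integral_time_strip_iterated:
  assumes F: "F \<in> borel_measurable (time_strip T)"
  shows "(\<integral>\<^sup>+ z. F z \<partial>time_strip T) = (\<integral>\<^sup>+ t. (\<integral>\<^sup>+ x. F (t, x) * indicator {0<..<T} t \<partial>lborel) \<partial>lborel)"
proof -
  have m: "(\<lambda>z. F z * indicator ({0<..<T} \<times> UNIV) z) \<in> borel_measurable (lborel \<Otimes>\<^sub>M lborel)"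
    using F unfolding time_strip_def lborel_prod
    by (subst (asm) borel_measurable_restrict_space_iff_ennreal) (auto simp: strip_sets)
  have "(\<integral>\<^sup>+ z. F z \<partial>time_strip T) = (\<integral>\<^sup>+ z. F z * indicator ({0<..<T} \<times> UNIV) z \<partial>(lborel \<Otimes>\<^sub>M lborel))"
    unfolding nn_integral_time_strip lborel_prod ..
  also have "\<dots> = (\<integral>\<^sup>+ t. (\<integral>\<^sup>+ x. F (t, x) * indicator ({0<..<T} \<times> UNIV) (t, x) \<partial>lborel) \<partial>lborel)"
    by (rule lborel.nn_integral_fst[OF m, symmetric])
  also have "\<dots> = (\<integral>\<^sup>+ t. (\<integral>\<^sup>+ x. F (t, x) * indicator {0<..<T} t \<partial>lborel) \<partial>lborel)"
    by (intro nn_integral_cong) (auto simp: indicator_def)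
  finally show ?thesis .
qed

lemma weakly_continuous_tendsto:
  assumes W: "weakly_continuous_in_time T u" and s: "\<And>k. s k \<in> {0..T}" "s \<longlonglongrightarrow> t" "t \<in> {0..T}"
  shows "weakly_tendsto (\<lambda>k. u (s k)) (u t)"
  unfolding weakly_tendsto_def
proof (intro conjI allI impI)
  show "locally_integrable_R (u (s k))" "locally_integrable_R (u t)" for k using W s by (auto simp: weakly_continuous_in_time_def)
  fix \<psi> :: "real \<Rightarrow> real" assume "continuous_on UNIV \<psi> \<and> (\<exists>K. compact K \<and> (\<forall>x. x \<notin> K \<longrightarrow> \<psi> x = 0))"
  then have "continuous_on {0..T} (\<lambda>t. LINT x|lborel. \<psi> x *\<^sub>R u t x)" using W unfolding weakly_continuous_in_time_def by blast
  then show "(\<lambda>k. LINT x|lborel. \<psi> x *\<^sub>R u (s k) x) \<longlonglongrightarrow> (LINT x|lborel. \<psi> x *\<^sub>R u t x)"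
    by (rule continuous_on_tendsto_compose[OF _ s(2,3)]) (use s(1) in auto)
qed

section \<open>Time ramp, cone cutoff and integrating factor\<close>

lemma lipschitz_on_fst_snd:
  assumes "L-lipschitz_on UNIV (g :: real \<Rightarrow> 'b::metric_space)"
  shows "L-lipschitz_on UNIV (\<lambda>(t, x::real). g t)" "L-lipschitz_on UNIV (\<lambda>(t::real, x). g x)"
proof -
  note n = lipschitz_on_nonneg[OF assms]
  show "L-lipschitz_on UNIV (\<lambda>(t, x::real). g t)"
  proof (rule lipschitz_onI[OF _ n])
    fix z z' :: "real \<times> real"
    have "dist (g (fst z)) (g (fst z')) \<le> L * dist (fst z) (fst z')" by (rule lipschitz_onD[OF assms]) auto
    also have "\<dots> \<le> L * dist z z'" using n by (intro mult_left_mono dist_fst_le)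
    finally show "dist (case z of (t, x) \<Rightarrow> g t) (case z' of (t, x) \<Rightarrow> g t) \<le> L * dist z z'" by (simp add: case_prod_unfold)
  qed
  show "L-lipschitz_on UNIV (\<lambda>(t::real, x). g x)"
  proof (rule lipschitz_onI[OF _ n])
    fix z z' :: "real \<times> real"
    have "dist (g (snd z)) (g (snd z')) \<le> L * dist (snd z) (snd z')" by (rule lipschitz_onD[OF assms]) auto
    also have "\<dots> \<le> L * dist z z'" using n by (intro mult_left_mono dist_snd_le)
    finally show "dist (case z of (t, x) \<Rightarrow> g x) (case z' of (t, x) \<Rightarrow> g x) \<le> L * dist z z'" by (simp add: case_prod_unfold)
  qed
qed

text \<open>As a factor of a test function it stands for the indicator of the times before the final
  one: minus its derivative is the uniform probability density on \<open>(a, b)\<close>, so testing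
  yields an average over that interval.\<close>

definition ramp :: "real \<Rightarrow> real \<Rightarrow> real \<Rightarrow> real" where
  "ramp a b t = max 0 (min 1 ((b - t) / (b - a)))"

lemma ramp_props:
  assumes "a < b"
  shows "0 \<le> ramp a b t" "ramp a b t \<le> 1" "t \<le> a \<Longrightarrow> ramp a b t = 1" "b \<le> t \<Longrightarrow> ramp a b t = 0"
    "(1 / (b - a))-lipschitz_on UNIV (ramp a b)"
    "t \<noteq> a \<Longrightarrow> t \<noteq> b \<Longrightarrow> (ramp a b has_vector_derivative (if a < t \<and> t < b then - 1 / (b - a) else 0)) (at t)"
proof -
  show "0 \<le> ramp a b t" "ramp a b t \<le> 1" "t \<le> a \<Longrightarrow> ramp a b t = 1" "b \<le> t \<Longrightarrow> ramp a b t = 0" for t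
    using assms by (auto simp: ramp_def divide_le_0_iff le_divide_eq)
  show "(1 / (b - a))-lipschitz_on UNIV (ramp a b)"
  proof (rule lipschitz_onI)
    fix x y
    have "\<bar>ramp a b x - ramp a b y\<bar> \<le> \<bar>(b - x) / (b - a) - (b - y) / (b - a)\<bar>" unfolding ramp_def by linarith
    also have "\<dots> = \<bar>x - y\<bar> / (b - a)" using assms by (simp add: diff_divide_distrib[symmetric] abs_divide abs_minus_commute)
    finally show "dist (ramp a b x) (ramp a b y) \<le> 1 / (b - a) * dist x y" by (simp add: dist_real_def)
  qed (use assms in simp)
  assume t: "t \<noteq> a" "t \<noteq> b"
  consider "t < a" | "a < t" "t < b" | "b < t" using t by linarith
  then show "(ramp a b has_vector_derivative (if a < t \<and> t < b then - 1 / (b - a) else 0)) (at t)"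
  proof cases
    case 1
    have "(ramp a b has_vector_derivative 0) (at t)"
      by (rule has_vector_derivative_transform_within_open[OF has_vector_derivative_const, of "{..<a}" _ 1])
         (use 1 \<open>\<And>t. t \<le> a \<Longrightarrow> ramp a b t = 1\<close> in auto)
    then show ?thesis using 1 by simp
  next
    case 2
    have "((\<lambda>t. (b - t) / (b - a)) has_real_derivative - 1 / (b - a)) (at t)"
      by (rule DERIV_cdivide) (auto intro!: derivative_eq_intros)
    then have "((\<lambda>t. (b - t) / (b - a)) has_vector_derivative - 1 / (b - a)) (at t)" by (simp add: has_real_derivative_iff_has_vector_derivative)
    then have "(ramp a b has_vector_derivative - 1 / (b - a)) (at t)"
      by (rule has_vector_derivative_transform_within_open[of _ _ _ "{a<..<b}"]) (use 2 assms in \<open>auto simp: ramp_def divide_le_eq\<close>)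
    then show ?thesis using 2 by simp
  next
    case 3
    have "(ramp a b has_vector_derivative 0) (at t)"
      by (rule has_vector_derivative_transform_within_open[OF has_vector_derivative_const, of "{b<..}" _ 0])
         (use 3 \<open>\<And>t. b \<le> t \<Longrightarrow> ramp a b t = 0\<close> in auto)
    then show ?thesis using 3 by simp
  qed
qed

text \<open>Supported in the backward cone \<open>\<bar>x\<bar> + c * t \<le> \<rho>\<close>. Using
  \<open>max 0 t\<close> freezes the profile for negative times, so that it stays bounded by 1 on
  the whole plane.\<close>

definition cone_cutoff :: "real \<Rightarrow> real \<Rightarrow> real \<Rightarrow> real \<Rightarrow> real" where
  "cone_cutoff c \<rho> t x = max 0 (1 - (\<bar>x\<bar> + c * max 0 t) / \<rho>)"

lemma cone_cutoff_props:
  assumes "0 \<le> c" "0 < \<rho>"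
  shows "0 \<le> cone_cutoff c \<rho> t x" "cone_cutoff c \<rho> t x \<le> 1" "\<rho> \<le> \<bar>x\<bar> \<Longrightarrow> cone_cutoff c \<rho> t x = 0"
    "s \<le> t \<Longrightarrow> cone_cutoff c \<rho> t x \<le> cone_cutoff c \<rho> s x"
    "((1 + c) / \<rho>)-lipschitz_on UNIV (\<lambda>(t, x). cone_cutoff c \<rho> t x)"
proof -
  have n: "0 \<le> c * max 0 t" for t using assms by simp
  show "0 \<le> cone_cutoff c \<rho> t x" by (simp add: cone_cutoff_def)
  show "cone_cutoff c \<rho> t x \<le> 1" using n[of t] assms by (auto simp: cone_cutoff_def)
  show "\<rho> \<le> \<bar>x\<bar> \<Longrightarrow> cone_cutoff c \<rho> t x = 0"
  proof -
    assume "\<rho> \<le> \<bar>x\<bar>"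
    then have "1 \<le> (\<bar>x\<bar> + c * max 0 t) / \<rho>" using n[of t] by (subst le_divide_eq_1_pos[OF assms(2)]) linarith
    then show ?thesis by (simp add: cone_cutoff_def)
  qed
  show "s \<le> t \<Longrightarrow> cone_cutoff c \<rho> t x \<le> cone_cutoff c \<rho> s x"
    unfolding cone_cutoff_def using assms by (intro max.mono diff_left_mono divide_right_mono add_left_mono mult_left_mono) auto
  show "((1 + c) / \<rho>)-lipschitz_on UNIV (\<lambda>(t, x). cone_cutoff c \<rho> t x)"
  proof (rule lipschitz_onI)
    fix z z' :: "real \<times> real"
    obtain t x t' x' where z: "z = (t, x)" "z' = (t', x')" by (cases z, cases z')
    have d: "\<bar>t - t'\<bar> \<le> dist z z'" "\<bar>x - x'\<bar> \<le> dist z z'"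
      using dist_fst_le[of z z'] dist_snd_le[of z z'] by (auto simp: z dist_real_def)
    have "\<bar>cone_cutoff c \<rho> t x - cone_cutoff c \<rho> t' x'\<bar> \<le> \<bar>(\<bar>x\<bar> + c * max 0 t) / \<rho> - (\<bar>x'\<bar> + c * max 0 t') / \<rho>\<bar>"
      unfolding cone_cutoff_def by linarith
    also have "\<dots> = \<bar>(\<bar>x\<bar> - \<bar>x'\<bar>) + c * (max 0 t - max 0 t')\<bar> / \<rho>"
      using assms by (simp add: diff_divide_distrib[symmetric] abs_divide algebra_simps)
    also have "\<dots> \<le> (1 + c) * dist z z' / \<rho>"
    proof (rule divide_right_mono)
      have "\<bar>c * (max 0 t - max 0 t')\<bar> \<le> c * \<bar>t - t'\<bar>" using assms by (simp add: abs_mult mult_left_mono)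
      also have "\<dots> \<le> c * dist z z'" using d assms by (intro mult_left_mono)
      finally have "\<bar>c * (max 0 t - max 0 t')\<bar> \<le> c * dist z z'" .
      moreover have "\<bar>\<bar>x\<bar> - \<bar>x'\<bar>\<bar> \<le> dist z z'" using d by linarith
      ultimately show "\<bar>(\<bar>x\<bar> - \<bar>x'\<bar>) + c * (max 0 t - max 0 t')\<bar> \<le> (1 + c) * dist z z'"
        using abs_triangle_ineq[of "\<bar>x\<bar> - \<bar>x'\<bar>" "c * (max 0 t - max 0 t')"] by (simp add: algebra_simps)
    qed (use assms in simp)
    finally show "dist (case z of (t, x) \<Rightarrow> cone_cutoff c \<rho> t x) (case z' of (t, x) \<Rightarrow> cone_cutoff c \<rho> t x) \<le> (1 + c) / \<rho> * dist z z'"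
      by (simp add: z dist_real_def)
  qed (use assms in simp)
qed

text \<open>The cutoff decreases in time at least as fast as information travels: its time derivative
  absorbs the entropy flux term.\<close>
lemma cone_cutoff_derivatives:
  assumes c: "0 \<le> c" "0 < \<rho>" and t: "0 < t" and x: "x \<noteq> 0" "\<bar>x\<bar> + c * t \<noteq> \<rho>"
  obtains k kx where "0 \<le> k" "((\<lambda>s. cone_cutoff c \<rho> s x) has_vector_derivative - c * k) (at t)"
    "(cone_cutoff c \<rho> t has_vector_derivative kx) (at x)" "\<bar>kx\<bar> \<le> k"
proof (cases "\<bar>x\<bar> + c * t < \<rho>")
  case True
  have o1: "open ({0<..} \<inter> {s. \<bar>x\<bar> + c * s < \<rho>})" by (intro open_Int open_Collect_less continuous_intros open_greaterThan)
  \<comment> \<open>The condition \<open>0 < y * x\<close> keeps \<open>y\<close> on the same side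
    of the kink at the origin as \<open>x\<close>, where \<open>\<bar>y\<bar>\<close> is the linear
    function \<open>sgn x * y\<close>.\<close>
  have o2: "open ({y. 0 < y * x} \<inter> {y. \<bar>y\<bar> + c * t < \<rho>})" by (intro open_Int open_Collect_less continuous_intros)
  have "((\<lambda>s. 1 - (\<bar>x\<bar> + c * s) / \<rho>) has_real_derivative - c * (1 / \<rho>)) (at t)"
    using c by (auto intro!: derivative_eq_intros)
  then have "((\<lambda>s. 1 - (\<bar>x\<bar> + c * s) / \<rho>) has_vector_derivative - c * (1 / \<rho>)) (at t)"
    by (simp only: has_real_derivative_iff_has_vector_derivative)
  then have 1: "((\<lambda>s. cone_cutoff c \<rho> s x) has_vector_derivative - c * (1 / \<rho>)) (at t)"
    by (rule has_vector_derivative_transform_within_open[OF _ o1]) (use t True c in \<open>auto simp: cone_cutoff_def\<close>)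
  have "((\<lambda>y. 1 - (sgn x * y + c * t) / \<rho>) has_real_derivative - sgn x / \<rho>) (at x)"
    using c by (auto intro!: derivative_eq_intros)
  then have "((\<lambda>y. 1 - (sgn x * y + c * t) / \<rho>) has_vector_derivative - sgn x / \<rho>) (at x)"
    by (simp only: has_real_derivative_iff_has_vector_derivative)
  then have 2: "(cone_cutoff c \<rho> t has_vector_derivative - sgn x / \<rho>) (at x)"
  proof (rule has_vector_derivative_transform_within_open[OF _ o2])
    show "x \<in> {y. 0 < y * x} \<inter> {y. \<bar>y\<bar> + c * t < \<rho>}" using True x by (auto simp: zero_less_mult_iff)
    fix y assume y: "y \<in> {y. 0 < y * x} \<inter> {y. \<bar>y\<bar> + c * t < \<rho>}"
    then have "sgn x * y = \<bar>y\<bar>" by (auto simp: zero_less_mult_iff sgn_if)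
    then show "1 - (sgn x * y + c * t) / \<rho> = cone_cutoff c \<rho> t y" using y c t by (simp add: cone_cutoff_def)
  qed
  show thesis by (rule that[OF _ 1 2]) (use c x in \<open>auto simp: sgn_if\<close>)
next
  case False
  then have gt: "\<rho> < \<bar>x\<bar> + c * t" using x by simp
  have o1: "open ({0<..} \<inter> {s. \<rho> < \<bar>x\<bar> + c * s})" by (intro open_Int open_Collect_less continuous_intros open_greaterThan)
  have o2: "open {y. \<rho> < \<bar>y\<bar> + c * t}" by (intro open_Collect_less continuous_intros)
  have 1: "((\<lambda>s. cone_cutoff c \<rho> s x) has_vector_derivative 0) (at t)"
    by (rule has_vector_derivative_zero_on_open[OF o1]) (use gt t c in \<open>auto simp: cone_cutoff_def le_divide_eq\<close>)
  have 2: "(cone_cutoff c \<rho> t has_vector_derivative 0) (at x)"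
    by (rule has_vector_derivative_zero_on_open[OF o2]) (use gt t c in \<open>auto simp: cone_cutoff_def le_divide_eq\<close>)
  show thesis by (rule that[of 0 0]) (use 1 2 in auto)
qed

text \<open>Lebesgue differentiation for a bounded density: the primitive is Lipschitz, so it has an
  almost everywhere derivative whose interval integrals are its increments; the same integrals are
  those of \<open>\<beta>\<close>, so both agree.\<close>

lemma primitive_AE_derivative:
  fixes \<beta> :: "real \<Rightarrow> real"
  assumes \<beta>: "\<beta> \<in> borel_measurable borel" "\<And>t. 0 \<le> \<beta> t" "\<And>t. \<beta> t \<le> K" "\<And>t. t < 0 \<Longrightarrow> \<beta> t = 0"
  defines "B \<equiv> \<lambda>t. LINT s:{0..t}|lborel. \<beta> s"
  shows "K-lipschitz_on UNIV B" "\<And>s t. s \<le> t \<Longrightarrow> B s \<le> B t" "\<And>t. 0 \<le> B t" "AE t in lborel. (B has_vector_derivative \<beta> t) (at t)"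
proof -
  have si: "set_integrable lborel {a..b} \<beta>" for a b by (rule set_integrable_bounded[OF \<beta>(1), of K]) (use \<beta> in auto)
  \<comment> \<open>Valid also for negative end points, where \<open>B\<close> is constant because
    \<open>\<beta>\<close> vanishes there.\<close>
  have diff: "B b - B a = (LINT s:{a..b}|lborel. \<beta> s)" if "a \<le> b" for a b
  proof -
    have "B b - B a = (LINT s|lborel. indicator {0..b} s *\<^sub>R \<beta> s - indicator {0..a} s *\<^sub>R \<beta> s)"
      using si unfolding B_def set_lebesgue_integral_def set_integrable_def by (subst Bochner_Integration.integral_diff) auto
    also have "\<dots> = (LINT s:{a..b}|lborel. \<beta> s)"
      unfolding set_lebesgue_integral_def
    proof (rule integral_cong_AE)
      show "AE s in lborel. indicat_real {0..b} s *\<^sub>R \<beta> s - indicat_real {0..a} s *\<^sub>R \<beta> s = indicat_real {a..b} s *\<^sub>R \<beta> s"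
        using AE_lborel_singleton[of a]
      proof eventually_elim
        case (elim s)
        show ?case using elim \<beta>(4)[of s] that by (cases "s < 0") (auto simp: indicator_def)
      qed
    qed (use \<beta>(1) in auto)
    finally show ?thesis .
  qed
  have up: "(LINT s:{a..b}|lborel. \<beta> s) \<le> K * (b - a)" if "a \<le> b" for a b
  proof -
    have "(LINT s:{a..b}|lborel. \<beta> s) \<le> (LINT s:{a..b}|lborel. K)"
      by (rule set_integral_mono[OF si]) (use \<beta> in \<open>auto simp: set_integrable_def emeasure_lborel_Icc_eq\<close>)
    then show ?thesis using that by (simp add: set_lebesgue_integral_def mult.commute)
  qed
  have lo: "0 \<le> (LINT s:{a..b}|lborel. \<beta> s)" for a b
    unfolding set_lebesgue_integral_def using \<beta>(2) by (intro Bochner_Integration.integral_nonneg) auto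
  show mono: "B s \<le> B t" if "s \<le> t" for s t using diff[OF that] lo[of s t] by simp
  show "0 \<le> B t" for t unfolding B_def by (rule lo)
  have K0: "0 \<le> K" using \<beta>(2)[of 0] \<beta>(3)[of 0] by linarith
  show lip: "K-lipschitz_on UNIV B"
  proof (rule lipschitz_onI[OF _ K0])
    fix x y
    show "dist (B x) (B y) \<le> K * dist x y"
      using diff[of x y] diff[of y x] up[of x y] up[of y x] mono[of x y] mono[of y x]
      by (cases "x \<le> y") (auto simp: dist_real_def)
  qed
  obtain g where g: "g \<in> borel_measurable borel" "\<And>t. \<bar>g t\<bar> \<le> K" "\<And>a b. a \<le> b \<Longrightarrow> (LINT t:{a..b}|lborel. g t) = B b - B a"
    "AE t in lborel. (B has_real_derivative g t) (at t)"
    using Lipschitz_real_AE_derivative[OF lip] by metis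
  have sg: "set_integrable lborel {a..b} g" for a b by (rule set_integrable_bounded[OF g(1), of K]) (use g in auto)
  have "AE t in lborel. g t - \<beta> t = 0"
    by (rule AE_eq_0_if_interval_integrals_eq_0) (auto simp: set_integral_diff si sg g(3) diff)
  with g(4) show "AE t in lborel. (B has_vector_derivative \<beta> t) (at t)"
    by eventually_elim (simp add: has_real_derivative_iff_has_vector_derivative)
qed

context entropy_system
begin

lemma Df_bound:
  obtains K where "0 \<le> K" "\<And>w v. w \<in> C \<Longrightarrow> norm (Df w v) \<le> K * norm v"
  using C2_on_bounds[OF C2_f open_U compact_C C_sub] by metis

lemma bounded_f:
  obtains B where "0 \<le> B" "\<And>w. w \<in> C \<Longrightarrow> norm (f w) \<le> B"
proof -
  have "continuous_on C f" using C2_onD(1)[OF C2_f] CU by (intro continuous_at_imp_continuous_on ballI has_derivative_continuous) blast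
  then have "bounded (f ` C)" using compact_C by (intro compact_imp_bounded compact_continuous_image)
  then obtain B1 where "\<forall>y\<in>f ` C. norm y \<le> B1" unfolding bounded_iff by blast
  then show thesis by (intro that[of "max 0 B1"]) (auto simp: le_max_iff_disj)
qed

lemma bounded_diff_C:
  obtains B where "0 \<le> B" "\<And>w w'. w \<in> C \<Longrightarrow> w' \<in> C \<Longrightarrow> norm (w - w') \<le> B"
proof -
  obtain B1 where "\<forall>y\<in>C. norm y \<le> B1" using compact_imp_bounded[OF compact_C] unfolding bounded_iff by blast
  then have "norm (w - w') \<le> B1 + B1" if "w \<in> C" "w' \<in> C" for w w'
  proof -
    have "norm w \<le> B1" "norm w' \<le> B1" using that \<open>\<forall>y\<in>C. norm y \<le> B1\<close> by auto
    then show ?thesis using norm_triangle_ineq4[of w w'] by linarith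
  qed
  then show thesis by (intro that[of "max 0 (B1 + B1)"]) (auto simp: le_max_iff_disj)
qed

text \<open>Testing with a ramp on \<open>(0, \<tau>)\<close> times \<open>\<psi>\<close> turns the
  time derivative into an average of the moments of \<open>u\<close> over
  \<open>(0, \<tau>)\<close>. It tends to the moment at time 0 by weak continuity, while the flux
  term is of order \<open>\<tau>\<close> because \<open>f\<close> is bounded on \<open>C\<close>.
  The datum entering the weak formulation is thus the value of the weakly continuous
  representative.\<close>

lemma initial_trace:
  assumes T: "0 < T" and sol: "weak_solution T f u0 u" and W: "weakly_continuous_in_time T u"
    and uC: "AE (t, x) in time_strip T. u t x \<in> C"
  shows "AE x in lborel. u 0 x = u0 x"
proof -
  have li0: "locally_integrable_R (u 0)" using W T by (auto simp: weakly_continuous_in_time_def)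
  have liu0: "locally_integrable_R u0" and lit: "locally_integrable T u" "locally_integrable T (\<lambda>t x. f (u t x))"
    using sol by (auto simp: weak_solution_def)
  obtain Bf where Bf: "0 \<le> Bf" "\<And>w. w \<in> C \<Longrightarrow> norm (f w) \<le> Bf" using bounded_f by metis
  have "AE x in lborel. u 0 x - u0 x = 0"
  proof (rule AE_eq_0_of_Lipschitz_tests)
    show "locally_integrable_R (\<lambda>x. u 0 x - u0 x)"
      using li0 liu0 unfolding locally_integrable_R_def by (auto intro: set_integral_diff)
    fix \<psi> :: "real \<Rightarrow> real" and L a
    assume \<psi>: "L-lipschitz_on UNIV \<psi>" "\<And>x. 0 \<le> \<psi> x \<and> \<psi> x \<le> 1" "\<And>x. a \<le> \<bar>x\<bar> \<Longrightarrow> \<psi> x = 0"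
    have \<psi>c: "continuous_on UNIV \<psi>" using \<psi>(1) by (rule lipschitz_on_continuous_on)
    have \<psi>m[measurable]: "\<psi> \<in> borel_measurable borel" using \<psi>c by (rule borel_measurable_continuous_onI)
    have \<psi>K: "\<exists>K. compact K \<and> (\<forall>x. x \<notin> K \<longrightarrow> \<psi> x = 0)"
      using \<psi>(3)[OF less_imp_le] by (intro exI[of _ "{-a..a}"] conjI allI impI compact_Icc) (simp only: not_in_symmetric_interval)
    have \<psi>abs: "\<bar>\<psi> x\<bar> \<le> 1" for x using \<psi>(2)[of x] by linarith
    define U where "U t = (LINT x|lborel. \<psi> x *\<^sub>R u t x)" for t
    have Uc: "continuous_on {0..T} U" using W \<psi>c \<psi>K unfolding weakly_continuous_in_time_def U_def by blast
    have int_\<psi>: "integrable lborel (\<lambda>x. \<psi> x *\<^sub>R y x)" if "locally_integrable_R y" for y :: "real \<Rightarrow> real^'m"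
      by (rule integrable_test_times_local_R[OF that \<psi>m, where B=1 and a=a]) (use \<psi>abs \<psi>(3) in auto)
    have L0: "0 \<le> L" using \<psi>(1) by (rule lipschitz_on_nonneg)
    \<comment> \<open>\<open>a\<close> may be negative; the replacement makes the width
      \<open>2 * a'\<close> of the spatial support nonnegative.\<close>
    define a' where "a' = max 0 a"
    have est: "norm (U 0 - (LINT x|lborel. \<psi> x *\<^sub>R u0 x)) \<le> e + L * Bf * (2 * a') * \<tau>"
      if \<tau>: "0 < \<tau>" "\<tau> < T" and e: "\<And>t. t \<in> {0..\<tau>} \<Longrightarrow> norm (U t - U 0) \<le> e" for \<tau> e
    proof -
      define \<phi> where "\<phi> t x = ramp 0 \<tau> t * \<psi> x" for t x
      note r = ramp_props[OF \<tau>(1)]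
      have lip: "(1 / (\<tau> - 0) * 1 + 1 * L)-lipschitz_on UNIV (\<lambda>z. (case z of (t, x::real) \<Rightarrow> ramp 0 \<tau> t) * (case z of (t::real, x) \<Rightarrow> \<psi> x))"
        by (rule lipschitz_on_mult_bounded[OF lipschitz_on_fst_snd(1)[OF r(5)] lipschitz_on_fst_snd(2)[OF \<psi>(1)]])
           (use r(1,2) \<psi>abs in auto)
      then have lip: "(1 / (\<tau> - 0) * 1 + 1 * L)-lipschitz_on UNIV (\<lambda>(t, x). \<phi> t x)"
        by (simp add: \<phi>_def case_prod_unfold)
      have sup: "\<phi> t x = 0" if "\<tau> \<le> t \<or> a \<le> \<bar>x\<bar>" for t x using that r(4)[of t] \<psi>(3)[of x] by (auto simp: \<phi>_def)
      have "test_function T \<phi>"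
        unfolding test_function_def
      proof (intro conjI exI)
        show "(1 / (\<tau> - 0) * 1 + 1 * L)-lipschitz_on ({0..<T} \<times> UNIV) (\<lambda>(t, x). \<phi> t x)" using lip by (rule lipschitz_on_subset) auto
        show "compact ({0..\<tau>} \<times> {-a..a})" by (intro compact_Times) auto
        show "{0..\<tau>} \<times> {-a..a} \<subseteq> {0..<T} \<times> UNIV" using \<tau> by auto
        show "\<forall>t\<in>{0..<T}. \<forall>x. (t, x) \<notin> {0..\<tau>} \<times> {-a..a} \<longrightarrow> \<phi> t x = 0"
        proof (intro ballI allI impI)
          fix t x assume "t \<in> {0..<T}" "(t, x) \<notin> {0..\<tau>} \<times> {-a..a}"
          then have "\<tau> \<le> t \<or> a \<le> \<bar>x\<bar>" by auto
          then show "\<phi> t x = 0" by (rule sup)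
        qed
      qed
      then have weak: "(LINT (t, x)|time_strip T. dt \<phi> t x *\<^sub>R u t x + dx \<phi> t x *\<^sub>R f (u t x)) + (LINT x|lborel. \<phi> 0 x *\<^sub>R u0 x) = 0"
        using sol by (auto simp: weak_solution_def)
      have \<phi>0: "\<phi> 0 x = \<psi> x" for x using r(3)[of 0] by (simp add: \<phi>_def)
      have c: "continuous_on UNIV (\<lambda>(t, x). \<phi> t x)" using lip by (rule lipschitz_on_continuous_on)
      have Z: "dt \<phi> t x = 0 \<and> dx \<phi> t x = 0" if "0 < t" "\<tau> < t \<or> a < \<bar>x\<bar>" for t x
        using support_partial_derivatives[of \<tau> a \<phi> t x] sup that by blast
      have B: "AE (t, x) in time_strip T. \<bar>dt \<phi> t x\<bar> \<le> 1 / (\<tau> - 0) * 1 + 1 * L" "AE (t, x) in time_strip T. \<bar>dx \<phi> t x\<bar> \<le> 1 / (\<tau> - 0) * 1 + 1 * L"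
        by (rule AE_time_stripI, use Lipschitz_AE_partial_derivatives[OF lip] in eventually_elim, auto)+
      have i1: "integrable (time_strip T) (\<lambda>(t, x). dt \<phi> t x *\<^sub>R u t x)"
        by (rule integrable_test_times_local[OF lit(1) borel_measurable_dt(2)[OF c] B(1), where b=\<tau> and \<rho>=a]) (use Z \<tau> in simp_all)
      have i2: "integrable (time_strip T) (\<lambda>(t, x). dx \<phi> t x *\<^sub>R f (u t x))"
        by (rule integrable_test_times_local[OF lit(2) borel_measurable_dx(2)[OF c] B(2), where b=\<tau> and \<rho>=a]) (use Z \<tau> in simp_all)
      have "(LINT z|time_strip T. (case z of (t, x) \<Rightarrow> dt \<phi> t x *\<^sub>R u t x) + (case z of (t, x) \<Rightarrow> dx \<phi> t x *\<^sub>R f (u t x)))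
         + (LINT x|lborel. \<psi> x *\<^sub>R u0 x) = 0"
        using weak by (simp add: case_prod_unfold \<phi>0)
      then have split: "(LINT (t, x)|time_strip T. dt \<phi> t x *\<^sub>R u t x) + (LINT (t, x)|time_strip T. dx \<phi> t x *\<^sub>R f (u t x)) + (LINT x|lborel. \<psi> x *\<^sub>R u0 x) = 0"
        using i1 i2 by simp
      \<comment> \<open>Equal to minus the average of \<open>U\<close> over
        \<open>(0, \<tau>)\<close>, since the ramp has slope \<open>- 1 / \<tau>\<close>
        there.\<close>
      define D where "D = (LINT (t, x)|time_strip T. dt \<phi> t x *\<^sub>R u t x)"
      have D: "norm (D + U 0) \<le> e"
      proof -
        have i1': "integrable (lborel \<Otimes>\<^sub>M lborel) (\<lambda>(t, x). indicator {0<..<T} t *\<^sub>R (dt \<phi> t x *\<^sub>R u t x))"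
          using i1 unfolding integrable_time_strip_iff lborel_prod
          by (rule Bochner_Integration.integrable_cong[THEN iffD1, rotated -1]) (auto simp: indicator_def)
        have "D = (LINT z|(lborel \<Otimes>\<^sub>M lborel). (case z of (t, x) \<Rightarrow> indicator {0<..<T} t *\<^sub>R (dt \<phi> t x *\<^sub>R u t x)))"
          unfolding D_def integral_time_strip lborel_prod
          by (rule Bochner_Integration.integral_cong) (auto simp: indicator_def)
        also have "\<dots> = (LINT t|lborel. LINT x|lborel. indicator {0<..<T} t *\<^sub>R (dt \<phi> t x *\<^sub>R u t x))"
          using lborel_pair.integral_fst'[OF i1'] by simp
        also have "\<dots> = (LINT t|lborel. indicator {0..\<tau>} t *\<^sub>R ((- (1 / \<tau>)) *\<^sub>R U t))"
        proof (rule integral_cong_AE)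
          show "(\<lambda>t. LINT x|lborel. indicator {0<..<T} t *\<^sub>R (dt \<phi> t x *\<^sub>R u t x)) \<in> borel_measurable lborel"
            using lborel_pair.integrable_fst'[OF i1'] by (auto dest: borel_measurable_integrable)
          have "continuous_on {0..\<tau>} U" using Uc \<tau> by (auto intro: continuous_on_subset)
          then have "set_borel_measurable borel {0..\<tau>} (\<lambda>t. (- (1 / \<tau>)) *\<^sub>R U t)"
            unfolding set_borel_measurable_def by (intro borel_measurable_continuous_on_indicator) (auto intro!: continuous_intros)
          then show "(\<lambda>t. indicator {0..\<tau>} t *\<^sub>R ((- (1 / \<tau>)) *\<^sub>R U t)) \<in> borel_measurable lborel"
            by (simp add: set_borel_measurable_def)
          show "AE t in lborel. (LINT x|lborel. indicator {0<..<T} t *\<^sub>R (dt \<phi> t x *\<^sub>R u t x)) = indicator {0..\<tau>} t *\<^sub>R ((- (1 / \<tau>)) *\<^sub>R U t)"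
            using AE_lborel_singleton[of 0] AE_lborel_singleton[of \<tau>]
          proof eventually_elim
            case (elim t)
            show ?case
            proof (cases "t \<in> {0<..<T}")
              case True
              have "(ramp 0 \<tau> has_vector_derivative (if 0 < t \<and> t < \<tau> then - 1 / (\<tau> - 0) else 0)) (at t)"
                using r(6)[of t] elim by simp
              then have "((\<lambda>s. ramp 0 \<tau> s * \<psi> x) has_vector_derivative (if 0 < t \<and> t < \<tau> then - 1 / (\<tau> - 0) else 0) * \<psi> x) (at t)" for x
                by (rule has_vector_derivative_mult_left)
              then have "dt \<phi> t x = (if 0 < t \<and> t < \<tau> then - 1 / (\<tau> - 0) else 0) * \<psi> x" for x
                unfolding dt_def \<phi>_def by (rule vector_derivative_at)
              then have "(LINT x|lborel. indicator {0<..<T} t *\<^sub>R (dt \<phi> t x *\<^sub>R u t x)) = (LINT x|lborel. (indicator {0..\<tau>} t * (- (1 / \<tau>))) *\<^sub>R (\<psi> x *\<^sub>R u t x))"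
                using True elim by (intro Bochner_Integration.integral_cong) (auto simp: indicator_def)
              also have "\<dots> = (indicator {0..\<tau>} t * (- (1 / \<tau>))) *\<^sub>R U t" unfolding U_def by (rule integral_scaleR_right)
              finally show ?thesis by simp
            qed (use elim \<tau> in \<open>auto simp: indicator_def\<close>)
          qed
        qed
        finally have Deq: "D = (LINT t|lborel. indicator {0..\<tau>} t *\<^sub>R ((- (1 / \<tau>)) *\<^sub>R U t))" .
        have iU: "integrable lborel (\<lambda>t. indicator {0..\<tau>} t *\<^sub>R ((- (1 / \<tau>)) *\<^sub>R U t))"
        proof -
          have "continuous_on {0..\<tau>} U" using Uc \<tau> by (auto intro: continuous_on_subset)
          then have "continuous_on {0..\<tau>} (\<lambda>t. (- (1 / \<tau>)) *\<^sub>R U t)" by (intro continuous_intros)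
          from borel_integrable_compact[OF compact_Icc this] show ?thesis .
        qed
        have ic: "integrable lborel (\<lambda>t. indicator {0..\<tau>} t *\<^sub>R ((1 / \<tau>) *\<^sub>R U 0))"
          by (auto simp: emeasure_lborel_Icc_eq intro!: integrable_scaleR_left)
        have "(LINT t|lborel. indicator {0..\<tau>} t *\<^sub>R ((1 / \<tau>) *\<^sub>R U 0)) = U 0" using \<tau> by simp
        then have "D + U 0 = (LINT t|lborel. indicator {0..\<tau>} t *\<^sub>R ((- (1 / \<tau>)) *\<^sub>R U t) + indicator {0..\<tau>} t *\<^sub>R ((1 / \<tau>) *\<^sub>R U 0))"
          unfolding Deq using iU ic by (subst Bochner_Integration.integral_add) auto
        also have "norm \<dots> \<le> (LINT t|lborel. indicator {0..\<tau>} t * (e / \<tau>))"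
        proof (rule order_trans[OF Bochner_Integration.integral_norm_bound], rule integral_mono)
          show "integrable lborel (\<lambda>t. norm (indicator {0..\<tau>} t *\<^sub>R ((- (1 / \<tau>)) *\<^sub>R U t) + indicator {0..\<tau>} t *\<^sub>R ((1 / \<tau>) *\<^sub>R U 0)))"
            by (rule integrable_norm[OF Bochner_Integration.integrable_add[OF iU ic]])
          show "integrable lborel (\<lambda>t. indicator {0..\<tau>} t * (e / \<tau>))" by (auto simp: emeasure_lborel_Icc_eq)
          fix t
          show "norm (indicator {0..\<tau>} t *\<^sub>R ((- (1 / \<tau>)) *\<^sub>R U t) + indicator {0..\<tau>} t *\<^sub>R ((1 / \<tau>) *\<^sub>R U 0)) \<le> indicator {0..\<tau>} t * (e / \<tau>)"
          proof (cases "t \<in> {0..\<tau>}")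
            case True
            have "norm ((- (1 / \<tau>)) *\<^sub>R U t + (1 / \<tau>) *\<^sub>R U 0) = norm (U t - U 0) / \<tau>"
            proof -
              have "(- (1 / \<tau>)) *\<^sub>R U t + (1 / \<tau>) *\<^sub>R U 0 = (- (1 / \<tau>)) *\<^sub>R (U t - U 0)" by (simp add: scaleR_diff_right)
              then show ?thesis using \<tau> by simp
            qed
            then show ?thesis using e[OF True] True \<tau> by (simp add: divide_right_mono)
          qed simp
        qed
        also have "\<dots> = e" using \<tau> by simp
        finally show ?thesis .
      qed
      have F: "norm (LINT (t, x)|time_strip T. dx \<phi> t x *\<^sub>R f (u t x)) \<le> L * Bf * (2 * a') * \<tau>"
      proof -
        define A where "A = {0..\<tau>} \<times> {-a'..a'}"
        have As: "A \<in> sets borel" unfolding A_def by (intro borel_closed closed_Times) auto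
        have Aem: "emeasure lborel A = ennreal (\<tau> * (2 * a'))"
          unfolding A_def lborel_prod[symmetric] using \<tau>
          by (subst lborel.emeasure_pair_measure_Times) (auto simp: a'_def ennreal_mult[symmetric])
        have iA: "integrable lborel (\<lambda>z. L * Bf * indicat_real A z)" using As Aem by auto
        have "norm (LINT z|time_strip T. (case z of (t, x) \<Rightarrow> dx \<phi> t x *\<^sub>R f (u t x))) \<le> (LINT z|time_strip T. L * Bf * indicat_real A z)"
        proof (rule Bochner_Integration.integral_norm_bound[THEN order_trans], rule integral_mono_AE)
          show "integrable (time_strip T) (\<lambda>z. norm (case z of (t, x) \<Rightarrow> dx \<phi> t x *\<^sub>R f (u t x)))" using i2 by (rule integrable_norm)
          show "integrable (time_strip T) (\<lambda>z. L * Bf * indicat_real A z)"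
            unfolding integrable_time_strip_iff using iA by (intro integrable_mult_indicator) (simp_all add: strip_sets)
          have "AE z in lborel. norm (dx \<phi> (fst z) (snd z)) \<le> L"
            using Lipschitz_AE_partial_derivatives[OF lip]
          proof eventually_elim
            case (elim z)
            obtain t x where z: "z = (t, x)" by (cases z)
            have d: "(\<phi> t has_vector_derivative dx \<phi> t x) (at x)" using elim z by simp
            \<comment> \<open>In the spatial variable alone the constant remains \<open>L\<close>.
              The joint constant contains \<open>1 / \<tau>\<close> and would destroy the smallness
              of the flux term as \<open>\<tau>\<close> tends to 0.\<close>
            have "L-lipschitz_on UNIV (\<phi> t)"
            proof (rule lipschitz_onI[OF _ L0])
              fix y y'
              have "\<bar>ramp 0 \<tau> t\<bar> * \<bar>\<psi> y - \<psi> y'\<bar> \<le> 1 * (L * dist y y')"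
                using r(1,2)[of t] lipschitz_onD[OF \<psi>(1), of y y'] by (intro mult_mono) (auto simp: dist_real_def)
              then show "dist (\<phi> t y) (\<phi> t y') \<le> L * dist y y'" by (simp add: \<phi>_def dist_real_def right_diff_distrib[symmetric] abs_mult)
            qed
            from has_vector_derivative_Lipschitz_le[OF this d] show ?case by (simp add: z)
          qed
          then have "AE z in time_strip T. norm (dx \<phi> (fst z) (snd z)) \<le> L" by (intro AE_time_stripI) (erule eventually_mono, simp)
          then show "AE z in time_strip T. norm (case z of (t, x) \<Rightarrow> dx \<phi> t x *\<^sub>R f (u t x)) \<le> L * Bf * indicat_real A z"
            using uC AE_space
          proof eventually_elim
            case (elim z)
            obtain t x where z: "z = (t, x)" by (cases z)
            have t: "0 < t" using elim(3) by (simp add: z space_time_strip)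
            show ?case
            proof (cases "z \<in> A")
              case True
              have "norm (dx \<phi> t x) * norm (f (u t x)) \<le> L * Bf" using elim Bf L0 by (intro mult_mono) (auto simp: z)
              then show ?thesis using True by (simp add: z)
            next
              case False
              then have "\<tau> < t \<or> a < \<bar>x\<bar>" using t by (auto simp: A_def z a'_def)
              then show ?thesis using Z[OF t] False by (simp add: z)
            qed
          qed
        qed
        also have "\<dots> \<le> (LINT z|lborel. L * Bf * indicat_real A z)"
          unfolding integral_time_strip
          by (rule integral_mono[OF integrable_mult_indicator[OF _ iA] iA])
             (use L0 Bf(1) in \<open>auto simp: strip_sets indicator_def\<close>)
        also have "\<dots> = L * Bf * (\<tau> * (2 * a'))" using Aem \<tau> by (simp add: measure_def a'_def)
        finally show ?thesis by (simp add: mult_ac)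
      qed
      have eq: "U 0 - (LINT x|lborel. \<psi> x *\<^sub>R u0 x) = (D + U 0) + (LINT (t, x)|time_strip T. dx \<phi> t x *\<^sub>R f (u t x))"
        using split unfolding D_def by (simp add: algebra_simps eq_neg_iff_add_eq_0)
      show ?thesis
        unfolding eq using norm_triangle_ineq[of "D + U 0" "LINT (t, x)|time_strip T. dx \<phi> t x *\<^sub>R f (u t x)"] D F by linarith
    qed
    have "norm (U 0 - (LINT x|lborel. \<psi> x *\<^sub>R u0 x)) \<le> 0"
    proof (rule field_le_epsilon)
      fix e :: real assume e: "0 < e"
      have "\<exists>d>0. \<forall>t\<in>{0..T}. dist t 0 < d \<longrightarrow> dist (U t) (U 0) < e / 2"
        using Uc[unfolded continuous_on_iff, rule_format, of 0 "e / 2"] T e by auto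
      then obtain d where d: "d > 0" "\<And>t. t \<in> {0..T} \<Longrightarrow> dist t 0 < d \<Longrightarrow> dist (U t) (U 0) < e / 2" by blast
      define c where "c = L * Bf * (2 * a')"
      have c: "0 \<le> c" using L0 Bf(1) by (simp add: c_def a'_def)
      \<comment> \<open>Small enough for weak continuity to give \<open>e / 2\<close> and for the
        flux term to be at most \<open>e / 2\<close>; the summand 1 guards against
        \<open>c = 0\<close>.\<close>
      define \<tau> where "\<tau> = min (min (d / 2) (T / 2)) (e / 2 / (c + 1))"
      have \<tau>: "0 < \<tau>" "\<tau> < T" "\<tau> < d" using d T e c by (auto simp: \<tau>_def)
      have "c * \<tau> \<le> (c + 1) * (e / 2 / (c + 1))" using c e \<tau> by (intro mult_mono) (auto simp: \<tau>_def)
      also have "\<dots> = e / 2"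
      proof -
        have "k * (e / 2 / k) = e / 2" if "k \<noteq> 0" for k :: real using that by simp
        from this[of "c + 1"] c show ?thesis by linarith
      qed
      finally have c\<tau>: "c * \<tau> \<le> e / 2" .
      have "norm (U 0 - (LINT x|lborel. \<psi> x *\<^sub>R u0 x)) \<le> e / 2 + c * \<tau>"
        unfolding c_def
      proof (rule est[OF \<tau>(1,2)])
        fix t assume "t \<in> {0..\<tau>}"
        then show "norm (U t - U 0) \<le> e / 2" using d(2)[of t] \<tau> by (simp add: dist_norm)
      qed
      then show "norm (U 0 - (LINT x|lborel. \<psi> x *\<^sub>R u0 x)) \<le> 0 + e" using c\<tau> by simp
    qed
    then have "U 0 = (LINT x|lborel. \<psi> x *\<^sub>R u0 x)" by simp
    then show "(LINT x|lborel. \<psi> x *\<^sub>R (u 0 x - u0 x)) = 0"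
      using int_\<psi>[OF li0] int_\<psi>[OF liu0] by (simp add: scaleR_diff_right U_def)
  qed
  then show ?thesis by eventually_elim simp
qed

lemma residual_measurable:
  assumes v: "Lv-lipschitz_on UNIV (\<lambda>(t, x). v t x)" "\<And>t x. v t x \<in> C"
  shows "(\<lambda>(t, x). residual f v t x) \<in> borel_measurable borel"
    "AE (t, x) in lborel. residual f v t x = dt v t x + Df (v t x) (dx v t x)"
proof -
  have vc: "continuous_on UNIV (\<lambda>(t, x). v t x)" using v(1) by (rule lipschitz_on_continuous_on)
  have fc: "continuous_on U f" using C2_onD(1)[OF C2_f] by (intro continuous_at_imp_continuous_on ballI has_derivative_continuous) blast
  have "continuous_on UNIV (\<lambda>z. f (case z of (t, x) \<Rightarrow> v t x))"
    by (rule continuous_on_compose2[OF fc vc]) (use v(2) CU in auto)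
  then have fvc: "continuous_on UNIV (\<lambda>(t, x). f (v t x))" by (simp add: case_prod_unfold)
  show "(\<lambda>(t, x). residual f v t x) \<in> borel_measurable borel"
    using borel_measurable_add[OF borel_measurable_dt(2)[OF vc] borel_measurable_dx(2)[OF fvc]]
    by (simp add: residual_def case_prod_unfold)
  show "AE (t, x) in lborel. residual f v t x = dt v t x + Df (v t x) (dx v t x)"
    using Lipschitz_AE_partial_derivatives[OF v(1)]
  proof eventually_elim
    case (elim z)
    obtain t x where z: "z = (t, x)" by (cases z)
    have "(v t has_vector_derivative dx v t x) (at x)" using elim by (simp add: z)
    from has_vector_derivative_chain[OF this C2_onD(1)[OF C2_f CU[OF v(2)]]]
    have "dx (\<lambda>s z. f (v s z)) t x = Df (v t x) (dx v t x)" unfolding dx_def by (rule vector_derivative_at)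
    then show ?case by (simp add: z residual_def)
  qed
qed

text \<open>The rate \<open>\<beta>\<close> is tuned so that \<open>\<beta> * Cl / 2\<close> is the
  coefficient of the squared distance in \<open>source_bound\<close>; as \<open>rel_\<eta>\<close>
  is at least \<open>Cl / 2\<close> times that square, the growth is absorbed by the derivative of
  \<open>exp (- B t)\<close>. The right side is proportional to \<open>b - a\<close>, so it bounds
  an average over \<open>(a, b)\<close> independently of the length of the interval.\<close>

lemma averaged_stability:
  fixes u v :: "real \<Rightarrow> real \<Rightarrow> real ^ 'm"
  assumes Cf: "0 \<le> Cf" and ab: "0 \<le> a" "a < b" "b < T"
    and sol: "entropy_solution T f \<eta> q u0 u" and um: "(\<lambda>(t, x). u t x) \<in> borel_measurable (time_strip T)"
    and uC: "AE (t, x) in time_strip T. u t x \<in> C" and u0C: "AE x in lborel. u0 x \<in> C"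
    and v: "Lv-lipschitz_on UNIV (\<lambda>(t, x). v t x)" "\<And>t x. v t x \<in> C"
    and S: "S \<in> borel_measurable borel" "\<And>t. 0 \<le> S t" "\<And>t. S t \<le> BS" "AE (t, x) in time_strip T. norm (dx v t x) \<le> S t"
    and lam: "0 \<le> lam" "\<And>a b. a \<in> C \<Longrightarrow> b \<in> C \<Longrightarrow> \<bar>rel_q a b\<bar> \<le> lam * rel_\<eta> a b" and \<rho>: "0 < \<rho>"
  defines "\<beta> \<equiv> \<lambda>t. if 0 \<le> t then inverse Cl * (Cu * Cf * S t + Cu\<^sup>2) else 0"
  defines "B \<equiv> \<lambda>t. LINT s:{0..t}|lborel. \<beta> s"
  shows "(\<integral>\<^sup>+ (t, x). ennreal (indicator {a<..<b} t * cone_cutoff lam \<rho> t x * (norm (u t x - v t x))\<^sup>2) \<partial>time_strip T)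
    \<le> ennreal ((b - a) * exp (B b) * inverse Cl) *
      (ennreal Cu * (\<integral>\<^sup>+ x. ennreal ((norm (u0 x - v 0 x))\<^sup>2) \<partial>lborel) + sqnorm_L2 (time_strip b) (\<lambda>(t, x). residual f v t x))"
proof -
  have Cu: "0 \<le> Cu" using Cu_nonneg[OF v(2)] .
  have li0: "locally_integrable_R u0" using sol by (simp add: entropy_solution_def weak_solution_def)
  have u0m[measurable]: "u0 \<in> borel_measurable borel" by (rule locally_integrable_R_measurable[OF li0])
  have vc: "continuous_on UNIV (\<lambda>(t, x). v t x)" using v(1) by (rule lipschitz_on_continuous_on)
  have v0m[measurable]: "v 0 \<in> borel_measurable borel"
    using Lipschitz_sections(2)[OF v(1)] by (intro borel_measurable_continuous_onI lipschitz_on_continuous_on)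
  define K\<beta> where "K\<beta> = inverse Cl * (Cu * Cf * BS + Cu\<^sup>2)"
  have \<beta>: "\<beta> \<in> borel_measurable borel" "\<And>t. 0 \<le> \<beta> t" "\<And>t. \<beta> t \<le> K\<beta>" "\<And>t. t < 0 \<Longrightarrow> \<beta> t = 0"
  proof -
    show "\<beta> \<in> borel_measurable borel" unfolding \<beta>_def using S(1) by measurable
    show "0 \<le> \<beta> t" for t unfolding \<beta>_def using Cu Cf S(2) Cl_pos by auto
    have "0 \<le> BS" using S(2,3)[of 0] by linarith
    then have "0 \<le> K\<beta>" unfolding K\<beta>_def using Cu Cf Cl_pos by simp
    moreover have "inverse Cl * (Cu * Cf * S t + Cu\<^sup>2) \<le> K\<beta>" for t
      unfolding K\<beta>_def using S(3)[of t] Cu Cf Cl_pos by (intro mult_left_mono add_right_mono) auto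
    ultimately show "\<beta> t \<le> K\<beta>" for t by (simp add: \<beta>_def)
  qed (simp add: \<beta>_def)
  have BP: "K\<beta>-lipschitz_on UNIV B" "\<And>s t. s \<le> t \<Longrightarrow> B s \<le> B t" "\<And>t. 0 \<le> B t" "AE t in lborel. (B has_vector_derivative \<beta> t) (at t)"
    unfolding B_def by (rule primitive_AE_derivative[OF \<beta>]; assumption)+
  define \<mu> where "\<mu> t = exp (- B t)" for t
  have \<mu>: "0 < \<mu> t" "\<mu> t \<le> 1" for t using BP(3)[of t] by (auto simp: \<mu>_def)
  have \<mu>lip: "K\<beta>-lipschitz_on UNIV \<mu>"
  proof (rule lipschitz_onI)
    fix x y
    have "\<bar>exp (- s) - exp (- t)\<bar> \<le> \<bar>s - t\<bar>" if "0 \<le> s" "s \<le> t" for s t :: real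
    proof -
      have "exp (- s) - exp (- t) = exp (- s) * (1 - exp (- (t - s)))" by (simp add: right_diff_distrib exp_add[symmetric])
      also have "\<dots> \<le> 1 * (t - s)"
      proof (rule mult_mono)
        show "1 - exp (- (t - s)) \<le> t - s" using exp_ge_add_one_self[of "- (t - s)"] by linarith
      qed (use that in auto)
      finally show ?thesis using that by simp
    qed
    then have "\<bar>\<mu> x - \<mu> y\<bar> \<le> \<bar>B x - B y\<bar>"
      unfolding \<mu>_def using BP(3)[of x] BP(3)[of y] by (metis abs_minus_commute linear)
    also have "\<dots> \<le> K\<beta> * dist x y" using lipschitz_onD[OF BP(1), of x y] by (simp add: dist_real_def)
    finally show "dist (\<mu> x) (\<mu> y) \<le> K\<beta> * dist x y" by (simp add: dist_real_def)
  qed (rule lipschitz_on_nonneg[OF BP(1)])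
  note r = ramp_props[OF ab(2)] and cc = cone_cutoff_props[OF lam(1) \<rho>]
  define g where "g t = ramp a b t * \<mu> t" for t
  have g01: "0 \<le> g t" "g t \<le> 1" for t using r(1,2)[of t] \<mu>[of t] mult_mono[of "ramp a b t" 1 "\<mu> t" 1] by (auto simp: g_def less_imp_le)
  have glip: "(1 / (b - a) * 1 + 1 * K\<beta>)-lipschitz_on UNIV g"
    unfolding g_def[abs_def] by (rule lipschitz_on_mult_bounded[OF r(5) \<mu>lip]) (use r(1,2) \<mu> in \<open>auto simp: less_imp_le\<close>)
  define \<phi> where "\<phi> t x = g t * cone_cutoff lam \<rho> t x" for t x
  have \<phi>01: "0 \<le> \<phi> t x" "\<phi> t x \<le> 1" for t x
    using g01[of t] cc(1,2)[of t x] mult_mono[of "g t" 1 "cone_cutoff lam \<rho> t x" 1] by (auto simp: \<phi>_def)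
  obtain L where "L-lipschitz_on UNIV (\<lambda>z. (case z of (t, x::real) \<Rightarrow> g t) * (case z of (t, x) \<Rightarrow> cone_cutoff lam \<rho> t x))"
    using lipschitz_on_mult_bounded[OF lipschitz_on_fst_snd(1)[OF glip] cc(5), of 1 1] g01 cc(1,2) by auto
  then have \<phi>lip: "L-lipschitz_on UNIV (\<lambda>(t, x). \<phi> t x)" by (simp add: \<phi>_def case_prod_unfold)
  have \<phi>0: "\<phi> t x = 0" if "0 \<le> t" "b \<le> t \<or> \<rho> \<le> \<bar>x\<bar>" for t x
    using that r(4)[of t] cc(3)[of x t] by (auto simp: \<phi>_def g_def)
  have \<phi>m: "(\<lambda>(t, x). \<phi> t x) \<in> borel_measurable borel"
    using lipschitz_on_continuous_on[OF \<phi>lip] by (rule borel_measurable_continuous_onI)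
  have ccm: "(\<lambda>(t, x). cone_cutoff lam \<rho> t x) \<in> borel_measurable borel"
    using lipschitz_on_continuous_on[OF cc(5)] by (rule borel_measurable_continuous_onI)
  have b0: "0 \<le> b" using ab by simp
  obtain H where H: "integrable (time_strip T) H"
    "AE (t, x) in time_strip T. H (t, x) = dt \<phi> t x * rel_\<eta> (u t x) (v t x) + dx \<phi> t x * rel_q (u t x) (v t x)
       - \<phi> t x * (hess \<eta> (v t x) (u t x - v t x) (dt v t x) + hess \<eta> (v t x) (f (u t x) - f (v t x)) (dx v t x))"
    "integrable lborel (\<lambda>x. \<phi> 0 x * rel_\<eta> (u0 x) (v 0 x))"
    "0 \<le> (LINT z|time_strip T. H z) + (LINT x|lborel. \<phi> 0 x * rel_\<eta> (u0 x) (v 0 x))"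
    by (rule relative_entropy_inequality[OF b0 ab(3) sol v \<phi>lip \<phi>01 \<phi>0])
  \<comment> \<open>The product of the smallest value of the weight on \<open>(a, b)\<close>, the
    lower constant of the relative entropy, and the slope of the ramp.\<close>
  define c0 where "c0 = exp (- B b) * (Cl / 2) / (b - a)"
  have c0: "0 < c0" using Cl_pos ab by (simp add: c0_def)
  define Q where "Q z = (case z of (t, x) \<Rightarrow> indicator {a<..<b} t * cone_cutoff lam \<rho> t x * (norm (u t x - v t x))\<^sup>2)" for z
  define Rs where "Rs z = (case z of (t, x) \<Rightarrow> \<phi> t x * (norm (residual f v t x))\<^sup>2)" for z
  obtain BC where BC: "0 \<le> BC" "\<And>w w'. w \<in> C \<Longrightarrow> w' \<in> C \<Longrightarrow> norm (w - w') \<le> BC" using bounded_diff_C by metis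
  obtain Kf where Kf: "0 \<le> Kf" "\<And>w v. w \<in> C \<Longrightarrow> norm (Df w v) \<le> Kf * norm v" using Df_bound by metis
  have [measurable]: "(\<lambda>z. v (fst z) (snd z)) \<in> borel_measurable (time_strip T)"
    using measurable_time_strip[OF borel_measurable_continuous_onI[OF vc]] by (simp add: case_prod_unfold)
  have [measurable]: "(\<lambda>z. u (fst z) (snd z)) \<in> borel_measurable (time_strip T)" using um by (simp add: case_prod_unfold)
  have [measurable]: "(\<lambda>z. cone_cutoff lam \<rho> (fst z) (snd z)) \<in> borel_measurable (time_strip T)"
    using measurable_time_strip[OF ccm] by (simp add: case_prod_unfold)
  have [measurable]: "(\<lambda>z. \<phi> (fst z) (snd z)) \<in> borel_measurable (time_strip T)"
    using measurable_time_strip[OF \<phi>m] by (simp add: case_prod_unfold)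
  have [measurable]: "(\<lambda>z. residual f v (fst z) (snd z)) \<in> borel_measurable (time_strip T)"
    using measurable_time_strip[OF residual_measurable(1)[OF v]] by (simp add: case_prod_unfold)
  have [measurable]: "(\<lambda>z. indicat_real {a<..<b} (fst z)) \<in> borel_measurable (time_strip T)"
  proof -
    have "fst \<in> borel_measurable (borel :: (real \<times> real) measure)" by (intro borel_measurable_continuous_onI continuous_intros)
    then show ?thesis by (intro measurable_time_strip borel_measurable_indicator') auto
  qed
  have Qm: "Q \<in> borel_measurable (time_strip T)" unfolding Q_def case_prod_unfold by measurable
  have Rm: "Rs \<in> borel_measurable (time_strip T)" unfolding Rs_def case_prod_unfold by measurable
  have Q0: "0 \<le> Q z" for z using cc(1) by (auto simp: Q_def split: prod.splits)
  have R0: "0 \<le> Rs z" for z using \<phi>01(1) by (auto simp: Rs_def split: prod.splits)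
  have iQ: "integrable (time_strip T) Q"
  proof (rule integrable_time_strip_bounded[where \<rho>=\<rho> and B="BC\<^sup>2"])
    show "AE z in time_strip T. norm (Q z) \<le> BC\<^sup>2"
      using uC
    proof eventually_elim
      case (elim z)
      obtain t x where z: "z = (t, x)" by (cases z)
      have "indicat_real {a<..<b} t * cone_cutoff lam \<rho> t x * (norm (u t x - v t x))\<^sup>2 \<le> 1 * 1 * BC\<^sup>2"
        using cc(1,2)[of t x] BC(2)[of "u t x" "v t x"] elim v(2) by (intro mult_mono power_mono) (auto simp: z indicator_def)
      then show ?case using Q0[of z] by (simp add: Q_def z)
    qed
    show "AE (t, x) in time_strip T. \<rho> < \<bar>x\<bar> \<longrightarrow> Q (t, x) = 0" using cc(3) by (auto simp: Q_def less_imp_le)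
  qed (rule Qm)
  have dd: "AE (t, x) in time_strip T. residual f v t x = dt v t x + Df (v t x) (dx v t x) \<and> norm (dt v t x) \<le> Lv \<and> norm (dx v t x) \<le> Lv"
    by (rule AE_time_stripI) (use residual_measurable(2)[OF v] Lipschitz_AE_partial_derivatives[OF v(1)] in eventually_elim, auto)
  have iR: "integrable (time_strip T) Rs"
  proof (rule integrable_time_strip_bounded[where \<rho>=\<rho> and B="(Lv + Kf * Lv)\<^sup>2"])
    show "AE z in time_strip T. norm (Rs z) \<le> (Lv + Kf * Lv)\<^sup>2"
      using dd
    proof eventually_elim
      case (elim z)
      obtain t x where z: "z = (t, x)" by (cases z)
      have "norm (Df (v t x) (dx v t x)) \<le> Kf * Lv"
        using Kf(2)[OF v(2), of t x "dx v t x"] mult_left_mono[OF _ Kf(1), of "norm (dx v t x)" Lv] elim by (auto simp: z)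
      then have "norm (residual f v t x) \<le> Lv + Kf * Lv"
        using elim norm_triangle_ineq[of "dt v t x" "Df (v t x) (dx v t x)"] by (auto simp: z)
      then have "\<phi> t x * (norm (residual f v t x))\<^sup>2 \<le> 1 * (Lv + Kf * Lv)\<^sup>2"
        using \<phi>01[of t x] by (intro mult_mono power_mono) auto
      then show ?case using R0[of z] by (simp add: Rs_def z)
    qed
    show "AE (t, x) in time_strip T. \<rho> < \<bar>x\<bar> \<longrightarrow> Rs (t, x) = 0"
      using AE_space by eventually_elim (auto simp: Rs_def space_time_strip intro: \<phi>0)
  qed (rule Rm)
  have pointwise: "AE z in time_strip T. H z \<le> - (c0 * Q z) + Rs z / 2"
  proof -
    \<comment> \<open>The exceptional times for \<open>B\<close> must become a null set of the
      plane. Fubini is applied to the Borel set where \<open>dt B\<close> equals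
      \<open>\<beta>\<close>, and existence of the derivative comes from viewing \<open>B\<close> as
      a Lipschitz function of \<open>(t, x)\<close>.\<close>
    have Blip: "K\<beta>-lipschitz_on UNIV (\<lambda>(t, x::real). B t)" by (rule lipschitz_on_fst_snd(1)[OF BP(1)])
    have dtB: "(\<lambda>(t, x). dt (\<lambda>t x. B t) t x) \<in> borel_measurable borel"
      by (rule borel_measurable_dt(2)) (rule lipschitz_on_continuous_on[OF Blip])
    have "{z. dt (\<lambda>t x. B t) (fst z) (snd z) = \<beta> (fst z)} \<in> sets borel"
    proof -
      have "(\<lambda>z::real\<times>real. \<beta> (fst z)) \<in> borel_measurable borel"
        by (rule measurable_compose[OF _ \<beta>(1)]) (intro borel_measurable_continuous_onI continuous_intros)
      then have "{z\<in>space borel. (case z of (t, x) \<Rightarrow> dt (\<lambda>t x. B t) t x) = \<beta> (fst z)} \<in> sets borel" using dtB by measurable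
      then show ?thesis by (simp add: case_prod_unfold)
    qed
    then have "AE z in lborel. dt (\<lambda>t x::real. B t) (fst z) (snd z) = \<beta> (fst z)"
      by (rule AE_lborel_pairI') (use BP(4) in \<open>simp add: dt_def, eventually_elim, simp add: vector_derivative_at\<close>)
    then have aeB: "AE z in (lborel :: (real \<times> real) measure). (B has_vector_derivative \<beta> (fst z)) (at (fst z))"
      using Lipschitz_AE_partial_derivatives[OF Blip]
    proof eventually_elim
      case (elim z)
      then show ?case by (simp add: case_prod_unfold)
    qed
    have "{z :: real \<times> real. fst z \<noteq> a \<and> fst z \<noteq> b} \<in> sets borel"
      by (intro borel_open open_Collect_conj open_Collect_neq continuous_intros)
    then have aet: "AE z in lborel. fst (z :: real \<times> real) \<noteq> a \<and> fst z \<noteq> b"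
      by (rule AE_lborel_pairI') (use AE_lborel_singleton[of a] AE_lborel_singleton[of b] in auto)
    \<comment> \<open>Excluded are the kinks of the cone cutoff, which at each time are at most
      three points.\<close>
    have "{z :: real \<times> real. snd z \<noteq> 0 \<and> \<bar>snd z\<bar> + lam * fst z \<noteq> \<rho>} \<in> sets borel"
      by (intro borel_open open_Collect_conj open_Collect_neq continuous_intros)
    then have aex: "AE z in lborel. snd (z :: real \<times> real) \<noteq> 0 \<and> \<bar>snd z\<bar> + lam * fst z \<noteq> \<rho>"
    proof (rule AE_lborel_pairI)
      fix t
      show "AE x in lborel. snd (t, x) \<noteq> 0 \<and> \<bar>snd (t, x)\<bar> + lam * fst (t, x) \<noteq> \<rho>"
        using AE_lborel_singleton[of 0] AE_lborel_singleton[of "\<rho> - lam * t"] AE_lborel_singleton[of "lam * t - \<rho>"]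
        by eventually_elim (auto simp: abs_if)
    qed
    have "AE z in time_strip T. (B has_vector_derivative \<beta> (fst z)) (at (fst z)) \<and> fst z \<noteq> a \<and> fst z \<noteq> b \<and> snd z \<noteq> 0 \<and> \<bar>snd z\<bar> + lam * fst z \<noteq> \<rho>"
      by (rule AE_time_stripI) (use aeB aet aex in eventually_elim, auto)
    then show ?thesis
      using H(2) uC S(4) dd AE_space
    proof eventually_elim
      case (elim z)
      obtain t x where z: "z = (t, x)" by (cases z)
      have t: "0 < t" using elim(6) by (simp add: z space_time_strip)
      have uv: "u t x \<in> C" "v t x \<in> C" using elim(3) v(2) by (auto simp: z)
      define k where "k = cone_cutoff lam \<rho> t x"
      define re where "re = rel_\<eta> (u t x) (v t x)"
      define r' where "r' = (if a < t \<and> t < b then - 1 / (b - a) else 0)"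
      obtain \<kappa> kx where \<kappa>: "0 \<le> \<kappa>" "((\<lambda>s. cone_cutoff lam \<rho> s x) has_vector_derivative - lam * \<kappa>) (at t)"
        "(cone_cutoff lam \<rho> t has_vector_derivative kx) (at x)" "\<bar>kx\<bar> \<le> \<kappa>"
        using cone_cutoff_derivatives[OF lam(1) \<rho> t, of x] elim(1) z by auto
      have "(B has_real_derivative \<beta> t) (at t)" using elim(1) z by (simp add: has_real_derivative_iff_has_vector_derivative)
      then have "(\<mu> has_real_derivative - \<beta> t * \<mu> t) (at t)" unfolding \<mu>_def[abs_def] by (auto intro!: derivative_eq_intros)
      then have d\<mu>: "(\<mu> has_vector_derivative - \<beta> t * \<mu> t) (at t)" by (simp add: has_real_derivative_iff_has_vector_derivative)
      have dr: "(ramp a b has_vector_derivative r') (at t)" unfolding r'_def using r(6)[of t] elim(1) z by simp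
      have dg: "(g has_vector_derivative (ramp a b t * (- \<beta> t * \<mu> t) + r' * \<mu> t)) (at t)"
        unfolding g_def[abs_def] by (rule has_vector_derivative_mult[OF dr d\<mu>])
      have dt\<phi>: "dt \<phi> t x = g t * (- lam * \<kappa>) + (ramp a b t * (- \<beta> t * \<mu> t) + r' * \<mu> t) * k"
        unfolding dt_def \<phi>_def k_def by (rule vector_derivative_at) (rule has_vector_derivative_mult[OF dg \<kappa>(2)])
      have dx\<phi>: "dx \<phi> t x = g t * kx"
        unfolding dx_def \<phi>_def by (rule vector_derivative_at) (rule has_vector_derivative_mult_right[OF \<kappa>(3)])
      define n2 where "n2 = (norm (u t x - v t x))\<^sup>2"
      have n2: "0 \<le> n2" by (simp add: n2_def)
      have k0: "0 \<le> k" using cc(1) by (simp add: k_def)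
      have re: "Cl / 2 * n2 \<le> re" "0 \<le> re" using rel_\<eta>_bounds(1)[OF uv] rel_\<eta>_nonneg[OF uv] by (auto simp: re_def n2_def)
      have "kx * rel_q (u t x) (v t x) \<le> \<bar>kx\<bar> * \<bar>rel_q (u t x) (v t x)\<bar>" by (metis abs_ge_self abs_mult)
      also have "\<dots> \<le> \<kappa> * (lam * re)" using \<kappa>(1,4) lam(2)[OF uv] by (intro mult_mono) (auto simp: re_def)
      \<comment> \<open>Here the cone speed enters: the relative flux is at most \<open>lam\<close>
        times the relative entropy, and the cutoff decays in time at \<open>lam\<close> times its
        spatial slope.\<close>
      finally have flux: "g t * (kx * rel_q (u t x) (v t x)) \<le> g t * (\<kappa> * (lam * re))" using g01(1) by (intro mult_left_mono)
      have src: "- (hess \<eta> (v t x) (u t x - v t x) (dt v t x) + hess \<eta> (v t x) (f (u t x) - f (v t x)) (dx v t x))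
          \<le> (norm (residual f v t x))\<^sup>2 / 2 + (Cu * Cf * S t + Cu\<^sup>2) / 2 * n2"
        unfolding n2_def by (rule source_bound[OF uv _ _ Cf]) (use elim(4,5) z in auto)
      have "(Cu * Cf * S t + Cu\<^sup>2) / 2 * n2 = \<beta> t * (Cl / 2 * n2)" using t Cl_pos by (simp add: \<beta>_def field_simps)
      also have "\<dots> \<le> \<beta> t * re" using re \<beta>(2) by (intro mult_left_mono)
      finally have "- (hess \<eta> (v t x) (u t x - v t x) (dt v t x) + hess \<eta> (v t x) (f (u t x) - f (v t x)) (dx v t x))
          \<le> (norm (residual f v t x))\<^sup>2 / 2 + \<beta> t * re" using src by linarith
      then have src': "\<phi> t x * - (hess \<eta> (v t x) (u t x - v t x) (dt v t x) + hess \<eta> (v t x) (f (u t x) - f (v t x)) (dx v t x))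
          \<le> \<phi> t x * ((norm (residual f v t x))\<^sup>2 / 2 + \<beta> t * re)" using \<phi>01(1) by (intro mult_left_mono)
      \<comment> \<open>On \<open>(a, b)\<close> the weight is decreasing in time and hence at least
        \<open>exp (- B b)\<close>; outside, both sides vanish.\<close>
      have rm: "r' * \<mu> t * k * re \<le> - (c0 * Q z)"
      proof (cases "a < t \<and> t < b")
        case True
        have "exp (- B b) \<le> \<mu> t" unfolding \<mu>_def using BP(2)[of t b] True by simp
        then have "exp (- B b) * (Cl / 2 * n2) \<le> \<mu> t * re" using re n2 Cl_pos by (intro mult_mono) (auto simp: \<mu>_def)
        then have "k / (b - a) * (exp (- B b) * (Cl / 2 * n2)) \<le> k / (b - a) * (\<mu> t * re)" using k0 ab by (intro mult_left_mono) auto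
        then show ?thesis using True by (simp add: r'_def c0_def Q_def z n2_def[symmetric] k_def[symmetric] field_simps)
      next
        case False
        then show ?thesis by (auto simp: r'_def Q_def z)
      qed
      have "H z = (g t * (- lam * \<kappa>) + (ramp a b t * (- \<beta> t * \<mu> t) + r' * \<mu> t) * k) * re + g t * kx * rel_q (u t x) (v t x)
         + \<phi> t x * - (hess \<eta> (v t x) (u t x - v t x) (dt v t x) + hess \<eta> (v t x) (f (u t x) - f (v t x)) (dx v t x))"
        using elim(2) unfolding z prod.case dt\<phi> dx\<phi> re_def by (simp only: mult_minus_right diff_conv_add_uminus)
      \<comment> \<open>The flux is absorbed by the time derivative of the cutoff and the growth
        term by that of the weight. What remains is the ramp contribution and half the squared
        residual.\<close>
      also have "\<dots> \<le> - (c0 * Q z) + \<phi> t x * (norm (residual f v t x))\<^sup>2 / 2"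
        using flux src' rm by (simp add: \<phi>_def g_def k_def[symmetric] algebra_simps)
      finally show ?case by (simp add: Rs_def z)
    qed
  qed
  have iE: "integrable lborel (\<lambda>x. \<phi> 0 x * (norm (u0 x - v 0 x))\<^sup>2)"
  proof (rule integrableI_bounded_set[where A="{-\<rho>..\<rho>}" and B="BC\<^sup>2"])
    have [measurable]: "\<phi> 0 \<in> borel_measurable borel"
      using Lipschitz_sections(2)[OF \<phi>lip] by (intro borel_measurable_continuous_onI lipschitz_on_continuous_on)
    show "(\<lambda>x. \<phi> 0 x * (norm (u0 x - v 0 x))\<^sup>2) \<in> borel_measurable lborel" by measurable
    show "AE x in lborel. x \<in> {-\<rho>..\<rho>} \<longrightarrow> norm (\<phi> 0 x * (norm (u0 x - v 0 x))\<^sup>2) \<le> BC\<^sup>2"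
      using u0C
    proof eventually_elim
      case (elim x)
      have "\<phi> 0 x * (norm (u0 x - v 0 x))\<^sup>2 \<le> 1 * BC\<^sup>2" using \<phi>01[of 0 x] BC(2)[OF elim v(2), of 0 x] by (intro mult_mono power_mono) auto
      then show ?case using \<phi>01(1)[of 0 x] by simp
    qed
    show "AE x in lborel. x \<notin> {-\<rho>..\<rho>} \<longrightarrow> \<phi> 0 x * (norm (u0 x - v 0 x))\<^sup>2 = 0"
      using \<phi>0[of 0] by (intro AE_I2 impI) (simp only: not_in_symmetric_interval, simp)
  qed (auto simp: emeasure_lborel_Icc_eq)
  have "(LINT z|time_strip T. H z) \<le> (LINT z|time_strip T. - (c0 * Q z) + Rs z / 2)"
    by (rule integral_mono_AE[OF H(1) _ pointwise]) (use iQ iR in auto)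
  also have "\<dots> = - (c0 * (LINT z|time_strip T. Q z)) + (LINT z|time_strip T. Rs z) / 2" using iQ iR by simp
  finally have 1: "(LINT z|time_strip T. H z) \<le> - (c0 * (LINT z|time_strip T. Q z)) + (LINT z|time_strip T. Rs z) / 2" .
  have "(LINT x|lborel. \<phi> 0 x * rel_\<eta> (u0 x) (v 0 x)) \<le> (LINT x|lborel. Cu / 2 * (\<phi> 0 x * (norm (u0 x - v 0 x))\<^sup>2))"
  proof (rule integral_mono_AE[OF H(3)])
    show "AE x in lborel. \<phi> 0 x * rel_\<eta> (u0 x) (v 0 x) \<le> Cu / 2 * (\<phi> 0 x * (norm (u0 x - v 0 x))\<^sup>2)"
      using u0C
    proof eventually_elim
      case (elim x)
      then show ?case using mult_left_mono[OF rel_\<eta>_bounds(2)[OF elim v(2)[of 0 x]] \<phi>01(1)[of 0 x]] by (simp add: mult_ac)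
    qed
  qed (use iE in auto)
  then have 2: "c0 * (LINT z|time_strip T. Q z) \<le> (LINT z|time_strip T. Rs z) / 2 + Cu / 2 * (LINT x|lborel. \<phi> 0 x * (norm (u0 x - v 0 x))\<^sup>2)"
    using 1 H(4) by simp
  have eQ: "(\<integral>\<^sup>+ z. ennreal (Q z) \<partial>time_strip T) = ennreal (LINT z|time_strip T. Q z)" by (rule nn_integral_eq_integral[OF iQ]) (use Q0 in auto)
  have eR: "(\<integral>\<^sup>+ z. ennreal (Rs z) \<partial>time_strip T) = ennreal (LINT z|time_strip T. Rs z)" by (rule nn_integral_eq_integral[OF iR]) (use R0 in auto)
  have eE: "(\<integral>\<^sup>+ x. ennreal (\<phi> 0 x * (norm (u0 x - v 0 x))\<^sup>2) \<partial>lborel) = ennreal (LINT x|lborel. \<phi> 0 x * (norm (u0 x - v 0 x))\<^sup>2)"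
    by (rule nn_integral_eq_integral[OF iE]) (use \<phi>01 in auto)
  have pos: "0 \<le> (LINT z|time_strip T. Q z)" "0 \<le> (LINT z|time_strip T. Rs z)" "0 \<le> (LINT x|lborel. \<phi> 0 x * (norm (u0 x - v 0 x))\<^sup>2)"
    using Q0 R0 \<phi>01 by (auto intro!: Bochner_Integration.integral_nonneg)
  have RS: "(\<integral>\<^sup>+ z. ennreal (Rs z) \<partial>time_strip T) \<le> sqnorm_L2 (time_strip b) (\<lambda>(t, x). residual f v t x)"
    unfolding sqnorm_L2_def nn_integral_time_strip
  proof (rule nn_integral_mono)
    fix z :: "real \<times> real"
    obtain t x where z: "z = (t, x)" by (cases z)
    show "ennreal (Rs z) * indicator ({0<..<T} \<times> UNIV) z \<le> ennreal ((norm (case z of (t, x) \<Rightarrow> residual f v t x))\<^sup>2) * indicator ({0<..<b} \<times> UNIV) z"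
    proof (cases "0 < t \<and> t < b")
      case True
      have "\<phi> t x * (norm (residual f v t x))\<^sup>2 \<le> (norm (residual f v t x))\<^sup>2" using \<phi>01[of t x] by (simp add: mult_left_le_one_le)
      then show ?thesis using True ab by (auto simp: z Rs_def intro!: ennreal_leI)
    next
      case False
      then show ?thesis using \<phi>0[of t x] by (auto simp: z Rs_def indicator_def)
    qed
  qed
  have ES: "(\<integral>\<^sup>+ x. ennreal (\<phi> 0 x * (norm (u0 x - v 0 x))\<^sup>2) \<partial>lborel) \<le> (\<integral>\<^sup>+ x. ennreal ((norm (u0 x - v 0 x))\<^sup>2) \<partial>lborel)"
    using \<phi>01 by (intro nn_integral_mono ennreal_leI) (simp add: mult_left_le_one_le)
  have "ennreal (LINT z|time_strip T. Q z) \<le> ennreal (1 / (2 * c0) * (Cu * (LINT x|lborel. \<phi> 0 x * (norm (u0 x - v 0 x))\<^sup>2) + (LINT z|time_strip T. Rs z)))"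
    by (rule ennreal_leI) (use 2 c0 in \<open>simp add: field_simps\<close>)
  also have "\<dots> = ennreal (1 / (2 * c0)) * (ennreal Cu * ennreal (LINT x|lborel. \<phi> 0 x * (norm (u0 x - v 0 x))\<^sup>2) + ennreal (LINT z|time_strip T. Rs z))"
  proof -
    have "ennreal (p * (q * r + s)) = ennreal p * (ennreal q * ennreal r + ennreal s)" if "0 \<le> p" "0 \<le> q" "0 \<le> r" "0 \<le> s" for p q r s
      using that by (simp add: ennreal_mult ennreal_plus)
    from this[of "1 / (2 * c0)" Cu, OF _ Cu pos(3,2)] c0 show ?thesis by simp
  qed
  also have "\<dots> \<le> ennreal (1 / (2 * c0)) * (ennreal Cu * (\<integral>\<^sup>+ x. ennreal ((norm (u0 x - v 0 x))\<^sup>2) \<partial>lborel) + sqnorm_L2 (time_strip b) (\<lambda>(t, x). residual f v t x))"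
    using RS ES unfolding eR eE by (intro mult_left_mono add_mono) auto
  \<comment> \<open>The factor \<open>1 / 2\<close> in front of residual and initial error cancels
    against the \<open>Cl / 2\<close> hidden in \<open>c0\<close>.\<close>
  also have "1 / (2 * c0) = (b - a) * exp (B b) * inverse Cl" using Cl_pos ab by (simp add: c0_def exp_minus field_simps)
  finally show ?thesis unfolding eQ[symmetric] by (simp add: Q_def case_prod_unfold)
qed

end

section \<open>From averages in time to a single time\<close>

lemma AE_lborel_interval_ex:
  fixes a b :: real
  assumes "AE t in lborel. P t" "a < b"
  obtains t where "a < t" "t < b" "P t"
proof -
  have "\<exists>t. a < t \<and> t < b \<and> P t"
  proof (rule ccontr)
    assume "\<not> ?thesis"
    then have n: "\<not> P t" if "a < t" "t < b" for t using that by blast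
    from assms(1) have "AE t in (lborel :: real measure). t \<notin> {a<..<b}"
    proof eventually_elim
      case (elim t)
      then show ?case using n[of t] by auto
    qed
    then have "{a<..<b} \<in> null_sets lborel" by (subst AE_iff_null_sets) auto
    then show False using assms(2) by (simp add: null_sets_def)
  qed
  then show thesis using that by blast
qed

lemma locally_integrable_R_continuous:
  fixes z :: "real \<Rightarrow> 'a::euclidean_space"
  assumes "continuous_on UNIV z"
  shows "locally_integrable_R z"
  unfolding locally_integrable_R_def set_integrable_def
  using borel_integrable_compact[OF compact_Icc continuous_on_subset[OF assms subset_UNIV]] by blast

text \<open>The reconstruction moves along with the times \<open>s k\<close>, so it has to be
  subtracted inside the weak limit; uniform convergence makes its moments converge.\<close>

lemma weakly_tendsto_diff_uniform:
  fixes z v :: "nat \<Rightarrow> real \<Rightarrow> 'a::euclidean_space"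
  assumes W: "weakly_tendsto z zl" and v: "\<And>k. continuous_on UNIV (v k)" "continuous_on UNIV vl"
    and d: "\<And>k x. norm (v k x - vl x) \<le> d k" "d \<longlonglongrightarrow> 0"
  shows "weakly_tendsto (\<lambda>k x. z k x - v k x) (\<lambda>x. zl x - vl x)"
  unfolding weakly_tendsto_def
proof (intro conjI allI impI)
  have li: "locally_integrable_R (z k)" "locally_integrable_R zl" "locally_integrable_R (v k)" "locally_integrable_R vl" for k
    using W v by (auto simp: weakly_tendsto_def intro: locally_integrable_R_continuous)
  then show "locally_integrable_R (\<lambda>x. z k x - v k x)" "locally_integrable_R (\<lambda>x. zl x - vl x)" for k
    unfolding locally_integrable_R_def by (auto intro: set_integral_diff)
  fix \<psi> :: "real \<Rightarrow> real" assume \<psi>: "continuous_on UNIV \<psi> \<and> (\<exists>K. compact K \<and> (\<forall>x. x \<notin> K \<longrightarrow> \<psi> x = 0))"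
  then obtain K where K: "compact K" "\<And>x. x \<notin> K \<Longrightarrow> \<psi> x = 0" by blast
  obtain a where a: "\<And>x. x \<in> K \<Longrightarrow> norm x \<le> a" using compact_imp_bounded[OF K(1)] by (auto simp: bounded_iff)
  have \<psi>0: "\<psi> x = 0" if "a < \<bar>x\<bar>" for x using K(2)[of x] a[of x] that by (cases "x \<in> K") auto
  have "bounded (\<psi> ` {-a..a})" using \<psi> by (intro compact_imp_bounded compact_continuous_image) (auto intro: continuous_on_subset)
  then obtain M where "\<forall>y\<in>\<psi> ` {-a..a}. norm y \<le> M" unfolding bounded_iff by blast
  then have M: "\<bar>\<psi> x\<bar> \<le> max M 0" for x
  proof (cases "x \<in> {-a..a}")
    case True
    then have "\<bar>\<psi> x\<bar> \<le> M" using \<open>\<forall>y\<in>\<psi> ` {-a..a}. norm y \<le> M\<close> by simp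
    then show ?thesis by simp
  next
    case False
    then have "a < \<bar>x\<bar>" by (simp only: not_in_symmetric_interval)
    then show ?thesis using \<psi>0 by simp
  qed
  have \<psi>m: "\<psi> \<in> borel_measurable borel" using \<psi> by (intro borel_measurable_continuous_onI) blast
  have i: "integrable lborel (\<lambda>x. \<psi> x *\<^sub>R y x)" if "locally_integrable_R y" for y :: "real \<Rightarrow> 'a"
    by (rule integrable_test_times_local_R[OF that \<psi>m M \<psi>0])
  have i1: "integrable lborel \<psi>"
    using integrable_test_times_local_R[OF locally_integrable_R_continuous[OF continuous_on_const[of UNIV "1::real"]] \<psi>m M \<psi>0] by simp
  have zc: "(\<lambda>k. LINT x|lborel. \<psi> x *\<^sub>R z k x) \<longlonglongrightarrow> (LINT x|lborel. \<psi> x *\<^sub>R zl x)"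
    using W \<psi> unfolding weakly_tendsto_def by blast
  have "(\<lambda>k. (LINT x|lborel. \<psi> x *\<^sub>R v k x) - (LINT x|lborel. \<psi> x *\<^sub>R vl x)) \<longlonglongrightarrow> 0"
  proof (rule Lim_null_comparison)
    show "(\<lambda>k. d k * (LINT x|lborel. \<bar>\<psi> x\<bar>)) \<longlonglongrightarrow> 0" using tendsto_mult_left_zero[OF d(2)] by blast
    show "eventually (\<lambda>k. norm ((LINT x|lborel. \<psi> x *\<^sub>R v k x) - (LINT x|lborel. \<psi> x *\<^sub>R vl x)) \<le> d k * (LINT x|lborel. \<bar>\<psi> x\<bar>)) sequentially"
    proof (intro always_eventually allI)
      fix k
      have "(LINT x|lborel. \<psi> x *\<^sub>R v k x) - (LINT x|lborel. \<psi> x *\<^sub>R vl x) = (LINT x|lborel. \<psi> x *\<^sub>R v k x - \<psi> x *\<^sub>R vl x)"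
        using i[OF li(3)] i[OF li(4)] by simp
      also have "norm \<dots> \<le> (LINT x|lborel. norm (\<psi> x *\<^sub>R v k x - \<psi> x *\<^sub>R vl x))" by (rule Bochner_Integration.integral_norm_bound)
      also have "\<dots> \<le> (LINT x|lborel. d k * \<bar>\<psi> x\<bar>)"
      proof (rule integral_mono)
        show "integrable lborel (\<lambda>x. norm (\<psi> x *\<^sub>R v k x - \<psi> x *\<^sub>R vl x))" using i[OF li(3)] i[OF li(4)] by (intro integrable_norm Bochner_Integration.integrable_diff)
        show "integrable lborel (\<lambda>x. d k * \<bar>\<psi> x\<bar>)" using i1 by simp
        fix x
        show "norm (\<psi> x *\<^sub>R v k x - \<psi> x *\<^sub>R vl x) \<le> d k * \<bar>\<psi> x\<bar>"
          using mult_left_mono[OF d(1)[of k x] abs_ge_zero[of "\<psi> x"]] by (simp add: scaleR_diff_right[symmetric] mult.commute)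
      qed
      finally show "norm ((LINT x|lborel. \<psi> x *\<^sub>R v k x) - (LINT x|lborel. \<psi> x *\<^sub>R vl x)) \<le> d k * (LINT x|lborel. \<bar>\<psi> x\<bar>)" by simp
    qed
  qed
  then have "(\<lambda>k. LINT x|lborel. \<psi> x *\<^sub>R v k x) \<longlonglongrightarrow> (LINT x|lborel. \<psi> x *\<^sub>R vl x)" by (simp add: LIM_zero_iff)
  from tendsto_diff[OF zc this]
  show "(\<lambda>k. LINT x|lborel. \<psi> x *\<^sub>R (z k x - v k x)) \<longlonglongrightarrow> (LINT x|lborel. \<psi> x *\<^sub>R (zl x - vl x))"
    using i li by (simp add: scaleR_diff_right)
qed

text \<open>For fixed \<open>t\<close> the cutoffs tend pointwise to 1 as the radius grows, so
  Fatou's lemma removes the cone together with its speed.\<close>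

lemma nn_integral_cutoff_bound:
  assumes c: "0 \<le> c" and F: "F \<in> borel_measurable lborel" "\<And>x. 0 \<le> F x"
    and bound: "\<And>\<rho>. 0 < \<rho> \<Longrightarrow> (\<integral>\<^sup>+ x. ennreal (cone_cutoff c \<rho> t x * F x) \<partial>lborel) \<le> G"
  shows "(\<integral>\<^sup>+ x. ennreal (F x) \<partial>lborel) \<le> G"
proof -
  have lim: "(\<lambda>n. cone_cutoff c (real n + 1) t x) \<longlonglongrightarrow> 1" for x
  proof -
    have "(\<lambda>n. 1 / (real n + 1)) \<longlonglongrightarrow> 0" using LIMSEQ_inverse_real_of_nat by (simp add: inverse_eq_divide add.commute)
    then have "(\<lambda>n. max 0 (1 - (\<bar>x\<bar> + c * max 0 t) * (1 / (real n + 1)))) \<longlonglongrightarrow> max 0 (1 - (\<bar>x\<bar> + c * max 0 t) * 0)"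
      by (intro tendsto_intros)
    then show ?thesis by (simp add: cone_cutoff_def)
  qed
  have m: "(\<lambda>x. ennreal (cone_cutoff c (real n + 1) t x * F x)) \<in> borel_measurable lborel" for n
  proof -
    have "cone_cutoff c (real n + 1) t \<in> borel_measurable borel"
      using Lipschitz_sections(2)[OF cone_cutoff_props(5)[OF c, of "real n + 1"]]
      by (intro borel_measurable_continuous_onI lipschitz_on_continuous_on) auto
    then show ?thesis using F(1) by measurable
  qed
  have "(\<integral>\<^sup>+ x. ennreal (F x) \<partial>lborel) = (\<integral>\<^sup>+ x. liminf (\<lambda>n. ennreal (cone_cutoff c (real n + 1) t x * F x)) \<partial>lborel)"
  proof (rule nn_integral_cong)
    fix x
    have "(\<lambda>n. ennreal (cone_cutoff c (real n + 1) t x * F x)) \<longlonglongrightarrow> ennreal (1 * F x)"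
      by (intro tendsto_ennrealI tendsto_intros lim)
    then show "ennreal (F x) = liminf (\<lambda>n. ennreal (cone_cutoff c (real n + 1) t x * F x))"
      by (simp add: lim_imp_Liminf)
  qed
  also have "\<dots> \<le> liminf (\<lambda>n. \<integral>\<^sup>+ x. ennreal (cone_cutoff c (real n + 1) t x * F x) \<partial>lborel)"
    by (rule nn_integral_liminf[OF m])
  also have "\<dots> \<le> liminf (\<lambda>n::nat. G)" by (intro Liminf_mono always_eventually allI bound) simp
  also have "\<dots> = G" by (simp add: Liminf_const)
  finally show ?thesis .
qed

context entropy_system
begin

text \<open>An average bounded by a constant forces times in the interval at which the bound holds
  up to any positive tolerance. Such times are taken to increase to \<open>t0\<close>: approached
  from below, residual and exponent never exceed their values at \<open>t0\<close>, and
  \<open>t0 = T\<close> can be reached.\<close>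

theorem relative_entropy_stability:
  fixes u v :: "real \<Rightarrow> real \<Rightarrow> real ^ 'm"
  assumes Cf: "0 \<le> Cf" and T: "0 < T" "0 \<le> t0" "t0 \<le> T"
    and sol: "entropy_solution T f \<eta> q u0 u" and W: "weakly_continuous_in_time T u"
    and um: "(\<lambda>(t, x). u t x) \<in> borel_measurable (time_strip T)"
    and uC: "AE (t, x) in time_strip T. u t x \<in> C"
    and v: "Lv-lipschitz_on UNIV (\<lambda>(t, x). v t x)" "\<And>t x. v t x \<in> C"
    and S: "S \<in> borel_measurable borel" "\<And>t. 0 \<le> S t" "\<And>t. S t \<le> BS" "AE (t, x) in time_strip T. norm (dx v t x) \<le> S t"
  shows "(\<integral>\<^sup>+ x. ennreal ((norm (u t0 x - v t0 x))\<^sup>2) \<partial>lborel)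
    \<le> ennreal (inverse Cl) * (ennreal Cu * (\<integral>\<^sup>+ x. ennreal ((norm (u0 x - v 0 x))\<^sup>2) \<partial>lborel) + sqnorm_L2 (time_strip t0) (\<lambda>(t, x). residual f v t x))
      * ennreal (exp (LINT s:{0..t0}|lborel. inverse Cl * (Cu * Cf * S s + Cu\<^sup>2)))"
proof -
  define \<beta> where "\<beta> t = (if 0 \<le> t then inverse Cl * (Cu * Cf * S t + Cu\<^sup>2) else 0)" for t
  define B where "B t = (LINT s:{0..t}|lborel. \<beta> s)" for t
  define E0 where "E0 = (\<integral>\<^sup>+ x. ennreal ((norm (u0 x - v 0 x))\<^sup>2) \<partial>lborel)"
  define \<Gamma> where "\<Gamma> t = ennreal Cu * E0 + sqnorm_L2 (time_strip t) (\<lambda>(t, x). residual f v t x)" for t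
  have Cu: "0 \<le> Cu" using Cu_nonneg[OF v(2)] .
  have Beq: "(LINT s:{0..t0}|lborel. inverse Cl * (Cu * Cf * S s + Cu\<^sup>2)) = B t0"
    unfolding B_def set_lebesgue_integral_def by (rule Bochner_Integration.integral_cong) (auto simp: \<beta>_def indicator_def)
  have \<beta>: "0 \<le> \<beta> t" for t unfolding \<beta>_def using Cu Cf S(2) Cl_pos by auto
  have \<beta>m: "\<beta> \<in> borel_measurable borel" unfolding \<beta>_def using S(1) by measurable
  have \<beta>b: "\<beta> t \<le> inverse Cl * (Cu * Cf * BS + Cu\<^sup>2)" for t
  proof -
    have "0 \<le> BS" using S(2,3)[of 0] by linarith
    then have "0 \<le> inverse Cl * (Cu * Cf * BS + Cu\<^sup>2)" using Cu Cf Cl_pos by simp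
    moreover have "inverse Cl * (Cu * Cf * S t + Cu\<^sup>2) \<le> inverse Cl * (Cu * Cf * BS + Cu\<^sup>2)"
      using S(3)[of t] Cu Cf Cl_pos by (intro mult_left_mono add_right_mono) auto
    ultimately show ?thesis by (simp add: \<beta>_def)
  qed
  have Bmono: "B s \<le> B t" if "s \<le> t" for s t
    unfolding B_def by (rule primitive_AE_derivative(2)[OF \<beta>m \<beta> \<beta>b _ that]) (simp add: \<beta>_def)
  have B0: "0 \<le> B t" for t unfolding B_def by (rule primitive_AE_derivative(3)[OF \<beta>m \<beta> \<beta>b]) (simp add: \<beta>_def)
  obtain lam where lam: "0 \<le> lam" "\<And>a b. a \<in> C \<Longrightarrow> b \<in> C \<Longrightarrow> \<bar>rel_q a b\<bar> \<le> lam * rel_\<eta> a b" using rel_q_bound by metis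
  have weak: "weak_solution T f u0 u" using sol by (simp add: entropy_solution_def)
  have tr: "AE x in lborel. u 0 x = u0 x" by (rule initial_trace[OF T(1) weak W uC])
  \<comment> \<open>Values in \<open>C\<close> are known for almost every time in
    \<open>(0, T)\<close> only. Along such times tending to 0 the solution converges weakly,
    convexity keeps the limit in \<open>C\<close>, and the limit is the initial datum by
    \<open>tr\<close>.\<close>
  have u0C: "AE x in lborel. u0 x \<in> C"
  proof -
    have "AE z in (lborel \<Otimes>\<^sub>M lborel). z \<in> {0<..<T} \<times> UNIV \<longrightarrow> u (fst z) (snd z) \<in> C"
      using uC unfolding AE_time_strip_iff lborel_prod by (auto simp: case_prod_unfold)
    from lborel_pair.AE_pair[OF this] have ae: "AE t in lborel. AE x in lborel. t \<in> {0<..<T} \<longrightarrow> u t x \<in> C" by simp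
    have "\<exists>s. 0 < s \<and> s < T / (real k + 1) \<and> (AE x in lborel. s \<in> {0<..<T} \<longrightarrow> u s x \<in> C)" for k :: nat
      using AE_lborel_interval_ex[OF ae, of 0 "T / (real k + 1)"] T by (metis divide_pos_pos of_nat_0_le_iff add_nonneg_pos zero_less_one)
    then obtain s where s: "\<And>k. 0 < s k" "\<And>k. s k < T / (real k + 1)" "\<And>k. AE x in lborel. s k \<in> {0<..<T} \<longrightarrow> u (s k) x \<in> C" by metis
    have sT: "s k < T" for k
    proof -
      have "T / (real k + 1) \<le> T" using T by (simp add: divide_le_eq mult_left_mono)
      then show ?thesis using s(2)[of k] by linarith
    qed
    have "s \<longlonglongrightarrow> 0"
    proof (rule tendsto_sandwich[where f="\<lambda>_. 0" and h="\<lambda>k. T / (real k + 1)"])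
      have "(\<lambda>n. 1 / (real n + 1)) \<longlonglongrightarrow> 0" using LIMSEQ_inverse_real_of_nat by (simp add: inverse_eq_divide add.commute)
      from tendsto_mult_right_zero[OF this, of T] show "(\<lambda>k. T / (real k + 1)) \<longlonglongrightarrow> 0" by simp
    qed (simp_all add: s(1,2) less_imp_le)
    then have "weakly_tendsto (\<lambda>k. u (s k)) (u 0)"
    proof (rule weakly_continuous_tendsto[OF W, rotated])
      show "s k \<in> {0..T}" for k using s(1)[of k] sT[of k] by simp
      show "0 \<in> {0..T}" using T by simp
    qed
    then have "AE x in lborel. u 0 x \<in> C"
    proof (rule weakly_tendsto_in_convex[OF _ convex_C compact_C])
      show "AE x in lborel. u (s k) x \<in> C" for k using s(3)[of k] s(1)[of k] sT[of k] by simp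
    qed
    with tr show ?thesis by eventually_elim simp
  qed
  have u0m[measurable]: "u0 \<in> borel_measurable borel" using weak by (intro locally_integrable_R_measurable) (simp add: weak_solution_def)
  have vm: "v t \<in> borel_measurable borel" "continuous_on UNIV (v t)" for t
    using Lipschitz_sections(2)[OF v(1)] by (auto intro: borel_measurable_continuous_onI lipschitz_on_continuous_on)
  have um_t: "u t \<in> borel_measurable borel" if "t \<in> {0..T}" for t
    using W that by (intro locally_integrable_R_measurable) (auto simp: weakly_continuous_in_time_def)
  have main: "(\<integral>\<^sup>+ x. ennreal ((norm (u t0 x - v t0 x))\<^sup>2) \<partial>lborel) \<le> ennreal (inverse Cl) * \<Gamma> t0 * ennreal (exp (B t0))"
  proof (cases "t0 = 0")
    case True
    \<comment> \<open>At time 0 there is nothing to average over. The error is the initial one, and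
      the factor \<open>Cu / Cl\<close> is at least 1, as the two Hessian bounds show at a unit
      vector.\<close>
    have "Cl * 1 \<le> Cu * 1"
      using order_trans[OF hess_\<eta>_lower[OF v(2)[of 0 0], of "axis undefined 1"] hess_\<eta>_upper[OF v(2)[of 0 0]]] by (simp add: norm_axis_1)
    then have q: "1 \<le> inverse Cl * Cu" using Cl_pos by (simp add: field_simps)
    have "(\<integral>\<^sup>+ x. ennreal ((norm (u t0 x - v t0 x))\<^sup>2) \<partial>lborel) = E0"
      unfolding E0_def True using tr by (intro nn_integral_cong_AE) (auto elim: eventually_mono)
    also have "\<dots> \<le> ennreal (inverse Cl * Cu) * E0" using mult_right_mono[OF ennreal_leI[OF q], of E0] by simp
    also have "\<dots> = ennreal (inverse Cl) * (ennreal Cu * E0)" using Cl_pos Cu by (simp add: ennreal_mult mult.assoc)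
    also have "\<dots> \<le> ennreal (inverse Cl) * \<Gamma> t0" unfolding \<Gamma>_def by (intro mult_left_mono) auto
    also have "\<dots> * 1 \<le> ennreal (inverse Cl) * \<Gamma> t0 * ennreal (exp (B t0))" using B0[of t0] by (intro mult_left_mono) auto
    finally show ?thesis by simp
  next
    case False
    then have t0: "0 < t0" using T by simp
    show ?thesis
    proof (cases "\<Gamma> t0 = \<top>")
      case True
      then show ?thesis using Cl_pos by (simp add: ennreal_mult_top ennreal_top_mult)
    next
      case False
      then obtain \<gamma> where \<gamma>: "0 \<le> \<gamma>" "\<Gamma> t0 = ennreal \<gamma>" by (cases "\<Gamma> t0") auto
      define G where "G = inverse Cl * \<gamma> * exp (B t0)"
      have G0: "0 \<le> G" using \<gamma>(1) Cl_pos by (simp add: G_def)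
      have "(\<integral>\<^sup>+ x. ennreal ((norm (u t0 x - v t0 x))\<^sup>2) \<partial>lborel) \<le> ennreal G"
      proof (rule nn_integral_cutoff_bound[OF lam(1), where t=t0])
        show "(\<lambda>x. (norm (u t0 x - v t0 x))\<^sup>2) \<in> borel_measurable lborel" using um_t[of t0] vm(1) T by simp
        fix \<rho> :: real assume \<rho>: "0 < \<rho>"
        note cc = cone_cutoff_props[OF lam(1) \<rho>]
        \<comment> \<open>Otherwise the bound would be violated throughout \<open>(a, b)\<close>,
          and integration would contradict the averaged estimate by the amount
          \<open>(b - a) * e\<close>. The cutoff is frozen at \<open>t0\<close>, where it is
          smallest, so that the weight is the same for all times.\<close>
        have ex: "\<exists>s. a < s \<and> s < b \<and> (\<integral>\<^sup>+ x. ennreal (cone_cutoff lam \<rho> t0 x * (norm (u s x - v s x))\<^sup>2) \<partial>lborel) \<le> ennreal (G + e)"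
          if ab: "0 < a" "a < b" "b < t0" and e: "0 < e" for a b e
        proof (rule ccontr)
          assume "\<not> ?thesis"
          then have big: "ennreal (G + e) \<le> (\<integral>\<^sup>+ x. ennreal (cone_cutoff lam \<rho> t0 x * (norm (u s x - v s x))\<^sup>2) \<partial>lborel)" if "a < s" "s < b" for s
            using that by (auto simp: not_le intro: less_imp_le)
          define Q where "Q z = (case z of (t, x) \<Rightarrow> indicator {a<..<b} t * cone_cutoff lam \<rho> t x * (norm (u t x - v t x))\<^sup>2)" for z
          have [measurable]: "(\<lambda>z. v (fst z) (snd z)) \<in> borel_measurable (time_strip T)"
            using measurable_time_strip[OF borel_measurable_continuous_onI[OF lipschitz_on_continuous_on[OF v(1)]]] by (simp add: case_prod_unfold)
          have [measurable]: "(\<lambda>z. u (fst z) (snd z)) \<in> borel_measurable (time_strip T)" using um by (simp add: case_prod_unfold)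
          have [measurable]: "(\<lambda>z. cone_cutoff lam \<rho> (fst z) (snd z)) \<in> borel_measurable (time_strip T)"
            using measurable_time_strip[OF borel_measurable_continuous_onI[OF lipschitz_on_continuous_on[OF cc(5)]]] by (simp add: case_prod_unfold)
          have [measurable]: "(\<lambda>z. indicat_real {a<..<b} (fst z)) \<in> borel_measurable (time_strip T)"
          proof -
            have "fst \<in> borel_measurable (borel :: (real \<times> real) measure)" by (intro borel_measurable_continuous_onI continuous_intros)
            then show ?thesis by (intro measurable_time_strip borel_measurable_indicator') auto
          qed
          have Qm: "(\<lambda>z. ennreal (Q z)) \<in> borel_measurable (time_strip T)" unfolding Q_def case_prod_unfold by measurable
          have "ennreal ((b - a) * (G + e)) = ennreal (G + e) * ennreal (b - a)" using ab G0 e by (subst ennreal_mult[symmetric]) (simp_all add: mult.commute)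
          also have "\<dots> = (\<integral>\<^sup>+ t. ennreal (G + e) * indicator {a<..<b} t \<partial>lborel)" using ab by (subst nn_integral_cmult_indicator) auto
          also have "\<dots> \<le> (\<integral>\<^sup>+ t. (\<integral>\<^sup>+ x. ennreal (Q (t, x)) * indicator {0<..<T} t \<partial>lborel) \<partial>lborel)"
          proof (rule nn_integral_mono)
            fix t
            show "ennreal (G + e) * indicator {a<..<b} t \<le> (\<integral>\<^sup>+ x. ennreal (Q (t, x)) * indicator {0<..<T} t \<partial>lborel)"
            proof (cases "a < t \<and> t < b")
              case True
              have "ennreal (G + e) \<le> (\<integral>\<^sup>+ x. ennreal (cone_cutoff lam \<rho> t0 x * (norm (u t x - v t x))\<^sup>2) \<partial>lborel)" using big True by blast
              also have "\<dots> \<le> (\<integral>\<^sup>+ x. ennreal (Q (t, x)) * indicator {0<..<T} t \<partial>lborel)"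
              proof (rule nn_integral_mono)
                fix x
                have "cone_cutoff lam \<rho> t0 x * (norm (u t x - v t x))\<^sup>2 \<le> Q (t, x)"
                  using True cc(4)[of t t0 x] ab by (auto simp: Q_def intro!: mult_right_mono)
                then show "ennreal (cone_cutoff lam \<rho> t0 x * (norm (u t x - v t x))\<^sup>2) \<le> ennreal (Q (t, x)) * indicator {0<..<T} t"
                  using True ab T by (simp add: ennreal_leI)
              qed
              finally show ?thesis using True by simp
            qed simp
          qed
          also have "\<dots> = (\<integral>\<^sup>+ z. ennreal (Q z) \<partial>time_strip T)" by (rule nn_integral_time_strip_iterated[OF Qm, symmetric])
          also have "\<dots> \<le> ennreal ((b - a) * exp (B b) * inverse Cl) * \<Gamma> b"
            using averaged_stability[OF Cf _ ab(2) _ sol um uC u0C v S lam \<rho>] ab T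
            unfolding \<Gamma>_def E0_def B_def \<beta>_def Q_def by (simp add: case_prod_unfold)
          also have "\<dots> \<le> ennreal ((b - a) * exp (B t0) * inverse Cl) * \<Gamma> t0"
          proof (rule mult_mono)
            show "ennreal ((b - a) * exp (B b) * inverse Cl) \<le> ennreal ((b - a) * exp (B t0) * inverse Cl)"
              using Bmono[of b t0] ab Cl_pos by (intro ennreal_leI mult_right_mono mult_left_mono) auto
            show "\<Gamma> b \<le> \<Gamma> t0"
              unfolding \<Gamma>_def sqnorm_L2_def nn_integral_time_strip using ab
              by (intro add_left_mono nn_integral_mono mult_left_mono) (auto simp: indicator_def)
          qed auto
          also have "\<dots> = ennreal ((b - a) * G)" using ab \<gamma> Cl_pos unfolding \<gamma>(2) by (subst ennreal_mult[symmetric]) (auto simp: G_def mult_ac)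
          finally have "(b - a) * (G + e) \<le> (b - a) * G" using ab G0 by (subst (asm) ennreal_le_iff) auto
          then show False using ab e by simp
        qed
        \<comment> \<open>Increasing to \<open>t0\<close>; the shift by 2 makes already the first
          term, \<open>t0 / 2\<close>, positive. Consecutive terms enclose the times
          \<open>s k\<close>.\<close>
        define al where "al k = t0 * (1 - 1 / (real k + 2))" for k :: nat
        have al: "0 < al k" "al k < al (Suc k)" "al k < t0" for k
        proof -
          have r: "1 / (real k + 2) < 1" "1 / (real (Suc k) + 2) < 1 / (real k + 2)" "0 < 1 / (real k + 2)" by (auto simp: field_simps)
          show "0 < al k" unfolding al_def using r t0 by (intro mult_pos_pos) linarith+
          show "al k < al (Suc k)" unfolding al_def using r t0 by (intro mult_strict_left_mono) linarith+
          show "al k < t0" using mult_strict_left_mono[of "1 - 1 / (real k + 2)" 1 t0] r t0 unfolding al_def by linarith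
        qed
        have "\<exists>s. al k < s \<and> s < al (Suc k) \<and> (\<integral>\<^sup>+ x. ennreal (cone_cutoff lam \<rho> t0 x * (norm (u s x - v s x))\<^sup>2) \<partial>lborel) \<le> ennreal (G + 1 / (real k + 1))" for k
          by (rule ex[OF al(1,2,3)]) simp
        then have "\<forall>k. \<exists>s. al k < s \<and> s < al (Suc k) \<and> (\<integral>\<^sup>+ x. ennreal (cone_cutoff lam \<rho> t0 x * (norm (u s x - v s x))\<^sup>2) \<partial>lborel) \<le> ennreal (G + 1 / (real k + 1))" by (rule allI)
        from choice[OF this] obtain s where sall: "\<forall>k. al k < s k \<and> s k < al (Suc k) \<and>
            (\<integral>\<^sup>+ x. ennreal (cone_cutoff lam \<rho> t0 x * (norm (u (s k) x - v (s k) x))\<^sup>2) \<partial>lborel) \<le> ennreal (G + 1 / (real k + 1))" ..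
        have s: "al k < s k" "s k < al (Suc k)"
          "(\<integral>\<^sup>+ x. ennreal (cone_cutoff lam \<rho> t0 x * (norm (u (s k) x - v (s k) x))\<^sup>2) \<partial>lborel) \<le> ennreal (G + 1 / (real k + 1))" for k
          using sall[rule_format, of k] by simp_all
        have sin: "0 < s k" "s k < t0" for k using s(1,2)[of k] al(1)[of k] al(3)[of "Suc k"] by linarith+
        have lim1: "(\<lambda>n. 1 / (real n + 1)) \<longlonglongrightarrow> 0" using LIMSEQ_inverse_real_of_nat by (simp add: inverse_eq_divide add.commute)
        have slim: "s \<longlonglongrightarrow> t0"
        proof (rule tendsto_sandwich[where f=al and h="\<lambda>_. t0"])
          have "(\<lambda>k. 1 / (real (Suc k) + 1)) \<longlonglongrightarrow> 0" using lim1 by (rule LIMSEQ_Suc)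
          then have "(\<lambda>k. 1 / (real k + 2)) \<longlonglongrightarrow> 0" by (simp add: add.commute)
          then have "(\<lambda>k. t0 * (1 - 1 / (real k + 2))) \<longlonglongrightarrow> t0 * (1 - 0)" by (intro tendsto_intros)
          then show "al \<longlonglongrightarrow> t0" by (simp add: al_def[abs_def])
          show "(\<lambda>_. t0) \<longlonglongrightarrow> t0" by simp
        qed (simp_all add: s(1) sin(2) less_imp_le)
        have Wk: "weakly_tendsto (\<lambda>k. u (s k)) (u t0)"
        proof (rule weakly_continuous_tendsto[OF W _ slim])
          show "s k \<in> {0..T}" for k using sin[of k] T by simp
          show "t0 \<in> {0..T}" using T by simp
        qed
        have Wd: "weakly_tendsto (\<lambda>k x. u (s k) x - v (s k) x) (\<lambda>x. u t0 x - v t0 x)"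
        proof (rule weakly_tendsto_diff_uniform[OF Wk vm(2) vm(2)])
          show "norm (v (s k) x - v t0 x) \<le> Lv * dist (s k) t0" for k x
            using lipschitz_onD[OF Lipschitz_sections(1)[OF v(1)], of "s k" t0 x] by (simp add: dist_norm)
          show "(\<lambda>k. Lv * dist (s k) t0) \<longlonglongrightarrow> 0" using tendsto_mult_right_zero[OF tendsto_dist_iff[THEN iffD1, OF slim]] .
        qed
        show "(\<integral>\<^sup>+ x. ennreal (cone_cutoff lam \<rho> t0 x * (norm (u t0 x - v t0 x))\<^sup>2) \<partial>lborel) \<le> ennreal G"
        proof (rule weakly_tendsto_lower_semicontinuous[OF Wd, where w="cone_cutoff lam \<rho> t0" and B=1 and a=\<rho> and c="\<lambda>k. G + 1 / (real k + 1)"])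
          show "0 \<le> cone_cutoff lam \<rho> t0 x" "cone_cutoff lam \<rho> t0 x \<le> 1" for x by (rule cc)+
          show "(\<integral>\<^sup>+ x. ennreal (cone_cutoff lam \<rho> t0 x * (norm (u (s k) x - v (s k) x))\<^sup>2) \<partial>lborel) \<le> ennreal (G + 1 / (real k + 1))" for k by (rule s(3))
          show "continuous_on UNIV (cone_cutoff lam \<rho> t0)" using Lipschitz_sections(2)[OF cc(5)] by (rule lipschitz_on_continuous_on)
          show "cone_cutoff lam \<rho> t0 x = 0" if "\<rho> < \<bar>x\<bar>" for x using cc(3) that by simp
          show "0 \<le> G + 1 / (real k + 1)" for k using G0 by simp
          show "(\<lambda>k. G + 1 / (real k + 1)) \<longlonglongrightarrow> G" using tendsto_add[OF tendsto_const[of G] lim1] by simp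
        qed
      qed simp
      also have "ennreal G = ennreal (inverse Cl) * \<Gamma> t0 * ennreal (exp (B t0))"
        unfolding \<gamma>(2) G_def using \<gamma>(1) Cl_pos by (simp add: ennreal_mult)
      finally show ?thesis .
    qed
  qed
  then show ?thesis unfolding Beq \<Gamma>_def E0_def .
qed

end

section \<open>Expansion in the stochastic variable\<close>

text \<open>The essential supremum of a section exceeds \<open>a\<close> exactly when the section of
  the superlevel set has positive measure, and the measure of sections is a measurable
  function.\<close>

lemma borel_measurable_esssup:
  fixes g :: "'a \<times> 'b \<Rightarrow> ennreal"
  assumes Q: "sigma_finite_measure Q" and g: "g \<in> borel_measurable (N \<Otimes>\<^sub>M Q)"
  shows "(\<lambda>t. esssup Q (\<lambda>z. g (t, z))) \<in> borel_measurable N"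
proof (rule borel_measurableI_greater)
  fix a :: ennreal
  define A where "A = {p \<in> space (N \<Otimes>\<^sub>M Q). a < g p}"
  have A: "A \<in> sets (N \<Otimes>\<^sub>M Q)" unfolding A_def using g by measurable
  have gt: "(\<lambda>z. g (t, z)) \<in> borel_measurable Q" if "t \<in> space N" for t
    using that g by measurable
  have "a < esssup Q (\<lambda>z. g (t, z)) \<longleftrightarrow> emeasure Q (Pair t -` A) \<noteq> 0" if t: "t \<in> space N" for t
  proof -
    have eq: "Pair t -` A = {z \<in> space Q. \<not> g (t, z) \<le> a}" using t by (auto simp: A_def space_pair_measure not_le)
    have "{z \<in> space Q. \<not> g (t, z) \<le> a} \<in> sets Q" using gt[OF t] by measurable
    then have iff: "emeasure Q (Pair t -` A) = 0 \<longleftrightarrow> (AE z in Q. g (t, z) \<le> a)" unfolding eq by (subst AE_iff_measurable[OF _ refl]) auto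
    have "esssup Q (\<lambda>z. g (t, z)) \<le> a \<longleftrightarrow> (AE z in Q. g (t, z) \<le> a)"
    proof
      assume *: "esssup Q (\<lambda>z. g (t, z)) \<le> a"
      have "AE z in Q. g (t, z) \<le> esssup Q (\<lambda>z. g (t, z))" by (rule esssup_AE)
      then show "AE z in Q. g (t, z) \<le> a" by eventually_elim (use * in auto)
    qed (rule esssup_I[OF gt[OF t]])
    then show ?thesis using iff by (simp add: not_le[symmetric])
  qed
  then have "{t \<in> space N. a < esssup Q (\<lambda>z. g (t, z))} = {t \<in> space N. emeasure Q (Pair t -` A) \<noteq> 0}" by auto
  also have "\<dots> \<in> sets N" using sigma_finite_measure.measurable_emeasure_Pair[OF Q A] by measurable
  finally show "{t \<in> space N. a < esssup Q (\<lambda>z. g (t, z))} \<in> sets N" .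
qed

lemma in_L2_scaleR_integrable:
  fixes g :: "'a \<Rightarrow> 'b::{banach, second_countable_topology}"
  assumes h: "in_L2 P (h :: 'a \<Rightarrow> real)" and g: "in_L2 P g"
  shows "integrable P (\<lambda>y. h y *\<^sub>R g y)"
proof -
  have sq: "integrable P (\<lambda>y. (norm (k y))\<^sup>2)" if "in_L2 P k" for k :: "'a \<Rightarrow> 'c::{banach, second_countable_topology}"
    using that unfolding in_L2_def sqnorm_L2_def by (intro integrableI_nonneg) auto
  show ?thesis
  proof (rule Bochner_Integration.integrable_bound[OF Bochner_Integration.integrable_add[OF sq[OF h] sq[OF g]]])
    show "(\<lambda>y. h y *\<^sub>R g y) \<in> borel_measurable P" using h g by (auto simp: in_L2_def)
    show "AE y in P. norm (h y *\<^sub>R g y) \<le> norm ((norm (h y))\<^sup>2 + (norm (g y))\<^sup>2)"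
    proof (rule AE_I2)
      fix y
      have "0 \<le> (norm (h y) - norm (g y))\<^sup>2" by simp
      then have "2 * (norm (h y) * norm (g y)) \<le> (norm (h y))\<^sup>2 + (norm (g y))\<^sup>2" by (simp add: power2_diff)
      moreover have "0 \<le> norm (h y) * norm (g y)" by simp
      ultimately have "norm (h y) * norm (g y) \<le> (norm (h y))\<^sup>2 + (norm (g y))\<^sup>2" by linarith
      then show "norm (h y *\<^sub>R g y) \<le> norm ((norm (h y))\<^sup>2 + (norm (g y))\<^sup>2)" by simp
    qed
  qed
qed

text \<open>By orthonormality the squared error of the \<open>n\<close>-th partial sum is the
  squared norm of \<open>h\<close> minus the sum of the first \<open>n\<close> squared coefficients,
  and completeness says precisely that this error tends to 0.\<close>

lemma Parseval_real:
  assumes \<Psi>: "orthonormal_basis_L2 P \<Psi>" and h: "in_L2 P (h :: real \<Rightarrow> real)"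
  shows "(\<lambda>j. (LINT y|P. h y * \<Psi> j y)\<^sup>2) sums (LINT y|P. (h y)\<^sup>2)"
proof -
  define c where "c j = (LINT y|P. h y * \<Psi> j y)" for j
  have L2: "in_L2 P (\<Psi> i)" and on: "(LINT y|P. \<Psi> i y * \<Psi> j y) = (if i = j then 1 else 0)" for i j
    using \<Psi> by (auto simp: orthonormal_basis_L2_def)
  have ih: "integrable P (\<lambda>y. h y * \<Psi> i y)" and ii: "integrable P (\<lambda>y. \<Psi> i y * \<Psi> j y)" and ihh: "integrable P (\<lambda>y. h y * h y)" for i j
    using in_L2_scaleR_integrable[OF h L2[of i]] in_L2_scaleR_integrable[OF L2[of i] L2[of j]] in_L2_scaleR_integrable[OF h h] by auto
  have exp: "(h y - (\<Sum>i<n. c i * \<Psi> i y))\<^sup>2 = h y * h y - 2 * (\<Sum>i<n. c i * (h y * \<Psi> i y)) + (\<Sum>i<n. \<Sum>j<n. c i * c j * (\<Psi> i y * \<Psi> j y))" for n y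
    by (simp add: power2_eq_square algebra_simps sum_product sum_distrib_left)
  have iexp: "integrable P (\<lambda>y. (h y - (\<Sum>i<n. c i * \<Psi> i y))\<^sup>2)" for n
    unfolding exp using ih ii ihh by (intro Bochner_Integration.integrable_add Bochner_Integration.integrable_diff integrable_mult_right Bochner_Integration.integrable_sum) auto
  have "(LINT y|P. (h y - (\<Sum>i<n. c i * \<Psi> i y))\<^sup>2) = (LINT y|P. h y * h y) - 2 * (\<Sum>i<n. c i * c i) + (\<Sum>i<n. \<Sum>j<n. c i * c j * (if i = j then 1 else 0))" for n
    unfolding exp using ih ii ihh by (simp add: c_def on)
  then have e: "(LINT y|P. (h y - (\<Sum>i<n. c i * \<Psi> i y))\<^sup>2) = (LINT y|P. (h y)\<^sup>2) - (\<Sum>i<n. (c i)\<^sup>2)" for n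
    by (simp add: power2_eq_square sum.delta if_distrib[of "\<lambda>x. _ * x"] cong: if_cong)
  have s: "sqnorm_L2 P (\<lambda>y. h y - (\<Sum>i<n. c i * \<Psi> i y)) = ennreal ((LINT y|P. (h y)\<^sup>2) - (\<Sum>i<n. (c i)\<^sup>2))" for n
    unfolding sqnorm_L2_def real_norm_def power2_abs e[symmetric] by (rule nn_integral_eq_integral[OF iexp]) auto
  have "(\<lambda>n. sqnorm_L2 P (\<lambda>y. h y - (\<Sum>i<n. c i * \<Psi> i y))) \<longlonglongrightarrow> 0"
    using \<Psi> h unfolding orthonormal_basis_L2_def c_def by blast
  then have "(\<lambda>n. ennreal ((LINT y|P. (h y)\<^sup>2) - (\<Sum>i<n. (c i)\<^sup>2))) \<longlonglongrightarrow> ennreal 0" unfolding s by simp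
  moreover have "0 \<le> (LINT y|P. (h y)\<^sup>2) - (\<Sum>i<n. (c i)\<^sup>2)" for n unfolding e[symmetric] by (rule Bochner_Integration.integral_nonneg) simp
  ultimately have "(\<lambda>n. (LINT y|P. (h y)\<^sup>2) - (\<Sum>i<n. (c i)\<^sup>2)) \<longlonglongrightarrow> 0" by (subst (asm) tendsto_ennreal_iff) auto
  then have "(\<lambda>n. (LINT y|P. (h y)\<^sup>2) - ((LINT y|P. (h y)\<^sup>2) - (\<Sum>i<n. (c i)\<^sup>2))) \<longlonglongrightarrow> (LINT y|P. (h y)\<^sup>2) - 0"
    by (intro tendsto_intros)
  then show ?thesis by (simp add: sums_def c_def)
qed

lemma in_L2_inner:
  fixes g :: "'a \<Rightarrow> 'b::euclidean_space"
  assumes "in_L2 P g" "b \<in> Basis"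
  shows "in_L2 P (\<lambda>y. g y \<bullet> b)"
proof -
  have "sqnorm_L2 P (\<lambda>y. g y \<bullet> b) \<le> sqnorm_L2 P g"
    unfolding sqnorm_L2_def using Basis_le_norm[OF assms(2)] by (intro nn_integral_mono ennreal_leI power_mono) auto
  then show ?thesis using assms unfolding in_L2_def by (auto intro: le_less_trans)
qed

lemma Parseval:
  fixes g :: "real \<Rightarrow> 'b::euclidean_space"
  assumes \<Psi>: "orthonormal_basis_L2 P \<Psi>" and g: "in_L2 P g"
  shows "sqnorm_L2 P g = (\<Sum>j. ennreal ((norm (LINT y|P. \<Psi> j y *\<^sub>R g y))\<^sup>2))"
proof -
  have L2: "in_L2 P (\<Psi> i)" for i using \<Psi> by (auto simp: orthonormal_basis_L2_def)
  have ip: "integrable P (\<lambda>y. \<Psi> j y *\<^sub>R g y)" for j by (rule in_L2_scaleR_integrable[OF L2 g])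
  have isq: "integrable P (\<lambda>y. (g y \<bullet> b)\<^sup>2)" if "b \<in> Basis" for b
    using in_L2_scaleR_integrable[OF in_L2_inner[OF g that] in_L2_inner[OF g that]] by (simp add: power2_eq_square)
  have nsq: "(norm (x::'b))\<^sup>2 = (\<Sum>b\<in>Basis. (x \<bullet> b)\<^sup>2)" for x
    unfolding power2_norm_eq_inner by (subst euclidean_inner) (simp add: power2_eq_square)
  have "(\<lambda>j. \<Sum>b\<in>Basis. (LINT y|P. (g y \<bullet> b) * \<Psi> j y)\<^sup>2) sums (\<Sum>b\<in>Basis. LINT y|P. (g y \<bullet> b)\<^sup>2)"
    by (intro sums_sum Parseval_real[OF \<Psi>] in_L2_inner[OF g])
  moreover have "(\<Sum>b\<in>Basis. (LINT y|P. (g y \<bullet> b) * \<Psi> j y)\<^sup>2) = (norm (LINT y|P. \<Psi> j y *\<^sub>R g y))\<^sup>2" for j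
  proof -
    have "(LINT y|P. (g y \<bullet> b) * \<Psi> j y) = (LINT y|P. \<Psi> j y *\<^sub>R g y) \<bullet> b" for b
      using integral_inner_left[OF ip[of j], of b] by (simp add: mult.commute)
    then show ?thesis unfolding nsq by simp
  qed
  moreover have "(\<Sum>b\<in>Basis. LINT y|P. (g y \<bullet> b)\<^sup>2) = (LINT y|P. (norm (g y))\<^sup>2)"
    unfolding nsq using isq by simp
  ultimately have "(\<lambda>j. (norm (LINT y|P. \<Psi> j y *\<^sub>R g y))\<^sup>2) sums (LINT y|P. (norm (g y))\<^sup>2)" by simp
  then have "(\<Sum>j. ennreal ((norm (LINT y|P. \<Psi> j y *\<^sub>R g y))\<^sup>2)) = ennreal (LINT y|P. (norm (g y))\<^sup>2)"
    by (intro suminf_ennreal_eq) auto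
  moreover have "sqnorm_L2 P g = ennreal (LINT y|P. (norm (g y))\<^sup>2)"
    unfolding sqnorm_L2_def using isq by (intro nn_integral_eq_integral) (simp_all add: nsq sum_nonneg)
  ultimately show ?thesis by simp
qed

lemma ennreal_norm_add_square_le:
  "ennreal ((norm (a + b))\<^sup>2) \<le> 2 * ennreal ((norm a)\<^sup>2) + 2 * ennreal ((norm b)\<^sup>2)"
proof -
  have "(norm (a + b))\<^sup>2 \<le> (norm a + norm b)\<^sup>2" by (intro power_mono norm_triangle_ineq) simp
  also have "\<dots> \<le> 2 * (norm a)\<^sup>2 + 2 * (norm b)\<^sup>2"
    using zero_le_power2[of "norm a - norm b"] by (simp add: power2_eq_square algebra_simps)
  finally have "ennreal ((norm (a + b))\<^sup>2) \<le> ennreal (2 * (norm a)\<^sup>2 + 2 * (norm b)\<^sup>2)" by (rule ennreal_leI)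
  also have "\<dots> = 2 * ennreal ((norm a)\<^sup>2) + 2 * ennreal ((norm b)\<^sup>2)" by (simp add: ennreal_plus ennreal_mult)
  finally show ?thesis .
qed

lemma sqnorm_L2_add_le:
  fixes g h :: "'a \<Rightarrow> 'b::{real_normed_vector, second_countable_topology}"
  assumes "g \<in> borel_measurable N" "h \<in> borel_measurable N"
  shows "sqnorm_L2 N (\<lambda>z. g z + h z) \<le> 2 * sqnorm_L2 N g + 2 * sqnorm_L2 N h"
proof -
  have "sqnorm_L2 N (\<lambda>z. g z + h z) \<le> (\<integral>\<^sup>+ z. 2 * ennreal ((norm (g z))\<^sup>2) + 2 * ennreal ((norm (h z))\<^sup>2) \<partial>N)"
    unfolding sqnorm_L2_def by (intro nn_integral_mono ennreal_norm_add_square_le)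
  also have "\<dots> = 2 * sqnorm_L2 N g + 2 * sqnorm_L2 N h"
    unfolding sqnorm_L2_def using assms by (subst nn_integral_add) (auto simp: nn_integral_cmult)
  finally show ?thesis .
qed

lemma sqnorm_L2_cong_AE:
  assumes "AE z in N. g z = h z"
  shows "sqnorm_L2 N g = sqnorm_L2 N h"
  unfolding sqnorm_L2_def by (rule nn_integral_cong_AE) (use assms in eventually_elim, auto)

text \<open>Projecting the residual on the modes \<open>\<Psi> j\<close>, the truncated expansion \<open>\<Sum>i\<le>M. \<Psi> i * a i\<close> contributes
  only to the modes \<open>j \<le> M\<close>.\<close>
lemma residual_energy_le:
  fixes r g :: "real \<Rightarrow> 'z \<Rightarrow> 'b::euclidean_space" and a b :: "nat \<Rightarrow> 'z \<Rightarrow> 'b"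
  assumes P: "sigma_finite_measure P" and N: "sigma_finite_measure N"
    and \<Psi>: "orthonormal_basis_L2 P \<Psi>" and r: "in_L2_L2 P N r"
    and split: "AE z in N. \<forall>y. r y z = (\<Sum>i\<le>M. \<Psi> i y *\<^sub>R a i z) + g y z"
    and dm: "\<And>j. j \<le> M \<Longrightarrow> (\<lambda>z. a j z + b j z) \<in> borel_measurable N"
  shows "sqnorm_L2_L2 P N r \<le> 2 * (\<Sum>j\<le>M. sqnorm_L2 N (\<lambda>z. a j z + b j z))
    + 2 * (\<Sum>j\<le>M. sqnorm_L2 N (\<lambda>z. (LINT y|P. \<Psi> j y *\<^sub>R g y z) - b j z))
    + (\<Sum>\<^sub>\<infinity>j\<in>{M<..}. sqnorm_L2 N (\<lambda>z. LINT y|P. \<Psi> j y *\<^sub>R g y z))"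
proof -
  interpret P: sigma_finite_measure P by fact
  interpret N: sigma_finite_measure N by fact
  interpret pair_sigma_finite P N ..
  interpret NP: pair_sigma_finite N P ..
  have L2: "in_L2 P (\<Psi> i)" and on: "(LINT y|P. \<Psi> i y * \<Psi> j y) = (if i = j then 1 else 0)" for i j
    using \<Psi> by (auto simp: orthonormal_basis_L2_def)
  have \<Psi>m[measurable]: "\<Psi> i \<in> borel_measurable P" for i using L2 by (auto simp: in_L2_def)
  have rm: "(\<lambda>(y, z). r y z) \<in> borel_measurable (P \<Otimes>\<^sub>M N)" and rfin: "sqnorm_L2_L2 P N r < \<infinity>"
    using r by (auto simp: in_L2_L2_def)
  note [measurable] = rm
  have rm': "(\<lambda>(z, y). r y z) \<in> borel_measurable (N \<Otimes>\<^sub>M P)"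
    using measurable_pair_swap[OF rm] by (simp add: case_prod_unfold)
  \<comment> \<open>The order of integration is exchanged so that the expansion in \<open>y\<close>
    can be carried out at each fixed space-time point.\<close>
  have sw: "sqnorm_L2_L2 P N r = (\<integral>\<^sup>+ z. sqnorm_L2 P (\<lambda>y. r y z) \<partial>N)"
    unfolding sqnorm_L2_L2_def sqnorm_L2_def by (rule Fubini'[symmetric]) measurable
  define c where "c j z = (LINT y|P. \<Psi> j y *\<^sub>R r y z)" for j z
  have cm: "c j \<in> borel_measurable N" for j
  proof -
    have "(\<lambda>(z, y). \<Psi> j y *\<^sub>R r y z) \<in> borel_measurable (N \<Otimes>\<^sub>M P)"
      using rm' by (simp add: case_prod_unfold)
    then show ?thesis
      unfolding c_def[abs_def] using sigma_finite_measure.borel_measurable_lebesgue_integral[OF P, of "\<lambda>z y. \<Psi> j y *\<^sub>R r y z" N] by simp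
  qed
  have sqm: "(\<lambda>z. sqnorm_L2 P (\<lambda>y. r y z)) \<in> borel_measurable N"
  proof -
    have "(\<lambda>(z, y). ennreal ((norm (r y z))\<^sup>2)) \<in> borel_measurable (N \<Otimes>\<^sub>M P)" using rm' by (simp add: case_prod_unfold)
    then show ?thesis
      unfolding sqnorm_L2_def using sigma_finite_measure.borel_measurable_nn_integral[OF P, of "\<lambda>z y. ennreal ((norm (r y z))\<^sup>2)" N] by simp
  qed
  have fin: "AE z in N. sqnorm_L2 P (\<lambda>y. r y z) \<noteq> \<infinity>"
    using rfin unfolding sw by (intro nn_integral_PInf_AE[OF sqm]) auto
  have good: "AE z in N. in_L2 P (\<lambda>y. r y z)"
    using fin AE_space
  proof eventually_elim
    case (elim z)
    have "(\<lambda>y. (y, z)) \<in> P \<rightarrow>\<^sub>M P \<Otimes>\<^sub>M N" using elim(2) by measurable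
    from measurable_compose[OF this rm] show ?case using elim by (simp add: in_L2_def less_top)
  qed
  \<comment> \<open>By orthonormality the truncated sum contributes \<open>a j\<close> to mode
    \<open>j \<le> M\<close> and nothing to higher modes, so the coefficients of \<open>g\<close>
    differ from those of \<open>r\<close> only there.\<close>
  have G: "AE z in N. \<forall>j. (LINT y|P. \<Psi> j y *\<^sub>R g y z) = c j z - (if j \<le> M then a j z else 0)"
    using good split
  proof eventually_elim
    case (elim z)
    show ?case
    proof
      fix j
      have i1: "integrable P (\<lambda>y. \<Psi> j y *\<^sub>R r y z)" by (rule in_L2_scaleR_integrable[OF L2 elim(1)])
      have i2: "integrable P (\<lambda>y. (\<Psi> j y * \<Psi> i y) *\<^sub>R a i z)" for i
        using in_L2_scaleR_integrable[OF L2[of j] L2[of i]] by simp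
      have "(LINT y|P. \<Psi> j y *\<^sub>R g y z) = (LINT y|P. \<Psi> j y *\<^sub>R r y z - (\<Sum>i\<le>M. (\<Psi> j y * \<Psi> i y) *\<^sub>R a i z))"
        using elim(2) by (intro Bochner_Integration.integral_cong refl) (simp add: scaleR_add_right scaleR_sum_right)
      also have "\<dots> = c j z - (\<Sum>i\<le>M. LINT y|P. (\<Psi> j y * \<Psi> i y) *\<^sub>R a i z)"
        using i1 i2 by (simp add: c_def)
      also have "(\<Sum>i\<le>M. LINT y|P. (\<Psi> j y * \<Psi> i y) *\<^sub>R a i z) = (\<Sum>i\<le>M. (if j = i then 1 else 0) *\<^sub>R a i z)"
        using in_L2_scaleR_integrable[OF L2[of j] L2] by (intro sum.cong refl) (simp add: on[symmetric])
      also have "\<dots> = (if j \<le> M then a j z else 0)" by (simp add: if_distrib[of "\<lambda>x. x *\<^sub>R _"] sum.delta cong: if_cong)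
      finally show "(LINT y|P. \<Psi> j y *\<^sub>R g y z) = c j z - (if j \<le> M then a j z else 0)" .
    qed
  qed
  have "sqnorm_L2_L2 P N r = (\<integral>\<^sup>+ z. (\<Sum>j. ennreal ((norm (c j z))\<^sup>2)) \<partial>N)"
    unfolding sw c_def by (rule nn_integral_cong_AE) (use good in eventually_elim, rule Parseval[OF \<Psi>])
  also have "\<dots> = (\<Sum>j. sqnorm_L2 N (c j))"
    unfolding sqnorm_L2_def using cm by (intro nn_integral_suminf) auto
  also have "\<dots> = (\<Sum>j. sqnorm_L2 N (c (j + Suc M))) + (\<Sum>j<Suc M. sqnorm_L2 N (c j))"
    by (rule suminf_offset) (rule summableI)
  also have "(\<Sum>j<Suc M. sqnorm_L2 N (c j)) \<le> (\<Sum>j<Suc M. 2 * sqnorm_L2 N (\<lambda>z. a j z + b j z) + 2 * sqnorm_L2 N (\<lambda>z. (LINT y|P. \<Psi> j y *\<^sub>R g y z) - b j z))"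
  proof (rule sum_mono)
    fix j assume "j \<in> {..<Suc M}"
    then have j: "j \<le> M" by simp
    have sm: "(\<lambda>z. c j z - (a j z + b j z)) \<in> borel_measurable N" using cm dm[OF j] by measurable
    \<comment> \<open>The quadrature value \<open>b j\<close> is added and subtracted:
      \<open>a j + b j\<close> is the deterministic part, and the rest is the quadrature error of
      the flux. Squaring the sum costs the factor 2.\<close>
    have "sqnorm_L2 N (c j) = sqnorm_L2 N (\<lambda>z. (a j z + b j z) + (c j z - (a j z + b j z)))" by simp
    also have "\<dots> \<le> 2 * sqnorm_L2 N (\<lambda>z. a j z + b j z) + 2 * sqnorm_L2 N (\<lambda>z. c j z - (a j z + b j z))"
      by (rule sqnorm_L2_add_le[OF dm[OF j] sm])
    also have "sqnorm_L2 N (\<lambda>z. c j z - (a j z + b j z)) = sqnorm_L2 N (\<lambda>z. (LINT y|P. \<Psi> j y *\<^sub>R g y z) - b j z)"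
      by (rule sqnorm_L2_cong_AE) (use G in eventually_elim, use j in simp)
    finally show "sqnorm_L2 N (c j) \<le> 2 * sqnorm_L2 N (\<lambda>z. a j z + b j z) + 2 * sqnorm_L2 N (\<lambda>z. (LINT y|P. \<Psi> j y *\<^sub>R g y z) - b j z)" .
  qed
  also have "\<dots> = 2 * (\<Sum>j\<le>M. sqnorm_L2 N (\<lambda>z. a j z + b j z)) + 2 * (\<Sum>j\<le>M. sqnorm_L2 N (\<lambda>z. (LINT y|P. \<Psi> j y *\<^sub>R g y z) - b j z))"
    by (simp add: sum.distrib sum_distrib_left lessThan_Suc_atMost)
  \<comment> \<open>For \<open>j > M\<close> the coefficient of \<open>r\<close> is that of
    \<open>g\<close> alone, so no splitting occurs. The terms are nonnegative, so the ordinary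
    series and the unconditional sum over \<open>{M<..}\<close> coincide.\<close>
  also have "(\<Sum>j. sqnorm_L2 N (c (j + Suc M))) = (\<Sum>\<^sub>\<infinity>j\<in>{M<..}. sqnorm_L2 N (\<lambda>z. LINT y|P. \<Psi> j y *\<^sub>R g y z))"
  proof -
    have bij: "bij_betw (\<lambda>j. j + Suc M) UNIV {M<..}"
      by (rule bij_betwI[where g="\<lambda>j. j - Suc M"]) auto
    have "(\<Sum>\<^sub>\<infinity>j\<in>{M<..}. sqnorm_L2 N (\<lambda>z. LINT y|P. \<Psi> j y *\<^sub>R g y z)) = (\<Sum>\<^sub>\<infinity>j\<in>{M<..}. sqnorm_L2 N (c j))"
      by (intro infsum_cong sqnorm_L2_cong_AE) (use G in eventually_elim, auto)
    also have "\<dots> = (\<Sum>\<^sub>\<infinity>j\<in>UNIV. sqnorm_L2 N (c (j + Suc M)))" by (rule infsum_reindex_bij_betw[OF bij, symmetric])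
    also have "\<dots> = (\<Sum>j. sqnorm_L2 N (c (j + Suc M)))"
      by (rule sums_unique, rule has_sum_imp_sums, rule has_sum_infsum, rule nonneg_summable_on_complete) simp
    finally show ?thesis by simp
  qed
  finally show ?thesis by (simp add: add_ac add_mono)
qed

section \<open>Regularity and measurability of the discrete expansions\<close>

lemma DG_space_measurable:
  assumes h: "0 < h" and v: "v \<in> DG_space x0 h p"
  shows "v \<in> borel_measurable borel"
proof -
  obtain \<psi> where \<psi>: "\<And>k. vec_poly p (\<psi> k)" "\<And>k x. x \<in> cell x0 h k \<Longrightarrow> v x = \<psi> k x"
    using v unfolding DG_space_def by simp metis
  \<comment> \<open>At the nodes a member of \<open>DG_space\<close> may take any value; these
    points are countable and do not affect Borel measurability.\<close>
  define N where "N = range (node x0 h)"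
  have \<psi>m: "\<psi> k \<in> borel_measurable borel" for k
  proof -
    obtain c where "\<And>x. \<psi> k x = (\<Sum>i\<le>p. x ^ i *\<^sub>R c i)" using \<psi>(1) unfolding vec_poly_def by blast
    then have "\<psi> k = (\<lambda>x. \<Sum>i\<le>p. x ^ i *\<^sub>R c i)" by blast
    then show ?thesis by (simp only:) (intro borel_measurable_continuous_onI continuous_intros)
  qed
  have cells: "x \<in> cell x0 h \<lfloor>(x - x0) / h\<rfloor>" if "x \<notin> N" for x
  proof -
    let ?k = "\<lfloor>(x - x0) / h\<rfloor>"
    have "of_int ?k * h \<le> (x - x0) / h * h" using h by (intro mult_right_mono of_int_floor_le) auto
    then have le: "node x0 h ?k \<le> x" using h by (simp add: node_def)
    have "(x - x0) / h * h < (of_int ?k + 1) * h" using h by (intro mult_strict_right_mono) auto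
    then have lt: "x < node x0 h (?k + 1)" using h by (simp add: node_def)
    have "x \<noteq> node x0 h ?k" using that by (auto simp: N_def)
    then show ?thesis using le lt by (simp add: cell_def)
  qed
  show ?thesis
  proof (rule measurable_discrete_difference)
    show "(\<lambda>x. \<psi> \<lfloor>(x - x0) / h\<rfloor> x) \<in> borel_measurable borel"
    proof (rule measurable_compose_countable[where f="\<lambda>k x. \<psi> k x" and g="\<lambda>x. \<lfloor>(x - x0) / h\<rfloor>"])
      show "(\<lambda>x. \<lfloor>(x - x0) / h\<rfloor>) \<in> borel \<rightarrow>\<^sub>M count_space UNIV" by measurable
    qed (rule \<psi>m)
    show "countable N" unfolding N_def by simp
    show "\<psi> \<lfloor>(x - x0) / h\<rfloor> x = v x" if "x \<notin> N" for x using \<psi>(2)[OF cells[OF that]] by simp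
  qed auto
qed

lemma nisp_coeff_has_vector_derivative:
  assumes "\<And>l. l \<le> R \<Longrightarrow> (a l has_vector_derivative d l) (at t)"
  shows "((\<lambda>s. nisp_coeff R \<Psi> yq wq (\<lambda>l. a l s) i) has_vector_derivative nisp_coeff R \<Psi> yq wq d i) (at t)"
  unfolding nisp_coeff_def using assms
  by (intro has_vector_derivative_sum) (auto intro!: derivative_eq_intros)

lemma nisp_has_vector_derivative:
  assumes "\<And>l. l \<le> R \<Longrightarrow> (a l has_vector_derivative d l) (at t)"
  shows "((\<lambda>s. nisp M R \<Psi> yq wq (\<lambda>l. a l s) y) has_vector_derivative nisp M R \<Psi> yq wq d y) (at t)"
proof -
  have "((\<lambda>s. \<Psi> i y *\<^sub>R nisp_coeff R \<Psi> yq wq (\<lambda>l. a l s) i) has_vector_derivative \<Psi> i y *\<^sub>R nisp_coeff R \<Psi> yq wq d i) (at t)" for i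
    using bounded_linear.has_vector_derivative[OF bounded_linear_scaleR_right nisp_coeff_has_vector_derivative[OF assms]] .
  then show ?thesis unfolding nisp_def by (intro has_vector_derivative_sum)
qed

text \<open>The reconstruction is controlled on \<open>[0, T]\<close> only, whereas the stability
  estimate wants a function on the whole plane. Clamping the time is 1-Lipschitz and preserves both
  the Lipschitz constant and the set of values on \<open>[0, T]\<close>.\<close>

lemma Lipschitz_clamp:
  fixes v :: "real \<Rightarrow> 'b::metric_space \<Rightarrow> 'c::metric_space"
  assumes "L-lipschitz_on ({0..T} \<times> UNIV) (\<lambda>(t, x). v t x)" and T: "0 \<le> T"
  shows "L-lipschitz_on UNIV (\<lambda>(t, x). v (max 0 (min T t)) x)"
proof (rule lipschitz_onI)
  note n = lipschitz_on_nonneg[OF assms(1)]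
  fix z z' :: "real \<times> 'b"
  obtain t x t' x' where z: "z = (t, x)" "z' = (t', x')" by (cases z, cases z')
  have "dist (v (max 0 (min T t)) x) (v (max 0 (min T t')) x') \<le> L * dist (max 0 (min T t), x) (max 0 (min T t'), x')"
    using lipschitz_onD[OF assms(1), of "(max 0 (min T t), x)" "(max 0 (min T t'), x')"] T by simp
  also have "\<dots> \<le> L * dist (t, x) (t', x')"
  proof (rule mult_left_mono[OF _ n])
    have "\<bar>max 0 (min T t) - max 0 (min T t')\<bar> \<le> \<bar>t - t'\<bar>" by linarith
    then show "dist (max 0 (min T t), x) (max 0 (min T t'), x') \<le> dist (t, x) (t', x')"
      unfolding dist_Pair_Pair dist_real_def by (intro real_sqrt_le_mono add_right_mono) (simp add: abs_le_square_iff[symmetric] power2_abs)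
  qed
  finally show "dist (case z of (t, x) \<Rightarrow> v (max 0 (min T t)) x) (case z' of (t, x) \<Rightarrow> v (max 0 (min T t)) x) \<le> L * dist z z'"
    by (simp add: z)
qed (rule lipschitz_on_nonneg[OF assms(1)])

lemma Lipschitz_nisp:
  fixes V :: "nat \<Rightarrow> 'c::metric_space \<Rightarrow> real ^ 'm::finite"
  assumes "\<And>l. l \<le> R \<Longrightarrow> \<exists>L. L-lipschitz_on S (V l)"
  shows "\<exists>L. L-lipschitz_on S (\<lambda>z. nisp M R \<Psi> yq wq (\<lambda>l. V l z) y)"
proof -
  have sumL: "\<exists>L. L-lipschitz_on S (\<lambda>z. \<Sum>i\<in>I. F i z)" if "finite I" "\<And>i. i \<in> I \<Longrightarrow> \<exists>L. L-lipschitz_on S (F i)"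
    for I :: "nat set" and F :: "nat \<Rightarrow> 'c \<Rightarrow> real ^ 'm"
    using that
  proof (induction I rule: finite_induct)
    case empty
    have "0-lipschitz_on S (\<lambda>z. 0 :: real ^ 'm)" by (rule lipschitz_on_constant)
    then show ?case by auto
  next
    case (insert i I)
    then obtain L1 L2 where "L1-lipschitz_on S (F i)" "L2-lipschitz_on S (\<lambda>z. \<Sum>i\<in>I. F i z)" by blast
    from lipschitz_on_add[OF this] show ?case using insert by (auto intro!: exI)
  qed
  have scale: "\<exists>L. L-lipschitz_on S (\<lambda>z. c *\<^sub>R F z)" if "\<exists>L. L-lipschitz_on S F" for c :: real and F :: "'c \<Rightarrow> real ^ 'm"
    using that lipschitz_on_cmult by blast
  show ?thesis unfolding nisp_def nisp_coeff_def
    by (intro sumL scale) (auto intro: assms)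
qed


lemma nisp_coeff_measurable:
  fixes a :: "nat \<Rightarrow> 'z \<Rightarrow> real ^ 'm::finite"
  assumes "\<And>l. l \<le> R \<Longrightarrow> a l \<in> borel_measurable N"
  shows "(\<lambda>z. nisp_coeff R \<Psi> yq wq (\<lambda>l. a l z) i) \<in> borel_measurable N"
  unfolding nisp_coeff_def using assms by (intro borel_measurable_sum borel_measurable_scaleR borel_measurable_const) auto

lemma nisp_measurable:
  fixes a :: "nat \<Rightarrow> 'z \<Rightarrow> real ^ 'm::finite"
  assumes a: "\<And>l. l \<le> R \<Longrightarrow> a l \<in> borel_measurable N" and \<Psi>: "\<And>i. \<Psi> i \<in> borel_measurable P"
  shows "(\<lambda>(y, z). nisp M R \<Psi> yq wq (\<lambda>l. a l z) y) \<in> borel_measurable (P \<Otimes>\<^sub>M N)"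
proof -
  have 1: "(\<lambda>p. nisp_coeff R \<Psi> yq wq (\<lambda>l. a l (snd p)) i) \<in> borel_measurable (P \<Otimes>\<^sub>M N)" for i
    by (rule measurable_compose[OF measurable_snd nisp_coeff_measurable[OF a]])
  have 2: "(\<lambda>p. \<Psi> i (fst p)) \<in> borel_measurable (P \<Otimes>\<^sub>M N)" for i
    by (rule measurable_compose[OF measurable_fst \<Psi>])
  show ?thesis unfolding nisp_def case_prod_unfold by (intro borel_measurable_sum borel_measurable_scaleR 1 2)
qed

text \<open>For each \<open>t\<close> the bound by \<open>G t\<close> fails on a null set of pairs
  \<open>(y, x)\<close> that depends on \<open>t\<close>. Fubini rearranges these into one null set
  of \<open>y\<close>, outside of which the bound holds for almost every \<open>(t, x)\<close>; so a
  single function \<open>G\<close> serves almost all \<open>y\<close>.\<close>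

lemma AE_le_esssup_slices:
  fixes g :: "'y \<Rightarrow> real \<Rightarrow> real \<Rightarrow> ennreal"
  assumes P: "sigma_finite_measure P" and g: "(\<lambda>(y, z). g y (fst z) (snd z)) \<in> borel_measurable (P \<Otimes>\<^sub>M (lborel \<Otimes>\<^sub>M lborel))"
  defines "G \<equiv> \<lambda>t. esssup (P \<Otimes>\<^sub>M lborel) (\<lambda>(y, x). g y t x)"
  shows "G \<in> borel_measurable borel"
    and "AE y in P. AE z in (lborel :: (real \<times> real) measure). g y (fst z) (snd z) \<le> G (fst z)"
proof -
  interpret P: sigma_finite_measure P by fact
  interpret Pl: pair_sigma_finite P "lborel :: real measure" ..
  interpret PL: pair_sigma_finite P "lborel \<Otimes>\<^sub>M lborel :: (real \<times> real) measure" ..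
  have "(\<lambda>p. (fst (snd p), (fst p, snd (snd p)))) \<in> lborel \<Otimes>\<^sub>M (P \<Otimes>\<^sub>M lborel) \<rightarrow>\<^sub>M P \<Otimes>\<^sub>M (lborel \<Otimes>\<^sub>M lborel)"
    by measurable
  from measurable_compose[OF this g]
  have g1: "(\<lambda>p. g (fst (snd p)) (fst p) (snd (snd p))) \<in> borel_measurable (lborel \<Otimes>\<^sub>M (P \<Otimes>\<^sub>M (lborel :: real measure)))"
    by (simp add: case_prod_unfold)
  have sfPl: "sigma_finite_measure (P \<Otimes>\<^sub>M (lborel :: real measure))" by unfold_locales
  show Gm: "G \<in> borel_measurable borel"
    using borel_measurable_esssup[OF sfPl g1] unfolding G_def by (simp add: case_prod_unfold)
  \<comment> \<open>Indicator of the failure set. Its triple integral is computed with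
    \<open>t\<close> outermost to see that it vanishes, and is then read with \<open>y\<close>
    outermost.\<close>
  define F where "F y z = (if g y (fst z) (snd z) \<le> G (fst z) then 0 else 1 :: ennreal)" for y and z :: "real \<times> real"
  have Gm': "(\<lambda>p. G (fst (snd p))) \<in> borel_measurable (P \<Otimes>\<^sub>M (lborel \<Otimes>\<^sub>M (lborel :: real measure)))"
    by (rule measurable_compose[OF _ Gm]) measurable
  have gm': "(\<lambda>p. g (fst p) (fst (snd p)) (snd (snd p))) \<in> borel_measurable (P \<Otimes>\<^sub>M (lborel \<Otimes>\<^sub>M (lborel :: real measure)))"
    using g by (simp add: case_prod_unfold)
  have Fm: "case_prod F \<in> borel_measurable (P \<Otimes>\<^sub>M (lborel \<Otimes>\<^sub>M lborel))"
    unfolding F_def case_prod_unfold using Gm' gm' by measurable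
  have zero: "(\<integral>\<^sup>+ x. (\<integral>\<^sup>+ y. F y (t, x) \<partial>P) \<partial>lborel) = 0" for t
  proof -
    have "(\<lambda>p. (fst p, (t, snd p))) \<in> P \<Otimes>\<^sub>M lborel \<rightarrow>\<^sub>M P \<Otimes>\<^sub>M (lborel \<Otimes>\<^sub>M lborel)" by measurable
    from measurable_compose[OF this Fm] have m: "(\<lambda>(y, x). F y (t, x)) \<in> borel_measurable (P \<Otimes>\<^sub>M lborel)"
      by (simp add: case_prod_unfold)
    have "(\<integral>\<^sup>+ x. (\<integral>\<^sup>+ y. F y (t, x) \<partial>P) \<partial>lborel) = (\<integral>\<^sup>+ p. (case p of (y, x) \<Rightarrow> F y (t, x)) \<partial>(P \<Otimes>\<^sub>M lborel))"
      using Pl.nn_integral_snd[OF m] by simp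
    also have "\<dots> = (\<integral>\<^sup>+ p. 0 \<partial>(P \<Otimes>\<^sub>M (lborel :: real measure)))"
    proof (rule nn_integral_cong_AE)
      have "AE p in P \<Otimes>\<^sub>M lborel. (case p of (y, x) \<Rightarrow> g y t x) \<le> G t" unfolding G_def by (rule esssup_AE)
      then show "AE p in P \<Otimes>\<^sub>M lborel. (case p of (y, x) \<Rightarrow> F y (t, x)) = 0" by eventually_elim (auto simp: F_def)
    qed
    finally show ?thesis by simp
  qed
  have hm: "(\<lambda>z. \<integral>\<^sup>+ y. F y z \<partial>P) \<in> borel_measurable (lborel \<Otimes>\<^sub>M lborel)"
  proof -
    have "(\<lambda>p. F (snd p) (fst p)) \<in> borel_measurable ((lborel \<Otimes>\<^sub>M lborel) \<Otimes>\<^sub>M P)"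
      using measurable_pair_swap[OF Fm] by (simp add: case_prod_unfold)
    then show ?thesis using P.borel_measurable_nn_integral[of "\<lambda>z y. F y z"] by (simp add: case_prod_unfold)
  qed
  have "(\<integral>\<^sup>+ y. (\<integral>\<^sup>+ z. F y z \<partial>(lborel \<Otimes>\<^sub>M lborel)) \<partial>P) = (\<integral>\<^sup>+ z. (\<integral>\<^sup>+ y. F y z \<partial>P) \<partial>(lborel \<Otimes>\<^sub>M lborel))"
    by (rule PL.Fubini'[OF Fm, symmetric])
  also have "\<dots> = (\<integral>\<^sup>+ t. (\<integral>\<^sup>+ x. (\<integral>\<^sup>+ y. F y (t, x) \<partial>P) \<partial>lborel) \<partial>lborel)"
    by (rule lborel.nn_integral_fst[OF hm, symmetric])
  also have "\<dots> = 0" by (simp add: zero)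
  finally have 0: "(\<integral>\<^sup>+ y. (\<integral>\<^sup>+ z. F y z \<partial>(lborel \<Otimes>\<^sub>M lborel)) \<partial>P) = 0" .
  have "(\<lambda>y. \<integral>\<^sup>+ z. F y z \<partial>(lborel \<Otimes>\<^sub>M lborel)) \<in> borel_measurable P"
    by (rule sigma_finite_measure.borel_measurable_nn_integral[OF _ Fm]) (simp add: lborel_prod lborel.sigma_finite_measure_axioms)
  with 0 have "AE y in P. (\<integral>\<^sup>+ z. F y z \<partial>(lborel \<Otimes>\<^sub>M lborel)) = 0" by (subst (asm) nn_integral_0_iff_AE) auto
  then show "AE y in P. AE z in (lborel :: (real \<times> real) measure). g y (fst z) (snd z) \<le> G (fst z)"
    using AE_space
  proof eventually_elim
    case (elim y)
    have "(\<lambda>z. (y, z)) \<in> lborel \<Otimes>\<^sub>M lborel \<rightarrow>\<^sub>M P \<Otimes>\<^sub>M (lborel \<Otimes>\<^sub>M lborel)" using elim(2) by measurable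
    from measurable_compose[OF this Fm] have m: "F y \<in> borel_measurable (lborel \<Otimes>\<^sub>M lborel)" by simp
    have "AE z in lborel \<Otimes>\<^sub>M lborel. F y z = 0" using elim(1) by (subst (asm) nn_integral_0_iff_AE[OF m])
    then show ?case unfolding lborel_prod by eventually_elim (auto simp: F_def split: if_splits)
  qed
qed

text \<open>\<open>vector_derivative\<close> is defined by choice, so equality at points without a
  derivative requires that exactly the same vectors are derivatives of both functions.\<close>

lemma dt_cong_open:
  assumes "0 < t" "t < T" "\<And>s. 0 < s \<Longrightarrow> s < T \<Longrightarrow> v s x = w s x"
  shows "dt v t x = dt w t x"
proof -
  have "((\<lambda>s. v s x) has_vector_derivative d) (at t) \<longleftrightarrow> ((\<lambda>s. w s x) has_vector_derivative d) (at t)" for d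
    using has_vector_derivative_transform_within_open[of "\<lambda>s. v s x" d t "{0<..<T}" "\<lambda>s. w s x"]
      has_vector_derivative_transform_within_open[of "\<lambda>s. w s x" d t "{0<..<T}" "\<lambda>s. v s x"] assms by auto
  then show ?thesis unfolding dt_def vector_derivative_def by simp
qed

lemma id_measurable_time_strip: "a \<le> b \<Longrightarrow> (\<lambda>z. z) \<in> time_strip a \<rightarrow>\<^sub>M time_strip b"
  unfolding time_strip_def by (rule measurable_restrict_space2[OF _ measurable_restrict_space1]) (auto simp: space_restrict_space)

lemma sigma_finite_time_strip: "sigma_finite_measure (time_strip T)"
  unfolding time_strip_def by (rule sigma_finite_measure_restrict_space[OF lborel.sigma_finite_measure_axioms]) (simp add: strip_sets)

section \<open>Assembly of the mean-square error estimate\<close>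

theorem theorem4p3:
  fixes Pr :: "'w measure" and \<xi> :: "'w \<Rightarrow> real" and \<Xi> :: "real set" and w\<xi> :: "real \<Rightarrow> real"
    and P :: "real measure"
    and T :: real and U C :: "(real ^ 'm::finite) set"
    and f :: "real ^ 'm \<Rightarrow> real ^ 'm" and \<eta> q :: "real ^ 'm \<Rightarrow> real"
    and u0 :: "real \<Rightarrow> real \<Rightarrow> real ^ 'm" and u :: "real \<Rightarrow> real \<Rightarrow> real \<Rightarrow> real ^ 'm"
    and Cf C\<eta>l C\<eta>u :: real
    and \<Psi> :: "nat \<Rightarrow> real \<Rightarrow> real" and M R :: nat and yq wq :: "nat \<Rightarrow> real"
    and x0 h :: real and p :: nat and Nt :: nat and tp :: "nat \<Rightarrow> real"
    and F :: "real ^ 'm \<Rightarrow> real ^ 'm \<Rightarrow> real ^ 'm" and s :: nat and \<alpha> \<beta> :: "nat \<Rightarrow> nat \<Rightarrow> real"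
    and \<Lambda> :: "nat \<Rightarrow> (real \<Rightarrow> real ^ 'm) \<Rightarrow> (real \<Rightarrow> real ^ 'm)"
    and uh :: "nat \<Rightarrow> nat \<Rightarrow> real \<Rightarrow> real ^ 'm" and uh_nisp :: "nat \<Rightarrow> real \<Rightarrow> real \<Rightarrow> real ^ 'm"
    and ust :: "nat \<Rightarrow> real \<Rightarrow> real \<Rightarrow> real ^ 'm" and usts :: "real \<Rightarrow> real \<Rightarrow> real \<Rightarrow> real ^ 'm"
    and n :: nat
  assumes random_space:
      "prob_space Pr" "\<Xi> \<in> sets borel" "\<And>y. y \<in> \<Xi> \<Longrightarrow> 0 \<le> w\<xi> y"
      "distributed Pr (restrict_space lborel \<Xi>) \<xi> (\<lambda>y. ennreal (w\<xi> y))"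
      "P = xi_law \<Xi> w\<xi>"
    and equation:
      "0 < T" "open U" "C2_on U f" "strictly_hyperbolic U f" "entropy_pair U f \<eta> q"
    and initial_datum: "(\<lambda>(x, y). u0 x y) \<in> borel_measurable (lborel \<Otimes>\<^sub>M P)"
    and solution:
      "random_entropy_solution T U f \<eta> q P u0 u"
      "AE (t, x) in time_strip T. in_L2 P (\<lambda>y. u t x y)"
    and compact_set: "C \<subseteq> U" "convex C" "compact C"
    and constants:
      "0 < Cf" "0 < C\<eta>l" "C\<eta>l < C\<eta>u"
      "\<And>v w. w \<in> C \<Longrightarrow> norm (hess f w v v) \<le> Cf * (norm v)\<^sup>2"
      "\<And>v w. w \<in> C \<Longrightarrow> C\<eta>l * (norm v)\<^sup>2 \<le> hess \<eta> w v v"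
      "\<And>v w. w \<in> C \<Longrightarrow> hess \<eta> w v v \<le> C\<eta>u * (norm v)\<^sup>2"
    and stochastic_discretization:
      "orthonormal_basis_L2 P \<Psi>" "\<And>l. l \<le> R \<Longrightarrow> yq l \<in> \<Xi>"
    and mesh: "0 < h" "tp 0 = 0" "tp Nt = T" "strict_mono_on {..Nt} tp"
    and RKDG:
      "RKDG_scheme U f F x0 h p s \<alpha> \<Lambda>"
      "\<And>l. l \<le> R \<Longrightarrow>
        RKDG_approximation f F x0 h p s \<alpha> \<beta> \<Lambda> Nt tp (\<lambda>x. u0 x (yq l)) (\<lambda>k. uh k l)"
    and NISP: "uh_nisp = (\<lambda>k x y. nisp M R \<Psi> yq wq (\<lambda>l. uh k l x) y)"
    and reconstruction:
      "\<And>l. l \<le> R \<Longrightarrow> st_reconstruction T x0 h p (ust l)"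
      "\<And>l t x. l \<le> R \<Longrightarrow> t \<in> {0..T} \<Longrightarrow> ust l t x \<in> U"
      "\<And>l. l \<le> R \<Longrightarrow> in_L2 (time_strip T) (\<lambda>(t, x). residual f (ust l) t x)"
      "usts = (\<lambda>t x y. nisp M R \<Psi> yq wq (\<lambda>l. ust l t x) y)"
      "in_L2_L2 P (time_strip T) (\<lambda>y (t, x). residual f (\<lambda>s z. usts s z y) t x)"
    and values_in_C:
      "AE y in P. AE (t, x) in time_strip T. u t x y \<in> C"
      "AE y in P. \<forall>t\<in>{0..T}. \<forall>x. usts t x y \<in> C"
    and "n \<le> Nt"
  shows "sqnorm_L2_L2 P lborel (\<lambda>y x. u (tp n) x y - uh_nisp n x y)
    \<le> 2 * sqnorm_L2_L2 P lborel (\<lambda>y x. usts (tp n) x y - uh_nisp n x y)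
      + 2 * ennreal (inverse C\<eta>l)
        * (2 * E_det M R \<Psi> yq wq f ust (tp n)
           + 2 * E_sq P M R \<Psi> yq wq f ust usts (tp n)
           + E_sc P M \<Psi> f usts (tp n)
           + ennreal C\<eta>u * sqnorm_L2_L2 P lborel (\<lambda>y x. u0 x y - usts 0 x y))
        * ennreal_exp (ennreal (inverse C\<eta>l)
            * (\<integral>\<^sup>+ t\<in>{0..tp n}.
                (ennreal (C\<eta>u * Cf)
                   * norm_Linf_Linf P lborel (\<lambda>y x. dx (\<lambda>s z. usts s z y) t x)
                 + ennreal (C\<eta>u\<^sup>2)) \<partial>lborel))"
proof -
  interpret Pr: prob_space Pr by (rule random_space(1))
  \<comment> \<open>Identifying the weighted Lebesgue measure with the law of \<open>\<xi>\<close>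
    gives it total mass one.\<close>
  have P_distr: "P = distr Pr (restrict_space lborel \<Xi>) \<xi>"
    unfolding random_space(5) xi_law_def using distributed_distr_eq_density[OF random_space(4)] by simp
  interpret P: prob_space P
    unfolding P_distr by (rule Pr.prob_space_distr[OF distributed_measurable[OF random_space(4)]])
  have sfP: "sigma_finite_measure P" by (rule P.sigma_finite_measure_axioms)
  interpret Pl: pair_sigma_finite P "lborel :: real measure" ..
  have \<Psi>m: "\<Psi> i \<in> borel_measurable P" for i
    using stochastic_discretization(1) by (auto simp: orthonormal_basis_L2_def in_L2_def)
  interpret E: entropy_system U C f \<eta> q Cf C\<eta>l C\<eta>u
    by (unfold_locales) (use equation compact_set constants in auto)
  define tn where "tn = tp n"
  have tn: "0 \<le> tn" "tn \<le> T"
    using strict_mono_on_leD[OF mesh(4), of 0 n] strict_mono_on_leD[OF mesh(4), of n Nt] \<open>n \<le> Nt\<close> mesh(2,3)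
    by (auto simp: tn_def)
  \<comment> \<open>Extension in time by constants, so that \<open>V l\<close> is Lipschitz on the
    whole plane while still taking values in \<open>U\<close>.\<close>
  define V where "V l t x = ust l (max 0 (min T t)) x" for l t x
  have Vlip: "\<exists>L. L-lipschitz_on UNIV (\<lambda>(t, x). V l t x)" if l: "l \<le> R" for l
  proof -
    obtain L where "L-lipschitz_on ({0..T} \<times> UNIV) (\<lambda>(t, x). ust l t x)"
      using reconstruction(1)[OF l] by (auto simp: st_reconstruction_def Let_def)
    from Lipschitz_clamp[OF this] show ?thesis using equation(1) unfolding V_def by (intro exI) simp
  qed
  have VU: "V l t x \<in> U" if "l \<le> R" for l t x
    unfolding V_def using reconstruction(2)[OF that] equation(1) by simp
  have Vc: "continuous_on UNIV (\<lambda>(t, x). V l t x)" if "l \<le> R" for l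
    using Vlip[OF that] lipschitz_on_continuous_on by blast
  have Veq: "V l t = ust l t" if "0 \<le> t" "t \<le> T" for l t using that by (simp add: V_def fun_eq_iff)
  have fc: "continuous_on U f"
    using C2_onD(1)[OF equation(3)] by (intro continuous_at_imp_continuous_on ballI has_derivative_continuous) blast
  have fVc: "continuous_on UNIV (\<lambda>(t, x). f (V l t x))" if "l \<le> R" for l
    using continuous_on_compose2[OF fc Vc[OF that]] VU[OF that] by (auto simp: case_prod_unfold)
  \<comment> \<open>Plays the role of \<open>v\<close> in the stability estimate. It agrees with the
    stochastic reconstruction for times in \<open>[0, T]\<close>.\<close>
  define w where "w y t x = nisp M R \<Psi> yq wq (\<lambda>l. V l t x) y" for y t x
  have wlip: "\<exists>L. L-lipschitz_on UNIV (\<lambda>(t, x). w y t x)" for y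
    using Lipschitz_nisp[of R UNIV "\<lambda>l. \<lambda>(t, x). V l t x" M \<Psi> yq wq y] Vlip
    by (simp add: w_def case_prod_unfold)
  have weq: "w y t = (\<lambda>x. usts t x y)" if "0 \<le> t" "t \<le> T" for y t
    unfolding w_def reconstruction(4) using Veq[OF that] by (simp add: fun_eq_iff)
  define dV where "dV l t x = dx (V l) t x" for l t x
  define tV where "tV l t x = dt (V l) t x" for l t x
  define Dw where "Dw y t x = nisp M R \<Psi> yq wq (\<lambda>l. dV l t x) y" for y t x
  define tw where "tw y t x = nisp M R \<Psi> yq wq (\<lambda>l. tV l t x) y" for y t x
  have dVm: "(\<lambda>z. dV l (fst z) (snd z)) \<in> borel_measurable borel" if "l \<le> R" for l
    using borel_measurable_dx(2)[OF Vc[OF that]] by (simp add: dV_def case_prod_unfold)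
  have tVm: "(\<lambda>z. tV l (fst z) (snd z)) \<in> borel_measurable borel" if "l \<le> R" for l
    using borel_measurable_dt(2)[OF Vc[OF that]] by (simp add: tV_def case_prod_unfold)
  have fVm: "(\<lambda>z. dx (\<lambda>s z. f (V l s z)) (fst z) (snd z)) \<in> borel_measurable borel" if "l \<le> R" for l
    using borel_measurable_dx(2)[OF fVc[OF that]] by (simp add: case_prod_unfold)
  have aeV: "AE z in lborel. \<forall>l\<in>{..R}. ((\<lambda>s. V l s (snd z)) has_vector_derivative tV l (fst z) (snd z)) (at (fst z)) \<and>
      (V l (fst z) has_vector_derivative dV l (fst z) (snd z)) (at (snd z))"
  proof (rule AE_finite_allI)
    fix l assume "l \<in> {..R}"
    then obtain L where "L-lipschitz_on UNIV (\<lambda>(t, x). V l t x)" using Vlip by auto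
    from Lipschitz_AE_partial_derivatives[OF this]
    show "AE z in lborel. ((\<lambda>s. V l s (snd z)) has_vector_derivative tV l (fst z) (snd z)) (at (fst z)) \<and>
      (V l (fst z) has_vector_derivative dV l (fst z) (snd z)) (at (snd z))"
    proof eventually_elim
      case (elim z)
      then show ?case by (simp add: case_prod_unfold tV_def dV_def)
    qed
  qed simp
  \<comment> \<open>The exceptional set stems from the finitely many \<open>V l\<close> and so is
    the same for all \<open>y\<close>. Off it, the derivatives of \<open>w y\<close> are the
    expansions \<open>tw\<close> and \<open>Dw\<close>, and \<open>Dw\<close> is jointly measurable
    in \<open>(y, t, x)\<close>.\<close>
  have aew: "AE z in lborel. \<forall>y. dt (w y) (fst z) (snd z) = tw y (fst z) (snd z) \<and> dx (w y) (fst z) (snd z) = Dw y (fst z) (snd z)"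
    using aeV
  proof eventually_elim
    case (elim z)
    obtain t x where z: "z = (t, x)" by (cases z)
    show ?case
    proof
      fix y
      have 1: "((\<lambda>s. w y s x) has_vector_derivative tw y t x) (at t)"
        unfolding w_def tw_def by (rule nisp_has_vector_derivative) (use elim z in auto)
      have 2: "((\<lambda>x. w y t x) has_vector_derivative Dw y t x) (at x)"
        unfolding w_def Dw_def by (rule nisp_has_vector_derivative) (use elim z in auto)
      show "dt (w y) (fst z) (snd z) = tw y (fst z) (snd z) \<and> dx (w y) (fst z) (snd z) = Dw y (fst z) (snd z)"
        using vector_derivative_at[OF 1] vector_derivative_at[OF 2] by (simp add: z dt_def dx_def)
    qed
  qed
  \<comment> \<open>In contrast to the nested essential supremum in the statement, this one is taken
    jointly in \<open>(y, x)\<close>; it is measurable in \<open>t\<close> and, by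
    \<open>GN\<close>, almost everywhere at most the nested one.\<close>
  define G where "G t = esssup (P \<Otimes>\<^sub>M lborel) (\<lambda>(y, x). ennreal (norm (Dw y t x)))" for t
  have Dwm: "(\<lambda>(y, z). Dw y (fst z) (snd z)) \<in> borel_measurable (P \<Otimes>\<^sub>M borel)"
    unfolding Dw_def by (rule nisp_measurable[OF _ \<Psi>m]) (rule dVm)
  have sets_eq: "sets (P \<Otimes>\<^sub>M (lborel \<Otimes>\<^sub>M lborel)) = sets (P \<Otimes>\<^sub>M (borel :: (real \<times> real) measure))"
    by (intro sets_pair_measure_cong refl) (simp only: lborel_prod sets_lborel)
  have Dwm': "(\<lambda>(y, z). ennreal (norm (Dw y (fst z) (snd z)))) \<in> borel_measurable (P \<Otimes>\<^sub>M (lborel \<Otimes>\<^sub>M lborel))"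
    using Dwm unfolding measurable_cong_sets[OF sets_eq refl] by (simp add: case_prod_unfold)
  have Gm: "G \<in> borel_measurable borel"
    using AE_le_esssup_slices(1)[OF sfP Dwm'] by (simp add: G_def[abs_def])
  have Gae: "AE y in P. AE z in lborel. ennreal (norm (Dw y (fst z) (snd z))) \<le> G (fst z)"
    using AE_le_esssup_slices(2)[OF sfP Dwm'] by (simp add: G_def)
  define N where "N t = norm_Linf_Linf P lborel (\<lambda>y x. dx (\<lambda>s z. usts s z y) t x)" for t
  have GN: "AE t in lborel. 0 < t \<and> t < T \<longrightarrow> G t \<le> N t"
  proof -
    have "AE t in lborel. AE x in lborel. \<forall>y. dt (w y) t x = tw y t x \<and> dx (w y) t x = Dw y t x"
      using lborel_pair.AE_pair[OF aew[folded lborel_prod]] by simp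
    then show ?thesis
    proof eventually_elim
      case (elim t)
      show ?case
      proof
        assume t: "0 < t \<and> t < T"
        have d: "dx (\<lambda>s z. usts s z y) t x = dx (w y) t x" for x y using weq[of t y] t by (simp add: dx_def)
        have in1: "AE x in lborel. ennreal (norm (Dw y t x)) \<le> esssup lborel (\<lambda>x. ennreal (norm (dx (\<lambda>s z. usts s z y) t x)))" for y
        proof -
          have "AE x in lborel. ennreal (norm (dx (\<lambda>s z. usts s z y) t x)) \<le> esssup lborel (\<lambda>x. ennreal (norm (dx (\<lambda>s z. usts s z y) t x)))"
            by (rule esssup_AE)
          with elim show ?thesis by eventually_elim (simp add: d)
        qed
        have "AE y in P. esssup lborel (\<lambda>x. ennreal (norm (dx (\<lambda>s z. usts s z y) t x))) \<le> N t"
          unfolding N_def norm_Linf_Linf_def by (rule esssup_AE)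
        then have yx: "AE y in P. AE x in lborel. ennreal (norm (Dw y t x)) \<le> N t"
        proof eventually_elim
          case (elim y)
          show ?case using in1[of y] by eventually_elim (use elim in auto)
        qed
        have "(\<lambda>p. (fst p, (t, snd p))) \<in> P \<Otimes>\<^sub>M lborel \<rightarrow>\<^sub>M P \<Otimes>\<^sub>M (lborel \<Otimes>\<^sub>M lborel)" by measurable
        from measurable_compose[OF this Dwm']
        have m: "(\<lambda>(y, x). ennreal (norm (Dw y t x))) \<in> borel_measurable (P \<Otimes>\<^sub>M lborel)" by (simp add: case_prod_unfold)
        have "AE p in P \<Otimes>\<^sub>M lborel. (case p of (y, x) \<Rightarrow> ennreal (norm (Dw y t x))) \<le> N t"
          by (rule Pl.AE_pair_measure) (use yx m in \<open>measurable, simp\<close>)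
        then show "G t \<le> N t" unfolding G_def by (rule esssup_I[OF m])
      qed
    qed
  qed
  define X where "X = ennreal (inverse C\<eta>l) * (\<integral>\<^sup>+ t\<in>{0..tn}. (ennreal (C\<eta>u * Cf) * N t + ennreal (C\<eta>u\<^sup>2)) \<partial>lborel)"
  define E0 where "E0 y = (\<integral>\<^sup>+ x. ennreal ((norm (u0 x y - w y 0 x))\<^sup>2) \<partial>lborel)" for y
  define Rs where "Rs y = sqnorm_L2 (time_strip tn) (\<lambda>(t, x). residual f (w y) t x)" for y
  have Cu: "0 \<le> C\<eta>u" using constants by simp
  have stable: "AE y in P. sqnorm_L2 lborel (\<lambda>x. u tn x y - w y tn x)
      \<le> ennreal (inverse C\<eta>l) * (ennreal C\<eta>u * E0 y + Rs y) * ennreal_exp X"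
  proof -
    have sol: "(\<lambda>(t, x, y). u t x y) \<in> borel_measurable (restrict_space lborel {0..T} \<Otimes>\<^sub>M lborel \<Otimes>\<^sub>M P)"
      "AE y in P. entropy_solution T f \<eta> q (\<lambda>x. u0 x y) (\<lambda>t x. u t x y) \<and> weakly_continuous_in_time T (\<lambda>t x. u t x y)"
      using solution(1) by (auto simp: random_entropy_solution_def)
    show ?thesis
      using sol(2) values_in_C Gae AE_space
    proof eventually_elim
      case (elim y)
      obtain L where L: "L-lipschitz_on UNIV (\<lambda>(t, x). w y t x)" using wlip by blast
      have L0: "0 \<le> L" using L by (rule lipschitz_on_nonneg)
      have wC: "w y t x \<in> C" for t x
      proof -
        have "w y t x = usts (max 0 (min T t)) x y" by (simp add: w_def V_def reconstruction(4))
        then show ?thesis using elim(3) equation(1) by simp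
      qed
      \<comment> \<open>\<open>G\<close> may be infinite, while the stability estimate asks for a
        bounded real function; the Lipschitz constant \<open>L\<close> of the slice truncates it.
        Although \<open>L\<close> varies with \<open>y\<close>, the bound by \<open>G\<close> leads
        to an exponent that does not.\<close>
      define S where "S t = enn2real (min (ennreal L) (G t))" for t
      have Smin: "ennreal (S t) = min (ennreal L) (G t)" for t
        unfolding S_def by (rule ennreal_enn2real) (simp add: min_less_iff_disj)
      have S: "S \<in> borel_measurable borel" "0 \<le> S t" "S t \<le> L" for t
      proof -
        show "S \<in> borel_measurable borel" unfolding S_def using Gm by measurable
        show "0 \<le> S t" by (simp add: S_def)
        have "ennreal (S t) \<le> ennreal L" unfolding Smin by simp
        then show "S t \<le> L" using L0 by (simp add: ennreal_le_iff)
      qed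
      have SD: "AE (t, x) in time_strip T. norm (dx (w y) t x) \<le> S t"
      proof (rule AE_time_stripI)
        show "AE z in lborel. z \<in> {0<..<T} \<times> UNIV \<longrightarrow> (case z of (t, x) \<Rightarrow> norm (dx (w y) t x) \<le> S t)"
          using aew elim(4) Lipschitz_AE_partial_derivatives[OF L]
        proof eventually_elim
          case (elim z)
          obtain t x where z: "z = (t, x)" by (cases z)
          have "ennreal (norm (dx (w y) t x)) \<le> ennreal (S t)" unfolding Smin
          proof (rule min.boundedI)
            show "ennreal (norm (dx (w y) t x)) \<le> ennreal L" using elim(3) by (simp add: z ennreal_leI)
            show "ennreal (norm (dx (w y) t x)) \<le> G t" using elim(1,2) by (simp add: z)
          qed
          then show ?case using S(2) by (simp add: z ennreal_le_iff)
        qed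
      qed
      have um: "(\<lambda>(t, x). u t x y) \<in> borel_measurable (time_strip T)"
      proof -
        have f1: "(\<lambda>z. fst z) \<in> time_strip T \<rightarrow>\<^sub>M restrict_space lborel {0..T}"
        proof (rule measurable_restrict_space2)
          have "fst \<in> borel_measurable (borel :: (real \<times> real) measure)" by (intro borel_measurable_continuous_onI continuous_intros)
          from measurable_time_strip[OF this] show "(\<lambda>z. fst z) \<in> time_strip T \<rightarrow>\<^sub>M lborel" by simp
        qed (auto simp: space_time_strip)
        have f2: "(\<lambda>z. snd z) \<in> time_strip T \<rightarrow>\<^sub>M lborel"
        proof -
          have "snd \<in> borel_measurable (borel :: (real \<times> real) measure)" by (intro borel_measurable_continuous_onI continuous_intros)
          from measurable_time_strip[OF this] show ?thesis by simp
        qed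
        have "(\<lambda>z. (fst z, snd z, y)) \<in> time_strip T \<rightarrow>\<^sub>M restrict_space lborel {0..T} \<Otimes>\<^sub>M lborel \<Otimes>\<^sub>M P"
          by (intro measurable_Pair f1 f2 measurable_const elim(5))
        from measurable_compose[OF this sol(1)] show ?thesis by (simp add: case_prod_unfold)
      qed
      have st: "(\<integral>\<^sup>+ x. ennreal ((norm (u tn x y - w y tn x))\<^sup>2) \<partial>lborel)
        \<le> ennreal (inverse C\<eta>l) * (ennreal C\<eta>u * E0 y + Rs y)
          * ennreal (exp (LINT s:{0..tn}|lborel. inverse C\<eta>l * (C\<eta>u * Cf * S s + C\<eta>u\<^sup>2)))"
        unfolding E0_def Rs_def
        by (rule E.relative_entropy_stability[where Lv=L and BS=L])
           (use constants(1) equation(1) tn elim(1) um elim(2) L wC S SD in auto)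
      define J where "J = (LINT s:{0..tn}|lborel. inverse C\<eta>l * (C\<eta>u * Cf * S s + C\<eta>u\<^sup>2))"
      \<comment> \<open>Here the dependence on \<open>y\<close> is given up:
        \<open>S \<le> G \<le> N\<close> for almost every time, and \<open>X\<close> contains
        \<open>N\<close> only.\<close>
      have JX: "ennreal J \<le> X"
      proof -
        have i: "integrable lborel (\<lambda>s. indicator {0..tn} s *\<^sub>R (inverse C\<eta>l * (C\<eta>u * Cf * S s + C\<eta>u\<^sup>2)))"
        proof -
          have "\<bar>inverse C\<eta>l * (C\<eta>u * Cf * S s + C\<eta>u\<^sup>2)\<bar> \<le> inverse C\<eta>l * (C\<eta>u * Cf * L + C\<eta>u\<^sup>2)" for s
            using S(2,3)[of s] constants(1,2) Cu
            by (subst abs_of_nonneg) (auto intro!: mult_left_mono add_right_mono mult_nonneg_nonneg add_nonneg_nonneg)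
          then have "set_integrable lborel {0..tn} (\<lambda>s. inverse C\<eta>l * (C\<eta>u * Cf * S s + C\<eta>u\<^sup>2))"
            using S(1) by (intro set_integrable_bounded[where K="inverse C\<eta>l * (C\<eta>u * Cf * L + C\<eta>u\<^sup>2)"]) auto
          then show ?thesis by (simp only: set_integrable_def)
        qed
        have "ennreal J = (\<integral>\<^sup>+ s. ennreal (indicator {0..tn} s *\<^sub>R (inverse C\<eta>l * (C\<eta>u * Cf * S s + C\<eta>u\<^sup>2))) \<partial>lborel)"
          unfolding J_def set_lebesgue_integral_def
          by (rule nn_integral_eq_integral[OF i, symmetric]) (use S(2) constants(1,2) Cu in auto)
        also have "\<dots> = (\<integral>\<^sup>+ s. ennreal (inverse C\<eta>l) * ((ennreal (C\<eta>u * Cf) * ennreal (S s) + ennreal (C\<eta>u\<^sup>2)) * indicator {0..tn} s) \<partial>lborel)"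
        proof (rule nn_integral_cong)
          fix s
          show "ennreal (indicator {0..tn} s *\<^sub>R (inverse C\<eta>l * (C\<eta>u * Cf * S s + C\<eta>u\<^sup>2)))
            = ennreal (inverse C\<eta>l) * ((ennreal (C\<eta>u * Cf) * ennreal (S s) + ennreal (C\<eta>u\<^sup>2)) * indicator {0..tn} s)"
            using S(2)[of s] constants(1,2) Cu by (cases "s \<in> {0..tn}") (simp_all add: ennreal_mult ennreal_plus)
        qed
        also have "\<dots> = ennreal (inverse C\<eta>l) * (\<integral>\<^sup>+ s. (ennreal (C\<eta>u * Cf) * ennreal (S s) + ennreal (C\<eta>u\<^sup>2)) * indicator {0..tn} s \<partial>lborel)"
          by (rule nn_integral_cmult) (use S(1) in \<open>simp add: borel_measurable_times_ennreal\<close>)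
        also have "\<dots> \<le> X"
          unfolding X_def
        proof (intro mult_left_mono nn_integral_mono_AE)
          show "AE s in lborel. (ennreal (C\<eta>u * Cf) * ennreal (S s) + ennreal (C\<eta>u\<^sup>2)) * indicator {0..tn} s
            \<le> (ennreal (C\<eta>u * Cf) * N s + ennreal (C\<eta>u\<^sup>2)) * indicator {0..tn} s"
            using GN AE_lborel_singleton[of 0] AE_lborel_singleton[of T]
          proof eventually_elim
            case (elim s)
            show ?case
            proof (cases "s \<in> {0..tn}")
              case True
              then have "G s \<le> N s" using elim tn by auto
              then have "ennreal (S s) \<le> N s" unfolding Smin by (simp add: min.coboundedI2)
              then show ?thesis by (intro mult_right_mono add_right_mono mult_left_mono) auto
            qed simp
          qed
        qed simp
        finally show ?thesis .
      qed
      \<comment> \<open>If the integral in the exponent is infinite, so is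
        \<open>ennreal_exp\<close> of it and the bound is trivial.\<close>
      have "ennreal (exp J) \<le> ennreal_exp X"
      proof (cases "X = \<infinity>")
        case True
        then show ?thesis by (simp add: ennreal_exp_def)
      next
        case False
        then have "J \<le> enn2real X"
        proof -
          have "ennreal J \<le> ennreal (enn2real X)" using JX False by (simp add: ennreal_enn2real less_top)
          then show ?thesis by (simp add: ennreal_le_iff2) (metis enn2real_nonneg order_trans)
        qed
        then show ?thesis using False by (simp add: ennreal_exp_def ennreal_leI)
      qed
      then show ?case
        using order_trans[OF st[folded J_def] mult_left_mono] by (simp add: sqnorm_L2_def)
    qed
  qed
  have uhm: "uh n l \<in> borel_measurable borel" if "l \<le> R" for l
    using RKDG(2)[OF that] \<open>n \<le> Nt\<close> by (intro DG_space_measurable[OF mesh(1)]) (auto simp: RKDG_approximation_def)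
  have unm: "(\<lambda>(y, x). uh_nisp n x y) \<in> borel_measurable (P \<Otimes>\<^sub>M lborel)"
    unfolding NISP by (rule nisp_measurable[OF _ \<Psi>m]) (simp add: uhm)
  have wm: "(\<lambda>(y, x). w y t x) \<in> borel_measurable (P \<Otimes>\<^sub>M lborel)" for t
    unfolding w_def
  proof (rule nisp_measurable[OF _ \<Psi>m])
    fix l assume "l \<le> R"
    then obtain L where "L-lipschitz_on UNIV (\<lambda>(t, x). V l t x)" using Vlip by blast
    then have "continuous_on UNIV (V l t)" by (rule lipschitz_on_continuous_on[OF Lipschitz_sections(2)])
    then show "V l t \<in> borel_measurable lborel" using borel_measurable_continuous_onI by simp
  qed
  have um: "(\<lambda>(y, x). u tn x y) \<in> borel_measurable (P \<Otimes>\<^sub>M lborel)"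
  proof -
    have "(\<lambda>p. (tn, snd p, fst p)) \<in> P \<Otimes>\<^sub>M lborel \<rightarrow>\<^sub>M restrict_space lborel {0..T} \<Otimes>\<^sub>M lborel \<Otimes>\<^sub>M P"
      by (intro measurable_Pair measurable_const measurable_fst measurable_snd) (use tn in \<open>simp add: space_restrict_space\<close>)
    moreover have "(\<lambda>(t, x, y). u t x y) \<in> borel_measurable (restrict_space lborel {0..T} \<Otimes>\<^sub>M lborel \<Otimes>\<^sub>M P)"
      using solution(1) by (auto simp: random_entropy_solution_def)
    ultimately have "(\<lambda>p. case (tn, snd p, fst p) of (t, x, y) \<Rightarrow> u t x y) \<in> borel_measurable (P \<Otimes>\<^sub>M lborel)"
      by (rule measurable_compose)
    then show ?thesis by (simp add: case_prod_unfold)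
  qed
  have u0m: "(\<lambda>(y, x). u0 x y) \<in> borel_measurable (P \<Otimes>\<^sub>M lborel)"
    using measurable_pair_swap[OF initial_datum] by (simp add: case_prod_unfold)
  have slice: "(\<lambda>x. k y x) \<in> borel_measurable lborel" if "(\<lambda>(y, x). k y x) \<in> borel_measurable (P \<Otimes>\<^sub>M lborel)" "y \<in> space P"
    for k :: "real \<Rightarrow> real \<Rightarrow> real ^ 'm" and y
  proof -
    have "(\<lambda>x. (y, x)) \<in> lborel \<rightarrow>\<^sub>M P \<Otimes>\<^sub>M lborel" using that(2) by measurable
    from measurable_compose[OF this that(1)] show ?thesis by simp
  qed
  have sqm: "(\<lambda>y. sqnorm_L2 lborel (k y)) \<in> borel_measurable P" if "(\<lambda>(y, x). k y x) \<in> borel_measurable (P \<Otimes>\<^sub>M lborel)"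
    for k :: "real \<Rightarrow> real \<Rightarrow> real ^ 'm"
  proof -
    have "(\<lambda>(y, x). ennreal ((norm (k y x))\<^sup>2)) \<in> borel_measurable (P \<Otimes>\<^sub>M lborel)"
      using that by (simp add: case_prod_unfold)
    then show ?thesis unfolding sqnorm_L2_def using lborel.borel_measurable_nn_integral[of "\<lambda>y x. ennreal ((norm (k y x))\<^sup>2)" P] by simp
  qed
  have diffm: "(\<lambda>(y, x). k y x - k' y x) \<in> borel_measurable (P \<Otimes>\<^sub>M lborel)"
    if "(\<lambda>(y, x). k y x) \<in> borel_measurable (P \<Otimes>\<^sub>M lborel)" "(\<lambda>(y, x). k' y x) \<in> borel_measurable (P \<Otimes>\<^sub>M lborel)"
    for k k' :: "real \<Rightarrow> real \<Rightarrow> real ^ 'm"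
    using that by (simp add: case_prod_unfold)
  \<comment> \<open>Residual of the extended reconstruction. On the open strip it equals the
    residual of \<open>usts\<close>, which carries the square-integrability assumption.\<close>
  define r where "r y z = residual f (w y) (fst z) (snd z)" for y z
  have req: "r y z = residual f (\<lambda>s z. usts s z y) (fst z) (snd z)" if "z \<in> space (time_strip T)" for y z
  proof -
    have t: "0 < fst z" "fst z < T" using that by (auto simp: space_time_strip)
    have "dt (w y) (fst z) (snd z) = dt (\<lambda>s z. usts s z y) (fst z) (snd z)"
      using t by (intro dt_cong_open[where T=T]) (simp_all add: weq)
    then show ?thesis using weq[of "fst z" y] t by (simp add: r_def residual_def dx_def)
  qed
  have rT: "in_L2_L2 P (time_strip T) r"
  proof -
    have "(\<lambda>(y, z). r y z) \<in> borel_measurable (P \<Otimes>\<^sub>M time_strip T)"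
      using reconstruction(5) unfolding in_L2_L2_def
      by (subst measurable_cong[where g="\<lambda>(y, z). case z of (t, x) \<Rightarrow> residual f (\<lambda>s z. usts s z y) t x"])
         (auto simp: space_pair_measure req split: prod.splits)
    moreover have "sqnorm_L2_L2 P (time_strip T) r = sqnorm_L2_L2 P (time_strip T) (\<lambda>y (t, x). residual f (\<lambda>s z. usts s z y) t x)"
      unfolding sqnorm_L2_L2_def sqnorm_L2_def
      by (intro nn_integral_cong) (simp add: req case_prod_unfold)
    ultimately show ?thesis using reconstruction(5) by (simp add: in_L2_L2_def)
  qed
  have rm: "(\<lambda>(y, z). r y z) \<in> borel_measurable (P \<Otimes>\<^sub>M time_strip tn)"
  proof -
    have "(\<lambda>p. (fst p, snd p)) \<in> P \<Otimes>\<^sub>M time_strip tn \<rightarrow>\<^sub>M P \<Otimes>\<^sub>M time_strip T"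
      by (intro measurable_Pair measurable_fst measurable_compose[OF measurable_snd id_measurable_time_strip[OF tn(2)]])
    then have "(\<lambda>p. p) \<in> P \<Otimes>\<^sub>M time_strip tn \<rightarrow>\<^sub>M P \<Otimes>\<^sub>M time_strip T" by simp
    moreover have "(\<lambda>(y, z). r y z) \<in> borel_measurable (P \<Otimes>\<^sub>M time_strip T)" using rT by (simp add: in_L2_L2_def)
    ultimately show ?thesis by (rule measurable_compose)
  qed
  have Rs_r: "Rs y = sqnorm_L2 (time_strip tn) (r y)" for y by (simp add: Rs_def r_def[abs_def] case_prod_unfold)
  have rn: "in_L2_L2 P (time_strip tn) r"
  proof -
    have "sqnorm_L2_L2 P (time_strip tn) r \<le> sqnorm_L2_L2 P (time_strip T) r"
      unfolding sqnorm_L2_L2_def sqnorm_L2_def nn_integral_time_strip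
      using tn(2) by (intro nn_integral_mono mult_left_mono) (auto simp: indicator_def)
    then show ?thesis using rm rT by (auto simp: in_L2_L2_def intro: le_less_trans)
  qed
  \<comment> \<open>The time derivative of the expansion stays within the modes
    \<open>i \<le> M\<close> with coefficients \<open>a i\<close>. The \<open>b i\<close> are the
    quadrature modes of the flux derivative, so that \<open>a j + b j\<close> is the deterministic
    residual, by linearity of the quadrature.\<close>
  define a where "a i z = nisp_coeff R \<Psi> yq wq (\<lambda>l. tV l (fst z) (snd z)) i" for i z
  define b where "b i z = nisp_coeff R \<Psi> yq wq (\<lambda>l. dx (\<lambda>s z. f (V l s z)) (fst z) (snd z)) i" for i z
  define g where "g y z = dx (\<lambda>s z. f (w y s z)) (fst z) (snd z)" for y z
  have energy: "sqnorm_L2_L2 P (time_strip tn) r \<le> 2 * (\<Sum>j\<le>M. sqnorm_L2 (time_strip tn) (\<lambda>z. a j z + b j z))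
    + 2 * (\<Sum>j\<le>M. sqnorm_L2 (time_strip tn) (\<lambda>z. (LINT y|P. \<Psi> j y *\<^sub>R g y z) - b j z))
    + (\<Sum>\<^sub>\<infinity>j\<in>{M<..}. sqnorm_L2 (time_strip tn) (\<lambda>z. LINT y|P. \<Psi> j y *\<^sub>R g y z))"
  proof (rule residual_energy_le[OF sfP sigma_finite_time_strip stochastic_discretization(1) rn])
    show "AE z in time_strip tn. \<forall>y. r y z = (\<Sum>i\<le>M. \<Psi> i y *\<^sub>R a i z) + g y z"
    proof (rule AE_time_stripI)
      show "AE z in lborel. z \<in> {0<..<tn} \<times> UNIV \<longrightarrow> (\<forall>y. r y z = (\<Sum>i\<le>M. \<Psi> i y *\<^sub>R a i z) + g y z)"
        using aew
      proof eventually_elim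
        case (elim z)
        then show ?case by (simp add: r_def residual_def tw_def nisp_def a_def g_def)
      qed
    qed
    show "(\<lambda>z. a j z + b j z) \<in> borel_measurable (time_strip tn)" for j
      unfolding a_def b_def
      by (intro borel_measurable_add nisp_coeff_measurable measurable_time_strip) (auto intro: tVm fVm)
  qed
  have strip: "0 < fst z" "fst z < T" if "z \<in> space (time_strip tn)" for z
    using that tn by (auto simp: space_time_strip)
  have dxV: "dx (\<lambda>s z. f (V l s z)) (fst z) (snd z) = dx (\<lambda>s z. f (ust l s z)) (fst z) (snd z)" if "z \<in> space (time_strip tn)" for l z
    using strip[OF that] Veq[of "fst z" l] by (simp add: dx_def)
  have tVe: "tV l (fst z) (snd z) = dt (ust l) (fst z) (snd z)" if "z \<in> space (time_strip tn)" for l z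
    unfolding tV_def using strip[OF that] by (intro dt_cong_open[where T=T]) (simp_all add: Veq)
  have ge: "g y z = dx (\<lambda>s z. f (usts s z y)) (fst z) (snd z)" if "z \<in> space (time_strip tn)" for y z
    unfolding g_def using strip[OF that] weq[of "fst z" y] by (simp add: dx_def)
  have sq_cong: "sqnorm_L2 (time_strip tn) k = sqnorm_L2 (time_strip tn) (\<lambda>(s, x). k' s x)"
    if "\<And>z. z \<in> space (time_strip tn) \<Longrightarrow> k z = k' (fst z) (snd z)" for k and k' :: "real \<Rightarrow> real \<Rightarrow> real ^ 'm"
    unfolding sqnorm_L2_def by (intro nn_integral_cong) (simp add: that case_prod_unfold)
  have coeff_add: "nisp_coeff R \<Psi> yq wq (\<lambda>l. k l + k' l) j = nisp_coeff R \<Psi> yq wq k j + nisp_coeff R \<Psi> yq wq k' j"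
    for k k' :: "nat \<Rightarrow> real ^ 'm" and j
    by (simp add: nisp_coeff_def scaleR_add_right sum.distrib)
  have Rs_le: "(\<integral>\<^sup>+ y. Rs y \<partial>P) \<le> 2 * E_det M R \<Psi> yq wq f ust tn + 2 * E_sq P M R \<Psi> yq wq f ust usts tn + E_sc P M \<Psi> f usts tn"
  proof -
    have "sqnorm_L2 (time_strip tn) (\<lambda>z. a j z + b j z) = sqnorm_L2 (time_strip tn) (\<lambda>(s, x). res_det R \<Psi> yq wq f ust j s x)" for j
      by (rule sq_cong) (simp add: a_def b_def res_det_def residual_def coeff_add tVe dxV)
    moreover have "sqnorm_L2 (time_strip tn) (\<lambda>z. (LINT y|P. \<Psi> j y *\<^sub>R g y z) - b j z)
        = sqnorm_L2 (time_strip tn) (\<lambda>(s, x). res_sq P R \<Psi> yq wq f ust usts j s x)" for j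
      by (rule sq_cong) (simp add: b_def res_sq_def ge dxV)
    moreover have "sqnorm_L2 (time_strip tn) (\<lambda>z. LINT y|P. \<Psi> j y *\<^sub>R g y z)
        = sqnorm_L2 (time_strip tn) (\<lambda>(s, x). res_sc P \<Psi> f usts j s x)" for j
      by (rule sq_cong) (simp add: res_sc_def ge)
    ultimately show ?thesis
      using energy unfolding Rs_r sqnorm_L2_L2_def E_det_def E_sq_def E_sc_def by simp
  qed
  have Rsm: "Rs \<in> borel_measurable P"
  proof -
    have "(\<lambda>(y, z). ennreal ((norm (r y z))\<^sup>2)) \<in> borel_measurable (P \<Otimes>\<^sub>M time_strip tn)"
      using rm by (simp add: case_prod_unfold)
    then show ?thesis
      unfolding Rs_r[abs_def] sqnorm_L2_def
      using sigma_finite_measure.borel_measurable_nn_integral[OF sigma_finite_time_strip, of "\<lambda>y z. ennreal ((norm (r y z))\<^sup>2)" P tn] by simp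
  qed
  have E0m: "E0 \<in> borel_measurable P"
    using sqm[OF diffm[OF u0m wm[of 0]]] by (simp add: E0_def[abs_def] sqnorm_L2_def)
  have E0_int: "(\<integral>\<^sup>+ y. E0 y \<partial>P) = sqnorm_L2_L2 P lborel (\<lambda>y x. u0 x y - usts 0 x y)"
    unfolding E0_def sqnorm_L2_L2_def sqnorm_L2_def using weq[of 0] equation(1) by simp
  define eX where "eX = ennreal_exp X"
  have err: "(\<integral>\<^sup>+ y. sqnorm_L2 lborel (\<lambda>x. u tn x y - w y tn x) \<partial>P)
    \<le> ennreal (inverse C\<eta>l) * (2 * E_det M R \<Psi> yq wq f ust tn + 2 * E_sq P M R \<Psi> yq wq f ust usts tn + E_sc P M \<Psi> f usts tn
        + ennreal C\<eta>u * sqnorm_L2_L2 P lborel (\<lambda>y x. u0 x y - usts 0 x y)) * eX"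
  proof -
    have "(\<integral>\<^sup>+ y. sqnorm_L2 lborel (\<lambda>x. u tn x y - w y tn x) \<partial>P)
      \<le> (\<integral>\<^sup>+ y. ennreal (inverse C\<eta>l) * (ennreal C\<eta>u * E0 y + Rs y) * eX \<partial>P)"
      unfolding eX_def by (rule nn_integral_mono_AE[OF stable])
    also have "\<dots> = ennreal (inverse C\<eta>l) * (ennreal C\<eta>u * (\<integral>\<^sup>+ y. E0 y \<partial>P) + (\<integral>\<^sup>+ y. Rs y \<partial>P)) * eX"
      using E0m Rsm by (simp add: nn_integral_multc nn_integral_cmult nn_integral_add)
    also have "\<dots> \<le> ennreal (inverse C\<eta>l) * (2 * E_det M R \<Psi> yq wq f ust tn + 2 * E_sq P M R \<Psi> yq wq f ust usts tn + E_sc P M \<Psi> f usts tn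
        + ennreal C\<eta>u * sqnorm_L2_L2 P lborel (\<lambda>y x. u0 x y - usts 0 x y)) * eX"
      unfolding E0_int using add_left_mono[OF Rs_le] by (intro mult_right_mono mult_left_mono) (auto simp: add.commute)
    finally show ?thesis .
  qed
  \<comment> \<open>The error is split at the reconstruction, whose distance to the numerical
    solution is computable; the squared sum of two terms gives the outer factors 2.\<close>
  have "sqnorm_L2_L2 P lborel (\<lambda>y x. u tn x y - uh_nisp n x y)
    \<le> (\<integral>\<^sup>+ y. 2 * sqnorm_L2 lborel (\<lambda>x. w y tn x - uh_nisp n x y) + 2 * sqnorm_L2 lborel (\<lambda>x. u tn x y - w y tn x) \<partial>P)"
    unfolding sqnorm_L2_L2_def
  proof (rule nn_integral_mono)
    fix y assume y: "y \<in> space P"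
    show "sqnorm_L2 lborel (\<lambda>x. u tn x y - uh_nisp n x y)
      \<le> 2 * sqnorm_L2 lborel (\<lambda>x. w y tn x - uh_nisp n x y) + 2 * sqnorm_L2 lborel (\<lambda>x. u tn x y - w y tn x)"
      using sqnorm_L2_add_le[OF slice[OF diffm[OF wm[of tn] unm] y] slice[OF diffm[OF um wm[of tn]] y]] by simp
  qed
  also have "\<dots> = 2 * (\<integral>\<^sup>+ y. sqnorm_L2 lborel (\<lambda>x. w y tn x - uh_nisp n x y) \<partial>P) + 2 * (\<integral>\<^sup>+ y. sqnorm_L2 lborel (\<lambda>x. u tn x y - w y tn x) \<partial>P)"
    using sqm[OF diffm[OF wm[of tn] unm]] sqm[OF diffm[OF um wm[of tn]]] by (simp add: nn_integral_add nn_integral_cmult)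
  also have "(\<integral>\<^sup>+ y. sqnorm_L2 lborel (\<lambda>x. w y tn x - uh_nisp n x y) \<partial>P) = sqnorm_L2_L2 P lborel (\<lambda>y x. usts tn x y - uh_nisp n x y)"
    unfolding sqnorm_L2_L2_def using weq[of tn] tn by simp
  finally have "sqnorm_L2_L2 P lborel (\<lambda>y x. u tn x y - uh_nisp n x y)
    \<le> 2 * sqnorm_L2_L2 P lborel (\<lambda>y x. usts tn x y - uh_nisp n x y)
      + 2 * (ennreal (inverse C\<eta>l) * (2 * E_det M R \<Psi> yq wq f ust tn + 2 * E_sq P M R \<Psi> yq wq f ust usts tn + E_sc P M \<Psi> f usts tn
        + ennreal C\<eta>u * sqnorm_L2_L2 P lborel (\<lambda>y x. u0 x y - usts 0 x y)) * eX)"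
    by (rule order_trans) (intro add_left_mono mult_left_mono err, simp)
  then show ?thesis unfolding eX_def X_def N_def tn_def by (simp only: mult.assoc)
qed

end
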